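(* Let $\omega\in\widehat{\mathcal{D}}$ and $1<p<\infty$, and let $p'$ be the conjugate exponent of $p$, $\frac1p+\frac1{p'}=1$. Then the following statements are equivalent: (i) $H_\omega:L^p_{[0,1)}\to H^p$ is bounded; (ii) $H_\omega:L^p_{[0,1)}\to D^p_{p-1}$ is bounded; (iii) $H_\omega:L^p_{[0,1)}\to HL(p)$ is bounded; (iv) $\omega$ satisfies the condition $$\sup_{0<r<1}\left(1+\int_0^r\frac{1}{\widehat{\omega}(t)^p}\,dt\right)^{\frac1p}\left(\int_r^1\omega(t)^{p'}\,dt\right)^{\frac1{p'}}<\infty.$$ In particular, if the condition in (iv) holds, then $H_\omega:H^p\to H^p$ is bounded.
   Context: $\mathbb{D}=\{z\in\mathbb{C}:|z|<1\}$, and $dA=\frac{dx\,dy}{\pi}$ is the normalized area measure. $\mathcal{H}(\mathbb{D})$ is the space of analytic functions on $\mathbb{D}$. A radial weight is a nonnegative function $\omega\in L^1_{[0,1)}$, extended to $\mathbb{D}$ by $\omega(z)=\omega(|z|)$; it is assumed throughout that $\widehat{\omega}(z)=\int_{|z|}^1\omega(s)\,ds>0$ for all $z\in\mathbb{D}$. A radial weight $\omega$ belongs to $\widehat{\mathcal{D}}$ if there is a constant $C=C(\omega)\ge1$ with $\widehat{\omega}(r)\le C\,\widehat{\omega}\left(\frac{1+r}{2}\right)$ for all $0\le r<1$. The Bergman space $A^2_\omega$ consists of the $f\in\mathcal{H}(\mathbb{D})$ with $\int_{\mathbb{D}}|f|^2\omega\,dA<\infty$. Its reproducing kernels $B^\omega_z\in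 A^2_\omega$ satisfy $f(z)=\int_{\mathbb{D}}f(\zeta)\overline{B^\omega_z(\zeta)}\,\omega(\zeta)\,dA(\zeta)$ for all $f\in A^2_\omega$. Explicitly, $B^\omega_z(\zeta)=\sum_{n=0}^\infty\frac{(\overline{z}\zeta)^n}{2\omega_{2n+1}}$, where $\omega_x=\int_0^1r^x\omega(r)\,dr$ for $x\ge0$. The Hilbert-type operator is $$H_\omega(f)(z)=\int_0^1 f(t)\left(\frac1z\int_0^zB^\omega_t(\zeta)\,d\zeta\right)\omega(t)\,dt,$$ where the kernel $\frac1z\int_0^zB^\omega_t(\zeta)\,d\zeta$ is extended analytically to $z=0$. A function on $\mathbb{D}$ is evaluated in this formula through its restriction to $[0,1)$. Boundedness of $H_\omega:X\to Y$ means that $H_\omega(f)$ is well defined and belongs to $Y$ for every $f\in X$, with $\|H_\omega(f)\|_Y\le C\|f\|_X$ for a constant $C$ independent of $f$. Spaces: $L^p_{[0,1)}$ is the space of measurable functions on $[0,1)$ with $\int_0^1|f(t)|^p\,dt<\infty$. $H^p$ is the Hardy space of $f\in\mathcal{H}(\mathbb{D})$ with $\|f\|_{H^p}=\sup_{0<r<1}\left(\frac1{2\pi}\int_0^{2\pi}|f(re^{i\theta})|^p\,d\theta\right)^{1/p}<\infty$. $D^p_{p-1}$ consists of the $f\in\mathcal{H}(\mathbb{D})$ with $\|f\|_{D^p_{p-1}}^p=|f(0)|^p+p\int_{\mathbb{D}}|f'(z)|^p(1-|z|^2)^{p-1}\,dA(z)<\infty$. $HL(p)$ consists of the $f(z)=\sum_{n=0}^\infty\widehat{f}(n)z^n\in\mathcal{H}(\mathbb{D})$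 with $\|f\|_{HL(p)}^p=\sum_{n=0}^\infty|\widehat{f}(n)|^p(n+1)^{p-2}<\infty$. *)

theory Defs
  imports "HOL-Complex_Analysis.Complex_Analysis"
begin

abbreviation unit_disc :: "complex set" where
  "unit_disc \<equiv> ball 0 1"

definition disc_integrable :: "(complex \<Rightarrow> 'a :: {banach, second_countable_topology}) \<Rightarrow> bool" where
  "disc_integrable g \<longleftrightarrow> set_integrable lebesgue unit_disc g"

text \<open>Integration over the disc against the normalized area measure \<open>dA = dx dy / pi\<close>.\<close>

definition disc_integral :: "(complex \<Rightarrow> 'a :: {banach, second_countable_topology}) \<Rightarrow> 'a" where
  "disc_integral g = (1 / pi) *\<^sub>R (LINT z:unit_disc|lebesgue. g z)"

definition weight_tail :: "(real \<Rightarrow> real) \<Rightarrow> real \<Rightarrow> real" where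
  "weight_tail \<omega> r = (LINT s:{r..<1}|lebesgue. \<omega> s)"

text \<open>A radial weight is given by its profile on \<open>[0,1)\<close>; its value at a point \<open>z\<close> of the disc
  is \<open>\<omega> (norm z)\<close>. The values of \<open>\<omega>\<close> outside \<open>[0,1)\<close> are never used.\<close>

definition radial_weight :: "(real \<Rightarrow> real) \<Rightarrow> bool" where
  "radial_weight \<omega> \<longleftrightarrow>
     set_integrable lebesgue {0..<1} \<omega> \<and>
     (\<forall>r\<in>{0..<1}. \<omega> r \<ge> 0) \<and>
     (\<forall>r\<in>{0..<1}. weight_tail \<omega> r > 0)"

definition D_hat :: "(real \<Rightarrow> real) set" where
  "D_hat = {\<omega>. radial_weight \<omega> \<and>
     (\<exists>C\<ge>1. \<forall>r\<in>{0..<1}. weight_tail \<omega> r \<le> C * weight_tail \<omega> ((1 + r) / 2))}"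

definition bergman_space :: "(real \<Rightarrow> real) \<Rightarrow> (complex \<Rightarrow> complex) set" where
  "bergman_space \<omega> = {f. f holomorphic_on unit_disc \<and>
     disc_integrable (\<lambda>z. (norm (f z))\<^sup>2 * \<omega> (norm z))}"

definition is_bergman_kernel ::
    "(real \<Rightarrow> real) \<Rightarrow> complex \<Rightarrow> (complex \<Rightarrow> complex) \<Rightarrow> bool" where
  "is_bergman_kernel \<omega> z B \<longleftrightarrow> B \<in> bergman_space \<omega> \<and>
     (\<forall>f\<in>bergman_space \<omega>.
        f z = disc_integral (\<lambda>\<zeta>. f \<zeta> * cnj (B \<zeta>) * of_real (\<omega> (norm \<zeta>))))"

text \<open>For \<open>z\<close> in the disc the kernel is determined only on the disc; the arbitrary values
  elsewhere are never used.\<close>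

definition bergman_kernel :: "(real \<Rightarrow> real) \<Rightarrow> complex \<Rightarrow> complex \<Rightarrow> complex" where
  "bergman_kernel \<omega> z = (SOME B. is_bergman_kernel \<omega> z B)"

text \<open>At \<open>z = 0\<close> the analytic extension of the averaged primitive takes the value \<open>B 0\<close>,
  the derivative of the primitive there.\<close>

definition hilbert_kernel :: "(real \<Rightarrow> real) \<Rightarrow> real \<Rightarrow> complex \<Rightarrow> complex" where
  "hilbert_kernel \<omega> t z =
     (if z = 0 then bergman_kernel \<omega> (of_real t) 0
      else 1 / z * contour_integral (linepath 0 z) (bergman_kernel \<omega> (of_real t)))"

definition hilbert_op_defined :: "(real \<Rightarrow> real) \<Rightarrow> (real \<Rightarrow> complex) \<Rightarrow> bool" where
  "hilbert_op_defined \<omega> f \<longleftrightarrow> (\<forall>z\<in>unit_disc.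
     set_integrable lebesgue {0..<1} (\<lambda>t. f t * hilbert_kernel \<omega> t z * of_real (\<omega> t)))"

definition hilbert_op :: "(real \<Rightarrow> real) \<Rightarrow> (real \<Rightarrow> complex) \<Rightarrow> complex \<Rightarrow> complex" where
  "hilbert_op \<omega> f z =
     (LINT t:{0..<1}|lebesgue. f t * hilbert_kernel \<omega> t z * of_real (\<omega> t))"

text \<open>The map \<open>R\<close> sends an element of \<open>X\<close> to the function on \<open>[0,1)\<close> to which the operator is
  applied: the identity if \<open>X\<close> is an \<open>L\<^sup>p\<close> space on \<open>[0,1)\<close>, restriction to the radius if \<open>X\<close>
  consists of functions on the disc.\<close>

definition hilbert_op_bounded ::
    "(real \<Rightarrow> real) \<Rightarrow> ('a \<Rightarrow> real \<Rightarrow> complex) \<Rightarrow> 'a set \<Rightarrow> ('a \<Rightarrow> real) \<Rightarrow>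
     (complex \<Rightarrow> complex) set \<Rightarrow> ((complex \<Rightarrow> complex) \<Rightarrow> real) \<Rightarrow> bool" where
  "hilbert_op_bounded \<omega> R X norm_X Y norm_Y \<longleftrightarrow>
     (\<exists>C. \<forall>f\<in>X. hilbert_op_defined \<omega> (R f) \<and> hilbert_op \<omega> (R f) \<in> Y \<and>
                norm_Y (hilbert_op \<omega> (R f)) \<le> C * norm_X f)"

definition radial_restriction :: "(complex \<Rightarrow> complex) \<Rightarrow> real \<Rightarrow> complex" where
  "radial_restriction f t = f (of_real t)"

text \<open>Each of the real-valued norms below is meaningful only on the corresponding space.\<close>

definition Lp_space :: "real \<Rightarrow> (real \<Rightarrow> complex) set" where
  "Lp_space p = {f. set_borel_measurable lebesgue {0..<1} f \<and>
     set_integrable lebesgue {0..<1} (\<lambda>t. norm (f t) powr p)}"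

definition Lp_norm :: "real \<Rightarrow> (real \<Rightarrow> complex) \<Rightarrow> real" where
  "Lp_norm p f = (LINT t:{0..<1}|lebesgue. norm (f t) powr p) powr (1 / p)"

definition hardy_mean :: "real \<Rightarrow> (complex \<Rightarrow> complex) \<Rightarrow> real \<Rightarrow> real" where
  "hardy_mean p f r =
     (1 / (2 * pi) * (LINT \<theta>:{0..2 * pi}|lebesgue. norm (f (of_real r * cis \<theta>)) powr p))
       powr (1 / p)"

definition hardy_space :: "real \<Rightarrow> (complex \<Rightarrow> complex) set" where
  "hardy_space p = {f. f holomorphic_on unit_disc \<and> bdd_above (hardy_mean p f ` {0<..<1})}"

definition hardy_norm :: "real \<Rightarrow> (complex \<Rightarrow> complex) \<Rightarrow> real" where
  "hardy_norm p f = (SUP r\<in>{0<..<1}. hardy_mean p f r)"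

definition dirichlet_space :: "real \<Rightarrow> (complex \<Rightarrow> complex) set" where
  "dirichlet_space p = {f. f holomorphic_on unit_disc \<and>
     disc_integrable (\<lambda>z. norm (deriv f z) powr p * (1 - (norm z)\<^sup>2) powr (p - 1))}"

definition dirichlet_norm :: "real \<Rightarrow> (complex \<Rightarrow> complex) \<Rightarrow> real" where
  "dirichlet_norm p f =
     (norm (f 0) powr p +
      p * disc_integral (\<lambda>z. norm (deriv f z) powr p * (1 - (norm z)\<^sup>2) powr (p - 1)))
       powr (1 / p)"

definition taylor_coeff :: "(complex \<Rightarrow> complex) \<Rightarrow> nat \<Rightarrow> complex" where
  "taylor_coeff f n = (deriv ^^ n) f 0 / fact n"

definition HL_space :: "real \<Rightarrow> (complex \<Rightarrow> complex) set" where
  "HL_space p = {f. f holomorphic_on unit_disc \<and>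
     summable (\<lambda>n. norm (taylor_coeff f n) powr p * (real n + 1) powr (p - 2))}"

definition HL_norm :: "real \<Rightarrow> (complex \<Rightarrow> complex) \<Rightarrow> real" where
  "HL_norm p f =
     (\<Sum>n. norm (taylor_coeff f n) powr p * (real n + 1) powr (p - 2)) powr (1 / p)"

text \<open>Finiteness of the supremum in the extended reals. The first factor is finite and at least
  1, since the tail is nonincreasing and positive, so finiteness of the product requires
  \<open>\<omega> powr p'\<close> to be integrable on every \<open>[r,1)\<close>; this is stated separately because a
  nonconvergent Lebesgue integral has value 0.\<close>

definition muckenhoupt_cond :: "real \<Rightarrow> real \<Rightarrow> (real \<Rightarrow> real) \<Rightarrow> bool" where
  "muckenhoupt_cond p p' \<omega> \<longleftrightarrow>
     (\<forall>r\<in>{0<..<1}. set_integrable lebesgue {r..<1} (\<lambda>t. \<omega> t powr p')) \<and>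
     bdd_above ((\<lambda>r.
       (1 + (LINT t:{0..r}|lebesgue. 1 / weight_tail \<omega> t powr p)) powr (1 / p) *
       (LINT t:{r..<1}|lebesgue. \<omega> t powr p') powr (1 / p')) ` {0<..<1})"

end

theory Submission
 imports Defs
begin

text \<open>
  Write \<open>tail r\<close> for the integral of the weight over \<open>[r,1)\<close> and
  \<open>u n = 1 / moment (2 * n + 1)\<close>. The monomials are orthogonal in the Bergman space, so
  for \<open>0 \<le> t < 1\<close> the Bergman kernel at \<open>t\<close> is
  \<open>U (t * z) / 2\<close> with \<open>U z = (\<Sum>n. u n * z ^ n)\<close>, and its averaged
  primitive is \<open>V (t * z) / 2\<close>, where \<open>V\<close> has the coefficients
  \<open>u n / (n + 1)\<close> (\<open>hilbert_kernel_eq\<close>). The operator becomes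
  \<open>Hop f z\<close>, the integral of \<open>f t * V (t * z) / 2 * w t\<close>.

  Sufficiency. Doubling makes moments comparable with tails,
  \<open>moment n \<approx> tail (1 - 1 / (n + 1))\<close>, and makes \<open>u\<close> a regular
  sequence: its \<open>k\<close>-th difference is \<open>O(u n / (n + 1) ^ k)\<close>. Summation by
  parts then gives \<open>\<bar>U z\<bar> \<le> C / (d * tail (1 - d))\<close> whenever
  \<open>d \<le> \<bar>1 - z\<bar>\<close> (\<open>U_bound\<close>). With \<open>Phi y = 1 +\<close>
  the integral of \<open>1 / ((1 - s) * tail s)\<close> over \<open>[0,y]\<close>, one gets
  \<open>\<bar>V (t * r * cis \<theta>)\<bar> \<le> C * Phi (min t y)\<close>, where
  \<open>1 - y\<close> is the larger of \<open>1 - r\<close> and the distance of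
  \<open>\<theta>\<close> to the point \<open>1\<close> of the circle. Hence a single positive
  operator \<open>T\<close> on the interval, with kernel \<open>Phi (min t y) * w t\<close>,
  dominates the values of \<open>Hop f\<close> on circles, its derivative multiplied by
  \<open>1 - y\<close>, and its coefficients \<open>(n + 1) * \<bar>hc f n\<bar>\<close> at
  \<open>y = 1 - 1 / (n + 1)\<close>. Interchanging the integrals, \<open>T f y\<close> is the
  integral of \<open>f * w\<close> plus that of \<open>G s / tail s / (1 - s)\<close> over
  \<open>[0,y]\<close>, where \<open>G s\<close> is the integral of \<open>f * w\<close> over
  \<open>[s,1)\<close>. The Muckenhoupt condition is what the weighted Hardy inequality
  (\<open>Muckenhoupt_Hardy\<close>) requires to control \<open>G / tail\<close> in
  \<open>L\<^sup>p\<close>, and integration against \<open>1 / (1 - s)\<close> is bounded by the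
  Hardy-Hilbert inequality. So \<open>T\<close> is bounded on \<open>L\<^sup>p\<close>
  (\<open>T_bound\<close>), and the three target norms follow (\<open>Hop_Hardy\<close>,
  \<open>Hop_Dirichlet\<close>, \<open>Hop_HL\<close>).

  Necessity. Let \<open>g \<ge> 0\<close> be bounded and supported in \<open>[r,1)\<close>, and let
  \<open>J\<close> be the integral of \<open>g * w\<close>. All Taylor coefficients of
  \<open>Hop g\<close> are nonnegative, and those of index about \<open>1 / (1 - \<rho>)\<close>
  alone give \<open>Hop g \<rho> \<ge> c * J / tail \<rho>\<close> for
  \<open>\<rho> \<le> r\<close>, with an analogous bound for \<open>(1 - \<rho>) * (Hop g)'\<close>.
  The Fejer-Riesz inequality bounds the \<open>L\<^sup>p\<close> norm of a function along a radius
  by its mean on a circle; applied to \<open>Hop g\<close>, or to its derivative and then integrated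
  over the radii, it shows that \<open>J\<^sup>p * (1 + \<integral> 1 / tail\<^sup>p)\<close>, with
  the integral over \<open>[0,r]\<close>, is at most a constant times the \<open>p\<close>-th power
  of the Hardy or Dirichlet norm; for the coefficient norm this is a comparison on the blocks from
  \<open>1 - 1 / (n + 1)\<close> to \<open>1 - 1 / (n + 2)\<close>. Boundedness and the extremal
  choice \<open>g = w powr (p' - 1)\<close> on \<open>[r,1)\<close>, reached by truncation, give the
  condition (\<open>muck_from_test\<close>).

  The Fejer-Riesz inequality also says that restriction to the radius maps \<open>H\<^sup>p\<close>
  boundedly into \<open>L\<^sup>p\<close>, which turns boundedness from \<open>L\<^sup>p\<close>
  into boundedness from \<open>H\<^sup>p\<close>.
\<close>

text \<open>Lebesgue integrals of functions with values in \<open>[0,\<infinity>]\<close> occur throughout; the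
  short forms fix Lebesgue measure and leave room for the domain of integration.\<close>

abbreviation nint :: "('a::euclidean_space \<Rightarrow> ennreal) \<Rightarrow> ennreal" (binder "NINT " 10)
 where "nint f \<equiv> nn_integral lborel f"

abbreviation nint_on :: "'a::euclidean_space set \<Rightarrow> ('a \<Rightarrow> ennreal) \<Rightarrow> ennreal"
 where "nint_on S f \<equiv> nn_integral lborel (\<lambda>x. f x * indicator S x)"

syntax "_nint_on" :: "pttrn \<Rightarrow> 'a set \<Rightarrow> ennreal \<Rightarrow> ennreal" ("(3NINT _:_./ _)" [0, 51, 10] 10)
translations "NINT x:S. f" \<rightleftharpoons> "CONST nint_on S (\<lambda>x. f)"

section \<open>Powers and the inequalities of Hoelder and Schur\<close>

text \<open>Real powers on \<open>[0,\<infinity>]\<close>. Working there makes every integral and every constant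
  meaningful before finiteness is known. The value at \<open>top\<close> is right for positive
  exponents only.\<close>

definition epow :: "ennreal \<Rightarrow> real \<Rightarrow> ennreal" where
 "epow x p = (if x = top then top else ennreal (enn2real x powr p))"

lemma epow_ennreal [simp]: "0 \<le> a \<Longrightarrow> epow (ennreal a) p = ennreal (a powr p)"
 by (simp add: epow_def)

lemma epow_top [simp]: "epow top p = top" by (simp add: epow_def)

lemma epow_0 [simp]: "epow 0 p = 0" by (simp add: epow_def)

lemma epow_one [simp]: "epow x 1 = x" by (cases x) (auto simp: epow_def)

lemma epow_mono: "x \<le> y \<Longrightarrow> 0 < p \<Longrightarrow> epow x p \<le> epow y p"
 by (cases x; cases y) (auto simp: powr_mono2 top_unique)

lemma epow_mult: "0 < p \<Longrightarrow> epow (x * y) p = epow x p * epow y p" by (cases x; cases y)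
  (auto simp: ennreal_mult'[symmetric] powr_mult ennreal_mult_eq_top_iff ennreal_top_mult ennreal_mult_top)

lemma epow_epow: "0 < p \<Longrightarrow> 0 < q \<Longrightarrow> epow (epow x p) q = epow x (p * q)"
 by (cases x) (auto simp: powr_powr)

lemma epow_eq_0_iff: "0 < p \<Longrightarrow> epow x p = 0 \<longleftrightarrow> x = 0"
 by (cases x) (auto simp: ennreal_eq_0_iff)

lemma epow_eq_top_iff [simp]: "epow x p = top \<longleftrightarrow> x = top" by (cases x) auto

lemma epow_add_le:
 assumes "0 < p" shows "epow (x + y) p \<le> ennreal (2 powr p) * (epow x p + epow y p)"
proof -
 have *: "epow (a + b) p \<le> ennreal (2 powr p) * (epow a p + epow b p)" if "a \<le> b" for a b
 proof -
  have "a + b \<le> 2 * b" using that by (metis add_mono mult_2 order_refl)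
  then have "epow (a + b) p \<le> epow (2 * b) p" using assms by (rule epow_mono)
  also have "\<dots> = ennreal (2 powr p) * epow b p" using assms epow_ennreal[of 2 p] by (simp add: epow_mult)
  also have "\<dots> \<le> ennreal (2 powr p) * (epow a p + epow b p)" by (intro mult_left_mono) auto
  finally show ?thesis .
 qed
 show ?thesis using *[of x y] *[of y x] by (metis add.commute linear)
qed

lemma measurable_epow [measurable]:
 assumes [measurable]: "f \<in> borel_measurable M"
 shows "(\<lambda>x. epow (f x) p) \<in> borel_measurable M" unfolding epow_def by measurable

lemma conjugate_gt_1:
 assumes "1 < p" "1 / p + 1 / q = (1::real)" shows "1 < q"
proof -
 have "1 / q = 1 - 1 / p" using assms by simp
 moreover have "0 < 1 - 1/p" "1 - 1/p < 1" using assms by auto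
 ultimately have "0 < 1/q" "1/q < 1" by auto
 then show ?thesis by (simp add: divide_less_eq split: if_splits)
qed

text \<open>If one factor vanishes or is infinite the claim is immediate; otherwise normalize both norms to 1
  and integrate Young's inequality.\<close>

lemma Holder_nn_integral:
 fixes f g :: "'a \<Rightarrow> ennreal"
 assumes [measurable]: "f \<in> borel_measurable M" "g \<in> borel_measurable M"
  and p: "1 < p" "1 / p + 1 / q = (1::real)"
 shows "(\<integral>\<^sup>+x. f x * g x \<partial>M) \<le>
  epow (\<integral>\<^sup>+x. epow (f x) p \<partial>M) (1/p) * epow (\<integral>\<^sup>+x. epow (g x) q \<partial>M) (1/q)"
  (is "_ \<le> epow ?X _ * epow ?Y _")
proof -
 have q: "1 < q" by (rule conjugate_gt_1[OF p])
 consider "?X = 0" | "?Y = 0" | "?X = top" "?Y \<noteq> 0" | "?Y = top" "?X \<noteq> 0"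
  | "?X \<noteq> 0" "?X \<noteq> top" "?Y \<noteq> 0" "?Y \<noteq> top" by blast
 then show ?thesis
 proof cases
  case 1
  then have "AE x in M. epow (f x) p = 0" by (subst (asm) nn_integral_0_iff_AE) auto
  then have "AE x in M. f x * g x = 0" using p by (auto simp: epow_eq_0_iff elim: eventually_mono)
  then have "(\<integral>\<^sup>+x. f x * g x \<partial>M) = 0" by (subst nn_integral_0_iff_AE) auto
  then show ?thesis by simp
 next
  case 2
  then have "AE x in M. epow (g x) q = 0" by (subst (asm) nn_integral_0_iff_AE) auto
  then have "AE x in M. f x * g x = 0" using q by (auto simp: epow_eq_0_iff elim: eventually_mono)
  then have "(\<integral>\<^sup>+x. f x * g x \<partial>M) = 0" by (subst nn_integral_0_iff_AE) auto
  then show ?thesis by simp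
 next
  case 3 then show ?thesis using q by (simp add: ennreal_top_mult epow_eq_0_iff)
 next
  case 4 then show ?thesis using p by (simp add: ennreal_mult_top epow_eq_0_iff)
 next
  case 5
  then obtain X Y where X: "?X = ennreal X" "0 < X" and Y: "?Y = ennreal Y" "0 < Y"
   by (metis ennreal_cases ennreal_0 less_eq_real_def)
  define a where "a = X powr (1/p)" define b where "b = Y powr (1/q)"
  have ab: "0 < a" "0 < b" using X Y by (auto simp: a_def b_def)
  have pt: "f x * g x \<le> ennreal (a * b / (p * X)) * epow (f x) p + ennreal (a * b / (q * Y)) * epow (g x) q" for x
  proof (cases "f x = top \<or> g x = top")
   case True
   have "0 < a * b / (p * X)" "0 < a * b / (q * Y)" using ab X Y p q by auto
   then have T: "ennreal (a * b / (p * X)) * epow (f x) p + ennreal (a * b / (q * Y)) * epow (g x) q = top"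
    using True ab X Y p q by (auto simp: ennreal_mult_top)
   show ?thesis unfolding T by simp
  next
   case False
   then obtain r s where r: "f x = ennreal r" "0 \<le> r" and s: "g x = ennreal s" "0 \<le> s"
    by (metis ennreal_cases)
   have "(r / a) * (s / b) \<le> (r/a) powr p / p + (s/b) powr q / q"
    using r s ab p q by (intro Youngs_inequality) auto
   also have "(r/a) powr p = r powr p / X" using r ab X p by (simp add: powr_divide a_def powr_powr)
   also have "(s/b) powr q = s powr q / Y" using s ab Y q by (simp add: powr_divide b_def powr_powr)
   finally have "(a * b) * ((r / a) * (s / b)) \<le> (a * b) * (r powr p / X / p + s powr q / Y / q)"
    using ab by (intro mult_left_mono) auto
   then have "r * s \<le> a * b / (p * X) * r powr p + a * b / (q * Y) * s powr q"
    using ab by (simp add: field_simps)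
   then show ?thesis using r s ab X Y p q
    by (simp add: ennreal_mult'[symmetric] ennreal_plus[symmetric] del: ennreal_plus)
  qed
  have "(\<integral>\<^sup>+x. f x * g x \<partial>M) \<le> (\<integral>\<^sup>+x. ennreal (a * b / (p * X)) * epow (f x) p + ennreal (a * b / (q * Y)) * epow (g x) q \<partial>M)"
   by (intro nn_integral_mono pt)
  also have "\<dots> = ennreal (a * b / (p * X)) * ?X + ennreal (a * b / (q * Y)) * ?Y"
   by (simp add: nn_integral_add nn_integral_cmult)
  also have "\<dots> = ennreal (a * b / (p * X) * X + a * b / (q * Y) * Y)"
   using X Y ab p q by (simp add: ennreal_mult'[symmetric])
  also have "a * b / (p * X) * X + a * b / (q * Y) * Y = a * b * (1/p + 1/q)" using X Y by (simp add: field_simps)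
  also have "ennreal (a * b * (1/p + 1/q)) = epow ?X (1/p) * epow ?Y (1/q)"
   using p X Y ab unfolding p(2) by (simp add: a_def b_def ennreal_mult'[symmetric])
  finally show ?thesis .
 qed
qed

lemma Holder_nn_integral_powr:
 fixes f g :: "'a \<Rightarrow> ennreal"
 assumes "f \<in> borel_measurable M" "g \<in> borel_measurable M"
  and p: "1 < p" "1 / p + 1 / q = (1::real)"
 shows "epow (\<integral>\<^sup>+x. f x * g x \<partial>M) p \<le>
  (\<integral>\<^sup>+x. epow (f x) p \<partial>M) * epow (\<integral>\<^sup>+x. epow (g x) q \<partial>M) (p/q)"
proof -
 have q: "1 < q" by (rule conjugate_gt_1[OF p])
 show ?thesis using epow_mono[OF Holder_nn_integral[OF assms], of p] p q by (simp add: epow_mult epow_epow)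
qed

text \<open>Apply Hoelder to \<open>(k powr (1 / q) * b) * (k powr (1 / p) * f / b)\<close> for fixed
  \<open>x\<close>: the first factor is controlled by the first hypothesis, and after interchanging
  the integrals the second hypothesis controls the rest.\<close>

lemma Schur_test:
 fixes k :: "'a \<Rightarrow> 'b \<Rightarrow> real" and f :: "'b \<Rightarrow> ennreal"
 assumes "sigma_finite_measure M" "sigma_finite_measure N"
 assumes [measurable]: "(\<lambda>(x,y). k x y) \<in> borel_measurable (M \<Otimes>\<^sub>M N)"
  "f \<in> borel_measurable N" "a \<in> borel_measurable M" "b \<in> borel_measurable N"
  and p: "1 < p" "1 / p + 1 / q = (1::real)"
  and pos: "\<And>x. 0 < a x" "\<And>y. 0 < b y" "0 \<le> A" "0 \<le> B" "\<And>x y. 0 \<le> k x y"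
  and 1: "\<And>x. (\<integral>\<^sup>+y. ennreal (k x y * b y powr q) \<partial>N) \<le> ennreal (A * a x powr q)"
  and 2: "\<And>y. (\<integral>\<^sup>+x. ennreal (k x y * a x powr p) \<partial>M) \<le> ennreal (B * b y powr p)"
 shows "(\<integral>\<^sup>+x. epow (\<integral>\<^sup>+y. ennreal (k x y) * f y \<partial>N) p \<partial>M)
   \<le> ennreal (A powr (p/q) * B) * (\<integral>\<^sup>+y. epow (f y) p \<partial>N)"
proof -
 interpret M: sigma_finite_measure M by fact
 interpret N: sigma_finite_measure N by fact
 interpret pair_sigma_finite M N by standard
 have q: "1 < q" by (rule conjugate_gt_1[OF p])
 have [measurable]: "(\<lambda>y. k x y) \<in> borel_measurable N" if "x \<in> space M" for x
  using that by measurable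
 have inner: "epow (\<integral>\<^sup>+y. ennreal (k x y) * f y \<partial>N) p \<le>
   (\<integral>\<^sup>+y. ennreal (k x y * b y powr (-p)) * epow (f y) p \<partial>N) * ennreal (A powr (p/q) * a x powr p)" if x: "x \<in> space M" for x
 proof -
  have eq: "ennreal (k x y) * f y = (ennreal (k x y powr (1/p) / b y) * f y) * ennreal (k x y powr (1/q) * b y)" for y
  proof -
   have "k x y powr (1/p) / b y * (k x y powr (1/q) * b y) = k x y powr (1/p + 1/q)"
    using pos(2)[of y] by (simp add: powr_add)
   also have "\<dots> = k x y" unfolding p(2) using pos(5)[of x y] by simp
   finally have e: "k x y powr (1/p) / b y * (k x y powr (1/q) * b y) = k x y" .
   have "(ennreal (k x y powr (1/p) / b y) * f y) * ennreal (k x y powr (1/q) * b y)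
    = ennreal (k x y powr (1/p) / b y * (k x y powr (1/q) * b y)) * f y"
    using pos(2)[of y] by (subst ennreal_mult) (auto simp: mult_ac intro!: divide_nonneg_pos)
   then show ?thesis unfolding e by simp
  qed
  have "epow (\<integral>\<^sup>+y. ennreal (k x y) * f y \<partial>N) p \<le>
   (\<integral>\<^sup>+y. epow (ennreal (k x y powr (1/p) / b y) * f y) p \<partial>N) *
    epow (\<integral>\<^sup>+y. epow (ennreal (k x y powr (1/q) * b y)) q \<partial>N) (p/q)"
   unfolding eq using x by (intro Holder_nn_integral_powr p) measurable
  also have "(\<lambda>y. epow (ennreal (k x y powr (1/p) / b y) * f y) p) = (\<lambda>y. ennreal (k x y * b y powr (-p)) * epow (f y) p)"
  proof
   fix y
   have "(k x y powr (1/p) / b y) powr p = k x y * b y powr (-p)"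
    using pos(2)[of y] pos(5)[of x y] p by (simp add: powr_divide powr_powr powr_minus divide_simps)
   moreover have "0 \<le> k x y powr (1/p) / b y" using pos(2)[of y] by (intro divide_nonneg_pos) auto
   ultimately show "epow (ennreal (k x y powr (1/p) / b y) * f y) p = ennreal (k x y * b y powr (-p)) * epow (f y) p"
    using p by (simp add: epow_mult)
  qed
  also have "(\<lambda>y. epow (ennreal (k x y powr (1/q) * b y)) q) = (\<lambda>y. ennreal (k x y * b y powr q))"
  proof
   fix y
   show "epow (ennreal (k x y powr (1/q) * b y)) q = ennreal (k x y * b y powr q)"
    using pos(2)[of y] pos(5)[of x y] q by (simp add: powr_mult powr_powr)
  qed
  finally have 3: "epow (\<integral>\<^sup>+y. ennreal (k x y) * f y \<partial>N) p \<le>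
   (\<integral>\<^sup>+y. ennreal (k x y * b y powr (-p)) * epow (f y) p \<partial>N) *
    epow (\<integral>\<^sup>+y. ennreal (k x y * b y powr q) \<partial>N) (p/q)" .
  have "epow (\<integral>\<^sup>+y. ennreal (k x y * b y powr q) \<partial>N) (p/q) \<le> epow (ennreal (A * a x powr q)) (p/q)"
   using p q by (intro epow_mono 1) auto
  also have "\<dots> = ennreal (A powr (p/q) * a x powr p)"
   using pos(1)[of x] pos(3) q by (simp add: powr_mult powr_powr)
  finally show ?thesis by (intro order.trans[OF 3] mult_left_mono) auto
 qed
 have "(\<integral>\<^sup>+x. epow (\<integral>\<^sup>+y. ennreal (k x y) * f y \<partial>N) p \<partial>M)
  \<le> (\<integral>\<^sup>+x. (\<integral>\<^sup>+y. ennreal (k x y * b y powr (-p)) * epow (f y) p \<partial>N) * ennreal (A powr (p/q) * a x powr p) \<partial>M)"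
  by (intro nn_integral_mono inner)
 also have "\<dots> = (\<integral>\<^sup>+x. (\<integral>\<^sup>+y. ennreal (k x y * b y powr (-p)) * epow (f y) p * ennreal (A powr (p/q) * a x powr p) \<partial>N) \<partial>M)"
  by (intro nn_integral_cong nn_integral_multc[symmetric]) measurable
 also have "\<dots> = (\<integral>\<^sup>+y. (\<integral>\<^sup>+x. ennreal (k x y * b y powr (-p)) * epow (f y) p * ennreal (A powr (p/q) * a x powr p) \<partial>M) \<partial>N)"
  by (rule Fubini'[symmetric]) measurable
 also have "\<dots> = (\<integral>\<^sup>+y. (\<integral>\<^sup>+x. ennreal (k x y * a x powr p) * (ennreal (A powr (p/q) * b y powr (-p)) * epow (f y) p) \<partial>M) \<partial>N)"
 proof (intro nn_integral_cong)
  fix x y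
  have "ennreal (k x y * b y powr (-p)) * ennreal (A powr (p/q) * a x powr p) = ennreal (k x y * a x powr p) * ennreal (A powr (p/q) * b y powr (-p))"
   using pos(5)[of x y] by (simp add: ennreal_mult'[symmetric] mult_ac)
  then show "ennreal (k x y * b y powr (-p)) * epow (f y) p * ennreal (A powr (p/q) * a x powr p)
    = ennreal (k x y * a x powr p) * (ennreal (A powr (p/q) * b y powr (-p)) * epow (f y) p)"
   by (simp add: mult_ac)
 qed
 also have "\<dots> = (\<integral>\<^sup>+y. (\<integral>\<^sup>+x. ennreal (k x y * a x powr p) \<partial>M) * (ennreal (A powr (p/q) * b y powr (-p)) * epow (f y) p) \<partial>N)"
  by (intro nn_integral_cong nn_integral_multc) measurable
 also have "\<dots> \<le> (\<integral>\<^sup>+y. ennreal (B * b y powr p) * (ennreal (A powr (p/q) * b y powr (-p)) * epow (f y) p) \<partial>N)"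
  by (intro nn_integral_mono mult_right_mono 2) auto
 also have "\<dots> = (\<integral>\<^sup>+y. ennreal (A powr (p/q) * B) * epow (f y) p \<partial>N)"
 proof (intro nn_integral_cong)
  fix y
  have "ennreal (B * b y powr p) * ennreal (A powr (p/q) * b y powr (-p)) = ennreal (A powr (p/q) * B)"
   using pos(2)[of y] pos(4) by (simp add: ennreal_mult'[symmetric] powr_minus field_simps)
  then show "ennreal (B * b y powr p) * (ennreal (A powr (p/q) * b y powr (-p)) * epow (f y) p) = ennreal (A powr (p/q) * B) * epow (f y) p"
   by (simp add: mult.assoc[symmetric])
 qed
 also have "\<dots> = ennreal (A powr (p/q) * B) * (\<integral>\<^sup>+y. epow (f y) p \<partial>N)"
  by (simp add: nn_integral_cmult)
 finally show ?thesis .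
qed

section \<open>The Hardy-Hilbert inequality and weighted Hardy inequalities\<close>

lemma epow_base_1 [simp]: "epow 1 p = 1" using epow_ennreal[of 1 p] by simp

lemma nn_integral_powr_from_0:
 assumes "c < 1" "0 \<le> x"
 shows "(NINT y:{0..x}. ennreal (y powr (-c))) = ennreal (x powr (1-c) / (1-c))"
proof -
 have "((\<lambda>y. y powr (-c)) has_integral (x powr (-c+1) / (-c+1))) {0..x}"
  using assms by (intro has_integral_powr_from_0) auto
 from nn_integral_has_integral_lebesgue[OF _ this] show ?thesis
  by (simp add: mult.commute ennreal_mult'' ennreal_indicator[symmetric] algebra_simps)
qed

lemma nn_integral_powr_to_inf:
 assumes "0 < c" "0 < x"
 shows "(NINT y:{x..}. ennreal (y powr (-c-1))) = ennreal (x powr (-c) / c)"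
proof -
 have "((\<lambda>y. y powr (-c-1)) has_integral (-(x powr (-c-1+1)) / (-c-1+1))) {x..}"
  using assms by (intro has_integral_powr_to_inf) auto
 from nn_integral_has_integral_lebesgue[OF _ this] show ?thesis
  using assms by (simp add: mult.commute ennreal_mult'' ennreal_indicator[symmetric] algebra_simps)
qed

text \<open>The kernel \<open>1 / max x u\<close> is comparable with the Hilbert kernel
  \<open>1 / (x + u)\<close> and easier to integrate.\<close>

definition hh_kernel :: "real \<Rightarrow> real \<Rightarrow> real" where
 "hh_kernel x u = (if 0 < x \<and> 0 < u then 1 / max x u else 0)"

lemma hh_kernel_nonneg [simp]: "0 \<le> hh_kernel x u" by (auto simp: hh_kernel_def max_def)

lemma hh_kernel_commute: "hh_kernel x u = hh_kernel u x" by (simp add: hh_kernel_def max.commute conj_commute)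

lemma measurable_hh_kernel [measurable]:
 "(\<lambda>(x,u). hh_kernel x u) \<in> borel_measurable (borel \<Otimes>\<^sub>M borel)"
 unfolding hh_kernel_def by measurable

lemma hh_kernel_powr:
 assumes c: "0 < c" "c < 1" and x: "0 < x"
 shows "(NINT u. ennreal (hh_kernel x u * u powr (-c))) \<le> ennreal ((1/(1-c) + 1/c) * x powr (-c))"
proof -
 have "ennreal (hh_kernel x u * u powr (-c)) \<le> ennreal (1/x) * (ennreal (u powr (-c)) * indicator {0..x} u)
    + ennreal (u powr (-c-1)) * indicator {x..} u" for u
 proof -
  consider "u \<le> 0" | "0 < u" "u < x" | "x \<le> u" using x by linarith
  then show ?thesis
  proof cases
   case 1 then show ?thesis by (simp add: hh_kernel_def)
  next
   case 2 then show ?thesis by (simp add: hh_kernel_def max_def ennreal_mult'[symmetric])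
  next
   case 3
   then have "hh_kernel x u * u powr (-c) = u powr (-c-1)" using x by (simp add: hh_kernel_def max_def powr_diff)
   then show ?thesis using 3 by (simp add: add_increasing)
  qed
 qed
 then have "(NINT u. ennreal (hh_kernel x u * u powr (-c))) \<le>
   (NINT u. ennreal (1/x) * (ennreal (u powr (-c)) * indicator {0..x} u)
    + ennreal (u powr (-c-1)) * indicator {x..} u)" by (intro nn_integral_mono) auto
 also have "\<dots> = ennreal (1/x) * ennreal (x powr (1-c) / (1-c)) + ennreal (x powr (-c) / c)"
  using nn_integral_powr_from_0[of c x] nn_integral_powr_to_inf[of c x] c x
  by (simp add: nn_integral_add nn_integral_cmult)
 also have "\<dots> = ennreal (1/x * (x powr (1-c) / (1-c)) + x powr (-c) / c)"
  using c x by (simp add: ennreal_mult'[symmetric] ennreal_plus[symmetric] del: ennreal_plus)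
 also have "1/x * (x powr (1-c) / (1-c)) + x powr (-c) / c = (1/(1-c) + 1/c) * x powr (-c)"
  using c x by (simp add: powr_diff powr_minus field_simps)
 finally show ?thesis .
qed

text \<open>Schur's test with the weight \<open>u powr (- 1 / (p * q))\<close>, an eigenfunction up to constants
  by \<open>hh_kernel_powr\<close>, since the kernel is homogeneous of degree -1.\<close>

theorem Hardy_Hilbert:
 fixes f :: "real \<Rightarrow> ennreal"
 assumes [measurable]: "f \<in> borel_measurable borel" and p: "1 < p" "1 / p + 1 / q = (1::real)"
 shows "(NINT x. epow (NINT u. ennreal (hh_kernel x u) * f u) p)
   \<le> ennreal ((p + q) powr p) * (NINT u. epow (f u) p)"
proof -
 have q: "1 < q" by (rule conjugate_gt_1[OF p])
 define a where "a x = (if 0 < x then x powr (-(1/(p*q))) else 1)" for x :: real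
 have [measurable]: "a \<in> borel_measurable borel" unfolding a_def by measurable
 have pq: "1 / (1 - 1/p) = q" "1 / (1 - 1/q) = p"
 proof -
  have e: "1 - 1/p = 1/q" "1 - 1/q = 1/p" using p by auto
  show "1 / (1 - 1/p) = q" "1 / (1 - 1/q) = p" unfolding e by auto
 qed
 have k: "(NINT u. ennreal (hh_kernel x u * a u powr r)) \<le> ennreal ((p+q) * a x powr r)"
  if r: "(r = p \<and> s = q) \<or> (r = q \<and> s = p)" for x r s
 proof (cases "0 < x")
  case False
  then show ?thesis by (simp add: hh_kernel_def)
 next
  case True
  have e: "1 / (p * q) * r = 1 / s" using r p q by auto
  have "ennreal (hh_kernel x u * a u powr r) = ennreal (hh_kernel x u * u powr (-(1/s)))" for u
   using e by (auto simp: hh_kernel_def a_def powr_powr simp del: times_divide_eq_left)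
  then have "(NINT u. ennreal (hh_kernel x u * a u powr r)) = (NINT u. ennreal (hh_kernel x u * u powr (-(1/s))))"
   by (simp only:)
  also have "\<dots> \<le> ennreal ((1/(1-1/s) + 1/(1/s)) * x powr (-(1/s)))"
   using True r p q by (intro hh_kernel_powr) auto
  also have "1/(1-1/s) + 1/(1/s) = p + q" using r pq by auto
  also have "x powr (-(1/s)) = a x powr r" using e True by (simp add: a_def powr_powr del: times_divide_eq_left)
  finally show ?thesis .
 qed
 have "(NINT x. epow (NINT u. ennreal (hh_kernel x u) * f u) p)
   \<le> ennreal ((p+q) powr (p/q) * (p+q)) * (NINT u. epow (f u) p)"
 proof (rule Schur_test[where a=a and b=a and q=q])
  show "(NINT x. ennreal (hh_kernel x y * a x powr p)) \<le> ennreal ((p+q) * a y powr p)" for y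
   using k[of p q y] by (simp add: hh_kernel_commute)
  show "(NINT y. ennreal (hh_kernel x y * a y powr q)) \<le> ennreal ((p+q) * a x powr q)" for x
   using k[of q p x] by simp
 qed (use p q in \<open>auto simp: a_def sigma_finite_lborel\<close>)
 also have "(p+q) powr (p/q) * (p+q) = (p + q) powr p"
 proof -
  have "p / q + 1 = p" using p q by (simp add: field_simps)
  then show ?thesis using p q powr_add[of "p+q" "p/q" 1] by simp
 qed
 finally show ?thesis .
qed

text \<open>The set is an up-set of the line, hence an increasing union of half-lines \<open>{t..}\<close> with
  \<open>t\<close> in the set, each of measure at most \<open>c\<close>.\<close>

lemma emeasure_small_upper_tails:
 fixes \<nu> :: "real measure"
 assumes [simp]: "sets \<nu> = sets borel"
 shows "emeasure \<nu> {t. emeasure \<nu> {t..} \<le> c} \<le> c"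
proof -
 define S where "S = {t. emeasure \<nu> {t..} \<le> c}"
 have up: "t' \<in> S" if "t \<in> S" "t \<le> t'" for t t'
  using that emeasure_mono[of "{t'..}" "{t..}" \<nu>] by (auto simp: S_def)
 have *: "emeasure \<nu> S \<le> c" if "incseq (\<lambda>n::nat. {x n..})" "S = (\<Union>n. {x n..})" "\<And>n. x n \<in> S" for x
 proof -
  have "emeasure \<nu> S = (SUP n. emeasure \<nu> {x n..})"
   unfolding that(2) using that(1) by (intro SUP_emeasure_incseq[symmetric]) auto
  also have "\<dots> \<le> c" using that(3) by (intro SUP_least) (auto simp: S_def)
  finally show ?thesis .
 qed
 consider "S = {}" | "S \<noteq> {}" "\<not> bdd_below S" | t where "t \<in> S" "\<And>s. s \<in> S \<Longrightarrow> t \<le> s"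
  | "S \<noteq> {}" "bdd_below S" "Inf S \<notin> S" by (metis cInf_lower)
 then have "emeasure \<nu> S \<le> c"
 proof cases
  case 1 then show ?thesis by simp
 next
  case 2
  then have all: "t \<in> S" for t using up unfolding bdd_below_def by (meson linear)
  show ?thesis
  proof (rule *[of "\<lambda>n. - real n"])
   show "S = (\<Union>n. {- real n..})"
   proof -
    have "\<exists>n. - real n \<le> x" for x by (meson minus_le_iff real_arch_simple)
    then show ?thesis using all by auto
   qed
  qed (auto simp: all incseq_def)
 next
  case 3
  then have S: "S = {t..}" using up by auto
  have "emeasure \<nu> {t..} \<le> c" using 3(1) by (simp add: S_def)
  then show ?thesis by (simp add: S)
 next
  case 4
  have gt: "t \<in> S" if "Inf S < t" for t using cInf_lessD[OF 4(1) that] up by (meson less_imp_le)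
  have gt': "Inf S < t" if "t \<in> S" for t using cInf_lower[OF that 4(2)] 4(3) that by (metis less_eq_real_def)
  show ?thesis
  proof (rule *[of "\<lambda>n. Inf S + 1 / real (Suc n)"])
   show "incseq (\<lambda>n. {Inf S + 1 / real (Suc n)..})"
   proof (rule incseq_SucI)
    fix n
    have "1 / real (Suc (Suc n)) \<le> 1 / real (Suc n)" by (intro divide_left_mono) auto
    then show "{Inf S + 1 / real (Suc n)..} \<le> {Inf S + 1 / real (Suc (Suc n))..}" by auto
   qed
   show "S = (\<Union>n. {Inf S + 1 / real (Suc n)..})"
   proof safe
    fix t assume "t \<in> S"
    from gt'[OF this] obtain n where "1 / real (Suc n) < t - Inf S" using nat_approx_posE[of "t - Inf S"] by auto
    then show "t \<in> (\<Union>n. {Inf S + 1 / real (Suc n)..})" by (intro UN_I[of n]) auto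
   next
    fix t n assume "Inf S + 1 / real (Suc n) \<le> t"
    then have "Inf S < t" by (smt (verit) divide_pos_pos of_nat_0_less_iff zero_less_Suc)
    then show "t \<in> S" by (rule gt)
   qed
   show "\<And>n. Inf S + 1 / real (Suc n) \<in> S" by (rule gt) simp
  qed
 qed
 then show ?thesis by (simp add: S_def)
qed

text \<open>The mirror image of the previous fact under reflection at the origin.\<close>

lemma emeasure_small_lower_tails:
 fixes \<nu> :: "real measure"
 assumes [simp]: "sets \<nu> = sets borel"
 shows "emeasure \<nu> {t. emeasure \<nu> {..t} \<le> c} \<le> c"
proof -
 have m: "uminus \<in> measurable \<nu> (borel :: real measure)"
  unfolding measurable_cong_sets[OF assms refl] by measurable
 let ?N = "distr \<nu> borel uminus"
 have sp: "space \<nu> = UNIV" using sets_eq_imp_space_eq[OF assms] by simp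
 have 1: "emeasure ?N {t..} = emeasure \<nu> {..-t}" for t
 proof -
  have "uminus -` {t..} \<inter> space \<nu> = {..-t}" by (auto simp: sp)
  then show ?thesis by (subst emeasure_distr[OF m]) auto
 qed
 have ms: "{t. emeasure ?N {t..} \<le> c} \<in> sets borel"
 proof -
  have "antimono (\<lambda>t. emeasure ?N {t..})" by (auto simp: antimono_def intro!: emeasure_mono)
  then have "is_interval {t. emeasure ?N {t..} \<le> c}"
   unfolding is_interval_1 by (auto simp: antimono_def intro: order.trans)
  then show ?thesis by (rule real_interval_borel_measurable)
 qed
 have "emeasure ?N {t. emeasure ?N {t..} \<le> c} = emeasure \<nu> {t. emeasure \<nu> {..t} \<le> c}"
  by (subst emeasure_distr[OF m ms]) (auto simp: 1 sp intro!: arg_cong[where f="emeasure \<nu>"])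
 then show ?thesis using emeasure_small_upper_tails[of ?N c] by simp
qed

text \<open>Layer cake: the hypothesis says that \<open>M\<close> is at least as spread out as the coordinate on
  \<open>[0,m]\<close> under Lebesgue measure, for which the integral of \<open>c powr (-a)\<close>
  equals the right-hand side.\<close>

lemma nn_integral_powr_minus_le:
 fixes M :: "'a \<Rightarrow> real"
 assumes [measurable]: "M \<in> borel_measurable \<nu>"
  and M: "\<And>t. t \<in> space \<nu> \<Longrightarrow> 0 < M t" "\<And>t. t \<in> space \<nu> \<Longrightarrow> M t \<le> m" and m: "0 < m"
  and small: "\<And>c. 0 < c \<Longrightarrow> emeasure \<nu> {t \<in> space \<nu>. M t \<le> c} \<le> ennreal c"
  and a: "0 < a" "a < 1"
 shows "(\<integral>\<^sup>+t. ennreal (M t powr (-a)) \<partial>\<nu>) \<le> ennreal (m powr (1-a) / (1-a))"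
proof -
 have tot: "emeasure \<nu> (space \<nu>) \<le> ennreal m"
  using small[OF m] M(2) by (metis (mono_tags, lifting) Collect_cong Collect_mem_eq)
 interpret finite_measure \<nu> by standard (use tot in \<open>auto simp: top_unique\<close>)
 interpret pair_sigma_finite \<nu> "lborel :: real measure" by standard
 let ?k = "\<lambda>t c. ennreal (a * c powr (-a-1)) * (if M t \<le> c \<and> 0 < c \<and> c \<le> m then 1 else 0)"
 have eq: "ennreal (M t powr (-a)) = ennreal (m powr (-a)) + (NINT c. ?k t c)" if t: "t \<in> space \<nu>" for t
 proof -
  have "(NINT c. ?k t c) = (NINT c:{M t..m}. ennreal (if 0 < c then a * c powr (-a-1) else 0))"
   using M(1)[OF t] by (intro nn_integral_cong) (auto split: split_indicator)
  also have "\<dots> = ennreal (- (m powr (-a)) - (- (M t powr (-a))))"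
  proof (rule nn_integral_FTC_Icc)
   show "DERIV (\<lambda>x. - (x powr (-a))) x :> (if 0 < x then a * x powr (-a-1) else 0)" if "x \<in> {M t..m}" for x
    using M(1)[OF t] that by (auto intro!: derivative_eq_intros)
  qed (use M(2)[OF t] a in auto)
  finally show ?thesis using M[OF t] a by (simp add: ennreal_plus[symmetric] powr_mono2' del: ennreal_plus)
 qed
 have "(\<integral>\<^sup>+t. ennreal (M t powr (-a)) \<partial>\<nu>) = (\<integral>\<^sup>+t. ennreal (m powr (-a)) + (NINT c. ?k t c) \<partial>\<nu>)"
  by (intro nn_integral_cong eq)
 also have "\<dots> = ennreal (m powr (-a)) * emeasure \<nu> (space \<nu>) + (\<integral>\<^sup>+t. (NINT c. ?k t c) \<partial>\<nu>)"
  by (subst nn_integral_add) auto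
 finally have 1: "(\<integral>\<^sup>+t. ennreal (M t powr (-a)) \<partial>\<nu>) =
  ennreal (m powr (-a)) * emeasure \<nu> (space \<nu>) + (\<integral>\<^sup>+t. (NINT c. ?k t c) \<partial>\<nu>)" .
 have "(\<integral>\<^sup>+t. (NINT c. ?k t c) \<partial>\<nu>) = (NINT c. \<integral>\<^sup>+t. ?k t c \<partial>\<nu>)"
  by (rule Fubini'[symmetric]) measurable
 also have "\<dots> \<le> (NINT c. ennreal a * (ennreal (c powr (-a)) * indicator {0..m} c))"
 proof (rule nn_integral_mono)
  fix c :: real
  show "(\<integral>\<^sup>+t. ?k t c \<partial>\<nu>) \<le> ennreal a * (ennreal (c powr (-a)) * indicator {0..m} c)"
  proof (cases "0 < c \<and> c \<le> m")
   case True
   have "(\<integral>\<^sup>+t. ?k t c \<partial>\<nu>) = (\<integral>\<^sup>+t. ennreal (a * c powr (-a-1)) * indicator {t \<in> space \<nu>. M t \<le> c} t \<partial>\<nu>)"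
    using True by (intro nn_integral_cong) (auto split: split_indicator)
   also have "\<dots> = ennreal (a * c powr (-a-1)) * emeasure \<nu> {t \<in> space \<nu>. M t \<le> c}"
    by (simp add: nn_integral_cmult)
   also have "\<dots> \<le> ennreal (a * c powr (-a-1)) * ennreal c" using True small by (intro mult_left_mono) auto
   also have "\<dots> = ennreal (a * c powr (-a))" using True a by (simp add: ennreal_mult'[symmetric] powr_diff)
   finally show ?thesis using True a by (simp add: ennreal_mult')
  next
   case False
   then have "(\<integral>\<^sup>+t. ?k t c \<partial>\<nu>) = (\<integral>\<^sup>+t. 0 \<partial>\<nu>)" by (intro nn_integral_cong) auto
   then show ?thesis by simp
  qed
 qed
 also have "\<dots> = ennreal (a * (m powr (1-a) / (1-a)))"
  using nn_integral_powr_from_0[of a m] a m by (simp add: nn_integral_cmult ennreal_mult'[symmetric])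
 finally have "(\<integral>\<^sup>+t. ennreal (M t powr (-a)) \<partial>\<nu>) \<le>
   ennreal (m powr (-a)) * ennreal m + ennreal (a * (m powr (1-a) / (1-a)))"
  unfolding 1 by (intro add_mono mult_left_mono tot) auto
 also have "ennreal (m powr (-a)) * ennreal m + ennreal (a * (m powr (1-a) / (1-a))) = ennreal (m powr (1-a) / (1-a))"
 proof -
  have "m powr (-a) * m + a * (m powr (1-a) / (1-a)) = m powr (1-a) / (1-a)"
   using a m by (simp add: powr_diff powr_minus field_simps)
  then show ?thesis using a m by (simp add: ennreal_mult'[symmetric] ennreal_plus[symmetric] del: ennreal_plus)
 qed
 finally show ?thesis .
qed

text \<open>The substitute for the change of variables \<open>X = \<integral> v\<close>, which would need
  absolute continuity of \<open>X\<close>: \<open>X\<close> only majorizes the mass of the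
  half-lines \<open>H t\<close>, and by the half-line lemmas the set where \<open>X \<le> c\<close>
  has mass at most \<open>c\<close>. One statement serves both upper and lower half-lines.\<close>

lemma nn_integral_powr_minus_tails:
 fixes X v :: "real \<Rightarrow> real" and H :: "real \<Rightarrow> real set"
 assumes [measurable]: "X \<in> borel_measurable borel" "v \<in> borel_measurable borel" "I \<in> sets borel" "\<And>t. H t \<in> sets borel"
  and v: "\<And>t. 0 \<le> v t" "\<And>t. t \<notin> I \<Longrightarrow> v t = 0" and a: "0 < a" "a < 1" and s: "s \<in> I"
  and X: "\<And>t. t \<in> I \<Longrightarrow> 0 < X t" "\<And>t. t \<in> I \<Longrightarrow> t \<in> H s \<Longrightarrow> X t \<le> X s"
   "\<And>t. t \<in> I \<Longrightarrow> (NINT s:(H t). ennreal (v s)) \<le> ennreal (X t)"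
  and H: "\<And>N c. sets N = sets borel \<Longrightarrow> is_interval {t. emeasure N (H t) \<le> c}"
   "\<And>N c. sets N = sets borel \<Longrightarrow> emeasure N {t. emeasure N (H t) \<le> c} \<le> c"
 shows "(NINT t:(H s). ennreal (v t * X t powr (-a))) \<le> ennreal (X s powr (1-a) / (1-a))"
proof -
 define N where "N = density lborel (\<lambda>t. ennreal (v t))"
 have N [simp]: "sets N = sets borel" by (simp add: N_def)
 have Nt: "emeasure N (H t) = (NINT s:(H t). ennreal (v s))" for t
  unfolding N_def by (subst emeasure_density) auto
 define N' where "N' = restrict_space N (I \<inter> H s)"
 have sp: "space N' = I \<inter> H s" by (simp add: N'_def space_restrict_space N_def)
 have Xm: "X \<in> borel_measurable N'" unfolding N'_def N_def by (intro measurable_restrict_space1) simp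
 have "(\<integral>\<^sup>+t. ennreal (X t powr (-a)) \<partial>N') \<le> ennreal (X s powr (1-a) / (1-a))"
 proof (rule nn_integral_powr_minus_le[OF Xm])
  fix c :: real assume c: "0 < c"
  have "emeasure N' {t \<in> space N'. X t \<le> c} = emeasure N {t \<in> space N'. X t \<le> c}"
   unfolding N'_def by (rule emeasure_restrict_space) (auto simp: sp[unfolded N'_def] N_def space_restrict_space)
  also have "\<dots> \<le> emeasure N {t. emeasure N (H t) \<le> ennreal c}"
  proof (rule emeasure_mono)
   show "{t \<in> space N'. X t \<le> c} \<subseteq> {t. emeasure N (H t) \<le> ennreal c}"
    using X(3) by (auto simp: sp Nt intro: order.trans ennreal_leI)
   show "{t. emeasure N (H t) \<le> ennreal c} \<in> sets N" using H(1)[OF N] by (simp add: real_interval_borel_measurable)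
  qed
  also have "\<dots> \<le> ennreal c" by (rule H(2)) simp
  finally show "emeasure N' {t \<in> space N'. X t \<le> c} \<le> ennreal c" .
 qed (use a s X in \<open>auto simp: sp\<close>)
 also have "(\<integral>\<^sup>+t. ennreal (X t powr (-a)) \<partial>N') = (\<integral>\<^sup>+t. ennreal (X t powr (-a)) * indicator (I \<inter> H s) t \<partial>N)"
  unfolding N'_def by (subst nn_integral_restrict_space) (auto simp: N_def)
 also have "\<dots> = (NINT t. ennreal (v t) * (ennreal (X t powr (-a)) * indicator (I \<inter> H s) t))"
  unfolding N_def by (subst nn_integral_density) auto
 also have "\<dots> = (NINT t:(H s). ennreal (v t * X t powr (-a)))"
  using v by (intro nn_integral_cong) (auto simp: ennreal_mult' split: split_indicator)
 finally show ?thesis .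
qed

text \<open>Insert \<open>W powr (1 / (p * q))\<close> and its inverse into the inner integral and use Hoelder.
  The factor containing \<open>v\<close> is estimated by integrating
  \<open>v\<^sup>q * W powr (- 1 / p)\<close>, which gives a multiple of
  \<open>W powr (1 / q)\<close> and hence, by the hypothesis on \<open>K\<close>, of
  \<open>A powr (- 1 / p)\<close>. After interchanging the integrals,
  \<open>U * A powr (- 1 / q)\<close> is integrated in the same way, and the hypothesis on
  \<open>K\<close> is used a second time.\<close>

theorem Muckenhoupt_Hardy:
 fixes U v A W :: "real \<Rightarrow> real" and f :: "real \<Rightarrow> ennreal" and I :: "real set"
 assumes [measurable]: "U \<in> borel_measurable borel" "v \<in> borel_measurable borel" "A \<in> borel_measurable borel"
   "W \<in> borel_measurable borel" "f \<in> borel_measurable borel"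
  and p: "1 < p" "1 / p + 1 / q = (1::real)"
  and nn: "\<And>s. 0 \<le> U s" "\<And>s. 0 \<le> v s"
  and supp: "\<And>s. s \<notin> I \<Longrightarrow> U s = 0" "\<And>s. s \<notin> I \<Longrightarrow> v s = 0"
  and pos: "\<And>s. s \<in> I \<Longrightarrow> 0 < A s" "\<And>s. s \<in> I \<Longrightarrow> 0 < W s"
  and mono: "\<And>s t. s \<in> I \<Longrightarrow> t \<in> I \<Longrightarrow> s \<le> t \<Longrightarrow> A s \<le> A t"
   "\<And>s t. s \<in> I \<Longrightarrow> t \<in> I \<Longrightarrow> s \<le> t \<Longrightarrow> W t \<le> W s"
  and A: "\<And>s. s \<in> I \<Longrightarrow> (NINT t:{..s}. ennreal (U t)) \<le> ennreal (A s)"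
  and W: "\<And>s. s \<in> I \<Longrightarrow> (NINT t:{s..}. ennreal (v t powr q)) \<le> ennreal (W s)"
  and K: "\<And>s. s \<in> I \<Longrightarrow> A s powr (1/p) * W s powr (1/q) \<le> K" "0 \<le> K"
  and [measurable]: "I \<in> sets borel"
 shows "(NINT s. ennreal (U s) * epow (NINT t:{s..}. f t * ennreal (v t)) p)
   \<le> ennreal ((q * K) powr (p/q) * p * K) * (NINT t. epow (f t) p)"
proof -
 let ?k = "\<lambda>s. ennreal (U s) * ennreal ((q*K) powr (p/q) * A s powr (-(1/q)))"
 have q: "1 < q" by (rule conjugate_gt_1[OF p])
 have pq: "1 - 1/p = 1/q" "1 - 1/q = 1/p" using p by auto
 define g where "g t = (if t \<in> I then epow (f t) p * ennreal (W t powr (1/q)) else 0)" for t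
 have [measurable]: "g \<in> borel_measurable borel" unfolding g_def by measurable
 have Wint: "(NINT t:{s..}. ennreal (v t powr q * W t powr (-(1/p)))) \<le> ennreal (q * W s powr (1/q))"
  if s: "s \<in> I" for s
 proof -
  have "is_interval {t. emeasure N {t..} \<le> c}" if "sets N = sets borel" for N :: "real measure" and c
   unfolding is_interval_1
  proof safe
   fix a b x assume "emeasure N {a..} \<le> c" "a \<le> x"
   moreover have "emeasure N {x..} \<le> emeasure N {a..}" using \<open>a \<le> x\<close> that by (intro emeasure_mono) auto
   ultimately show "emeasure N {x..} \<le> c" by simp
  qed
  then have "(NINT t:{s..}. ennreal (v t powr q * W t powr (-(1/p)))) \<le> ennreal (W s powr (1-1/p) / (1-1/p))"
   using p q s supp pos mono W
   by (intro nn_integral_powr_minus_tails[where I=I and H="\<lambda>t. {t..}"] emeasure_small_upper_tails) auto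
  then show ?thesis unfolding pq by (simp add: mult.commute)
 qed
 have Aint: "(NINT t:{..s}. ennreal (U t * A t powr (-(1/q)))) \<le> ennreal (p * A s powr (1/p))"
  if s: "s \<in> I" for s
 proof -
  have "is_interval {t. emeasure N {..t} \<le> c}" if "sets N = sets borel" for N :: "real measure" and c
   unfolding is_interval_1
  proof safe
   fix a b x assume "emeasure N {..b} \<le> c" "x \<le> b"
   moreover have "emeasure N {..x} \<le> emeasure N {..b}" using \<open>x \<le> b\<close> that by (intro emeasure_mono) auto
   ultimately show "emeasure N {..x} \<le> c" by simp
  qed
  then have "(NINT t:{..s}. ennreal (U t * A t powr (-(1/q)))) \<le> ennreal (A s powr (1-1/q) / (1-1/q))"
   using p q s supp pos mono A nn
   by (intro nn_integral_powr_minus_tails[where I=I and H="\<lambda>t. {..t}"] emeasure_small_lower_tails) auto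
  then show ?thesis unfolding pq by (simp add: mult.commute)
 qed
 have inner: "epow (NINT t:{s..}. f t * ennreal (v t)) p \<le>
   (NINT t:{s..}. g t) * ennreal ((q*K) powr (p/q) * A s powr (-(1/q)))" if s: "s \<in> I" for s
 proof -
  have eq: "f t * ennreal (v t) * indicator {s..} t
    = (f t * ennreal (W t powr (1/(p*q))) * indicator (I \<inter> {s..}) t) * (ennreal (v t * W t powr (-(1/(p*q)))) * indicator {s..} t)" for t
  proof (cases "t \<in> I")
   case False then show ?thesis using supp(2) by simp
  next
   case True
   have "ennreal (W t powr (1/(p*q))) * ennreal (v t * W t powr (-(1/(p*q)))) = ennreal (v t)"
    using pos(2)[OF True] nn(2)[of t] by (simp add: ennreal_mult'[symmetric] powr_minus)
   then have "f t * ennreal (v t) = f t * ennreal (W t powr (1/(p*q))) * ennreal (v t * W t powr (-(1/(p*q))))"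
    by (simp add: mult.assoc)
   then show ?thesis using True by (auto split: split_indicator)
  qed
  have "epow (NINT t:{s..}. f t * ennreal (v t)) p \<le>
   (NINT t. epow (f t * ennreal (W t powr (1/(p*q))) * indicator (I \<inter> {s..}) t) p)
    * epow (NINT t. epow (ennreal (v t * W t powr (-(1/(p*q)))) * indicator {s..} t) q) (p/q)"
   unfolding eq by (intro Holder_nn_integral_powr p) measurable
  also have "(\<lambda>t. epow (f t * ennreal (W t powr (1/(p*q))) * indicator (I \<inter> {s..}) t) p) = (\<lambda>t. g t * indicator {s..} t)"
   using p by (auto simp: fun_eq_iff g_def epow_mult powr_powr split: split_indicator)
  also have "(\<lambda>t. epow (ennreal (v t * W t powr (-(1/(p*q)))) * indicator {s..} t) q)
    = (\<lambda>t. ennreal (v t powr q * W t powr (-(1/p))) * indicator {s..} t)"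
   using q nn by (auto simp: fun_eq_iff powr_mult powr_powr split: split_indicator)
  finally have 3: "epow (NINT t:{s..}. f t * ennreal (v t)) p \<le>
   (NINT t:{s..}. g t) *
   epow (NINT t:{s..}. ennreal (v t powr q * W t powr (-(1/p)))) (p/q)" .
  have "epow (NINT t:{s..}. ennreal (v t powr q * W t powr (-(1/p)))) (p/q)
   \<le> epow (ennreal (q * W s powr (1/q))) (p/q)" using p q s by (intro epow_mono Wint) auto
  also have "\<dots> = ennreal ((q * W s powr (1/q)) powr (p/q))" using q by simp
  also have "\<dots> \<le> ennreal ((q*K) powr (p/q) * A s powr (-(1/q)))"
  proof -
   have "W s powr (1/q) \<le> K * A s powr (-(1/p))"
    using K(1)[OF s] pos(1)[OF s] by (simp add: powr_minus field_simps)
   then have "(q * W s powr (1/q)) powr (p/q) \<le> (q * K * A s powr (-(1/p))) powr (p/q)"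
    using p q by (intro powr_mono2) (auto simp: mult.assoc)
   also have "\<dots> = (q*K) powr (p/q) * A s powr (-(1/q))"
    using p q K pos(1)[OF s] by (simp add: powr_mult powr_powr)
   finally show ?thesis by (rule ennreal_leI)
  qed
  finally show ?thesis by (intro order.trans[OF 3] mult_left_mono) auto
 qed
 have "(NINT s. ennreal (U s) * epow (NINT t:{s..}. f t * ennreal (v t)) p)
  \<le> (NINT s. (NINT t. g t * indicator {s..} t * (?k s)))"
 proof (intro nn_integral_mono)
  fix s
  show "ennreal (U s) * epow (NINT t:{s..}. f t * ennreal (v t)) p
   \<le> (NINT t. g t * indicator {s..} t * (?k s))"
  proof (cases "s \<in> I")
   case False then show ?thesis using supp by simp
  next
   case True
   have "ennreal (U s) * epow (NINT t:{s..}. f t * ennreal (v t)) p \<le> ennreal (U s) *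
    ((NINT t:{s..}. g t) * ennreal ((q*K) powr (p/q) * A s powr (-(1/q))))"
    by (intro mult_left_mono inner True) auto
   also have "\<dots> = (NINT t. g t * indicator {s..} t * (?k s))"
    by (subst nn_integral_multc) (auto simp: mult_ac)
   finally show ?thesis .
  qed
 qed
 also have "\<dots> = (NINT t. (NINT s. g t * indicator {s..} t * (?k s)))"
 proof (rule lborel_pair.Fubini'[symmetric])
  have "(\<lambda>(s, t). g t * (if s \<le> t then 1 else 0) * (?k s)) \<in> borel_measurable (lborel \<Otimes>\<^sub>M lborel)"
   by measurable
  moreover have "indicator {s..} t = (if s \<le> t then 1 else 0 :: ennreal)" for s t :: real by auto
  ultimately show "(\<lambda>(s, t). g t * indicator {s..} t * (?k s)) \<in> borel_measurable (lborel \<Otimes>\<^sub>M lborel)"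
   by simp
 qed
 also have "\<dots> \<le> (NINT t. ennreal ((q * K) powr (p/q) * p * K) * epow (f t) p)"
 proof (intro nn_integral_mono)
  fix t
  show "(NINT s. g t * indicator {s..} t * (?k s))
   \<le> ennreal ((q * K) powr (p/q) * p * K) * epow (f t) p"
  proof (cases "t \<in> I")
   case False then show ?thesis by (simp add: g_def)
  next
   case True
   have "(NINT s. g t * indicator {s..} t * (?k s))
    = (NINT s. g t * ennreal ((q*K) powr (p/q)) * (ennreal (U s * A s powr (-(1/q))) * indicator {..t} s))"
    using nn by (intro nn_integral_cong) (auto simp: ennreal_mult' mult_ac split: split_indicator)
   also have "\<dots> = g t * ennreal ((q*K) powr (p/q)) * (NINT s. (ennreal (U s * A s powr (-(1/q))) * indicator {..t} s))"
    by (rule nn_integral_cmult) measurable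
   also have "\<dots> \<le> g t * ennreal ((q*K) powr (p/q)) * ennreal (p * A t powr (1/p))"
    by (intro mult_left_mono Aint True) auto
   also have "\<dots> = epow (f t) p * ennreal ((q*K) powr (p/q) * p * (A t powr (1/p) * W t powr (1/q)))"
    using True p by (simp add: g_def ennreal_mult' mult_ac)
   also have "\<dots> \<le> epow (f t) p * ennreal ((q*K) powr (p/q) * p * K)"
    using p by (intro mult_left_mono ennreal_leI K True) auto
   finally show ?thesis by (simp add: mult.commute)
  qed
 qed
 also have "\<dots> = ennreal ((q * K) powr (p/q) * p * K) * (NINT t. epow (f t) p)"
  by (rule nn_integral_cmult) measurable
 finally show ?thesis .
qed

section \<open>Polar coordinates\<close>

lemma lborel_complex_eq:
 "(lborel :: complex measure) = distr (lborel \<Otimes>\<^sub>M lborel) borel (\<lambda>(x,y). Complex x y)"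
proof (rule lborel_eqI)
 have [measurable]: "(\<lambda>(x,y). Complex x y) \<in> borel_measurable (borel \<Otimes>\<^sub>M borel)"
  unfolding Complex_eq case_prod_beta by measurable
 fix l u :: complex assume le: "\<And>b. b \<in> Basis \<Longrightarrow> l \<bullet> b \<le> u \<bullet> b"
 have le': "Re l \<le> Re u" "Im l \<le> Im u" using le[of 1] le[of \<i>] by (auto simp: Basis_complex_def)
 have "emeasure (distr (lborel \<Otimes>\<^sub>M lborel) borel (\<lambda>(x,y). Complex x y)) (box l u)
   = emeasure (lborel \<Otimes>\<^sub>M lborel) ({Re l<..<Re u} \<times> {Im l<..<Im u})" by (subst emeasure_distr)
   (auto simp: space_pair_measure box_def Basis_complex_def intro!: arg_cong2[where f=emeasure])
 also have "\<dots> = ennreal (Re u - Re l) * ennreal (Im u - Im l)"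
  using le' by (subst lborel.emeasure_pair_measure_Times) auto
 finally show "emeasure (distr (lborel \<Otimes>\<^sub>M lborel) borel (\<lambda>(x,y). Complex x y)) (box l u) = (\<Prod>b\<in>Basis. (u - l) \<bullet> b)"
  using le' by (simp add: Basis_complex_def ennreal_mult'[symmetric])
qed simp

lemma nn_integral_complex_Fubini:
 fixes g :: "complex \<Rightarrow> ennreal"
 assumes [measurable]: "g \<in> borel_measurable borel"
 shows "(NINT z. g z) = (NINT x. (NINT y. g (Complex x y)))"
proof -
 have [measurable]: "(\<lambda>(x,y). Complex x y) \<in> borel_measurable (borel \<Otimes>\<^sub>M borel)"
  unfolding Complex_eq case_prod_beta by measurable
 have "(NINT z. g z) = (\<integral>\<^sup>+xy. g (case xy of (x,y) \<Rightarrow> Complex x y) \<partial>(lborel \<Otimes>\<^sub>M lborel))"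
  by (subst lborel_complex_eq, subst nn_integral_distr) auto
 also have "\<dots> = (NINT x. (NINT y. g (Complex x y)))"
  by (subst lborel.nn_integral_fst[symmetric]) (auto simp: case_prod_beta)
 finally show ?thesis .
qed

lemma nn_integral_incseq:
 assumes [measurable]: "f \<in> borel_measurable M" and A: "\<And>n. A n \<in> sets M" "incseq A"
 shows "(\<integral>\<^sup>+x. f x * indicator (\<Union>n. A n) x \<partial>M) = (SUP n. \<integral>\<^sup>+x. f x * indicator (A n) x \<partial>M)"
proof -
 have "emeasure (density M f) (\<Union>n. A n) = (SUP n. emeasure (density M f) (A n))"
  using A by (intro SUP_emeasure_incseq[symmetric]) auto
 then show ?thesis using A by (subst (asm) (1 2) emeasure_density) (auto intro: sets.countable_UN)
qed

text \<open>The substitution \<open>\<theta> = arctan t\<close>, which carries slopes to angles.\<close>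

lemma nn_integral_arctan:
 fixes G :: "real \<Rightarrow> ennreal"
 assumes [measurable]: "G \<in> borel_measurable borel"
 shows "(NINT t. G (arctan t) * ennreal (1 / (1 + t\<^sup>2))) = (NINT \<theta>:{-(pi/2)<..<pi/2}. G \<theta>)"
proof -
 have arctan_m[measurable]: "(arctan :: real \<Rightarrow> real) \<in> borel_measurable borel"
  by (intro borel_measurable_continuous_onI continuous_intros)
 have U1: "(\<Union>n. {- real n..real n}) = UNIV"
 proof safe
  fix x :: real
  obtain n where "\<bar>x\<bar> \<le> real n" using real_arch_simple by blast
  then show "x \<in> (\<Union>n. {- real n..real n})" by (intro UN_I[of n]) auto
 qed auto
 have U2: "(\<Union>n. {arctan (- real n)..arctan (real n)}) = {-(pi/2)<..<pi/2}"
 proof safe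
  fix x :: real and n
  assume x: "x \<in> {arctan (- real n)..arctan (real n)}"
  show "x \<in> {-(pi/2)<..<pi/2}" using x arctan_lbound[of "- real n"] arctan_ubound[of "real n"] by auto
 next
  fix x :: real assume x: "x \<in> {-(pi/2)<..<pi/2}"
  obtain n where n: "\<bar>tan x\<bar> \<le> real n" using real_arch_simple by blast
  have "arctan (tan x) = x" using x by (intro arctan_tan) auto
  moreover have "arctan (- real n) \<le> arctan (tan x)" "arctan (tan x) \<le> arctan (real n)"
   using n by (auto simp only: arctan_le_iff)
  ultimately show "x \<in> (\<Union>n. {arctan (- real n)..arctan (real n)})" by (intro UN_I[of n]) auto
 qed
 have eq: "(NINT \<theta>:{arctan (- real n)..arctan (real n)}. G \<theta>)
   = (NINT t:{- real n..real n}. G (arctan t) * ennreal (1 / (1 + t\<^sup>2)))" for n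
 proof (cases "n = 0")
  case True
  have "AE x in lborel. x \<noteq> (0::real)" by (rule AE_lborel_singleton)
  then have "AE x in lborel. G x * indicator {0} x = 0" "AE x in lborel. G (arctan x) * ennreal (1 / (1 + x\<^sup>2)) * indicator {0} x = 0"
   by auto
  then show ?thesis using True by (simp add: nn_integral_0_iff_AE)
 next
  case False
  show ?thesis
  proof (rule nn_integral_substitution_aux)
   show "continuous_on {- real n..real n} (\<lambda>t. 1 / (1 + t\<^sup>2))"
    by (intro continuous_intros) (auto simp: add_nonneg_eq_0_iff)
   show "(arctan has_real_derivative 1 / (1 + x\<^sup>2)) (at x)" for x
    by (auto intro!: derivative_eq_intros simp: divide_simps)
  qed (use False in auto)
 qed
 have "(NINT t. G (arctan t) * ennreal (1 / (1 + t\<^sup>2))) =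
   (NINT t:(\<Union>n. {- real n..real n}). G (arctan t) * ennreal (1 / (1 + t\<^sup>2)))"
  unfolding U1 by simp
 also have "\<dots> = (SUP n. (NINT t:{- real n..real n}. G (arctan t) * ennreal (1 / (1 + t\<^sup>2))))"
  by (rule nn_integral_incseq) (auto simp: incseq_def)
 also have "\<dots> = (SUP n. (NINT \<theta>:{arctan (- real n)..arctan (real n)}. G \<theta>))"
  by (simp only: eq)
 also have "\<dots> = (NINT \<theta>:(\<Union>n. {arctan (- real n)..arctan (real n)}). G \<theta>)"
  by (rule nn_integral_incseq[symmetric]) (auto simp: incseq_def arctan_le_iff intro: order.trans)
 finally show ?thesis unfolding U2 .
qed

lemma nn_integral_split_interval:
 fixes f :: "real \<Rightarrow> ennreal"
 assumes [measurable]: "f \<in> borel_measurable borel" and "a \<le> b" "b \<le> c"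
 shows "(NINT x:{a..c}. f x) =
  (NINT x:{a..b}. f x) + (NINT x:{b..c}. f x)"
proof -
 have "AE x in lborel. x \<noteq> b" by (rule AE_lborel_singleton)
 then have "(NINT x:{a..c}. f x) =
   (NINT x. f x * indicator {a..b} x + f x * indicator {b..c} x)"
  using assms(2,3) by (intro nn_integral_cong_AE) (auto elim!: eventually_mono split: split_indicator)
 then show ?thesis by (simp add: nn_integral_add)
qed

lemma nn_integral_interval_ends:
 fixes f :: "real \<Rightarrow> ennreal"
 shows "(NINT x:{a<..<b}. f x) = (NINT x:{a..b}. f x)"
proof -
 have "AE x in lborel. x \<noteq> a" "AE x in lborel. x \<noteq> b" by (rule AE_lborel_singleton)+
 then have "AE x in lborel. f x * indicator {a<..<b} x = f x * indicator {a..b} x"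
  by eventually_elim (auto split: split_indicator)
 then show ?thesis by (rule nn_integral_cong_AE)
qed

lemma nn_integral_shift_interval:
 fixes f :: "real \<Rightarrow> ennreal"
 assumes [measurable]: "f \<in> borel_measurable borel"
 shows "(NINT x:{a..b}. f (x + h)) = (NINT x:{a+h..b+h}. f x)"
 by (subst (2) nn_integral_real_affine[of _ 1 h])
   (auto simp: add.commute intro!: nn_integral_cong split: split_indicator)

lemma measurable_cis [measurable (raw)]:
 fixes u :: "'a \<Rightarrow> real"
 assumes [measurable]: "u \<in> borel_measurable M"
 shows "(\<lambda>x. cis (u x)) \<in> borel_measurable M" unfolding cis.code Complex_eq by measurable

text \<open>In each vertical line substitute \<open>y = x * tan \<theta>\<close>; after interchanging the
  integrals, rescaling \<open>x\<close> in each direction gives the integral over all real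
  \<open>r\<close> and over \<open>\<theta>\<close> in a half circle, which is then split according
  to the sign of \<open>r\<close>. Only substitutions in one variable occur.\<close>

theorem nn_integral_polar:
 fixes g :: "complex \<Rightarrow> ennreal"
 assumes [measurable]: "g \<in> borel_measurable borel"
 shows "(NINT z. g z) =
  (NINT \<theta>:{0..2*pi}. (NINT r:{0<..}. ennreal r * g (of_real r * cis \<theta>)))"
proof -
 have [measurable]: "(\<lambda>(x,y). Complex x y) \<in> borel_measurable (borel \<Otimes>\<^sub>M borel)"
  unfolding Complex_eq case_prod_beta by measurable
 have Cm[measurable]: "(\<lambda>x. Complex (u x) (v x)) \<in> borel_measurable M"
  if [measurable]: "u \<in> borel_measurable M" "v \<in> borel_measurable M" for u v :: "'a \<Rightarrow> real" and M
  unfolding Complex_eq by measurable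
 define G where "G \<theta> = (NINT r. ennreal \<bar>r\<bar> * g (of_real r * cis \<theta>))" for \<theta>
 define H where "H \<theta> = (NINT r:{0<..}. ennreal r * g (of_real r * cis \<theta>))" for \<theta>
 have H_eq: "H \<theta> = (NINT r. ennreal r * g (of_real r * cis \<theta>) * (if 0 < r then 1 else 0))" for \<theta>
  unfolding H_def by (intro nn_integral_cong) auto
 have [measurable]: "G \<in> borel_measurable borel" unfolding G_def by measurable
 have Hm[measurable]: "H \<in> borel_measurable borel" unfolding H_eq by measurable
 have GH: "G \<theta> = H \<theta> + H (\<theta> + pi)" for \<theta>
 proof -
  have "G \<theta> = (NINT r. ennreal r * g (of_real r * cis \<theta>) * indicator {0<..} r
     + ennreal (-r) * g (of_real r * cis \<theta>) * indicator {0<..} (-r))"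
   unfolding G_def by (intro nn_integral_cong) (auto split: split_indicator)
  also have "\<dots> = H \<theta> + (NINT r. ennreal (-r) * g (of_real r * cis \<theta>) * indicator {0<..} (-r))"
   unfolding H_def by (rule nn_integral_add) measurable
  also have "(NINT r. ennreal (-r) * g (of_real r * cis \<theta>) * indicator {0<..} (-r))
    = (NINT r:{0<..}. ennreal r * g (of_real r * cis (\<theta>+pi)))"
   by (subst nn_integral_real_affine[of _ "-1" 0]) (auto simp: cis_mult[symmetric])
  finally show ?thesis by (simp add: H_def)
 qed
 have Hper: "H (\<theta> + 2 * pi) = H \<theta>" for \<theta> by (simp add: H_def cis_mult[symmetric])
 have "(NINT z. g z) = (NINT x. (NINT y. g (Complex x y)))" by (rule nn_integral_complex_Fubini) measurable
 also have "\<dots> = (NINT x. (NINT t. ennreal \<bar>x\<bar> * g (Complex x (x * t))))"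
 proof (rule nn_integral_cong_AE)
  have "AE x in lborel. x \<noteq> (0::real)" by (rule AE_lborel_singleton)
  then show "AE x in lborel. (NINT y. g (Complex x y)) = (NINT t. ennreal \<bar>x\<bar> * g (Complex x (x * t)))"
  proof eventually_elim
   fix x :: real assume "x \<noteq> 0"
   then show "(NINT y. g (Complex x y)) = (NINT t. ennreal \<bar>x\<bar> * g (Complex x (x * t)))"
    by (subst nn_integral_real_affine[of _ x 0]) (auto simp: nn_integral_cmult)
  qed
 qed
 also have "\<dots> = (NINT t. (NINT x. ennreal \<bar>x\<bar> * g (Complex x (x * t))))"
  by (rule lborel_pair.Fubini'[symmetric]) measurable
 also have "\<dots> = (NINT t. G (arctan t) * ennreal (1 / (1 + t\<^sup>2)))"
 proof (rule nn_integral_cong)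
  fix t :: real
  define c where "c = 1 / sqrt (1 + t\<^sup>2)"
  have pos: "0 < 1 + t\<^sup>2" by (simp add: add_pos_nonneg)
  then have c: "0 < c" "c * c = 1 / (1 + t\<^sup>2)" by (auto simp: c_def)
  have cis: "cis (arctan t) = Complex c (c * t)" by (simp add: cis.code cos_arctan sin_arctan c_def)
  have "(NINT x. ennreal \<bar>x\<bar> * g (Complex x (x * t))) =
    ennreal \<bar>c\<bar> * (NINT r. ennreal \<bar>c * r\<bar> * g (Complex (c * r) (c * r * t)))"
   using c by (subst nn_integral_real_affine[of _ c 0]) auto
  also have "\<dots> = (NINT r. ennreal \<bar>c\<bar> * (ennreal \<bar>c * r\<bar> * g (Complex (c * r) (c * r * t))))"
   by (rule nn_integral_cmult[symmetric]) measurable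
  also have "\<dots> = (NINT r. ennreal \<bar>r\<bar> * g (of_real r * cis (arctan t)) * ennreal (1 / (1 + t\<^sup>2)))"
  proof (rule nn_integral_cong)
   fix r
   have "of_real r * cis (arctan t) = Complex (c * r) (c * r * t)"
    unfolding cis by (simp add: complex_eq_iff mult_ac)
   moreover have "ennreal \<bar>c\<bar> * ennreal \<bar>c * r\<bar> = ennreal \<bar>r\<bar> * ennreal (1 / (1 + t\<^sup>2))"
    using c by (simp add: ennreal_mult'[symmetric] abs_mult mult.assoc[symmetric])
   ultimately show "ennreal \<bar>c\<bar> * (ennreal \<bar>c * r\<bar> * g (Complex (c * r) (c * r * t)))
    = ennreal \<bar>r\<bar> * g (of_real r * cis (arctan t)) * ennreal (1 / (1 + t\<^sup>2))"
    by (metis (no_types, lifting) mult.assoc mult.commute)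
  qed
  also have "\<dots> = G (arctan t) * ennreal (1 / (1 + t\<^sup>2))"
   unfolding G_def by (rule nn_integral_multc) measurable
  finally show "(NINT x. ennreal \<bar>x\<bar> * g (Complex x (x * t))) = G (arctan t) * ennreal (1 / (1 + t\<^sup>2))" .
 qed
 also have "\<dots> = (NINT \<theta>:{-(pi/2)<..<pi/2}. G \<theta>)"
  by (rule nn_integral_arctan) measurable
 also have "\<dots> = (NINT \<theta>:{-(pi/2)..pi/2}. G \<theta>)"
  by (rule nn_integral_interval_ends)
 also have "\<dots> = (NINT \<theta>:{-(pi/2)..pi/2}. H \<theta>) + (NINT \<theta>:{-(pi/2)..pi/2}. H (\<theta>+pi))"
  unfolding GH distrib_right by (rule nn_integral_add) measurable
 also have "(NINT \<theta>:{-(pi/2)..pi/2}. H (\<theta>+pi)) = (NINT \<theta>:{pi/2..pi + pi/2}. H \<theta>)"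
  using nn_integral_shift_interval[OF Hm, of pi "-(pi/2)" "pi/2"] by (simp add: field_simps)
 also have "(NINT \<theta>:{-(pi/2)..pi/2}. H \<theta>) =
   (NINT \<theta>:{-(pi/2)..0}. H \<theta>) + (NINT \<theta>:{0..pi/2}. H \<theta>)"
  by (rule nn_integral_split_interval) auto
 also have "(NINT \<theta>:{-(pi/2)..0}. H \<theta>) = (NINT \<theta>:{pi + pi/2..2*pi}. H \<theta>)"
  using nn_integral_shift_interval[OF Hm, of "2*pi" "-(pi/2)" 0] unfolding Hper by (simp add: field_simps)
 also have "(NINT \<theta>:{pi + pi/2..2*pi}. H \<theta>) + (NINT \<theta>:{0..pi/2}. H \<theta>)
   + (NINT \<theta>:{pi/2..pi + pi/2}. H \<theta>) = (NINT \<theta>:{0..2*pi}. H \<theta>)"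
  using nn_integral_split_interval[OF Hm, of 0 "pi/2" "2*pi"] nn_integral_split_interval[OF Hm, of "pi/2" "pi+pi/2" "2*pi"]
   pi_gt_zero by (simp add: add_ac)
 finally show ?thesis by (simp add: H_def)
qed

section \<open>Integrals over circles and the Fejer-Riesz inequality\<close>

text \<open>The length of the shorter arc from \<open>1\<close> to \<open>cis \<theta>\<close>, divided by the
  length \<open>2 * pi\<close> of the circle; it is meant for \<open>\<theta>\<close> between 0 and
  \<open>2 * pi\<close>. This normalization gives the lower bound in
  \<open>circle_dist_le_norm\<close> the constant 1.\<close>

definition circle_dist :: "real \<Rightarrow> real" where
 "circle_dist \<theta> = min \<theta> (2 * pi - \<theta>) / (2 * pi)"

lemma measurable_circle_dist [measurable]: "circle_dist \<in> borel_measurable borel"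
 unfolding circle_dist_def by measurable

lemma circle_dist_nonneg: "\<theta> \<in> {0..2*pi} \<Longrightarrow> 0 \<le> circle_dist \<theta>"
 by (auto simp: circle_dist_def)

lemma circle_dist_le_half: "circle_dist \<theta> \<le> 1 / 2" by (auto simp: circle_dist_def min_def field_simps)

lemma circle_dist_scaled: "0 \<le> v \<Longrightarrow> v \<le> 1/2 \<Longrightarrow> circle_dist (2*pi * v) = v" "0 \<le> v \<Longrightarrow> v \<le> 1/2 \<Longrightarrow> circle_dist (2*pi - 2*pi * v) = v"
proof -
 assume v: "0 \<le> v" "v \<le> 1/2"
 have "2*pi * v \<le> 2*pi*(1/2)" using v by (intro mult_left_mono) auto
 then have *: "min (2*pi * v) (2*pi - 2*pi * v) = 2*pi * v" by simp
 show "circle_dist (2*pi * v) = v" unfolding circle_dist_def * by simp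
 have *: "min (2*pi - 2*pi * v) (2*pi - (2*pi - 2*pi * v)) = 2*pi * v" using * by simp
 show "circle_dist (2*pi - 2*pi * v) = v" unfolding circle_dist_def * by simp
qed

lemma sin_ge_linear: "0 \<le> x \<Longrightarrow> x \<le> pi/2 \<Longrightarrow> 2 / pi * x \<le> sin x"
proof -
 assume x: "0 \<le> x" "x \<le> pi/2"
 have "convex_on {0..pi/2} (\<lambda>x. - sin x)"
 proof (rule f''_ge0_imp_convex)
  show "DERIV (\<lambda>x. - sin x) x :> - cos x" for x :: real by (auto intro!: derivative_eq_intros)
  show "DERIV (\<lambda>x. - cos x) x :> sin x" for x :: real by (auto intro!: derivative_eq_intros)
  show "0 \<le> sin x" if "x \<in> {0..pi/2}" for x :: real using that by (intro sin_ge_zero) auto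
 qed auto
 from convex_onD[OF this, of "2/pi * x" 0 "pi/2"] x show ?thesis by (simp add: field_simps)
qed

lemma norm_one_minus_cis: "norm (1 - cis \<theta>) = 2 * \<bar>sin (\<theta>/2)\<bar>"
proof -
 have "(norm (1 - cis \<theta>))\<^sup>2 = (1 - cos \<theta>)\<^sup>2 + (sin \<theta>)\<^sup>2" by (simp add: cmod_power2)
 also have "\<dots> = 2 - 2 * cos \<theta>" using sin_cos_squared_add[of \<theta>] by (simp add: power2_eq_square algebra_simps)
 also have "\<dots> = (2 * \<bar>sin (\<theta>/2)\<bar>)\<^sup>2" using cos_double_sin[of "\<theta>/2"] by (simp add: power_mult_distrib)
 finally show ?thesis by (rule power2_eq_imp_eq) auto
qed

lemma circle_dist_le_norm:
 assumes "0 \<le> s" "s \<le> 1" "\<theta> \<in> {0..2*pi}"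
 shows "max (1 - s) (circle_dist \<theta>) \<le> norm (1 - of_real s * cis \<theta>)"
proof -
 have 1: "1 - s \<le> norm (1 - of_real s * cis \<theta>)"
  using norm_triangle_ineq2[of 1 "of_real s * cis \<theta>"] assms by (simp add: norm_mult)
 have sin: "2 * circle_dist \<theta> \<le> \<bar>sin (\<theta>/2)\<bar>"
 proof (cases "\<theta> \<le> pi")
  case True
  then have "2 * circle_dist \<theta> = 2 / pi * (\<theta>/2)" by (simp add: circle_dist_def)
  also have "\<dots> \<le> sin (\<theta>/2)" using assms True by (intro sin_ge_linear) auto
  finally show ?thesis by simp
 next
  case False
  then have "2 * circle_dist \<theta> = 2 / pi * (pi - \<theta>/2)" by (simp add: circle_dist_def field_simps)
  also have "\<dots> \<le> sin (pi - \<theta>/2)" using assms False by (intro sin_ge_linear) auto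
  finally show ?thesis by simp
 qed
 have "norm (1 - cis \<theta>) \<le> norm (1 - of_real s * cis \<theta>) + norm (of_real s * cis \<theta> - cis \<theta>)"
  using norm_triangle_ineq[of "1 - of_real s * cis \<theta>" "of_real s * cis \<theta> - cis \<theta>"] by simp
 also have "of_real s * cis \<theta> - cis \<theta> = of_real (s - 1) * cis \<theta>" by (simp add: algebra_simps)
 also have "norm (of_real (s - 1) * cis \<theta>) = 1 - s" using assms by (simp add: norm_mult del: of_real_diff)
 finally have "norm (1 - cis \<theta>) \<le> 2 * norm (1 - of_real s * cis \<theta>)" using 1 by simp
 then show ?thesis using 1 sin circle_dist_nonneg[OF assms(3)] by (simp add: norm_one_minus_cis)
qed

text \<open>Parametrizing both half circles by the distance to \<open>1\<close> turns estimates on the circle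
  into estimates on an interval.\<close>

lemma nn_integral_fold_circle:
 fixes F :: "real \<Rightarrow> ennreal"
 assumes [measurable]: "F \<in> borel_measurable borel"
 shows "(NINT \<theta>:{0..2*pi}. F \<theta>) =
  ennreal (2*pi) * (NINT v:{0..1/2}. (F (2*pi * v) + F (2*pi - 2*pi * v)))"
proof -
 have "(NINT \<theta>:{0..2*pi}. F \<theta>) =
  (NINT \<theta>:{0..pi}. F \<theta>) + (NINT \<theta>:{pi..2*pi}. F \<theta>)"
  by (rule nn_integral_split_interval) auto
 also have "(NINT \<theta>:{0..pi}. F \<theta>) = ennreal (2*pi) * (NINT v:{0..1/2}. F (2*pi * v))"
 proof (subst nn_integral_real_affine[of _ "2*pi" 0])
  have "indicator {0..pi} (0 + 2*pi * v) = (indicator {0..1/2} v :: ennreal)" for v :: real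
   using mult_le_cancel_left_pos[of "2*pi" v "1/2"] mult_le_cancel_left_pos[of "2*pi" 0 v] pi_gt_zero by (auto simp: indicator_def)
  then show "ennreal \<bar>2*pi\<bar> * (NINT x. F (0 + 2*pi*x) * indicator {0..pi} (0 + 2*pi*x))
   = ennreal (2*pi) * (NINT v:{0..1/2}. F (2*pi * v))" by simp
 qed auto
 also have "(NINT \<theta>:{pi..2*pi}. F \<theta>) = ennreal (2*pi) * (NINT v:{0..1/2}. F (2*pi - 2*pi * v))"
 proof (subst nn_integral_real_affine[of _ "-2*pi" "2*pi"])
  have "indicator {pi..2*pi} (2*pi + (-2*pi) * v) = (indicator {0..1/2} v :: ennreal)" for v :: real
   using mult_le_cancel_left_pos[of "2*pi" v "1/2"] mult_le_cancel_left_pos[of "2*pi" 0 v] pi_gt_zero by (auto simp: indicator_def)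
  then show "ennreal \<bar>-2*pi\<bar> * (NINT x. F (2*pi + (-2*pi)*x) * indicator {pi..2*pi} (2*pi + (-2*pi)*x))
   = ennreal (2*pi) * (NINT v:{0..1/2}. F (2*pi - 2*pi * v))" by simp
 qed auto
 also have "ennreal (2*pi) * (NINT v:{0..1/2}. F (2*pi * v)) + ennreal (2*pi) * (NINT v:{0..1/2}. F (2*pi - 2*pi * v))
  = ennreal (2*pi) * (NINT v:{0..1/2}. (F (2*pi * v) + F (2*pi - 2*pi * v)))"
  by (simp add: distrib_left[symmetric] distrib_right nn_integral_add)
 finally show ?thesis .
qed

lemma continuous_on_circle:
 fixes g :: "complex \<Rightarrow> complex"
 assumes "g holomorphic_on ball 0 1" "0 \<le> R" "R < 1"
 shows "continuous_on A (\<lambda>\<theta>. g (of_real R * cis \<theta>))"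
proof -
 have "continuous_on (ball 0 1) g" using assms(1) by (rule holomorphic_on_imp_continuous_on)
 moreover have "continuous_on A (\<lambda>\<theta>. of_real R * cis \<theta>)" unfolding cis_conv_exp by (intro continuous_intros)
 ultimately show ?thesis using assms(2,3) by (elim continuous_on_compose2[of "ball 0 1" g]) (auto simp: norm_mult)
qed

lemma measurable_circle:
 fixes g :: "complex \<Rightarrow> complex"
 assumes "g holomorphic_on ball 0 1" "0 \<le> R" "R < 1"
 shows "(\<lambda>\<theta>. g (of_real R * cis \<theta>)) \<in> borel_measurable borel"
 by (intro borel_measurable_continuous_onI continuous_on_circle assms)

lemma nn_integral_has_integral_indicator:
 fixes f :: "'a::euclidean_space \<Rightarrow> real"
 assumes "\<And>x. x \<in> S \<Longrightarrow> 0 \<le> f x" "(f has_integral I) S"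
 shows "(NINT x:S. ennreal (f x)) = ennreal I"
proof -
 have "(NINT x:S. ennreal (f x)) = (NINT x. ennreal (indicator S x * f x))"
  by (intro nn_integral_cong) (auto split: split_indicator)
 then show ?thesis using nn_integral_has_integral_lebesgue[OF assms] by simp
qed

text \<open>Cauchy's formula at \<open>\<rho>\<close>, with the denominator estimated by
  \<open>circle_dist_le_norm\<close>.\<close>

lemma Cauchy_circle_bound:
 fixes g :: "complex \<Rightarrow> complex"
 assumes g: "g holomorphic_on ball 0 1" and \<rho>: "0 \<le> \<rho>" "\<rho> < R" "R < 1"
 shows "ennreal (norm (g (of_real \<rho>))) \<le> ennreal (1 / (2*pi)) *
  (NINT \<theta>:{0..2*pi}. ennreal (norm (g (of_real R * cis \<theta>)) / max (1 - \<rho>/R) (circle_dist \<theta>)))"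
proof -
 let ?w = "of_real \<rho> :: complex"
 let ?k = "\<lambda>\<theta>. g (of_real R * cis \<theta>) / (of_real R * cis \<theta> - ?w) * R * \<i> * cis \<theta>"
 have "((\<lambda>u. g u / (u - ?w)) has_contour_integral (2 * of_real pi * \<i> * g ?w)) (circlepath 0 R)"
  using \<rho> by (intro Cauchy_integral_circlepath_simple holomorphic_on_subset[OF g]) auto
 then have hi: "(?k has_integral (2 * of_real pi * \<i> * g ?w)) {0..2*pi}"
  unfolding circlepath_def by (subst (asm) has_contour_integral_part_circlepath_iff) auto
 have dist: "R * max (1 - \<rho>/R) (circle_dist \<theta>) \<le> norm (of_real R * cis \<theta> - ?w)" if "\<theta> \<in> {0..2*pi}" for \<theta>
 proof -
  have "max (1 - \<rho>/R) (circle_dist \<theta>) \<le> norm (1 - of_real (\<rho>/R) * cis \<theta>)"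
   using that \<rho> by (intro circle_dist_le_norm) auto
  also have "\<dots> = norm (cnj (1 - of_real (\<rho>/R) * cis \<theta>))" by (rule complex_mod_cnj[symmetric])
  also have "\<dots> = norm (cis \<theta> * cnj (1 - of_real (\<rho>/R) * cis \<theta>))" by (simp add: norm_mult)
  also have "cis \<theta> * cnj (1 - of_real (\<rho>/R) * cis \<theta>) = cis \<theta> - of_real (\<rho>/R)"
  proof -
   have "cis \<theta> * cnj (cis \<theta>) = 1" by (simp add: cis_cnj cis_mult)
   then show ?thesis by (simp add: algebra_simps)
  qed
  finally have "R * max (1 - \<rho>/R) (circle_dist \<theta>) \<le> norm (of_real R :: complex) * norm (cis \<theta> - of_real (\<rho>/R))"
   using \<rho> by (simp add: mult_left_mono)
  also have "\<dots> = norm (of_real R * (cis \<theta> - of_real (\<rho>/R)))" by (simp only: norm_mult)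
  also have "of_real R * (cis \<theta> - of_real (\<rho>/R)) = of_real R * cis \<theta> - ?w"
   using \<rho> by (simp add: algebra_simps)
  finally show ?thesis .
 qed
 have pos: "0 < max (1 - \<rho>/R) (circle_dist \<theta>)" for \<theta> using \<rho> by (simp add: less_max_iff_disj)
 let ?b = "\<lambda>\<theta>. norm (g (of_real R * cis \<theta>)) / max (1 - \<rho>/R) (circle_dist \<theta>)"
 have kb: "norm (?k \<theta>) \<le> ?b \<theta>" if \<theta>: "\<theta> \<in> {0..2*pi}" for \<theta>
 proof -
  define m where "m = max (1 - \<rho>/R) (circle_dist \<theta>)"
  define d where "d = norm (of_real R * cis \<theta> - ?w)"
  define G where "G = norm (g (of_real R * cis \<theta>))"
  have m: "0 < m" "R * m \<le> d" using pos[of \<theta>] dist[OF \<theta>] by (simp_all only: m_def d_def)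
  have R: "0 < R" using \<rho> by simp
  have d: "0 < d" using mult_pos_pos[OF R m(1)] m(2) by linarith
  have "norm (?k \<theta>) = G * (R / d)" using R by (simp add: norm_mult norm_divide G_def d_def)
  also have "\<dots> \<le> G * (1 / m)" using m R d by (intro mult_left_mono) (auto simp: field_simps G_def)
  finally show ?thesis by (simp add: m_def G_def)
 qed
 have c1: "continuous_on {0..2*pi} (\<lambda>\<theta>. norm (g (of_real R * cis \<theta>)))"
  using \<rho> by (intro continuous_on_norm continuous_on_circle[OF g]) auto
 have c2: "continuous_on {0..2*pi} (\<lambda>\<theta>. max (1 - \<rho>/R) (circle_dist \<theta>))"
  unfolding circle_dist_def by (intro continuous_intros) auto
 have cb: "continuous_on {0..2*pi} ?b" using continuous_on_divide[OF c1 c2] pos by (metis less_irrefl)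
 then have bi: "(?b has_integral integral {0..2*pi} ?b) {0..2*pi}"
  by (intro integrable_integral integrable_continuous_real)
 have nb: "0 \<le> ?b \<theta>" for \<theta> using pos[of \<theta>] by simp
 have "norm (2 * of_real pi * \<i> * g ?w) \<le> integral {0..2*pi} ?b"
  using integral_norm_bound_integral[of ?k "{0..2*pi}" ?b] hi bi kb by (auto simp: has_integral_iff)
 then have "norm (g ?w) \<le> 1 / (2*pi) * integral {0..2*pi} ?b" by (simp add: norm_mult field_simps)
 then have "ennreal (norm (g ?w)) \<le> ennreal (1 / (2*pi) * integral {0..2*pi} ?b)" by (rule ennreal_leI)
 also have "\<dots> = ennreal (1 / (2*pi)) * ennreal (integral {0..2*pi} ?b)" by (rule ennreal_mult') simp
 also have "ennreal (integral {0..2*pi} ?b) = (NINT \<theta>:{0..2*pi}. ennreal (?b \<theta>))"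
  by (rule nn_integral_has_integral_indicator[symmetric, OF nb bi])
 finally show ?thesis .
qed

text \<open>Without the normalizing factor and without the \<open>p\<close>-th root; the value may be
  \<open>top\<close>.\<close>

definition circle_mean :: "real \<Rightarrow> (complex \<Rightarrow> complex) \<Rightarrow> real \<Rightarrow> ennreal" where
 "circle_mean p g R = (NINT \<theta>:{0..2*pi}. ennreal (norm (g (of_real R * cis \<theta>)) powr p))"

lemma measurable_radius:
 fixes g :: "complex \<Rightarrow> complex"
 assumes "g holomorphic_on ball 0 1" "0 \<le> R" "R \<le> 1"
 shows "(\<lambda>\<rho>. indicator {0..<R} \<rho> *\<^sub>R g (of_real \<rho>)) \<in> borel_measurable borel"
proof -
 have "continuous_on (ball 0 1) g" using assms(1) by (rule holomorphic_on_imp_continuous_on)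
 then have "continuous_on {0..<R} (\<lambda>\<rho>. g (of_real \<rho>))"
  by (rule continuous_on_compose2) (use assms(2,3) in \<open>auto intro!: continuous_intros\<close>)
 then show ?thesis by (intro borel_measurable_continuous_on_indicator) auto
qed

lemma measurable_radius_powr:
 fixes g :: "complex \<Rightarrow> complex"
 assumes "g holomorphic_on ball 0 1" "0 \<le> R" "R \<le> 1"
 shows "(\<lambda>\<rho>. ennreal (norm (g (of_real \<rho>)) powr p) * indicator {0..<R} \<rho>) \<in> borel_measurable borel"
proof -
 have [measurable]: "(\<lambda>\<rho>. indicator {0..<R} \<rho> *\<^sub>R g (of_real \<rho>)) \<in> borel_measurable borel"
  by (rule measurable_radius[OF assms])
 have "(\<lambda>\<rho>. ennreal (norm (indicator {0..<R} \<rho> *\<^sub>R g (of_real \<rho>)) powr p)) \<in> borel_measurable borel" by measurable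
 also have "(\<lambda>\<rho>. ennreal (norm (indicator {0..<R} \<rho> *\<^sub>R g (of_real \<rho>)) powr p)) =
   (\<lambda>\<rho>. ennreal (norm (g (of_real \<rho>)) powr p) * indicator {0..<R} \<rho>)"
  by (auto simp: fun_eq_iff split: split_indicator)
 finally show ?thesis .
qed

text \<open>With \<open>\<rho> = R * (1 - x)\<close>, Cauchy's formula bounds
  \<open>\<bar>g \<rho>\<bar>\<close> by the integral of \<open>\<bar>g\<bar>\<close> on the circle,
  folded to the variable \<open>u = circle_dist \<theta>\<close>, against
  \<open>1 / max x u\<close>. The Hardy-Hilbert inequality finishes the proof.\<close>

theorem Fejer_Riesz_circle:
 fixes g :: "complex \<Rightarrow> complex"
 assumes g: "g holomorphic_on ball 0 1" and R: "0 < R" "R < 1" and p: "1 < p" "1 / p + 1 / q = (1::real)"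
 shows "(NINT \<rho>:{0..<R}. ennreal (norm (g (of_real \<rho>)) powr p))
   \<le> ennreal ((p + q) powr p * 2 powr p) * circle_mean p g R"
proof -
 define \<gamma> where "\<gamma> \<theta> = ennreal (norm (g (of_real R * cis \<theta>)))" for \<theta>
 have [measurable]: "\<gamma> \<in> borel_measurable borel"
 proof -
  have [measurable]: "(\<lambda>\<theta>. g (of_real R * cis \<theta>)) \<in> borel_measurable borel"
   using R by (intro measurable_circle g) auto
  show ?thesis unfolding \<gamma>_def by measurable
 qed
 define F where "F v = (\<gamma> (2*pi * v) + \<gamma> (2*pi - 2*pi * v)) * indicator {0..1/2} v" for v
 have [measurable]: "F \<in> borel_measurable borel" unfolding F_def by measurable
 have pt: "ennreal (norm (g (of_real (R * (1 - x))))) \<le> (NINT u. ennreal (hh_kernel x u) * F u)"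
  if x: "0 < x" "x \<le> 1" for x
 proof -
  have "ennreal (norm (g (of_real (R * (1 - x))))) \<le> ennreal (1 / (2*pi)) *
   (NINT \<theta>:{0..2*pi}. ennreal (norm (g (of_real R * cis \<theta>)) / max (1 - (R*(1-x))/R) (circle_dist \<theta>)))"
   using R x by (intro Cauchy_circle_bound g) auto
  also have "1 - (R*(1-x))/R = x" using R by simp
  also have "(NINT \<theta>:{0..2*pi}. ennreal (norm (g (of_real R * cis \<theta>)) / max x (circle_dist \<theta>)))
    = (NINT \<theta>:{0..2*pi}. \<gamma> \<theta> * ennreal (1 / max x (circle_dist \<theta>)))"
   using x by (intro nn_integral_cong) (auto simp: \<gamma>_def ennreal_mult''[symmetric])
  also have "\<dots> = ennreal (2*pi) * (NINT v:{0..1/2}. (\<gamma> (2*pi * v) * ennreal (1 / max x (circle_dist (2*pi * v)))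
    + \<gamma> (2*pi - 2*pi * v) * ennreal (1 / max x (circle_dist (2*pi - 2*pi * v)))))"
   by (rule nn_integral_fold_circle) measurable
  also have "(NINT v:{0..1/2}. (\<gamma> (2*pi * v) * ennreal (1 / max x (circle_dist (2*pi * v)))
    + \<gamma> (2*pi - 2*pi * v) * ennreal (1 / max x (circle_dist (2*pi - 2*pi * v)))))
    = (NINT u. ennreal (hh_kernel x u) * F u)"
  proof (rule nn_integral_cong_AE)
   have "AE v in lborel. v \<noteq> (0::real)" by (rule AE_lborel_singleton)
   then show "AE v in lborel. (\<gamma> (2*pi * v) * ennreal (1 / max x (circle_dist (2*pi * v)))
    + \<gamma> (2*pi - 2*pi * v) * ennreal (1 / max x (circle_dist (2*pi - 2*pi * v)))) * indicator {0..1/2} v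
    = ennreal (hh_kernel x v) * F v"
   proof eventually_elim
    fix v :: real assume "v \<noteq> 0"
    show "(\<gamma> (2*pi * v) * ennreal (1 / max x (circle_dist (2*pi * v)))
     + \<gamma> (2*pi - 2*pi * v) * ennreal (1 / max x (circle_dist (2*pi - 2*pi * v)))) * indicator {0..1/2} v
     = ennreal (hh_kernel x v) * F v"
    proof (cases "v \<in> {0..1/2}")
     case True
     then have c: "circle_dist (2*pi * v) = v" "circle_dist (2*pi - 2*pi * v) = v"
      by (auto intro: circle_dist_scaled)
     have k: "hh_kernel x v = 1 / max x v" using True x \<open>v \<noteq> 0\<close> by (simp add: hh_kernel_def)
     show ?thesis unfolding c k F_def by (simp only: distrib_left distrib_right mult_ac)
    next
     case False
     then show ?thesis by (simp add: F_def)
    qed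
   qed
  qed
  also have "ennreal (1 / (2*pi)) * (ennreal (2*pi) * (NINT u. ennreal (hh_kernel x u) * F u))
    = (NINT u. ennreal (hh_kernel x u) * F u)"
   by (subst mult.assoc[symmetric], subst ennreal_mult'[symmetric]) auto
  finally show ?thesis .
 qed
 have gm: "(\<lambda>\<rho>. ennreal (norm (g (of_real \<rho>)) powr p) * indicator {0..<R} \<rho>) \<in> borel_measurable borel"
  using R by (intro measurable_radius_powr g) auto
 have "(NINT \<rho>:{0..<R}. ennreal (norm (g (of_real \<rho>)) powr p))
   = ennreal R * (NINT x. ennreal (norm (g (of_real (R + (-R) * x))) powr p) * indicator {0..<R} (R + (-R) * x))"
  using R by (subst nn_integral_real_affine[OF gm, of "-R" R]) auto
 also have "\<dots> \<le> 1 * (NINT x. epow (NINT u. ennreal (hh_kernel x u) * F u) p)"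
 proof (intro mult_mono nn_integral_mono)
  fix x
  show "ennreal (norm (g (of_real (R + (-R) * x))) powr p) * indicator {0..<R} (R + (-R) * x) \<le> epow (NINT u. ennreal (hh_kernel x u) * F u) p"
  proof (cases "0 < x \<and> x \<le> 1")
   case True
   have "R + (-R) * x = R * (1 - x)" by (simp add: algebra_simps)
   then show ?thesis using epow_mono[OF pt, of x p] True p by (auto split: split_indicator)
  next
   case False
   then have "R + (-R) * x \<notin> {0..<R}" using R by (auto simp: algebra_simps mult_le_cancel_left1 zero_less_mult_iff)
   then show ?thesis by simp
  qed
 qed (use R in auto)
 also have "\<dots> \<le> ennreal ((p + q) powr p) * (NINT u. epow (F u) p)"
  using Hardy_Hilbert[OF _ p, of F] by simp
 also have "(NINT u. epow (F u) p) \<le> (NINT u. ennreal (2 powr p) * ((epow (\<gamma> (2*pi * u)) p + epow (\<gamma> (2*pi - 2*pi * u)) p) * indicator {0..1/2} u))"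
  using p by (intro nn_integral_mono) (auto simp: F_def intro!: epow_add_le split: split_indicator)
 also have "\<dots> = ennreal (2 powr p) * (NINT u:{0..1/2}. (epow (\<gamma> (2*pi * u)) p + epow (\<gamma> (2*pi - 2*pi * u)) p))"
  by (rule nn_integral_cmult) measurable
 also have "(NINT u:{0..1/2}. (epow (\<gamma> (2*pi * u)) p + epow (\<gamma> (2*pi - 2*pi * u)) p))
   \<le> ennreal (2*pi) * (NINT u:{0..1/2}. (epow (\<gamma> (2*pi * u)) p + epow (\<gamma> (2*pi - 2*pi * u)) p))"
 proof -
  have "1 \<le> ennreal (2 * pi)" using pi_ge_two by simp
  then show ?thesis using mult_right_mono[of 1 "ennreal (2*pi)"] by auto
 qed
 also have "\<dots> = (NINT \<theta>:{0..2*pi}. epow (\<gamma> \<theta>) p)"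
  by (rule nn_integral_fold_circle[symmetric]) measurable
 also have "\<dots> = circle_mean p g R" by (simp add: circle_mean_def \<gamma>_def)
 finally show ?thesis by (simp add: ennreal_mult' mult.assoc mult_left_mono)
qed

section \<open>Sequences with regular differences\<close>

text \<open>A discrete analogue of a symbol class: the \<open>j\<close>-th differences of \<open>a\<close>, for
  \<open>j \<le> k\<close>, are \<open>O(v n / (n + 1) ^ j)\<close>. The recursion on
  \<open>k\<close> passes to the difference sequence and to the smaller majorant.\<close>

primrec symbol :: "nat \<Rightarrow> (nat \<Rightarrow> real) \<Rightarrow> (nat \<Rightarrow> real) \<Rightarrow> bool" where
 "symbol 0 v a \<longleftrightarrow> (\<exists>C. \<forall>n. \<bar>a n\<bar> \<le> C * v n)"
| "symbol (Suc k) v a \<longleftrightarrow> (\<exists>C. \<forall>n. \<bar>a n\<bar> \<le> C * v n) \<and>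
   symbol k (\<lambda>n. v n / (real n + 1)) (\<lambda>n. a (Suc n) - a n)"

lemma symbol_bound: "symbol k v a \<Longrightarrow> (\<And>n. 0 \<le> v n) \<Longrightarrow> \<exists>C\<ge>0. \<forall>n. \<bar>a n\<bar> \<le> C * v n"
proof -
 assume "symbol k v a" and v: "\<And>n. 0 \<le> v n"
 then obtain C where C: "\<And>n. \<bar>a n\<bar> \<le> C * v n" by (cases k) auto
 have "\<bar>a n\<bar> \<le> \<bar>C\<bar> * v n" for n
  by (rule order.trans[OF C]) (intro mult_right_mono v abs_ge_self)
 then show ?thesis by (intro exI[of _ "\<bar>C\<bar>"]) auto
qed

lemma symbol_weaken: "symbol (Suc k) v a \<Longrightarrow> symbol k v a"
proof (induction k arbitrary: v a)
 case 0
 then show ?case by simp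
next
 case (Suc k)
 have 1: "\<exists>C. \<forall>n. \<bar>a n\<bar> \<le> C * v n" "symbol (Suc k) (\<lambda>n. v n / (real n + 1)) (\<lambda>n. a (Suc n) - a n)"
  using Suc.prems unfolding symbol.simps(2)[of "Suc k" v a] by blast+
 show ?case unfolding symbol.simps(2)[of k v a] using 1(1) Suc.IH[OF 1(2)] by (rule conjI)
qed

lemma symbol_add: "symbol k v a \<Longrightarrow> symbol k v b \<Longrightarrow> symbol k v (\<lambda>n. a n + b n)"
proof (induction k arbitrary: v a b)
 have *: "\<exists>C. \<forall>n. \<bar>a n + b n\<bar> \<le> C * v n"
  if "\<exists>C. \<forall>n. \<bar>a n\<bar> \<le> C * v n" "\<exists>C. \<forall>n. \<bar>b n\<bar> \<le> C * v n" for v a b :: "nat \<Rightarrow> real"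
 proof -
  from that obtain C D where "\<And>n. \<bar>a n\<bar> \<le> C * v n" "\<And>n. \<bar>b n\<bar> \<le> D * v n" by auto
  then have "\<bar>a n + b n\<bar> \<le> (C + D) * v n" for n
   using abs_triangle_ineq[of "a n" "b n"] by (simp add: distrib_right) (smt (verit))
  then show ?thesis by auto
 qed
 { case 0 then show ?case using *[of a v b] by simp }
 { case (Suc k)
  have "symbol k (\<lambda>n. v n / (real n + 1)) (\<lambda>n. (a (Suc n) - a n) + (b (Suc n) - b n))"
   using Suc by auto
  then show ?case using *[of a v b] Suc.prems by (simp add: algebra_simps) }
qed

lemma symbol_uminus: "symbol k v a \<Longrightarrow> symbol k v (\<lambda>n. - a n)"
proof (induction k arbitrary: v a)
 case (Suc k)
 from Suc.IH[of "\<lambda>n. v n / (real n + 1)" "\<lambda>n. a (Suc n) - a n"] Suc.prems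
 have "symbol k (\<lambda>n. v n / (real n + 1)) (\<lambda>n. - (a (Suc n) - a n))" by simp
 then show ?case using Suc.prems by simp
qed simp

lemma symbol_shift:
 assumes "symbol k v a" "\<And>n. 0 \<le> v n" "\<And>n. v (Suc n) \<le> C * v n"
 shows "symbol k v (\<lambda>n. a (Suc n))" using assms
proof (induction k arbitrary: v a)
 case 0
 then obtain D where D: "D \<ge> 0" "\<And>n. \<bar>a n\<bar> \<le> D * v n" using symbol_bound[of 0 v a] by auto
 have "\<bar>a (Suc n)\<bar> \<le> (D * C) * v n" for n
  using order.trans[OF D(2) mult_left_mono[OF 0(3) D(1)]] by (simp add: mult_ac)
 then show ?case by auto
next
 case (Suc k)
 obtain D where D: "D \<ge> 0" "\<And>n. \<bar>a n\<bar> \<le> D * v n" using symbol_bound[OF Suc.prems(1,2)] by auto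
 have 1: "\<bar>a (Suc n)\<bar> \<le> (D * C) * v n" for n
  using order.trans[OF D(2) mult_left_mono[OF Suc.prems(3) D(1)]] by (simp add: mult_ac)
 have "symbol k (\<lambda>n. v n / (real n + 1)) (\<lambda>n. (\<lambda>n. a (Suc n) - a n) (Suc n))"
 proof (rule Suc.IH)
  show "v (Suc n) / (real (Suc n) + 1) \<le> C * (v n / (real n + 1))" for n
  proof -
   have "v (Suc n) / (real (Suc n) + 1) \<le> v (Suc n) / (real n + 1)"
    using Suc.prems(2) by (intro divide_left_mono) auto
   also have "\<dots> \<le> C * v n / (real n + 1)" using Suc.prems(3) by (intro divide_right_mono) auto
   finally show ?thesis by simp
  qed
 qed (use Suc.prems in auto)
 with 1 show ?case by auto
qed

text \<open>The discrete Leibniz rule; the shift that it produces is absorbed by the growth condition on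
  \<open>v\<close>.\<close>

lemma symbol_mult:
 assumes "symbol k v a" "symbol k v' b" "\<And>n. 0 \<le> v n" "\<And>n. 0 \<le> v' n" "\<And>n. v (Suc n) \<le> C * v n"
 shows "symbol k (\<lambda>n. v n * v' n) (\<lambda>n. a n * b n)" using assms
proof (induction k arbitrary: v v' a b)
 have *: "\<exists>C. \<forall>n. \<bar>a n * b n\<bar> \<le> C * (v n * v' n)"
  if "symbol k v a" "symbol k v' b" "\<And>n. 0 \<le> v n" "\<And>n. 0 \<le> v' n" for k v a v' b
 proof -
  note nn = that(3,4) and bounds = symbol_bound[OF that(1,3)] symbol_bound[OF that(2,4)]
  obtain C D where "C \<ge> 0" "\<And>n. \<bar>a n\<bar> \<le> C * v n" "D \<ge> 0" "\<And>n. \<bar>b n\<bar> \<le> D * v' n"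
   using bounds by auto
  then have "\<bar>a n * b n\<bar> \<le> (C * v n) * (D * v' n)" for n
   unfolding abs_mult using nn by (intro mult_mono) auto
  then show ?thesis by (intro exI[of _ "C * D"]) (simp add: mult_ac)
 qed
 { case 0 then show ?case using *[of 0 v a v' b] by simp }
 { case (Suc k)
  have mono: "v (Suc n) / (real (Suc n) + 1) \<le> C * (v n / (real n + 1))" for n
  proof -
   have "v (Suc n) / (real (Suc n) + 1) \<le> v (Suc n) / (real n + 1)"
    using Suc.prems(3) by (intro divide_left_mono) auto
   also have "\<dots> \<le> C * v n / (real n + 1)" using Suc.prems(5) by (intro divide_right_mono) auto
   finally show ?thesis by simp
  qed
  have 1: "symbol k (\<lambda>n. v n / (real n + 1) * v' n) (\<lambda>n. (a (Suc n) - a n) * b n)"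
   using Suc.prems symbol_weaken[OF Suc.prems(2)] mono by (intro Suc.IH) auto
  have 2: "symbol k (\<lambda>n. v n * (v' n / (real n + 1))) (\<lambda>n. a (Suc n) * (b (Suc n) - b n))"
   using Suc.prems symbol_shift[OF symbol_weaken[OF Suc.prems(1)]] by (intro Suc.IH) auto
  have e: "(\<lambda>n. v n / (real n + 1) * v' n) = (\<lambda>n. v n * v' n / (real n + 1))"
   "(\<lambda>n. v n * (v' n / (real n + 1))) = (\<lambda>n. v n * v' n / (real n + 1))" by auto
  have "symbol k (\<lambda>n. v n * v' n / (real n + 1)) (\<lambda>n. (a (Suc n) - a n) * b n + a (Suc n) * (b (Suc n) - b n))"
   using 1 2 unfolding e by (rule symbol_add)
  also have "(\<lambda>n. (a (Suc n) - a n) * b n + a (Suc n) * (b (Suc n) - b n)) = (\<lambda>n. a (Suc n) * b (Suc n) - a n * b n)"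
   by (auto simp: algebra_simps)
  finally show ?case using *[OF Suc.prems(1-4)] by simp }
qed

text \<open>The difference of \<open>1 / m\<close> is \<open>- (m (n+1) - m n) / (m n * m (n+1))\<close>, a
  product of a difference of \<open>m\<close> with two reciprocals that lie in a smaller class by
  induction.\<close>

lemma symbol_inverse:
 assumes m: "\<And>k. symbol k m m" "\<And>n. 0 < m n" "decseq m"
  and C: "\<And>n. m n \<le> C * m (Suc n)"
 shows "symbol k (\<lambda>n. 1 / m n) (\<lambda>n. 1 / m n)"
proof (induction k)
 case 0 show ?case using m(2) by (auto intro!: exI[of _ 1] simp: less_imp_le)
next
 case (Suc k)
 define u where "u n = 1 / m n" for n
 have u: "symbol k u u" "\<And>n. 0 < u n" using Suc m(2) by (auto simp: u_def[abs_def])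
 have uC: "u (Suc n) \<le> C * u n" for n using C[of n] m(2)[of n] m(2)[of "Suc n"] by (simp add: u_def field_simps)
 have 1: "symbol k (\<lambda>n. m n / (real n + 1)) (\<lambda>n. m (Suc n) - m n)" using m(1)[of "Suc k"] by simp
 have 2: "symbol k (\<lambda>n. u n * u n) (\<lambda>n. u n * u (Suc n))"
  using u uC by (intro symbol_mult symbol_shift) (auto simp: less_imp_le)
 have 3: "m (Suc n) / (real (Suc n) + 1) \<le> 1 * (m n / (real n + 1))" for n
  using decseqD[OF m(3), of n "Suc n"] m(2)[of n] by (auto intro!: frac_le simp: less_imp_le)
 have "symbol k (\<lambda>n. m n / (real n + 1) * (u n * u n)) (\<lambda>n. (m (Suc n) - m n) * (u n * u (Suc n)))"
  using m(2) u(2) by (intro symbol_mult[OF 1 2 _ _ 3]) (auto simp: less_imp_le)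
 also have "(\<lambda>n. m n / (real n + 1) * (u n * u n)) = (\<lambda>n. u n / (real n + 1))"
  using m(2) by (auto simp: u_def fun_eq_iff less_imp_neq[symmetric])
 finally have "symbol k (\<lambda>n. u n / (real n + 1)) (\<lambda>n. - ((m (Suc n) - m n) * (u n * u (Suc n))))"
  by (rule symbol_uminus)
 also have "(\<lambda>n. - ((m (Suc n) - m n) * (u n * u (Suc n)))) = (\<lambda>n. u (Suc n) - u n)"
  using m(2) by (auto simp: u_def fun_eq_iff less_imp_neq[symmetric] field_simps)
 finally show ?case using u(2) unfolding u_def by (auto intro!: exI[of _ 1] simp: less_imp_le)
qed

lemma summable_real_powser:
 fixes a :: "nat \<Rightarrow> real" and w :: complex
 assumes "\<And>n. \<bar>a n\<bar> \<le> C * v n" "summable (\<lambda>n. v n * norm w ^ n)"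
 shows "summable (\<lambda>n. of_real (a n) * w ^ n)"
proof (rule summable_comparison_test')
 show "summable (\<lambda>n. C * (v n * norm w ^ n))" using assms(2) by (rule summable_mult)
 show "norm (of_real (a n) * w ^ n) \<le> C * (v n * norm w ^ n)" for n
  using mult_right_mono[OF assms(1), of "norm w ^ n"] by (simp add: norm_mult norm_power mult.assoc)
qed

text \<open>Summation by parts, \<open>k\<close> times: multiplying the tail of the series by
  \<open>1 - w\<close> replaces \<open>a\<close> by its difference, of relative size
  \<open>1 / (n + 1)\<close>, and leaves a boundary term of size \<open>v N\<close>. Dividing by
  \<open>1 - w\<close> costs a factor \<open>N + 1\<close> under the stated condition. After
  \<open>k\<close> steps the series converges absolutely, which is the last hypothesis.\<close>

lemma symbol_powser_tail:
 assumes "symbol k v a" "\<And>n. 0 \<le> v n"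
  and "\<And>r. 0 \<le> r \<Longrightarrow> r < 1 \<Longrightarrow> summable (\<lambda>n. v n * r ^ n)"
  and "\<And>N. summable (\<lambda>n. v (n + N) / (real (n + N) + 1) ^ k)"
  and "\<And>N. (real N + 1) ^ k * (\<Sum>n. v (n + N) / (real (n + N) + 1) ^ k) \<le> C' * ((real N + 1) * v N)"
 shows "\<exists>C\<ge>0. \<forall>N (w::complex). norm w < 1 \<longrightarrow> 1 \<le> (real N + 1) * norm (1 - w) \<longrightarrow>
   norm (\<Sum>n. of_real (a (n + N)) * w ^ (n + N)) \<le> C * ((real N + 1) * v N)" using assms
proof (induction k arbitrary: v a)
 case 0
 obtain C where C: "C \<ge> 0" "\<And>n. \<bar>a n\<bar> \<le> C * v n" using symbol_bound[OF 0(1,2)] by auto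
 show ?case
 proof (intro exI[of _ "C * \<bar>C'\<bar>"] conjI allI impI)
  fix N and w :: complex assume w: "norm w < 1"
  have le: "norm (of_real (a (n + N)) * w ^ (n + N)) \<le> C * v (n + N)" for n
  proof -
   have "norm (of_real (a (n + N)) * w ^ (n + N)) \<le> \<bar>a (n+N)\<bar> * 1"
    unfolding norm_mult norm_power using w by (intro mult_mono power_le_one) auto
   then show ?thesis using C(2)[of "n+N"] by simp
  qed
  have s: "summable (\<lambda>n. C * v (n + N))" using 0(4)[of N] by (simp add: summable_mult)
  have "norm (\<Sum>n. of_real (a (n + N)) * w ^ (n + N)) \<le> (\<Sum>n. C * v (n + N))"
   by (rule norm_suminf_le[OF le s])
  also have "\<dots> = C * (\<Sum>n. v (n + N))" using 0(4)[of N] by (simp add: suminf_mult)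
  also have "\<dots> \<le> C * (C' * ((real N + 1) * v N))" using 0(5)[of N] C(1) by (intro mult_left_mono) auto
  also have "\<dots> \<le> C * (\<bar>C'\<bar> * ((real N + 1) * v N))" using C(1) 0(2) by (intro mult_left_mono mult_right_mono) auto
  finally show "norm (\<Sum>n. of_real (a (n + N)) * w ^ (n + N)) \<le> C * \<bar>C'\<bar> * ((real N + 1) * v N)" by simp
 qed (use C in auto)
next
 case (Suc k)
 obtain C where C: "C \<ge> 0" "\<And>n. \<bar>a n\<bar> \<le> C * v n" using symbol_bound[OF Suc.prems(1,2)] by auto
 define d where "d n = a (Suc n) - a n" for n
 have ds: "symbol k (\<lambda>n. v n / (real n + 1)) d" using Suc.prems(1) by (simp add: d_def[abs_def])
 have sv: "summable (\<lambda>n. v n / (real n + 1) * r ^ n)" if "0 \<le> r" "r < 1" for r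
 proof (rule summable_comparison_test'[OF Suc.prems(3)[OF that]])
  fix n
  have "v n / (real n + 1) \<le> v n" using Suc.prems(2)[of n] by (simp add: divide_le_eq_1 field_simps)
  then have "v n / (real n + 1) * r ^ n \<le> v n * r ^ n" by (rule mult_right_mono) (use that in simp)
  moreover have "0 \<le> v n / (real n + 1) * r ^ n" using Suc.prems(2)[of n] that by simp
  ultimately show "norm (v n / (real n + 1) * r ^ n) \<le> v n * r ^ n" unfolding real_norm_def by linarith
 qed
 \<comment> \<open>The difference \<open>d\<close> is majorized by \<open>v n / (n + 1)\<close>.
  For this majorant and \<open>k\<close> the last hypothesis is the given one for \<open>v\<close>
  and \<open>Suc k\<close>, divided by \<open>N + 1\<close>.\<close>
 have "\<exists>D\<ge>0. \<forall>N (w::complex). norm w < 1 \<longrightarrow> 1 \<le> (real N + 1) * norm (1 - w) \<longrightarrow>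
   norm (\<Sum>n. of_real (d (n + N)) * w ^ (n + N)) \<le> D * ((real N + 1) * (v N / (real N + 1)))"
 proof (rule Suc.IH[OF ds])
  show "summable (\<lambda>n. v (n + N) / (real (n + N) + 1) / (real (n + N) + 1) ^ k)" for N
   using Suc.prems(4)[of N] by (simp add: mult.commute)
  show "(real N + 1) ^ k * (\<Sum>n. v (n + N) / (real (n + N) + 1) / (real (n + N) + 1) ^ k) \<le> C' * ((real N + 1) * (v N / (real N + 1)))" for N
  proof -
   have p: "0 < real N + 1" by simp
   have "(real N + 1) * ((real N + 1) ^ k * (\<Sum>n. v (n + N) / (real (n + N) + 1) / (real (n + N) + 1) ^ k)) \<le> (real N + 1) * (C' * v N)"
    using Suc.prems(5)[of N] by (simp add: mult_ac)
   then have "(real N + 1) ^ k * (\<Sum>n. v (n + N) / (real (n + N) + 1) / (real (n + N) + 1) ^ k) \<le> C' * v N"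
    using mult_le_cancel_left_pos[OF p] by blast
   then show ?thesis using p by simp
  qed
 qed (use Suc.prems(2) sv in auto)
 then obtain D where D: "D \<ge> 0" "\<And>N w. norm w < 1 \<Longrightarrow> 1 \<le> (real N + 1) * norm (1 - w) \<Longrightarrow>
   norm (\<Sum>n. of_real (d (n + N)) * w ^ (n + N) :: complex) \<le> D * v N" by (auto simp: add_nonneg_eq_0_iff)
 show ?case
 proof (intro exI[of _ "C + D"] conjI allI impI)
  fix N and w :: complex assume w: "norm w < 1" "1 \<le> (real N + 1) * norm (1 - w)"
  define s where "s = (\<Sum>n. of_real (a (n + N)) * w ^ (n + N))"
  define e where "e = (\<Sum>n. of_real (d (n + N)) * w ^ (n + N))"
  have sa: "summable (\<lambda>n. of_real (a n) * w ^ n)"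
   using w by (intro summable_real_powser[OF C(2)] Suc.prems(3)) auto
  have saN: "summable (\<lambda>n. of_real (a (n + N)) * w ^ (n + N))"
   using summable_ignore_initial_segment[OF sa, of N] .
  have saS: "summable (\<lambda>n. of_real (a (n + Suc N)) * w ^ (n + Suc N))"
   using summable_ignore_initial_segment[OF sa, of "Suc N"] .
  have head: "s = of_real (a N) * w ^ N + (\<Sum>n. of_real (a (n + Suc N)) * w ^ (n + Suc N))"
   unfolding s_def using suminf_split_head[OF saN] by simp
  have eq: "of_real (a (n + Suc N)) * w ^ (n + Suc N) - w * (of_real (a (n + N)) * w ^ (n + N))
    = w * (of_real (d (n + N)) * w ^ (n + N))" for n by (simp add: d_def algebra_simps)
  have sum_d: "summable (\<lambda>n. w * (of_real (d (n + N)) * w ^ (n + N)))"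
   unfolding eq[symmetric] by (intro summable_diff saS summable_mult saN)
  have "(\<Sum>n. of_real (a (n + Suc N)) * w ^ (n + Suc N)) - w * s = w * e"
  proof (cases "w = 0")
   case True then show ?thesis by simp
  next
   case False
   then have sd: "summable (\<lambda>n. of_real (d (n + N)) * w ^ (n + N))" by (rule summable_mult_D[OF sum_d])
   have "w * s = (\<Sum>n. w * (of_real (a (n + N)) * w ^ (n + N)))"
    unfolding s_def by (rule suminf_mult[OF saN, symmetric])
   then have "(\<Sum>n. of_real (a (n + Suc N)) * w ^ (n + Suc N)) - w * s =
     (\<Sum>n. of_real (a (n + Suc N)) * w ^ (n + Suc N) - w * (of_real (a (n + N)) * w ^ (n + N)))"
    using suminf_diff[OF saS summable_mult[OF saN, of w]] by (simp only:)
   also have "\<dots> = (\<Sum>n. w * (of_real (d (n + N)) * w ^ (n + N)))" by (intro suminf_cong eq)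
   also have "\<dots> = w * e" unfolding e_def by (rule suminf_mult[OF sd])
   finally show ?thesis .
  qed
  then have main: "(1 - w) * s = of_real (a N) * w ^ N + w * e" unfolding head by (simp add: algebra_simps)
  have "norm (1 - w) * norm s \<le> norm (of_real (a N) * w ^ N) + norm (w * e)"
   unfolding norm_mult[symmetric] main by (rule norm_triangle_ineq)
  also have "norm (of_real (a N) * w ^ N) \<le> \<bar>a N\<bar> * 1"
   unfolding norm_mult norm_power using w by (intro mult_mono power_le_one) auto
  also have "\<bar>a N\<bar> * 1 \<le> C * v N" using C(2)[of N] by simp
  also have "norm (w * e) \<le> 1 * norm e" unfolding norm_mult using w by (intro mult_right_mono) auto
  also have "1 * norm e \<le> D * v N" unfolding e_def using D(2)[OF w] by simp
  finally have 1: "norm (1 - w) * norm s \<le> (C + D) * v N" by (simp add: distrib_right)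
  have "norm s \<le> ((real N + 1) * norm (1 - w)) * norm s" using mult_right_mono[OF w(2), of "norm s"] by simp
  also have "\<dots> = (real N + 1) * (norm (1 - w) * norm s)" by simp
  also have "\<dots> \<le> (real N + 1) * ((C + D) * v N)" by (intro mult_left_mono 1) auto
  finally show "norm (\<Sum>n. of_real (a (n + N)) * w ^ (n + N)) \<le> (C + D) * ((real N + 1) * v N)"
   unfolding s_def by (simp add: mult_ac)
 qed (use C D in auto)
qed

text \<open>From \<open>(m + 1) * s ^ m \<le> (\<Sum>i\<le>m. s ^ i) \<le> 1 / (1 - s)\<close> with
  \<open>m = n div k\<close>, raised to the power \<open>k\<close>.\<close>

lemma power_one_minus_power_le:
 fixes s :: real
 assumes "0 \<le> s" "s \<le> 1" "1 \<le> k"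
 shows "s ^ n * (1 - s) ^ k \<le> (real k / (real n + 1)) ^ k"
proof -
 have 1: "(real m + 1) * s ^ m * (1 - s) \<le> 1" for m
 proof -
  have "(real m + 1) * s ^ m = (\<Sum>i<Suc m. s ^ m)" by simp
  also have "\<dots> \<le> (\<Sum>i<Suc m. s ^ i)" using assms by (intro sum_mono power_decreasing) auto
  finally have "(real m + 1) * s ^ m * (1 - s) \<le> (\<Sum>i<Suc m. s ^ i) * (1 - s)"
   using assms by (intro mult_right_mono) auto
  also have "\<dots> = 1 - s ^ Suc m" using one_diff_power_eq[of s "Suc m"] by (simp add: mult.commute)
  also have "\<dots> \<le> 1" using assms by simp
  finally show ?thesis .
 qed
 define m where "m = n div k"
 have "m * k \<le> n" by (simp add: m_def)
 then have "s ^ n \<le> (s ^ m) ^ k" using assms by (simp add: power_mult[symmetric] power_decreasing)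
 then have "s ^ n * (1 - s) ^ k \<le> (s ^ m * (1 - s)) ^ k"
  using assms by (simp add: power_mult_distrib mult_right_mono)
 also have "\<dots> \<le> (real k / (real n + 1)) ^ k"
 proof (rule power_mono)
  have "n = m * k + n mod k" by (simp add: m_def)
  moreover have "n mod k < k" using assms(3) by simp
  ultimately have "n < (m + 1) * k" by simp
  then have "n + 1 \<le> (m + 1) * k" by simp
  then have "real (n + 1) \<le> real ((m + 1) * k)" by (simp only: of_nat_le_iff)
  then have "1 / (real m + 1) \<le> real k / (real n + 1)" by (simp add: field_simps)
  moreover have "s ^ m * (1 - s) \<le> 1 / (real m + 1)" using 1[of m] by (simp add: field_simps)
  ultimately show "s ^ m * (1 - s) \<le> real k / (real n + 1)" by simp
 qed (use assms in auto)
 finally show ?thesis .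
qed

lemma suminf_inverse_squares_le:
 "summable (\<lambda>n. 1 / (real (n + N) + 1) ^ 2)" "(\<Sum>n. 1 / (real (n + N) + 1) ^ 2) \<le> 2 / (real N + 1)"
proof -
 let ?f = "\<lambda>n. 2 / (real (n + N) + 1)"
 have "?f \<longlonglongrightarrow> 0" by real_asymp
 from telescope_sums'[OF this] have s: "(\<lambda>n. ?f n - ?f (Suc n)) sums (2 / (real N + 1))" by simp
 have le: "1 / (real (n + N) + 1) ^ 2 \<le> ?f n - ?f (Suc n)" for n
 proof -
  define a where "a = real (n + N) + 1"
  have a: "1 \<le> a" by (simp add: a_def)
  have "1 / a\<^sup>2 \<le> 2 / (a * (a + 1))"
   using a by (intro frac_le[of 2 2 "a * (a+1)" "2 * a\<^sup>2", simplified]) (auto simp: power2_eq_square algebra_simps add_pos_pos)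
  also have "\<dots> = 2 / a - 2 / (a + 1)" using a by (simp add: field_simps)
  finally show ?thesis by (simp add: a_def add_ac)
 qed
 show 1: "summable (\<lambda>n. 1 / (real (n + N) + 1) ^ 2)"
  by (rule summable_comparison_test'[OF sums_summable[OF s]]) (use le in auto)
 show "(\<Sum>n. 1 / (real (n + N) + 1) ^ 2) \<le> 2 / (real N + 1)"
  using suminf_le[OF le 1 sums_summable[OF s]] sums_unique[OF s] by simp
qed

section \<open>Tails and moments of a doubling weight\<close>

definition wtail :: "(real \<Rightarrow> real) \<Rightarrow> real \<Rightarrow> real" where
 "wtail w r = (LBINT t. w t * indicator {r..} t)"

text \<open>A Borel representative of the radial weight, extended by zero outside the open interval so that no
  domain of integration has to be carried along.\<close>

locale dweight =
 fixes w :: "real \<Rightarrow> real"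
 assumes w_measurable [measurable]: "w \<in> borel_measurable borel"
  and w_nonneg [simp]: "0 \<le> w t"
  and w_supp: "t \<notin> {0<..<1} \<Longrightarrow> w t = 0"
  and w_integrable: "integrable lborel w"
  and wtail_pos: "0 \<le> r \<Longrightarrow> r < 1 \<Longrightarrow> 0 < wtail w r"
  and wtail_doubling: "\<exists>C\<ge>1. \<forall>r\<in>{0..<1}. wtail w r \<le> C * wtail w ((1 + r) / 2)"
begin

abbreviation "tail \<equiv> wtail w"

lemma integrable_w_mult:
 assumes [measurable]: "g \<in> borel_measurable borel" and "\<And>t. t \<in> {0<..<1} \<Longrightarrow> \<bar>g t\<bar> \<le> B"
 shows "integrable lborel (\<lambda>t. w t * g t)"
proof (rule Bochner_Integration.integrable_bound)
 show "integrable lborel (\<lambda>t. B * w t)" using w_integrable by simp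
 have "norm (w t * g t) \<le> norm (B * w t)" for t
 proof (cases "t \<in> {0<..<1}")
  case True
  then have "\<bar>g t\<bar> \<le> \<bar>B\<bar>" using assms(2)[of t] by linarith
  then have "w t * \<bar>g t\<bar> \<le> w t * \<bar>B\<bar>" by (rule mult_left_mono) simp
  then show ?thesis by (simp add: abs_mult mult.commute)
 qed (simp add: w_supp)
 then show "AE t in lborel. norm (w t * g t) \<le> norm (B * w t)" by simp
qed simp

lemma w_mult_mono:
 assumes "integrable lborel (\<lambda>t. w t * g t)" "integrable lborel (\<lambda>t. w t * h t)"
  "\<And>t. t \<in> {0<..<1} \<Longrightarrow> g t \<le> h t"
 shows "(LBINT t. w t * g t) \<le> (LBINT t. w t * h t)"
proof (rule integral_mono[OF assms(1,2)])
 fix t show "w t * g t \<le> w t * h t"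
  by (cases "t \<in> {0<..<1}") (auto simp: w_supp intro!: mult_left_mono assms(3))
qed

lemma integrable_tail: "integrable lborel (\<lambda>t. w t * indicator {r..} t)"
 by (rule integrable_w_mult[where B=1]) auto

lemma tail_antimono: "r \<le> s \<Longrightarrow> tail s \<le> tail r"
 unfolding wtail_def by (intro w_mult_mono integrable_tail) (auto split: split_indicator)

lemma tail_nonneg [simp]: "0 \<le> tail r" unfolding wtail_def by (intro Bochner_Integration.integral_nonneg) auto

lemma tail_eq_0: "1 \<le> r \<Longrightarrow> tail r = 0"
proof -
 assume "1 \<le> r"
 have z: "(\<lambda>t. w t * indicator {r..} t) = (\<lambda>t. 0)"
 proof
  fix t show "w t * indicator {r..} t = 0" using \<open>1 \<le> r\<close> by (cases "t \<in> {0<..<1}") (auto simp: w_supp)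
 qed
 show ?thesis unfolding wtail_def z by simp
qed

lemma nn_tail: "(NINT t:{r..}. ennreal (w t)) = ennreal (tail r)"
proof -
 have "(NINT t:{r..}. ennreal (w t)) = (NINT t. ennreal (w t * indicator {r..} t))"
  by (intro nn_integral_cong) (auto split: split_indicator)
 then show ?thesis unfolding wtail_def by (simp add: nn_integral_eq_integral[OF integrable_tail])
qed

lemma measurable_tail [measurable]: "tail \<in> borel_measurable borel"
proof -
 have "mono (\<lambda>r. - tail r)" by (auto simp: mono_def tail_antimono)
 then have "(\<lambda>r. - tail r) \<in> borel_measurable borel" by (rule borel_measurable_mono)
 then have "(\<lambda>r. - (- tail r)) \<in> borel_measurable borel" by measurable
 then show ?thesis by simp
qed

text \<open>Iterating the doubling inequality turns it into a power bound, with any exponent \<open>k\<close>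
  for which \<open>2 ^ k\<close> exceeds the doubling constant.\<close>

lemma tail_growth:
 "\<exists>(C::real) (k::nat). 1 \<le> C \<and> 1 \<le> k \<and>
  (\<forall>r s. 0 \<le> r \<longrightarrow> r \<le> s \<longrightarrow> s < 1 \<longrightarrow> tail r \<le> C * ((1 - r) / (1 - s)) ^ k * tail s)"
proof -
 obtain D where D: "1 \<le> D" "\<And>r. r \<in> {0..<1} \<Longrightarrow> tail r \<le> D * tail ((1 + r) / 2)"
  using wtail_doubling by auto
 have iter: "tail r \<le> D ^ j * tail s" if "0 \<le> r" "r \<le> s" "s < 1" "1 - r \<le> 2 ^ j * (1 - s)" for j r s
  using that
 proof (induction j arbitrary: r)
  case 0 then show ?case by (auto intro: tail_antimono)
 next
  case (Suc j)
  let ?r = "(1 + r) / 2"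
  have 1: "tail r \<le> D * tail ?r" using Suc.prems by (intro D) auto
  have "tail ?r \<le> D ^ j * tail s"
  proof (cases "?r \<le> s")
   case True
   then show ?thesis using Suc.prems by (intro Suc.IH) (auto simp: field_simps)
  next
   case False
   have "tail ?r \<le> 1 * tail s" using False by (auto intro: tail_antimono)
   also have "\<dots> \<le> D ^ j * tail s" using D(1) by (intro mult_right_mono) auto
   finally show ?thesis .
  qed
  then have "D * tail ?r \<le> D * (D ^ j * tail s)" using D(1) by (intro mult_left_mono) auto
  with 1 show ?case by (simp add: mult.assoc)
 qed
 obtain k0 :: nat where k0: "D < 2 ^ k0" using real_arch_pow[of 2 D] by auto
 have k: "D \<le> 2 ^ k0" "1 \<le> k0" using k0 D(1) by (cases k0; simp)+
 show ?thesis
 proof (rule exI[of _ "2 ^ k0"], rule exI[of _ k0], intro conjI allI impI)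
  show "1 \<le> (2::real) ^ k0" by simp
  show "1 \<le> k0" by (rule k)
  fix r s :: real assume rs: "0 \<le> r" "r \<le> s" "s < 1"
  define x where "x = (1 - r) / (1 - s)"
  have x: "1 \<le> x" using rs by (simp add: x_def)
  obtain j0 where "x < 2 ^ j0" using real_arch_pow[of 2 x] by auto
  then have ex: "\<exists>j. x \<le> 2 ^ j" by (auto intro: less_imp_le)
  define j where "j = (LEAST j. x \<le> 2 ^ j)"
  have j1: "x \<le> 2 ^ j" unfolding j_def using ex by (rule LeastI_ex)
  have j2: "2 ^ j \<le> 2 * x"
  proof (cases j)
   case 0 then show ?thesis using x by simp
  next
   case (Suc i)
   then have "\<not> x \<le> 2 ^ i" using not_less_Least[of i "\<lambda>j. x \<le> 2 ^ j"] by (simp add: j_def)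
   then show ?thesis using Suc by simp
  qed
  have "tail r \<le> D ^ j * tail s" using rs j1 by (intro iter) (auto simp: x_def divide_le_eq)
  also have "D ^ j \<le> (2 ^ k0) ^ j" using k D(1) by (intro power_mono) auto
  also have "((2::real) ^ k0) ^ j = (2 ^ j) ^ k0" by (simp add: power_mult[symmetric] mult.commute)
  also have "\<dots> \<le> (2 * x) ^ k0" using j2 by (intro power_mono) auto
  finally have "tail r \<le> (2 * x) ^ k0 * tail s" by (simp add: mult_right_mono)
  then show "tail r \<le> 2 ^ k0 * ((1 - r) / (1 - s)) ^ k0 * tail s"
   unfolding x_def[symmetric] by (simp only: power_mult_distrib)
 qed
qed

definition moment :: "nat \<Rightarrow> real" where
 "moment n = (LBINT t. w t * t ^ n)"

lemma integrable_moment: "integrable lborel (\<lambda>t. w t * t ^ n)"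
 by (rule integrable_w_mult[where B=1]) (auto intro: power_le_one)

lemma moment_nonneg [simp]: "0 \<le> moment n" unfolding moment_def
proof (rule Bochner_Integration.integral_nonneg)
 fix t show "0 \<le> w t * t ^ n" by (cases "t \<in> {0<..<1}") (auto simp: w_supp)
qed

lemma moment_antimono: "m \<le> n \<Longrightarrow> moment n \<le> moment m"
 unfolding moment_def by (intro w_mult_mono integrable_moment) (auto intro: power_decreasing)

lemma moment_lower: "0 \<le> y \<Longrightarrow> y ^ n * tail y \<le> moment n"
proof -
 assume y: "0 \<le> y"
 have "y ^ n * tail y = (LBINT t. w t * (y ^ n * indicator {y..} t))"
  unfolding wtail_def by (simp add: integral_mult_right_zero[symmetric] mult_ac del: integral_mult_right_zero)
 also have "\<dots> \<le> moment n" unfolding moment_def using y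
  by (intro w_mult_mono integrable_moment integrable_w_mult[where B="y ^ n"])
    (auto intro: power_mono split: split_indicator)
 finally show ?thesis .
qed

lemma exp_minus_1_le_power: "exp (-1) \<le> (1 - 1 / (real n + 1)) ^ n"
proof (cases "n = 0")
 case False
 have "(1 + 1 / real n) ^ n \<le> exp 1" using exp_ge_one_plus_x_over_n_power_n[of n 1] False by simp
 then have "1 / exp 1 \<le> 1 / (1 + 1 / real n) ^ n"
  by (intro divide_left_mono) (auto intro!: mult_pos_pos zero_less_power add_pos_nonneg)
 also have "\<dots> = (1 / (1 + 1 / real n)) ^ n" by (simp add: power_divide)
 also have "1 / (1 + 1 / real n) = 1 - 1 / (real n + 1)" using False by (simp add: field_simps)
 finally show ?thesis by (simp add: exp_minus inverse_eq_divide)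
qed simp

lemma moment_lower': "exp (-1) * tail (1 - 1 / (real n + 1)) \<le> moment n"
proof -
 have "exp (-1) * tail (1 - 1 / (real n + 1)) \<le> (1 - 1 / (real n + 1)) ^ n * tail (1 - 1 / (real n + 1))"
  by (intro mult_right_mono exp_minus_1_le_power) auto
 also have "\<dots> \<le> moment n" by (rule moment_lower) (simp add: divide_le_eq)
 finally show ?thesis .
qed

lemma moment_pos: "0 < moment n"
proof -
 have "0 < exp (-1) * tail (1 - 1 / (real n + 1))" by (intro mult_pos_pos wtail_pos) (auto simp: divide_le_eq)
 then show ?thesis using moment_lower'[of n] by linarith
qed

lemma nn_integral_power_Icc: "(NINT s:{0..1}. ennreal (real (Suc b) * s ^ b)) = 1"
proof -
 have "(NINT s:{0..1}. ennreal (real (Suc b) * s ^ b)) = ennreal (1 ^ Suc b - 0 ^ Suc b)"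
 proof (rule nn_integral_FTC_Icc)
  show "DERIV (\<lambda>s. s ^ Suc b) s :> real (Suc b) * s ^ b" for s :: real
   using DERIV_pow[of "Suc b" s] by (simp del: of_nat_Suc)
 qed auto
 then show ?thesis by simp
qed

text \<open>Integration by parts in the form \<open>t ^ n = \<integral> n * s ^ (n - 1)\<close> over
  \<open>[0,t]\<close> and an interchange of integrals.\<close>

lemma nn_moment_eq:
 assumes "1 \<le> n"
 shows "ennreal (moment n) = (NINT s:{0..1}. ennreal (real n * s ^ (n - 1)) * ennreal (tail s))"
proof -
 let ?k = "\<lambda>s t. ennreal (w t) * (ennreal (real n * s ^ (n - 1)) * (if 0 \<le> s \<and> s \<le> t \<and> s \<le> 1 then 1 else 0))"
 let ?d = "\<lambda>s. ennreal (real n * s ^ (n - 1))"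
 have pw: "ennreal (w t * t ^ n) = (NINT s. ?k s t)" for t
 proof (cases "t \<in> {0<..<1}")
  case False then show ?thesis by (simp add: w_supp)
 next
  case True
  have "(NINT s. ?d s * (if 0 \<le> s \<and> s \<le> t \<and> s \<le> 1 then 1 else 0))
   = (NINT s:{0..t}. ?d s)"
   using True by (intro nn_integral_cong) (auto split: split_indicator)
  also have "\<dots> = ennreal (t ^ n - 0 ^ n)"
   using True by (intro nn_integral_FTC_Icc) (auto intro!: derivative_eq_intros)
  also have "\<dots> = ennreal (t ^ n)" using assms by (simp add: zero_power)
  finally show ?thesis by (subst nn_integral_cmult) (auto simp: ennreal_mult')
 qed
 have "ennreal (moment n) = (NINT t. ennreal (w t * t ^ n))" unfolding moment_def
 proof (rule nn_integral_eq_integral[symmetric, OF integrable_moment])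
  show "AE t in lborel. 0 \<le> w t * t ^ n"
  proof (rule AE_I2)
   fix t show "0 \<le> w t * t ^ n" by (cases "t \<in> {0<..<1}") (auto simp: w_supp)
  qed
 qed
 also have "\<dots> = (NINT t. (NINT s. ?k s t))"
  by (simp only: pw)
 also have "\<dots> = (NINT s. (NINT t. ?k s t))"
  by (rule lborel_pair.Fubini'[symmetric]) measurable
 also have "\<dots> = (NINT s:{0..1}. ?d s * ennreal (tail s))"
 proof (rule nn_integral_cong)
  fix s :: real
  have "(NINT t. ?k s t)
   = (NINT t. (?d s * indicator {0..1} s) * (ennreal (w t) * indicator {s..} t))"
   by (intro nn_integral_cong) (auto simp: mult_ac split: split_indicator)
  also have "\<dots> = (?d s * indicator {0..1} s) * ennreal (tail s)"
   by (subst nn_integral_cmult) (auto simp: nn_tail)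
  finally show "(NINT t. ?k s t)
   = ?d s * ennreal (tail s) * indicator {0..1} s" by (simp add: mult_ac)
 qed
 finally show ?thesis .
qed

text \<open>By \<open>tail_growth\<close> the tail at \<open>s\<close> exceeds that at
  \<open>y = 1 - 1 / (n + 1)\<close> at most by a power of \<open>(n + 1) * (1 - s)\<close>. Half of
  the power \<open>s ^ (n - 1)\<close> compensates it by \<open>power_one_minus_power_le\<close>,
  and the other half stays integrable with mass of order \<open>1 / n\<close>.\<close>

lemma moment_upper: "\<exists>C>0. \<forall>n. moment n \<le> C * tail (1 - 1 / (real n + 1))"
proof -
 obtain C and k :: nat where C: "1 \<le> C" "1 \<le> k"
  "\<And>r s. 0 \<le> r \<Longrightarrow> r \<le> s \<Longrightarrow> s < 1 \<Longrightarrow> tail r \<le> C * ((1 - r) / (1 - s)) ^ k * tail s"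
  using tail_growth by blast
 have "moment n \<le> (C * (1 + 2 * (4 * real k) ^ k)) * tail (1 - 1 / (real n + 1))" for n
 proof (cases "n = 0")
  case True
  have "moment 0 = tail 0" unfolding moment_def wtail_def
  proof (rule Bochner_Integration.integral_cong)
   fix t :: real show "w t * t ^ 0 = w t * indicator {0..} t" by (cases "t \<in> {0<..<1}") (auto simp: w_supp)
  qed simp
  moreover have "1 * tail 0 \<le> (C * (1 + 2 * (4 * real k) ^ k)) * tail 0"
   using C(1) by (intro mult_right_mono mult_ge1_I) auto
  ultimately show ?thesis using True by simp
 next
  case False
  define y where "y = 1 - 1 / (real n + 1)"
  \<comment> \<open>Both \<open>a\<close> and \<open>b\<close> are about half of
   \<open>n - 1\<close>: \<open>s ^ a\<close> absorbs the power of
   \<open>(n + 1) * (1 - s)\<close>, and \<open>s ^ b\<close> is integrated.\<close>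
  define a where "a = (n - 1) div 2"
  define b where "b = (n - 1) - a"
  have y: "0 \<le> y" "y < 1" "1 - y = 1 / (real n + 1)" by (auto simp: y_def divide_le_eq)
  let ?d = "\<lambda>s. real n * s ^ (n - 1)" and ?b = "\<lambda>s. real (Suc b) * s ^ b" and ?c = "2 * (4 * real k) ^ k"
 have tl: "tail s \<le> C * tail y * (1 + ((real n + 1) * (1 - s)) ^ k)" if s: "s \<in> {0..<1}" for s
  proof (cases "s \<le> y")
   case True
   then have "tail s \<le> C * ((1 - s) / (1 - y)) ^ k * tail y" using s y by (intro C) auto
   also have "(1 - s) / (1 - y) = (real n + 1) * (1 - s)" unfolding y(3) by simp
   also have "C * ((real n + 1) * (1 - s)) ^ k * tail y \<le> C * (1 + ((real n + 1) * (1 - s)) ^ k) * tail y"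
    using C(1) by (intro mult_right_mono mult_left_mono) auto
   finally show ?thesis by (simp add: mult_ac)
  next
   case False
   then have "1 * tail s \<le> C * tail y" using C(1) by (intro mult_mono tail_antimono) auto
   moreover have "C * tail y * 1 \<le> C * tail y * (1 + ((real n + 1) * (1 - s)) ^ k)"
    using C(1) s by (intro mult_left_mono) auto
   ultimately show ?thesis by simp
  qed
  have ab: "real n + 1 \<le> 4 * (real a + 1)" "real n \<le> 2 * real (Suc b)" "n - 1 = b + a"
   using False by (auto simp: a_def b_def)
  have pw: "?d s * (1 + ((real n + 1) * (1 - s)) ^ k) \<le> ?d s + ?c * (?b s)"
   if s: "s \<in> {0..1}" for s
  proof -
   have "s ^ a * (1 - s) ^ k \<le> (real k / (real a + 1)) ^ k"
    using s C(2) by (intro power_one_minus_power_le) auto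
   then have "(real n + 1) ^ k * (s ^ a * (1 - s) ^ k) \<le> (real n + 1) ^ k * (real k / (real a + 1)) ^ k"
    by (intro mult_left_mono) auto
   also have "\<dots> = ((real n + 1) * (real k / (real a + 1))) ^ k" by (simp only: power_mult_distrib)
   also have "\<dots> \<le> (4 * real k) ^ k"
   proof (rule power_mono)
    have "(real n + 1) * real k \<le> 4 * (real a + 1) * real k" using ab(1) by (intro mult_right_mono) auto
    then show "(real n + 1) * (real k / (real a + 1)) \<le> 4 * real k" by (simp add: field_simps)
   qed auto
   finally have 1: "(real n + 1) ^ k * (s ^ a * (1 - s) ^ k) \<le> (4 * real k) ^ k" .
   have "?d s * ((real n + 1) * (1 - s)) ^ k = (real n * s ^ b) * ((real n + 1) ^ k * (s ^ a * (1 - s) ^ k))"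
    unfolding ab(3) by (simp add: power_add power_mult_distrib mult_ac)
   also have "\<dots> \<le> (2 * real (Suc b) * s ^ b) * (4 * real k) ^ k"
    using s ab(2) 1 by (intro mult_mono) auto
   finally show ?thesis by (simp add: distrib_left mult_ac)
  qed
  have "ennreal (moment n) = (NINT s:{0..1}. ennreal (?d s) * ennreal (tail s))"
   using False by (intro nn_moment_eq) auto
  also have "\<dots> \<le> (NINT s. ennreal (C * tail y) * (ennreal (?d s) * indicator {0..1} s
    + ennreal ?c * (ennreal (?b s) * indicator {0..1} s)))"
  proof (rule nn_integral_mono)
   fix s :: real
   show "ennreal (?d s) * ennreal (tail s) * indicator {0..1} s \<le>
    ennreal (C * tail y) * (ennreal (?d s) * indicator {0..1} s
    + ennreal ?c * (ennreal (?b s) * indicator {0..1} s))"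
   proof (cases "s \<in> {0..1}")
    case True
    have "tail s \<le> C * tail y * (1 + ((real n + 1) * (1 - s)) ^ k)"
    proof (cases "s = 1")
     case True then show ?thesis using C(1) by (simp add: tail_eq_0)
    qed (use tl \<open>s \<in> {0..1}\<close> in auto)
    then have "?d s * tail s \<le> ?d s * (C * tail y * (1 + ((real n + 1) * (1 - s)) ^ k))"
     using True by (intro mult_left_mono) auto
    also have "\<dots> = (C * tail y) * (?d s * (1 + ((real n + 1) * (1 - s)) ^ k))" by (simp add: mult_ac)
    also have "\<dots> \<le> (C * tail y) * (?d s + ?c * (?b s))"
     using C(1) pw[OF True] by (intro mult_left_mono) auto
    finally have "ennreal (?d s * tail s) \<le> ennreal ((C * tail y) * (?d s + ?c * (?b s)))"
     by (rule ennreal_leI)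
    also have "\<dots> = ennreal (C * tail y) * (ennreal (?d s) + ennreal ?c * ennreal (?b s))"
     using C(1) True by (subst ennreal_mult, simp, simp, subst ennreal_plus, simp, simp, subst (2) ennreal_mult, simp_all del: ennreal_plus)
    finally have F: "ennreal (?d s * tail s) \<le> ennreal (C * tail y) * (ennreal (?d s) + ennreal ?c * ennreal (?b s))" .
    have em: "ennreal (?d s) * ennreal (tail s) = ennreal (?d s * tail s)"
     using True by (subst ennreal_mult) auto
    show ?thesis unfolding em using True F by (simp only: indicator_simps mult_1_right)
   qed simp
  qed
  also have "\<dots> = ennreal (C * tail y) * ((NINT s:{0..1}. ennreal (?d s))
    + ennreal ?c * (NINT s:{0..1}. ennreal (?b s)))"
   by (subst nn_integral_cmult, simp, subst nn_integral_add, simp, simp, subst nn_integral_cmult, simp_all)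
  also have "(NINT s:{0..1}. ennreal (?d s)) = 1"
   using nn_integral_power_Icc[of "n - 1"] False by simp
  also have "(NINT s:{0..1}. ennreal (?b s)) = 1" by (rule nn_integral_power_Icc)
  also have "ennreal (C * tail y) * (1 + ennreal ?c * 1) = ennreal (C * tail y * (1 + ?c))"
   using C(1) by (subst ennreal_mult[of "C * tail y"]) (auto simp: ennreal_plus)
  finally have "moment n \<le> C * tail y * (1 + ?c)"
   using C(1) by (subst (asm) ennreal_le_iff) auto
  then show ?thesis by (simp add: y_def mult_ac)
 qed
 then show ?thesis using C(1)
  by (intro exI[of _ "C * (1 + 2 * (4 * real k) ^ k)"]) (auto intro!: mult_pos_pos add_pos_nonneg)
qed

end

section \<open>The kernel series and its size\<close>

context dweight
begin

text \<open>Twice the Taylor coefficients of the Bergman kernel at the point 1.\<close>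

definition u :: "nat \<Rightarrow> real" where "u n = 1 / moment (2 * n + 1)"

lemma u_pos [simp]: "0 < u n" by (simp add: u_def moment_pos)

lemma u_nonneg [simp]: "0 \<le> u n" using u_pos[of n] by linarith

lemma u_mono: "m \<le> n \<Longrightarrow> u m \<le> u n"
 unfolding u_def by (intro divide_left_mono moment_antimono mult_pos_pos moment_pos) auto

lemma u_upper: "\<exists>C>0. \<forall>n. u n * tail (1 - 1 / (real n + 1)) \<le> C"
proof -
 obtain C and k :: nat where C: "1 \<le> C" "1 \<le> k"
  "\<And>r s. 0 \<le> r \<Longrightarrow> r \<le> s \<Longrightarrow> s < 1 \<Longrightarrow> tail r \<le> C * ((1 - r) / (1 - s)) ^ k * tail s"
  using tail_growth by blast
 have "u n * tail (1 - 1 / (real n + 1)) \<le> C * 2 ^ k * exp 1" for n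
 proof -
  define s where "s = 1 - 1 / (real (2 * n + 1) + 1)"
  have "tail (1 - 1 / (real n + 1)) \<le> C * ((1 - (1 - 1 / (real n + 1))) / (1 - s)) ^ k * tail s"
   by (intro C) (auto simp: s_def field_simps)
  also have "(1 - (1 - 1 / (real n + 1))) / (1 - s) = 2" by (simp add: s_def field_simps)
  also have "C * 2 ^ k * tail s \<le> C * 2 ^ k * (exp 1 * moment (2 * n + 1))"
  proof -
   have "exp 1 * (exp (-1) * tail s) \<le> exp 1 * moment (2 * n + 1)"
    unfolding s_def by (intro mult_left_mono moment_lower') auto
   moreover have "exp (1::real) * exp (-1) = 1" by (simp add: exp_minus)
   then have "tail s = exp 1 * (exp (-1) * tail s)" by (simp only: mult.assoc[symmetric] mult_1_left)
   ultimately have "tail s \<le> exp 1 * moment (2 * n + 1)" by simp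
   then show ?thesis using C(1) by (intro mult_left_mono) auto
  qed
  finally have "u n * tail (1 - 1 / (real n + 1)) \<le> u n * (C * 2 ^ k * (exp 1 * moment (2 * n + 1)))"
   by (intro mult_left_mono) auto
  also have "\<dots> = C * 2 ^ k * exp 1" using moment_pos[of "2 * n + 1"] by (simp add: u_def)
  finally show ?thesis .
 qed
 then show ?thesis using C(1) by (intro exI[of _ "C * 2 ^ k * exp 1"]) auto
qed

lemma u_lower: "\<exists>c>0. \<forall>n. c \<le> u n * tail (1 - 1 / (2 * real n + 2))"
proof -
 obtain C where C: "0 < C" "\<And>n. moment n \<le> C * tail (1 - 1 / (real n + 1))" using moment_upper by blast
 have "1 / C \<le> u n * tail (1 - 1 / (2 * real n + 2))" for n
 proof -
  have "moment (2*n+1) \<le> C * tail (1 - 1 / (2 * real n + 2))" using C(2)[of "2*n+1"] by (simp add: add_ac)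
  then show ?thesis using C(1) moment_pos[of "2*n+1"] by (simp add: u_def field_simps)
 qed
 then show ?thesis using C(1) by (intro exI[of _ "1/C"]) auto
qed

lemma moment_doubling: "\<exists>C>0. \<forall>n. moment n \<le> C * moment (2 * n + 1)"
proof -
 obtain C where C: "0 < C" "\<And>n. moment n \<le> C * tail (1 - 1 / (real n + 1))" using moment_upper by blast
 obtain D where D: "0 < D" "\<And>n. u n * tail (1 - 1 / (real n + 1)) \<le> D" using u_upper by blast
 have "moment n \<le> C * D * moment (2 * n + 1)" for n
 proof -
  have "tail (1 - 1 / (real n + 1)) \<le> D * moment (2 * n + 1)"
   using D(2)[of n] moment_pos[of "2*n+1"] by (simp add: u_def field_simps)
  then have "C * tail (1 - 1 / (real n + 1)) \<le> C * (D * moment (2 * n + 1))"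
   using C(1) by (intro mult_left_mono) auto
  then show ?thesis using C(2)[of n] by (simp add: mult.assoc)
 qed
 then show ?thesis using C(1) D(1) by (intro exI[of _ "C * D"]) auto
qed

lemma u_growth: "\<exists>(C::real) (k::nat). 0 < C \<and> (\<forall>N n. N \<le> n \<longrightarrow> u n \<le> C * ((real n + 1) / (real N + 1)) ^ k * u N)"
proof -
 obtain C and k :: nat where C: "1 \<le> C" "1 \<le> k"
  "\<And>r s. 0 \<le> r \<Longrightarrow> r \<le> s \<Longrightarrow> s < 1 \<Longrightarrow> tail r \<le> C * ((1 - r) / (1 - s)) ^ k * tail s"
  using tail_growth by blast
 obtain D where D: "0 < D" "\<And>n. u n * tail (1 - 1 / (real n + 1)) \<le> D" using u_upper by blast
 obtain c where c: "0 < c" "\<And>n. c \<le> u n * tail (1 - 1 / (2 * real n + 2))" using u_lower by blast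
 have "u n \<le> (D * C / c) * ((real n + 1) / (real N + 1)) ^ k * u N" if "N \<le> n" for N n
 proof -
  define s where "s = 1 - 1 / (real n + 1)"
  define r where "r = 1 - 1 / (real N + 1)"
  define x where "x = ((real n + 1) / (real N + 1)) ^ k"
  have rs: "0 \<le> r" "r \<le> s" "s < 1" using that by (auto simp: r_def s_def field_simps)
  have ts: "0 < tail s" using rs by (intro wtail_pos) auto
  have x: "0 \<le> x" by (simp add: x_def)
  have "tail r \<le> C * ((1 - r) / (1 - s)) ^ k * tail s" using rs by (intro C)
  also have "(1 - r) / (1 - s) = (real n + 1) / (real N + 1)" by (simp add: r_def s_def)
  finally have 1: "tail r \<le> C * x * tail s" by (simp add: x_def)
  have "c \<le> u N * tail (1 - 1 / (2 * real N + 2))" by (rule c)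
  also have "\<dots> \<le> u N * tail r" by (intro mult_left_mono tail_antimono) (auto simp: r_def field_simps)
  also have "\<dots> \<le> u N * (C * x * tail s)" by (intro mult_left_mono 1) auto
  finally have 2: "c \<le> u N * (C * x) * tail s" by (simp add: mult_ac)
  have "u n * tail s \<le> D" unfolding s_def by (rule D)
  also have "D = D / c * c" using c(1) by simp
  also have "\<dots> \<le> D / c * (u N * (C * x) * tail s)" using 2 c(1) D(1) by (intro mult_left_mono) auto
  finally have "u n * tail s \<le> (D / c * (u N * (C * x))) * tail s" by (simp add: mult_ac)
  then have "u n \<le> D / c * (u N * (C * x))" using ts by (rule mult_right_le_imp_le)
  then show ?thesis by (simp add: x_def mult_ac)
 qed
 then show ?thesis using C(1) D(1) c(1) by (intro exI[of _ "D * C / c"] exI[of _ k]) auto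
qed

text \<open>Taking a difference in \<open>n\<close> multiplies the integrand by \<open>-(1 - t\<^sup>2)\<close>,
  which gains a factor \<open>1 / (n + 1)\<close>. The induction needs all powers \<open>j\<close>
  at once.\<close>

lemma symbol_moment_aux:
 "symbol k (\<lambda>n. moment (2*n+1) / (real n + 1) ^ j) (\<lambda>n. (LBINT t. w t * (t ^ (2*n+1) * (1 - t\<^sup>2) ^ j)))"
proof -
 define gm where "gm j n = (LBINT t. w t * (t ^ (2*n+1) * (1 - t\<^sup>2) ^ j))" for j n :: nat
 have int: "integrable lborel (\<lambda>t. w t * (t ^ (2*n+1) * (1 - t\<^sup>2) ^ j))" for j n :: nat
 proof (rule integrable_w_mult[where B=1])
  fix t :: real assume t: "t \<in> {0<..<1}"
  then have "t\<^sup>2 \<le> 1" "0 \<le> t\<^sup>2" by (auto simp: power2_eq_square mult_le_one)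
  then have "\<bar>(1 - t\<^sup>2) ^ j\<bar> \<le> 1" "\<bar>t ^ (2*n+1)\<bar> \<le> 1"
   unfolding power_abs by (auto intro!: power_le_one simp: abs_le_iff simp del: power_Suc) (use t in auto)
  then show "\<bar>t ^ (2*n+1) * (1 - t\<^sup>2) ^ j\<bar> \<le> 1" unfolding abs_mult by (intro mult_le_one) auto
 qed measurable
 obtain C where C: "0 < C" "\<And>n. moment n \<le> C * moment (2 * n + 1)" using moment_doubling by blast
 have bnd: "\<exists>D. \<forall>n. \<bar>gm j n\<bar> \<le> D * (moment (2*n+1) / (real n + 1) ^ j)" for j
 proof -
  have nn: "0 \<le> gm j n" for n unfolding gm_def
  proof (rule Bochner_Integration.integral_nonneg)
   fix t :: real show "0 \<le> w t * (t ^ (2*n+1) * (1 - t\<^sup>2) ^ j)"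
   proof (cases "t \<in> {0<..<1}")
    case True
    then have "t\<^sup>2 \<le> 1" by (auto simp: power2_eq_square mult_le_one)
    then show ?thesis using True by auto
   qed (simp add: w_supp)
  qed
  show ?thesis
  proof (cases "j = 0")
   case True
   then show ?thesis using nn by (intro exI[of _ 1]) (simp add: gm_def moment_def)
  next
   case False
   have "gm j n \<le> ((2 * real j) ^ j * C) * (moment (2*n+1) / (real n + 1) ^ j)" for n
   proof -
    have "gm j n \<le> (LBINT t. w t * ((2 * real j / (real n + 1)) ^ j * t ^ n))" unfolding gm_def
    proof (rule w_mult_mono[OF int])
     show "integrable lborel (\<lambda>t. w t * ((2 * real j / (real n + 1)) ^ j * t ^ n))"
      using integrable_mult_right[OF integrable_moment[of n], of "(2 * real j / (real n + 1)) ^ j"]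
      by (simp add: mult_ac)
     fix t :: real assume t: "t \<in> {0<..<1}"
     have "(1 - t\<^sup>2) ^ j = (1 - t) ^ j * (1 + t) ^ j"
      by (simp add: power_mult_distrib[symmetric] power2_eq_square algebra_simps)
     also have "\<dots> \<le> (1 - t) ^ j * 2 ^ j" using t by (intro mult_left_mono power_mono) auto
     finally have 1: "(1 - t\<^sup>2) ^ j \<le> (1 - t) ^ j * 2 ^ j" .
     \<comment> \<open>One factor \<open>t ^ n\<close> absorbs \<open>(1 - t) ^ j\<close>; the
      other one leaves \<open>moment n\<close>, which doubling compares with
      \<open>moment (2 * n + 1)\<close>.\<close>
     have "t ^ (2*n+1) \<le> t ^ (n + n)" using t by (intro power_decreasing) auto
     then have "t ^ (2*n+1) * (1 - t\<^sup>2) ^ j \<le> t ^ (n + n) * ((1 - t) ^ j * 2 ^ j)"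
      using 1 t by (intro mult_mono) (auto intro!: zero_le_power simp: power_le_one)
     also have "\<dots> = (2 ^ j * t ^ n) * (t ^ n * (1 - t) ^ j)" by (simp add: power_add mult_ac)
     also have "\<dots> \<le> (2 ^ j * t ^ n) * (real j / (real n + 1)) ^ j"
      using t False by (intro mult_left_mono power_one_minus_power_le) auto
     also have "\<dots> = (2 * (real j / (real n + 1))) ^ j * t ^ n" by (simp only: power_mult_distrib mult_ac)
     finally show "t ^ (2*n+1) * (1 - t\<^sup>2) ^ j \<le> (2 * real j / (real n + 1)) ^ j * t ^ n" by simp
    qed
    also have "\<dots> = (2 * real j / (real n + 1)) ^ j * moment n"
     unfolding moment_def by (subst integral_mult_right_zero[symmetric]) (simp only: mult.left_commute)
    also have "\<dots> \<le> (2 * real j / (real n + 1)) ^ j * (C * moment (2*n+1))"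
     by (intro mult_left_mono C) auto
    also have "\<dots> = ((2 * real j) ^ j * C) * (moment (2*n+1) / (real n + 1) ^ j)"
     by (simp only: power_divide times_divide_eq_left times_divide_eq_right mult_ac)
    finally show ?thesis .
   qed
   then show ?thesis using nn by (intro exI[of _ "(2 * real j) ^ j * C"]) auto
  qed
 qed
 have "symbol k (\<lambda>n. moment (2*n+1) / (real n + 1) ^ j) (gm j)"
 proof (induction k arbitrary: j)
  case 0 then show ?case using bnd[of j] by simp
 next
  case (Suc k)
  have "gm j (Suc n) - gm j n = - gm (Suc j) n" for n
  proof -
   have "gm j (Suc n) - gm j n = (LBINT t. w t * (t ^ (2*Suc n+1) * (1 - t\<^sup>2) ^ j) - w t * (t ^ (2*n+1) * (1 - t\<^sup>2) ^ j))"
    unfolding gm_def by (rule Bochner_Integration.integral_diff[symmetric, OF int int])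
   also have "\<dots> = (LBINT t. - (w t * (t ^ (2*n+1) * (1 - t\<^sup>2) ^ Suc j)))"
    by (intro Bochner_Integration.integral_cong) (auto simp: algebra_simps power2_eq_square)
   also have "\<dots> = - gm (Suc j) n" unfolding gm_def by (rule Bochner_Integration.integral_minus)
   finally show ?thesis .
  qed
  moreover have "(\<lambda>n. moment (2*n+1) / (real n + 1) ^ j / (real n + 1)) = (\<lambda>n. moment (2*n+1) / (real n + 1) ^ Suc j)"
   by (simp add: mult.commute)
  ultimately show ?case using bnd[of j] symbol_uminus[OF Suc.IH[of "Suc j"]] by simp
 qed
 then show ?thesis by (simp add: gm_def[abs_def])
qed

lemma symbol_u: "symbol k u u"
proof -
 obtain C where C: "0 < C" "\<And>n. moment n \<le> C * moment (2 * n + 1)" using moment_doubling by blast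
 have "symbol k (\<lambda>n. 1 / moment (2*n+1)) (\<lambda>n. 1 / moment (2*n+1))"
 proof (rule symbol_inverse)
  show "symbol k (\<lambda>n. moment (2*n+1)) (\<lambda>n. moment (2*n+1))" for k
   using symbol_moment_aux[of k 0] by (simp add: moment_def)
  show "decseq (\<lambda>n. moment (2*n+1))" by (auto simp: decseq_def intro: moment_antimono)
  show "moment (2*n+1) \<le> C * moment (2 * Suc n + 1)" for n
  proof -
   have "moment (2*n+1) \<le> C * moment (2 * (2*n+1) + 1)" by (rule C)
   then show ?thesis
   proof (cases "n = 0")
    case False
    then have "moment (2 * (2*n+1) + 1) \<le> moment (2 * Suc n + 1)" by (intro moment_antimono) auto
    then show ?thesis using C(1) \<open>moment (2*n+1) \<le> C * moment (2 * (2*n+1) + 1)\<close>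
     by (meson mult_left_mono less_imp_le order.trans)
   qed simp
  qed
 qed (auto simp: moment_pos)
 then show ?thesis by (simp add: u_def[abs_def])
qed

lemma summable_u:
 assumes "0 \<le> r" "r < 1" shows "summable (\<lambda>n. u n * r ^ n)"
proof -
 define y where "y = sqrt ((1 + r) / 2)"
 have y: "0 < y" "y < 1" "y\<^sup>2 = (1 + r) / 2" using assms by (auto simp: y_def)
 have q: "r / y\<^sup>2 < 1" "0 \<le> r / y\<^sup>2" using assms unfolding y(3) by (auto simp: field_simps)
 have ty: "0 < tail y" using y by (intro wtail_pos) auto
 show ?thesis
 proof (rule summable_comparison_test')
  show "summable (\<lambda>n. 1 / (y * tail y) * (r / y\<^sup>2) ^ n)"
   using q by (intro summable_mult summable_geometric) auto
  fix n
  have "0 < y ^ (2*n+1) * tail y" using y ty by simp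
  then have "u n \<le> 1 / (y ^ (2*n+1) * tail y)"
   unfolding u_def using y moment_pos[of "2*n+1"] by (intro divide_left_mono moment_lower) auto
  then have "u n * r ^ n \<le> 1 / (y ^ (2*n+1) * tail y) * r ^ n" using assms by (intro mult_right_mono) auto
  also have "\<dots> = 1 / (y * tail y) * (r / y\<^sup>2) ^ n"
   by (simp add: power_divide power_mult[symmetric] mult_ac)
  finally show "norm (u n * r ^ n) \<le> 1 / (y * tail y) * (r / y\<^sup>2) ^ n" using assms by simp
 qed
qed

definition U :: "complex \<Rightarrow> complex" where "U z = (\<Sum>n. of_real (u n) * z ^ n)"

lemma summable_U: "norm (z::complex) < 1 \<Longrightarrow> summable (\<lambda>n. of_real (u n) * z ^ n)"
 by (rule summable_real_powser[where C=1 and v=u]) (auto intro: summable_u)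

text \<open>The tail of the series from \<open>N\<close> on is small by \<open>symbol_powser_tail\<close>; the
  first \<open>N\<close> terms are at most \<open>u N\<close> each, since \<open>u\<close> is
  increasing.\<close>

lemma U_partial_bound:
 "\<exists>C>0. \<forall>N z. norm z < 1 \<longrightarrow> 1 \<le> (real N + 1) * norm (1 - z) \<longrightarrow> norm (U z) \<le> C * ((real N + 1) * u N)"
proof -
 obtain C and k :: nat where C: "0 < C" "\<And>N n. N \<le> n \<Longrightarrow> u n \<le> C * ((real n + 1) / (real N + 1)) ^ k * u N"
  using u_growth by blast
 \<comment> \<open>Since \<open>u\<close> grows at most like the power \<open>k\<close>, division
  by the power \<open>k + 2\<close> leaves inverse squares.\<close>
 have le: "u (n + N) / (real (n + N) + 1) ^ (k+2) \<le> C * u N / (real N + 1) ^ k * (1 / (real (n + N) + 1) ^ 2)" for n N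
 proof -
  have "u (n + N) / (real (n + N) + 1) ^ (k+2) \<le> C * ((real (n+N) + 1) / (real N + 1)) ^ k * u N / (real (n + N) + 1) ^ (k+2)"
   by (intro divide_right_mono C) auto
  also have "\<dots> = C * u N / (real N + 1) ^ k * (1 / (real (n + N) + 1) ^ 2)"
  proof -
   define a where "a = real (n+N) + 1"
   have "a \<noteq> 0" by (simp add: a_def)
   then show ?thesis unfolding a_def[symmetric] by (simp add: power_divide power_add power2_eq_square)
  qed
  finally show ?thesis .
 qed
 have sm: "summable (\<lambda>n. C * u N / (real N + 1) ^ k * (1 / (real (n + N) + 1) ^ 2))" for N
  by (intro summable_mult suminf_inverse_squares_le)
 have s: "summable (\<lambda>n. u (n + N) / (real (n + N) + 1) ^ (k+2))" for N
 proof (rule summable_comparison_test'[OF sm[of N]])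
  fix n
  have "0 \<le> u (n + N) / (real (n + N) + 1) ^ (k+2)" by (intro divide_nonneg_nonneg) auto
  then show "norm (u (n + N) / (real (n + N) + 1) ^ (k+2)) \<le> C * u N / (real N + 1) ^ k * (1 / (real (n + N) + 1) ^ 2)"
   using le[of n N] by (simp only: real_norm_def abs_of_nonneg)
 qed
 have tl: "(real N + 1) ^ (k+2) * (\<Sum>n. u (n + N) / (real (n + N) + 1) ^ (k+2)) \<le> (2 * C) * ((real N + 1) * u N)" for N
 proof -
  have "(\<Sum>n. u (n + N) / (real (n + N) + 1) ^ (k+2)) \<le> (\<Sum>n. C * u N / (real N + 1) ^ k * (1 / (real (n + N) + 1) ^ 2))"
   by (rule suminf_le[OF le s sm])
  also have "\<dots> = C * u N / (real N + 1) ^ k * (\<Sum>n. 1 / (real (n + N) + 1) ^ 2)"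
   by (rule suminf_mult[OF suminf_inverse_squares_le(1)])
  also have "\<dots> \<le> C * u N / (real N + 1) ^ k * (2 / (real N + 1))"
   using C(1) by (intro mult_left_mono suminf_inverse_squares_le divide_nonneg_nonneg) auto
  finally have "(real N + 1) ^ (k+2) * (\<Sum>n. u (n + N) / (real (n + N) + 1) ^ (k+2))
   \<le> (real N + 1) ^ (k+2) * (C * u N / (real N + 1) ^ k * (2 / (real N + 1)))" by (intro mult_left_mono) auto
  also have "\<dots> = (2 * C) * ((real N + 1) * u N)"
  proof -
   define a where "a = real N + 1"
   have "a \<noteq> 0" by (simp add: a_def)
   then show ?thesis unfolding a_def[symmetric] by (simp add: power_add power2_eq_square)
  qed
  finally show ?thesis .
 qed
 obtain D where D: "0 \<le> D" "\<And>N z. norm z < 1 \<Longrightarrow> 1 \<le> (real N + 1) * norm (1 - z) \<Longrightarrow>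
   norm (\<Sum>n. of_real (u (n + N)) * z ^ (n + N) :: complex) \<le> D * ((real N + 1) * u N)"
  using symbol_powser_tail[OF symbol_u[of "k+2"] u_nonneg summable_u s tl] by blast
 have "norm (U z) \<le> (D + 1) * ((real N + 1) * u N)" if z: "norm z < 1" "1 \<le> (real N + 1) * norm (1 - z)" for N z
 proof -
  have "U z = (\<Sum>n. of_real (u (n + N)) * z ^ (n + N)) + (\<Sum>n<N. of_real (u n) * z ^ n)"
   unfolding U_def by (rule suminf_split_initial_segment[OF summable_U[OF z(1)]])
  then have "norm (U z) \<le> norm (\<Sum>n. of_real (u (n + N)) * z ^ (n + N) :: complex) + norm (\<Sum>n<N. of_real (u n) * z ^ n)"
   by (simp add: norm_triangle_ineq)
  also have "norm (\<Sum>n<N. of_real (u n) * z ^ n) \<le> (\<Sum>n<N. u N)"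
  proof (rule sum_norm_le)
   fix n assume "n \<in> {..<N}"
   then have "norm (of_real (u n) * z ^ n) \<le> u N * 1"
    unfolding norm_mult norm_power using z u_mono[of n N] by (intro mult_mono power_le_one) auto
   then show "norm (of_real (u n) * z ^ n) \<le> u N" by simp
  qed
  also have "(\<Sum>n<N. u N) \<le> (real N + 1) * u N" by simp
  finally show ?thesis using D(2)[OF z] by (simp add: distrib_right)
 qed
 then show ?thesis using D(1) by (intro exI[of _ "D + 1"]) auto
qed

text \<open>The previous bound for \<open>N\<close> about \<open>1 / d\<close>, rewritten with
  \<open>u N \<approx> 1 / tail (1 - d)\<close>.\<close>

lemma U_bound:
 "\<exists>C>0. \<forall>z d. norm z < 1 \<longrightarrow> 0 < d \<longrightarrow> d \<le> 1 \<longrightarrow> d \<le> norm (1 - z) \<longrightarrow> norm (U z) \<le> C / (d * tail (1 - d))"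
proof -
 obtain C where C: "0 < C" "\<And>N z. norm z < 1 \<Longrightarrow> 1 \<le> (real N + 1) * norm (1 - z) \<Longrightarrow> norm (U z) \<le> C * ((real N + 1) * u N)"
  using U_partial_bound by blast
 obtain E and k :: nat where E: "1 \<le> E" "1 \<le> k"
  "\<And>r s. 0 \<le> r \<Longrightarrow> r \<le> s \<Longrightarrow> s < 1 \<Longrightarrow> tail r \<le> E * ((1 - r) / (1 - s)) ^ k * tail s"
  using tail_growth by blast
 obtain D where D: "0 < D" "\<And>n. u n * tail (1 - 1 / (real n + 1)) \<le> D" using u_upper by blast
 have "norm (U z) \<le> (C * 2 * D * E * 2 ^ k) / (d * tail (1 - d))"
  if z: "norm z < 1" "0 < d" "d \<le> 1" "d \<le> norm (1 - z)" for z d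
 proof -
  define N where "N = nat \<lfloor>1 / d\<rfloor>"
  have fl: "0 \<le> \<lfloor>1 / d\<rfloor>" using z by simp
  have N1: "1 / d < real N + 1" using fl by (simp add: N_def)
  have N2: "real N \<le> 1 / d" using fl by (simp add: N_def)
  have d1: "1 \<le> 1 / d" using z by simp
  have "1 \<le> (real N + 1) * d" using N1 z by (simp add: field_simps)
  also have "\<dots> \<le> (real N + 1) * norm (1 - z)" using z by (intro mult_left_mono) auto
  finally have "norm (U z) \<le> C * ((real N + 1) * u N)" using z by (intro C)
  also have "\<dots> \<le> C * (2 / d * u N)" using N2 d1 C(1) by (intro mult_left_mono mult_right_mono) auto
  finally have 1: "norm (U z) \<le> C * (2 / d) * u N" by (simp add: mult.assoc)
  define s where "s = 1 - 1 / (real N + 1)"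
  have Np: "0 < real N + 1" by simp
  have "tail (1 - d) \<le> E * 2 ^ k * tail s"
  proof (cases "1 - d \<le> s")
   case True
   have "tail (1 - d) \<le> E * ((1 - (1 - d)) / (1 - s)) ^ k * tail s"
    using z True by (intro E) (auto simp: s_def)
   also have "(1 - (1 - d)) / (1 - s) = d * (real N + 1)" by (simp add: s_def)
   also have "E * (d * (real N + 1)) ^ k * tail s \<le> E * 2 ^ k * tail s"
   proof -
    have "2 / d = 1 / d + 1 / d" by simp
    with N2 d1 have "real N + 1 \<le> 2 / d" by linarith
    then have "d * (real N + 1) \<le> d * (2 / d)" using z by (intro mult_left_mono) auto
    then have "d * (real N + 1) \<le> 2" using z by simp
    then show ?thesis using E(1) z by (intro mult_right_mono mult_left_mono power_mono) auto
   qed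
   finally show ?thesis .
  next
   case False
   have "1 - d \<le> s" using N1 z Np by (simp add: s_def field_simps)
   then show ?thesis using False by simp
  qed
  then have "u N * tail (1 - d) \<le> u N * (E * 2 ^ k * tail s)" by (intro mult_left_mono) auto
  also have "\<dots> = (u N * tail s) * (E * 2 ^ k)" by simp
  also have "\<dots> \<le> D * (E * 2 ^ k)" unfolding s_def using E(1) by (intro mult_right_mono D) auto
  finally have 2: "u N * tail (1 - d) \<le> D * E * 2 ^ k" by simp
  have t: "0 < tail (1 - d)" using z by (intro wtail_pos) auto
  have "norm (U z) * (d * tail (1 - d)) \<le> (C * (2 / d) * u N) * (d * tail (1 - d))"
   using z by (intro mult_right_mono 1) auto
  also have "\<dots> = C * 2 * (u N * tail (1 - d))" using z by simp
  also have "\<dots> \<le> C * 2 * (D * E * 2 ^ k)" using C(1) by (intro mult_left_mono 2) auto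
  finally show ?thesis using z t by (simp add: pos_le_divide_eq mult_ac)
 qed
 then show ?thesis using C(1) D(1) E(1) by (intro exI[of _ "C * 2 * D * E * 2 ^ k"]) auto
qed

end

section \<open>The averaged kernel\<close>

text \<open>In this form \<open>z * V z\<close> is a primitive of \<open>U\<close>, and multiplication by
  \<open>z\<close> links the operator with kernel \<open>V\<close> to the one with kernel
  \<open>U\<close>.\<close>

lemma powser_times_var_deriv:
 fixes a :: "nat \<Rightarrow> complex"
 assumes a: "\<And>x. norm x < 1 \<Longrightarrow> summable (\<lambda>n. a n * x ^ n)" and z: "norm z < 1"
 shows "((\<lambda>x. x * (\<Sum>n. a n * x ^ n)) has_field_derivative (\<Sum>n. of_nat (Suc n) * a n * z ^ n)) (at z)"
proof -
 define c :: "nat \<Rightarrow> complex" where "c n = (case n of 0 \<Rightarrow> 0 | Suc m \<Rightarrow> a m)" for n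
 have term_eq: "c (Suc n) * x ^ Suc n = x * (a n * x ^ n)" for x n by (simp add: c_def)
 have sum_c: "summable (\<lambda>n. c n * x ^ n)" and P_eq: "x * (\<Sum>n. a n * x ^ n) = (\<Sum>n. c n * x ^ n)" if x: "norm x < 1" for x
 proof -
  have 1: "summable (\<lambda>n. c (Suc n) * x ^ Suc n)" unfolding term_eq by (intro summable_mult a x)
  then show 2: "summable (\<lambda>n. c n * x ^ n)" by (subst (asm) summable_Suc_iff)
  have "(\<Sum>n. c n * x ^ n) = c 0 * x ^ 0 + (\<Sum>n. c (Suc n) * x ^ Suc n)"
   using suminf_split_head[OF 2] by simp
  also have "(\<Sum>n. c (Suc n) * x ^ Suc n) = x * (\<Sum>n. a n * x ^ n)"
   unfolding term_eq by (rule suminf_mult[OF a[OF x]])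
  finally show "x * (\<Sum>n. a n * x ^ n) = (\<Sum>n. c n * x ^ n)" by (simp add: c_def)
 qed
 obtain K :: real where K: "norm z < K" "K < 1" using dense z by blast
 have K0: "0 \<le> K" using K norm_ge_zero[of z] by linarith
 have "((\<lambda>x. \<Sum>n. c n * x ^ n) has_field_derivative (\<Sum>n. diffs c n * z ^ n)) (at z)"
 proof (rule termdiffs_strong[where K="of_real K"])
  show "summable (\<lambda>n. c n * of_real K ^ n)" using K K0 by (intro sum_c) auto
  show "norm z < norm (of_real K :: complex)" using K K0 by simp
 qed
 also have "(\<Sum>n. diffs c n * z ^ n) = (\<Sum>n. of_nat (Suc n) * a n * z ^ n)" by (simp add: diffs_def c_def)
 finally have "((\<lambda>x. \<Sum>n. c n * x ^ n) has_field_derivative (\<Sum>n. of_nat (Suc n) * a n * z ^ n)) (at z)" .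
 then show ?thesis
 proof (rule DERIV_cong_ev[THEN iffD1, rotated 3])
  have "eventually (\<lambda>x. x \<in> ball 0 1) (nhds z)" using z by (intro eventually_nhds_in_open) auto
  then show "\<forall>\<^sub>F x in nhds z. (\<Sum>n. c n * x ^ n) = x * (\<Sum>n. a n * x ^ n)"
   by eventually_elim (simp add: P_eq)
 qed auto
qed

context dweight
begin

definition V :: "complex \<Rightarrow> complex" where "V z = (\<Sum>n. of_real (u n / (real n + 1)) * z ^ n)"

lemma summable_V: "norm (z::complex) < 1 \<Longrightarrow> summable (\<lambda>n. of_real (u n / (real n + 1)) * z ^ n)"
proof (rule summable_real_powser[where C=1 and v=u])
 show "\<bar>u n / (real n + 1)\<bar> \<le> 1 * u n" for n
  using u_nonneg[of n] by (simp add: divide_le_eq mult_left_le_one_le mult_right_mono algebra_simps)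
qed (auto intro: summable_u)

definition P :: "complex \<Rightarrow> complex" where "P z = z * V z"

lemma V_0 [simp]: "V 0 = of_real (u 0)"
 unfolding V_def using powser_zero[of "\<lambda>n. of_real (u n / (real n + 1)) :: complex"] by simp

lemma U_0 [simp]: "U 0 = of_real (u 0)"
 unfolding U_def using powser_zero[of "\<lambda>n. of_real (u n) :: complex"] by simp

lemma P_deriv:
 assumes z: "norm z < 1" shows "(P has_field_derivative U z) (at z)"
proof -
 have eq: "of_nat (Suc n) * of_real (u n / (real n + 1)) = (of_real (u n) :: complex)" for n
 proof -
  have "(of_nat (Suc n) :: complex) \<noteq> 0" by (simp del: of_nat_Suc)
  moreover have "of_real (real n + 1) = (of_nat (Suc n) :: complex)" by simp
  ultimately show ?thesis by (simp del: of_nat_Suc)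
 qed
 show ?thesis using powser_times_var_deriv[OF summable_V z] by (simp only: eq U_def P_def[abs_def] V_def)
qed

lemma U_continuous: "continuous_on (ball 0 1) U"
proof -
 have "P holomorphic_on ball 0 1" unfolding holomorphic_on_open[OF open_ball] using P_deriv by (metis mem_ball_0)
 then have "deriv P holomorphic_on ball 0 1" by (rule holomorphic_deriv) simp
 then have "continuous_on (ball 0 1) (deriv P)" by (rule holomorphic_on_imp_continuous_on)
 also have "?this \<longleftrightarrow> continuous_on (ball 0 1) U"
  by (intro continuous_on_cong refl DERIV_imp_deriv P_deriv) auto
 finally show ?thesis .
qed

lemma V_eq_integral:
 assumes z: "norm z < 1"
 shows "((\<lambda>s. U (of_real s * z)) has_integral V z) {0..1}"
proof (cases "z = 0")
 case True
 then show ?thesis using has_integral_const_real[of "of_real (u 0) :: complex" 0 1] by simp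
next
 case False
 have "((\<lambda>s. z * U (of_real s * z)) has_integral (P (of_real 1 * z) - P (of_real 0 * z))) {0..1}"
 proof (rule fundamental_theorem_of_calculus)
  fix s :: real assume s: "s \<in> {0..1}"
  have "norm (of_real s * z) \<le> 1 * norm z" unfolding norm_mult using s by (intro mult_right_mono) auto
  then have n: "norm (of_real s * z) < 1" using z by simp
  have "((\<lambda>s. P (s * z)) has_field_derivative (U (of_real s * z) * z)) (at (of_real s))"
   by (rule DERIV_chain2[where f=P and g="\<lambda>s. s * z" and x="of_real s"])
    (rule P_deriv[OF n], auto intro!: derivative_eq_intros)
  then have "((\<lambda>s. P (of_real s * z)) has_vector_derivative (U (of_real s * z) * z)) (at s within {0..1})"
   by (rule has_vector_derivative_real_field)
  then show "((\<lambda>s. P (of_real s * z)) has_vector_derivative (z * U (of_real s * z))) (at s within {0..1})"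
   by (simp add: mult.commute)
 qed simp
 then have "((\<lambda>s. z * U (of_real s * z)) has_integral z * V z) {0..1}" by (simp add: P_def)
 then have "((\<lambda>s. (1/z) * (z * U (of_real s * z))) has_integral (1/z) * (z * V z)) {0..1}"
  by (rule has_integral_mult_right)
 then show ?thesis using False by simp
qed

lemma V_norm_le:
 assumes z: "norm z < 1"
 shows "ennreal (norm (V z)) \<le> (NINT s:{0..1}. ennreal (norm (U (of_real s * z))))"
proof -
 have c: "continuous_on {0..1} (\<lambda>s. U (of_real s * z))"
 proof (rule continuous_on_compose2[OF U_continuous])
  show "(\<lambda>s. of_real s * z) ` {0..1} \<subseteq> ball 0 1"
  proof safe
   fix s :: real assume s: "s \<in> {0..1}"
   have "norm (of_real s * z) \<le> 1 * norm z" unfolding norm_mult using s by (intro mult_right_mono) auto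
   then show "of_real s * z \<in> ball 0 1" using z by simp
  qed
 qed (intro continuous_intros)
 then have i: "(\<lambda>s. norm (U (of_real s * z))) integrable_on {0..1}"
  by (intro integrable_continuous_real continuous_intros)
 have "norm (V z) \<le> integral {0..1} (\<lambda>s. norm (U (of_real s * z)))"
  using integral_norm_bound_integral[of "\<lambda>s. U (of_real s * z)" "{0..1}", OF _ i] V_eq_integral[OF z]
  by (auto simp: has_integral_iff)
 then have "ennreal (norm (V z)) \<le> ennreal (integral {0..1} (\<lambda>s. norm (U (of_real s * z))))" by (rule ennreal_leI)
 also have "\<dots> = (NINT s:{0..1}. ennreal (norm (U (of_real s * z))))"
  by (rule nn_integral_has_integral_indicator[symmetric]) (use i in auto)
 finally show ?thesis .
qed

definition phi :: "real \<Rightarrow> real" where "phi s = 1 / ((1 - s) * tail s)"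

text \<open>The common majorant of the averaged kernel, its derivative and its coefficients. The summand 1 takes
  care of \<open>y\<close> near 0, where the integral vanishes.\<close>

definition Phi :: "real \<Rightarrow> ennreal" where "Phi y = 1 + (NINT s:{0..y}. ennreal (phi s))"

lemma measurable_phi [measurable]: "phi \<in> borel_measurable borel" unfolding phi_def by measurable

lemma phi_mono: "0 \<le> r \<Longrightarrow> r \<le> s \<Longrightarrow> s < 1 \<Longrightarrow> phi r \<le> phi s"
 unfolding phi_def by (intro divide_left_mono mult_mono tail_antimono mult_pos_pos wtail_pos) auto

lemma phi_nonneg: "s \<le> 1 \<Longrightarrow> 0 \<le> phi s" unfolding phi_def by simp

lemma Phi_mono: "r \<le> s \<Longrightarrow> Phi r \<le> Phi s"
 unfolding Phi_def by (intro add_left_mono nn_integral_mono) (auto split: split_indicator)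

text \<open>The integral over \<open>[2 * y - 1, y]\<close> alone is of order \<open>1 / tail y\<close>, by
  doubling.\<close>

lemma inverse_tail_le_Phi: "\<exists>C>0. \<forall>y. 0 \<le> y \<longrightarrow> y < 1 \<longrightarrow> ennreal (1 / tail y) \<le> ennreal C * Phi y"
proof -
 obtain D where D: "1 \<le> D" "\<And>r. r \<in> {0..<1} \<Longrightarrow> tail r \<le> D * tail ((1 + r) / 2)"
  using wtail_doubling by auto
 define C where "C = max (1 / tail (1/2)) (2 * D)"
 have C0: "0 < C" using D(1) by (simp add: C_def less_max_iff_disj)
 have "ennreal (1 / tail y) \<le> ennreal C * Phi y" if y: "0 \<le> y" "y < 1" for y
 proof (cases "y \<le> 1/2")
  case True
  have t: "0 < tail y" "0 < tail (1/2)" using y by (auto intro!: wtail_pos)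
  have "1 / tail y \<le> 1 / tail (1/2)" using t True by (intro divide_left_mono tail_antimono) auto
  also have "\<dots> \<le> C" by (simp add: C_def)
  finally have "ennreal (1 / tail y) \<le> ennreal C * 1" by (simp add: ennreal_leI)
  also have "\<dots> \<le> ennreal C * Phi y" by (intro mult_left_mono) (auto simp: Phi_def)
  finally show ?thesis .
 next
  case False
  define x where "x = 2 * y - 1"
  have x: "0 \<le> x" "x < y" "y - x = 1 - y" "(1 + x) / 2 = y" "1 - x = 2 * (1 - y)" using False y by (auto simp: x_def)
  have t: "0 < tail y" "0 < tail x" using x y by (auto intro!: wtail_pos)
  have "tail x \<le> D * tail y" using D(2)[of x] x y by auto
  then have 1: "1 / tail y \<le> D * (1 / tail x)" using t by (simp add: field_simps)
  have "2 * phi x * (y - x) = 2 * (1 / (2 * (1 - y) * tail x)) * (1 - y)" unfolding phi_def x(3) x(5) ..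
  also have "\<dots> = 1 / tail x" using y t by simp
  finally have "ennreal (1 / tail x) = ennreal (2 * phi x * (y - x))" by simp
  also have "\<dots> = 2 * (ennreal (phi x) * ennreal (y - x))"
   using phi_nonneg[of x] x y by (simp add: ennreal_mult mult.assoc)
  also have "ennreal (phi x) * ennreal (y - x) = (NINT s:{x..y}. ennreal (phi x))"
   using x by (subst nn_integral_cmult_indicator) auto
  also have "\<dots> \<le> (NINT s:{0..y}. ennreal (phi s))"
   using x y by (intro nn_integral_mono) (auto intro!: ennreal_leI phi_mono split: split_indicator)
  also have "\<dots> \<le> Phi y" by (simp add: Phi_def)
  finally have 2: "ennreal (1 / tail x) \<le> 2 * Phi y" by (simp add: mult_left_mono)
  have "ennreal (1 / tail y) \<le> ennreal (D * (1 / tail x))" by (rule ennreal_leI[OF 1])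
  also have "\<dots> = ennreal D * ennreal (1 / tail x)" using D(1) by (intro ennreal_mult) auto
  also have "\<dots> \<le> ennreal D * (2 * Phi y)" by (intro mult_left_mono 2) auto
  also have "\<dots> = ennreal (2 * D) * Phi y" using D(1) by (simp add: ennreal_mult mult_ac)
  also have "\<dots> \<le> ennreal C * Phi y" by (intro mult_right_mono ennreal_leI) (auto simp: C_def)
  finally show ?thesis .
 qed
 then show ?thesis using C0 by auto
qed

lemma U_circle_bound:
 "\<exists>C>0. \<forall>x \<theta> m. 0 \<le> x \<longrightarrow> x < 1 \<longrightarrow> \<theta> \<in> {0..2*pi} \<longrightarrow> 0 \<le> m \<longrightarrow> m < 1 \<longrightarrow> 1 - m \<le> max (1 - x) (circle_dist \<theta>)
   \<longrightarrow> norm (U (of_real x * cis \<theta>)) \<le> C * phi m"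
proof -
 obtain C where C: "0 < C" "\<And>z d. norm z < 1 \<Longrightarrow> 0 < d \<Longrightarrow> d \<le> 1 \<Longrightarrow> d \<le> norm (1 - z) \<Longrightarrow> norm (U z) \<le> C / (d * tail (1 - d))"
  using U_bound by blast
 have "norm (U (of_real x * cis \<theta>)) \<le> C * phi m"
  if h: "0 \<le> x" "x < 1" "\<theta> \<in> {0..2*pi}" "0 \<le> m" "m < 1" "1 - m \<le> max (1 - x) (circle_dist \<theta>)" for x \<theta> m
 proof -
  have "norm (U (of_real x * cis \<theta>)) \<le> C / ((1 - m) * tail (1 - (1 - m)))"
  proof (rule C(2))
   show "norm (of_real x * cis \<theta>) < 1" using h by (simp add: norm_mult)
   have "max (1 - x) (circle_dist \<theta>) \<le> norm (1 - of_real x * cis \<theta>)" using h by (intro circle_dist_le_norm) auto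
   then show "1 - m \<le> norm (1 - of_real x * cis \<theta>)" using h(6) by (rule order.trans[rotated])
  qed (use h in auto)
  then show ?thesis by (simp add: phi_def)
 qed
 then show ?thesis using C(1) by blast
qed

text \<open>The point of the radius that sees the singularity at 1 from the same distance as
  \<open>of_real r * cis \<theta>\<close>.\<close>

definition gap :: "real \<Rightarrow> real \<Rightarrow> real" where "gap r \<theta> = min r (1 - circle_dist \<theta>)"

lemma gap_bounds: "0 \<le> r \<Longrightarrow> r < 1 \<Longrightarrow> 0 \<le> gap r \<theta> \<and> gap r \<theta> < 1"
 using circle_dist_le_half[of \<theta>] by (auto simp: gap_def)

lemma one_minus_gap: "1 - gap r \<theta> = max (1 - r) (circle_dist \<theta>)" by (auto simp: gap_def)

lemma U_Phi_bound:
 "\<exists>C>0. \<forall>t r \<theta>. 0 \<le> t \<longrightarrow> t < 1 \<longrightarrow> 0 \<le> r \<longrightarrow> r < 1 \<longrightarrow> \<theta> \<in> {0..2*pi} \<longrightarrow>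
  ennreal (norm (U (of_real t * (of_real r * cis \<theta>))) * (1 - gap r \<theta>)) \<le> ennreal C * Phi (min t (gap r \<theta>))"
proof -
 obtain C where C: "0 < C" "\<And>x \<theta> m. 0 \<le> x \<Longrightarrow> x < 1 \<Longrightarrow> \<theta> \<in> {0..2*pi} \<Longrightarrow> 0 \<le> m \<Longrightarrow> m < 1 \<Longrightarrow>
   1 - m \<le> max (1 - x) (circle_dist \<theta>) \<Longrightarrow> norm (U (of_real x * cis \<theta>)) \<le> C * phi m"
  using U_circle_bound by blast
 obtain D where D: "0 < D" "\<And>y. 0 \<le> y \<Longrightarrow> y < 1 \<Longrightarrow> ennreal (1 / tail y) \<le> ennreal D * Phi y"
  using inverse_tail_le_Phi by blast
 have "ennreal (norm (U (of_real t * (of_real r * cis \<theta>))) * (1 - gap r \<theta>)) \<le> ennreal (C * D) * Phi (min t (gap r \<theta>))"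
  if h: "0 \<le> t" "t < 1" "0 \<le> r" "r < 1" "\<theta> \<in> {0..2*pi}" for t r \<theta>
 proof -
  define y where "y = gap r \<theta>"
  define m where "m = min t y"
  have y: "0 \<le> y" "y < 1" using gap_bounds[of r \<theta>] h by (auto simp: y_def)
  have m: "0 \<le> m" "m < 1" "m \<le> y" using h y by (auto simp: m_def)
  have tr1: "t * r \<le> t" "t * r \<le> r" "0 \<le> t * r" using h by (auto simp: mult_left_le mult_left_le_one_le)
  then have tr: "t * r \<le> t" "t * r \<le> r" "0 \<le> t * r" "t * r < 1" using h by linarith+
  have tm: "0 < tail m" using m by (intro wtail_pos)
  have om: "1 - m = max (1 - t) (1 - y)" by (auto simp: m_def)
  have y': "1 - y = max (1 - r) (circle_dist \<theta>)" unfolding y_def by (rule one_minus_gap)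
  have "norm (U (of_real (t * r) * cis \<theta>)) \<le> C * phi m"
   using h m tr unfolding om y' by (intro C) (auto simp: om y')
  then have "norm (U (of_real t * (of_real r * cis \<theta>))) * (1 - y) \<le> C * phi m * (1 - y)"
   using y by (intro mult_right_mono) (auto simp: mult.assoc)
  also have "\<dots> = C * (phi m * (1 - y))" by simp
  also have "\<dots> \<le> C * (1 / tail m)"
  proof -
   have "phi m * (1 - y) \<le> phi m * (1 - m)" using m phi_nonneg[of m] by (intro mult_left_mono) auto
   also have "\<dots> = 1 / tail m" using m tm by (simp add: phi_def)
   finally show ?thesis using C(1) by (intro mult_left_mono) auto
  qed
  finally have "ennreal (norm (U (of_real t * (of_real r * cis \<theta>))) * (1 - y)) \<le> ennreal (C * (1 / tail m))" by (rule ennreal_leI)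
  also have "\<dots> = ennreal C * ennreal (1 / tail m)" using C(1) by (intro ennreal_mult) auto
  also have "\<dots> \<le> ennreal C * (ennreal D * Phi m)" using m by (intro mult_left_mono D) auto
  also have "\<dots> = ennreal (C * D) * Phi m" using C(1) D(1) by (simp add: ennreal_mult mult.assoc)
  finally show ?thesis by (simp add: y_def m_def)
 qed
 then show ?thesis using C(1) D(1) by (intro exI[of _ "C * D"]) auto
qed

text \<open>\<open>V\<close> is the average of \<open>U\<close> over the segment from 0 to the point. On the
  segment \<open>\<bar>U\<bar>\<close> is at most \<open>phi (min s m)\<close>, so the part with
  \<open>s \<le> m\<close> gives \<open>Phi m\<close> and the rest gives
  \<open>phi m * (1 - m) = 1 / tail m\<close>, which \<open>Phi\<close> absorbs.\<close>

lemma V_Phi_bound: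
 "\<exists>C>0. \<forall>t r \<theta>. 0 \<le> t \<longrightarrow> t < 1 \<longrightarrow> 0 \<le> r \<longrightarrow> r < 1 \<longrightarrow> \<theta> \<in> {0..2*pi} \<longrightarrow>
  ennreal (norm (V (of_real t * (of_real r * cis \<theta>)))) \<le> ennreal C * Phi (min t (gap r \<theta>))"
proof -
 obtain C where C: "0 < C" "\<And>x \<theta> m. 0 \<le> x \<Longrightarrow> x < 1 \<Longrightarrow> \<theta> \<in> {0..2*pi} \<Longrightarrow> 0 \<le> m \<Longrightarrow> m < 1 \<Longrightarrow>
   1 - m \<le> max (1 - x) (circle_dist \<theta>) \<Longrightarrow> norm (U (of_real x * cis \<theta>)) \<le> C * phi m"
  using U_circle_bound by blast
 obtain D where D: "0 < D" "\<And>y. 0 \<le> y \<Longrightarrow> y < 1 \<Longrightarrow> ennreal (1 / tail y) \<le> ennreal D * Phi y"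
  using inverse_tail_le_Phi by blast
 have "ennreal (norm (V (of_real t * (of_real r * cis \<theta>)))) \<le> ennreal (C * (1 + D)) * Phi (min t (gap r \<theta>))"
  if h: "0 \<le> t" "t < 1" "0 \<le> r" "r < 1" "\<theta> \<in> {0..2*pi}" for t r \<theta>
 proof -
  define y where "y = gap r \<theta>"
  define m where "m = min t y"
  define z where "z = of_real t * (of_real r * cis \<theta>)"
  have y: "0 \<le> y" "y < 1" using gap_bounds[of r \<theta>] h by (auto simp: y_def)
  have m: "0 \<le> m" "m < 1" using h y by (auto simp: m_def)
  have y': "1 - y = max (1 - r) (circle_dist \<theta>)" unfolding y_def by (rule one_minus_gap)
  have tr1: "t * r \<le> t" "t * r \<le> r" "0 \<le> t * r" using h by (auto simp: mult_left_le mult_left_le_one_le)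
  then have tr: "t * r \<le> t" "t * r \<le> r" "0 \<le> t * r" "t * r < 1" using h by linarith+
  have pt: "norm (U (of_real s * z)) \<le> C * phi (min s m)" if s: "s \<in> {0..1}" for s
  proof -
   have x: "s * (t * r) \<le> s" "s * (t * r) \<le> t * r" "0 \<le> s * (t * r)"
    using s tr by (auto intro: mult_left_le mult_left_le_one_le)
   have om: "1 - min s m = max (1 - s) (max (1 - t) (max (1 - r) (circle_dist \<theta>)))"
    unfolding y'[symmetric] by (auto simp: m_def)
   have "norm (U (of_real (s * (t * r)) * cis \<theta>)) \<le> C * phi (min s m)"
    using h s m tr x by (intro C) (auto simp: om)
   then show ?thesis by (simp add: z_def mult.assoc)
  qed
  have ph: "ennreal (phi (min s m)) * indicator {0..1} s \<le> ennreal (phi s) * indicator {0..m} s + ennreal (phi m) * indicator {m..1} s" for s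
   using m by (cases "s \<le> m") (auto simp: min_def split: split_indicator)
  have "ennreal (norm (V z)) \<le> (NINT s:{0..1}. ennreal (norm (U (of_real s * z))))"
   using h tr by (intro V_norm_le) (simp add: z_def norm_mult)
  also have "\<dots> \<le> (NINT s. ennreal C * (ennreal (phi s) * indicator {0..m} s + ennreal (phi m) * indicator {m..1} s))"
  proof (rule nn_integral_mono)
   fix s :: real
   have "ennreal (norm (U (of_real s * z))) * indicator {0..1} s \<le> ennreal C * (ennreal (phi (min s m)) * indicator {0..1} s)"
    using pt[of s] C(1) by (auto simp: ennreal_mult'[symmetric] intro!: ennreal_leI split: split_indicator)
   also have "\<dots> \<le> ennreal C * (ennreal (phi s) * indicator {0..m} s + ennreal (phi m) * indicator {m..1} s)"
    by (intro mult_left_mono ph) auto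
   finally show "ennreal (norm (U (of_real s * z))) * indicator {0..1} s \<le>
    ennreal C * (ennreal (phi s) * indicator {0..m} s + ennreal (phi m) * indicator {m..1} s)" .
  qed
  also have "\<dots> = ennreal C * ((NINT s:{0..m}. ennreal (phi s)) + (NINT s:{m..1}. ennreal (phi m)))"
   by (subst nn_integral_cmult, simp, subst nn_integral_add, simp_all)
  also have "(NINT s:{m..1}. ennreal (phi m)) = ennreal (phi m) * ennreal (1 - m)"
   using m by (subst nn_integral_cmult_indicator) auto
  also have "\<dots> = ennreal (1 / tail m)"
   using m phi_nonneg[of m] by (simp add: ennreal_mult'[symmetric] phi_def)
  finally have "ennreal (norm (V z)) \<le> ennreal C * ((NINT s:{0..m}. ennreal (phi s)) + ennreal (1 / tail m))" .
  also have "\<dots> \<le> ennreal C * (Phi m + ennreal D * Phi m)"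
   using m D(2)[of m] by (intro mult_left_mono add_mono) (auto simp: Phi_def)
  also have "\<dots> = ennreal C * ((1 + ennreal D) * Phi m)" by (simp add: distrib_right)
  also have "\<dots> = ennreal (C * (1 + D)) * Phi m" using C(1) D(1) by (simp add: ennreal_mult ennreal_plus mult.assoc)
  finally show ?thesis by (simp add: y_def m_def z_def)
 qed
 then show ?thesis using C(1) D(1) by (intro exI[of _ "C * (1 + D)"]) auto
qed

text \<open>For \<open>t\<close> below \<open>1 - 1 / (n + 1)\<close> the factor \<open>t ^ n\<close>
  compensates the growth of \<open>u n\<close> relative to \<open>1 / tail t\<close>.\<close>

lemma coeff_Phi_bound:
 "\<exists>C>0. \<forall>t n. 0 \<le> t \<longrightarrow> t < 1 \<longrightarrow> ennreal (t ^ n * u n) \<le> ennreal C * Phi (min t (1 - 1 / (real n + 1)))"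
proof -
 obtain C and k :: nat where C: "1 \<le> C" "1 \<le> k"
  "\<And>r s. 0 \<le> r \<Longrightarrow> r \<le> s \<Longrightarrow> s < 1 \<Longrightarrow> tail r \<le> C * ((1 - r) / (1 - s)) ^ k * tail s"
  using tail_growth by blast
 obtain E where E: "0 < E" "\<And>n. u n * tail (1 - 1 / (real n + 1)) \<le> E" using u_upper by blast
 obtain D where D: "0 < D" "\<And>y. 0 \<le> y \<Longrightarrow> y < 1 \<Longrightarrow> ennreal (1 / tail y) \<le> ennreal D * Phi y"
  using inverse_tail_le_Phi by blast
 define B where "B = E * C * real k ^ k"
 have B: "0 < B" using E(1) C by (simp add: B_def)
 have k1: "1 \<le> real k ^ k" using C(2) by (intro one_le_power) simp
 have "ennreal (t ^ n * u n) \<le> ennreal (B * D) * Phi (min t (1 - 1 / (real n + 1)))" if t: "0 \<le> t" "t < 1" for t n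
 proof -
  define y where "y = 1 - 1 / (real n + 1)"
  define m where "m = min t y"
  have y: "0 \<le> y" "y < 1" "1 - y = 1 / (real n + 1)" by (auto simp: y_def divide_le_eq)
  have m: "0 \<le> m" "m < 1" using t y by (auto simp: m_def)
  have ty: "0 < tail y" "0 < tail m" using y m by (auto intro: wtail_pos)
  have uy: "u n \<le> E / tail y" using E(2)[of n] ty by (simp add: y_def pos_le_divide_eq)
  have "t ^ n * u n \<le> B / tail m"
  proof (cases "t \<le> y")
   case False
   have "t ^ n * u n \<le> 1 * (E / tail y)" using t uy by (intro mult_mono power_le_one) auto
   also have "\<dots> \<le> B / tail y"
   proof -
    have "E * 1 \<le> E * (C * real k ^ k)" using E(1) C(1) k1 by (intro mult_left_mono mult_ge1_I) auto
    then show ?thesis using ty by (simp add: B_def mult.assoc divide_right_mono)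
   qed
   finally show ?thesis using False by (simp add: m_def)
  next
   case True
   have "tail t \<le> C * ((1 - t) / (1 - y)) ^ k * tail y" using t True y by (intro C)
   also have "(1 - t) / (1 - y) = (real n + 1) * (1 - t)" unfolding y(3) by simp
   finally have 1: "tail t \<le> C * ((real n + 1) * (1 - t)) ^ k * tail y" .
   have "t ^ n * tail t \<le> t ^ n * (C * ((real n + 1) * (1 - t)) ^ k * tail y)"
    using t by (intro mult_left_mono 1) auto
   also have "\<dots> = C * tail y * (real n + 1) ^ k * (t ^ n * (1 - t) ^ k)" by (simp only: power_mult_distrib mult_ac)
   also have "\<dots> \<le> C * tail y * (real n + 1) ^ k * (real k / (real n + 1)) ^ k"
    using t C ty by (intro mult_left_mono power_one_minus_power_le) auto
   also have "\<dots> = C * tail y * ((real n + 1) * (real k / (real n + 1))) ^ k" by (simp only: power_mult_distrib mult_ac)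
   also have "(real n + 1) * (real k / (real n + 1)) = real k" by (simp add: add_nonneg_eq_0_iff)
   finally have 2: "t ^ n * tail t \<le> C * tail y * real k ^ k" .
   have "u n * (t ^ n * tail t) \<le> u n * (C * tail y * real k ^ k)" by (intro mult_left_mono 2) auto
   also have "\<dots> = (u n * tail y) * (C * real k ^ k)" by simp
   also have "\<dots> \<le> E * (C * real k ^ k)" unfolding y_def using C(1) by (intro mult_right_mono E) auto
   finally have "(t ^ n * u n) * tail t \<le> B" by (simp add: B_def mult_ac)
   then show ?thesis using True ty by (simp add: m_def pos_le_divide_eq)
  qed
  then have "ennreal (t ^ n * u n) \<le> ennreal (B * (1 / tail m))" by (intro ennreal_leI) simp
  also have "\<dots> = ennreal B * ennreal (1 / tail m)" using B by (intro ennreal_mult) auto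
  also have "\<dots> \<le> ennreal B * (ennreal D * Phi m)" using m by (intro mult_left_mono D) auto
  also have "\<dots> = ennreal (B * D) * Phi m" using B D(1) by (simp add: ennreal_mult mult.assoc)
  finally show ?thesis by (simp add: m_def y_def)
 qed
 then show ?thesis using B D(1) by (intro exI[of _ "B * D"]) auto
qed

end

section \<open>The dominating operator and the Muckenhoupt condition\<close>

context dweight
begin

text \<open>The positive operator on the interval to which all three estimates reduce.\<close>

definition T :: "(real \<Rightarrow> ennreal) \<Rightarrow> real \<Rightarrow> ennreal" where
 "T f y = (NINT t. f t * ennreal (w t) * Phi (min t y))"

lemma T_mono: "x \<le> y \<Longrightarrow> T f x \<le> T f y"
 unfolding T_def by (intro nn_integral_mono mult_left_mono Phi_mono) auto

definition muck_A :: "real \<Rightarrow> real \<Rightarrow> ennreal" where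
 "muck_A p s = 1 + (NINT t:{0..s}. ennreal (1 / tail t powr p))"

definition muck_W :: "real \<Rightarrow> real \<Rightarrow> ennreal" where
 "muck_W q s = (NINT t:{s..}. ennreal (w t powr q))"

text \<open>The condition of the theorem with an explicit constant, in a form that makes sense before any
  integral is known to be finite.\<close>

definition muck :: "real \<Rightarrow> real \<Rightarrow> real \<Rightarrow> bool" where
 "muck p q K \<longleftrightarrow> (\<forall>s\<in>{0<..<1}. epow (muck_A p s) (1/p) * epow (muck_W q s) (1/q) \<le> ennreal K)"

lemma muck_A_finite:
 assumes "0 \<le> s" "s < 1" "0 < p" shows "muck_A p s < top"
proof -
 have ts: "0 < tail s" using assms by (intro wtail_pos)
 have "(NINT t:{0..s}. ennreal (1 / tail t powr p)) \<le> (NINT t:{0..s}. ennreal (1 / tail s powr p))"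
 proof (intro nn_integral_mono)
  fix t :: real
  show "ennreal (1 / tail t powr p) * indicator {0..s} t \<le> ennreal (1 / tail s powr p) * indicator {0..s} t"
  proof (cases "t \<in> {0..s}")
   case True
   then have "tail s powr p \<le> tail t powr p" using assms by (intro powr_mono2 tail_antimono) auto
   moreover have "0 < tail s powr p" using ts by simp
   ultimately have "1 / tail t powr p \<le> 1 / tail s powr p"
    by (intro divide_left_mono mult_pos_pos) (auto simp del: powr_gt_zero)
   then show ?thesis using True by (simp add: ennreal_leI)
  qed simp
 qed
 also have "\<dots> = ennreal (1 / tail s powr p) * ennreal s"
  using assms by (subst nn_integral_cmult_indicator) auto
 also have "\<dots> < top" by (simp add: ennreal_mult_less_top)
 finally show ?thesis by (simp add: muck_A_def)
qed

lemma muck_A_ge_1: "1 \<le> muck_A p s" by (simp add: muck_A_def)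

lemma muck_A_mono: "s \<le> t \<Longrightarrow> muck_A p s \<le> muck_A p t"
 unfolding muck_A_def by (intro add_left_mono nn_integral_mono) (auto split: split_indicator)

lemma muck_W_antimono: "s \<le> t \<Longrightarrow> muck_W q t \<le> muck_W q s"
 unfolding muck_W_def by (intro nn_integral_mono) (auto split: split_indicator)

lemma muck_W_pos:
 assumes "0 \<le> s" "s < 1" "0 < q" shows "0 < muck_W q s"
proof (rule ccontr)
 assume "\<not> 0 < muck_W q s"
 then have "AE t in lborel. ennreal (w t powr q) * indicator {s..} t = 0"
  unfolding muck_W_def by (subst (asm) not_gr_zero, subst (asm) nn_integral_0_iff_AE) auto
 then have "AE t in lborel. ennreal (w t) * indicator {s..} t = 0"
  by (auto elim!: eventually_mono split: split_indicator_asm simp: indicator_def)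
 then have "(NINT t:{s..}. ennreal (w t)) = 0" by (subst nn_integral_0_iff_AE) auto
 then have "tail s = 0" by (simp add: nn_tail)
 then show False using wtail_pos[of s] assms by simp
qed

lemma muck_W_le:
 assumes "muck p q K" "1 < p" "1 < q" "s \<in> {0<..<1}" shows "muck_W q s \<le> ennreal (K powr q)"
proof -
 have K: "epow (muck_A p s) (1/p) * epow (muck_W q s) (1/q) \<le> ennreal K" using assms by (auto simp: muck_def)
 have "1 * epow (muck_W q s) (1/q) \<le> epow (muck_A p s) (1/p) * epow (muck_W q s) (1/q)"
  using epow_mono[OF muck_A_ge_1, of "1/p" p s] assms by (intro mult_right_mono) auto
 with K have 1: "epow (muck_W q s) (1/q) \<le> ennreal K" by simp
 have "muck_W q s = epow (epow (muck_W q s) (1/q)) q" using assms by (simp add: epow_epow)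
 also have "\<dots> \<le> epow (ennreal K) q" using 1 assms by (intro epow_mono) auto
 also have "\<dots> \<le> ennreal (K powr q)" by (cases "0 \<le> K") (auto simp: ennreal_neg)
 finally show ?thesis .
qed

text \<open>The bounds for \<open>s > 0\<close> are uniform because the first factor in the condition is at
  least 1.\<close>

lemma muck_W_0_le:
 assumes "muck p q K" "1 < p" "1 < q" shows "(NINT t. ennreal (w t powr q)) \<le> ennreal (K powr q)"
proof -
 have U: "(\<Union>n. {1 / real (Suc (Suc n))..}) = {0<..}"
 proof safe
  fix x :: real assume "0 < x"
  then obtain n where "1 / real (Suc n) < x" using nat_approx_posE by blast
  moreover have "1 / real (Suc (Suc n)) \<le> 1 / real (Suc n)" by (intro divide_left_mono) auto
  ultimately show "x \<in> (\<Union>n. {1 / real (Suc (Suc n))..})" by (intro UN_I[of n]) auto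
 next
  fix x :: real and n assume "1 / real (Suc (Suc n)) \<le> x"
  moreover have "0 < 1 / real (Suc (Suc n))" by simp
  ultimately show "0 < x" by linarith
 qed
 have "(NINT t. ennreal (w t powr q)) = (NINT t:(\<Union>n. {1 / real (Suc (Suc n))..}). ennreal (w t powr q))"
  unfolding U
 proof (intro nn_integral_cong)
  fix t show "ennreal (w t powr q) = ennreal (w t powr q) * indicator {0<..} t"
   by (cases "t \<in> {0<..<1}") (auto simp: w_supp)
 qed
 also have "\<dots> = (SUP n. (NINT t:{1 / real (Suc (Suc n))..}. ennreal (w t powr q)))"
 proof (rule nn_integral_incseq)
  show "incseq (\<lambda>n. {1 / real (Suc (Suc n))..})"
  proof (rule incseq_SucI)
   fix n
   have "1 / real (Suc (Suc (Suc n))) \<le> 1 / real (Suc (Suc n))" by (intro divide_left_mono) auto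
   then show "{1 / real (Suc (Suc n))..} \<le> {1 / real (Suc (Suc (Suc n)))..}" by auto
  qed
 qed auto
 also have "\<dots> \<le> ennreal (K powr q)"
  using muck_W_le[OF assms] by (intro SUP_least) (auto simp: muck_W_def divide_less_eq)
 finally show ?thesis .
qed

text \<open>Write \<open>Phi\<close> as an integral and interchange.\<close>

lemma T_eq:
 assumes [measurable]: "f \<in> borel_measurable borel"
 shows "T f y = (NINT t. f t * ennreal (w t)) +
   (NINT s. ennreal (phi s) * indicator {0..y} s * (NINT t:{s..}. f t * ennreal (w t)))"
proof -
 let ?k = "\<lambda>s t. f t * ennreal (w t) * (ennreal (phi s) * (if 0 \<le> s \<and> s \<le> y \<and> s \<le> t then 1 else 0))"
 have "T f y = (NINT t. f t * ennreal (w t) + (NINT s. ?k s t))"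
  unfolding T_def
 proof (intro nn_integral_cong)
  fix t
  have "(NINT s:{0..min t y}. ennreal (phi s)) = (NINT s. ennreal (phi s) * (if 0 \<le> s \<and> s \<le> y \<and> s \<le> t then 1 else 0))"
   by (intro nn_integral_cong) (auto split: split_indicator)
  then show "f t * ennreal (w t) * Phi (min t y) = f t * ennreal (w t) + (NINT s. ?k s t)"
   by (simp add: Phi_def distrib_left nn_integral_cmult)
 qed
 also have "\<dots> = (NINT t. f t * ennreal (w t)) + (NINT t. (NINT s. ?k s t))"
  by (rule nn_integral_add) measurable
 also have "(NINT t. (NINT s. ?k s t))
   = (NINT s. (NINT t. ?k s t))"
  by (rule lborel_pair.Fubini'[symmetric]) measurable
 also have "\<dots> = (NINT s. ennreal (phi s) * indicator {0..y} s * (NINT t:{s..}. f t * ennreal (w t)))"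
 proof (intro nn_integral_cong)
  fix s
  have "(NINT t. ?k s t)
   = (NINT t. (ennreal (phi s) * indicator {0..y} s) * (f t * ennreal (w t) * indicator {s..} t))"
   by (intro nn_integral_cong) (auto simp: mult_ac split: split_indicator)
  then show "(NINT t. ?k s t)
   = ennreal (phi s) * indicator {0..y} s * (NINT t:{s..}. f t * ennreal (w t))"
   by (simp add: nn_integral_cmult)
 qed
 finally show ?thesis .
qed

text \<open>Hoelder, with the norm of the weight from \<open>muck_W_0_le\<close>.\<close>

lemma total_bound:
 assumes [measurable]: "f \<in> borel_measurable borel" and m: "muck p q K" and p: "1 < p" "1 / p + 1 / q = 1"
 shows "epow (NINT t. f t * ennreal (w t)) p \<le> ennreal (K powr p) * (NINT t:{0<..<1}. epow (f t) p)"
proof -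
 have q: "1 < q" by (rule conjugate_gt_1[OF p])
 have eq: "f t * ennreal (w t) = (f t * indicator {0<..<1} t) * ennreal (w t)" for t
  by (cases "t \<in> {0<..<1}") (auto simp: w_supp)
 have "epow (NINT t. f t * ennreal (w t)) p \<le> (NINT t. epow (f t * indicator {0<..<1} t) p) * epow (NINT t. epow (ennreal (w t)) q) (p/q)"
  by (subst eq, rule Holder_nn_integral_powr[OF _ _ p]) measurable
 also have "\<dots> \<le> (NINT t. epow (f t * indicator {0<..<1} t) p) * epow (ennreal (K powr q)) (p/q)"
  using muck_W_0_le[OF m p(1) q] p q by (intro mult_left_mono epow_mono) auto
 also have "epow (ennreal (K powr q)) (p/q) = ennreal (K powr p)" using q by (simp add: powr_powr)
 also have "(NINT t. epow (f t * indicator {0<..<1} t) p) = (NINT t:{0<..<1}. epow (f t) p)"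
  by (intro nn_integral_cong) (auto split: split_indicator)
 finally show ?thesis by (simp add: mult.commute)
qed

text \<open>In the decomposition \<open>T_eq\<close> the first term is constant in \<open>y\<close>. In the
  second, with \<open>x = 1 - y\<close> and \<open>v = 1 - s\<close>, the factor
  \<open>1 / (1 - s)\<close> on \<open>s \<le> y\<close> becomes \<open>1 / v\<close> on
  \<open>v \<ge> x\<close>, at most the kernel of the Hardy-Hilbert inequality; what remains is the
  norm of \<open>G / tail\<close>, to which \<open>Muckenhoupt_Hardy\<close> applies with
  \<open>U = 1 / tail powr p\<close> and \<open>v = w\<close>.\<close>

theorem T_bound:
 assumes m: "muck p q K" and p: "1 < p" "1 / p + 1 / q = 1"
 shows "\<exists>C>0. \<forall>f \<in> borel_measurable borel. (NINT y:{0<..<1}. epow (T f y) p)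
   \<le> ennreal C * (NINT t:{0<..<1}. epow (f t) p)"
proof -
 have q: "1 < q" by (rule conjugate_gt_1[OF p])
 define K' where "K' = max K 0"
 have mK: "epow (muck_A p s) (1/p) * epow (muck_W q s) (1/q) \<le> ennreal K'" if "s \<in> {0<..<1}" for s
 proof -
  have "epow (muck_A p s) (1/p) * epow (muck_W q s) (1/q) \<le> ennreal K" using m that by (auto simp: muck_def)
  also have "\<dots> \<le> ennreal K'" unfolding K'_def by (rule ennreal_leI) simp
  finally show ?thesis .
 qed
 define M where "M = (q * K') powr (p/q) * p * K'"
 have M0: "0 \<le> M" using p q by (simp add: M_def K'_def)
 define C where "C = 2 powr p * (K powr p + (p+q) powr p * M) + 1"
 have "(NINT y:{0<..<1}. epow (T f y) p)
   \<le> ennreal C * (NINT t:{0<..<1}. epow (f t) p)" if [measurable]: "f \<in> borel_measurable borel" for f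
 proof -
  define N where "N = (NINT t:{0<..<1}. epow (f t) p)"
  define f' where "f' t = f t * indicator {0<..<1} t" for t
  have [measurable]: "f' \<in> borel_measurable borel" unfolding f'_def by measurable
  define G where "G s = (NINT t:{s..}. f t * ennreal (w t))" for s
  have G_eq: "G s = (NINT t. f t * ennreal (w t) * (if s \<le> t then 1 else 0))" for s
   unfolding G_def by (intro nn_integral_cong) (auto split: split_indicator)
  have [measurable]: "G \<in> borel_measurable borel" unfolding G_eq by measurable
  have G_eq': "G s = (NINT t:{s..}. f' t * ennreal (w t))" for s unfolding G_def f'_def
  proof (intro nn_integral_cong)
   fix t show "f t * ennreal (w t) * indicator {s..} t = f t * indicator {0<..<1} t * ennreal (w t) * indicator {s..} t"
    by (cases "t \<in> {0<..<1}") (auto simp: w_supp)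
  qed
  define S where "S y = (NINT s. ennreal (phi s) * indicator {0..y} s * G s)" for y
  have S_eq: "S y = (NINT s. ennreal (phi s) * (if 0 \<le> s \<and> s \<le> y then 1 else 0) * G s)" for y
   unfolding S_def by (intro nn_integral_cong) (auto split: split_indicator)
  have [measurable]: "S \<in> borel_measurable borel" unfolding S_eq by measurable
  define I0 where "I0 = (NINT t. f t * ennreal (w t))"
  have Teq: "T f y = I0 + S y" for y unfolding I0_def S_def G_def by (rule T_eq) measurable
  have I0: "epow I0 p \<le> ennreal (K powr p) * N"
   unfolding I0_def N_def by (rule total_bound[OF _ m p]) measurable
  define Uf where "Uf s = (if s \<in> {0<..<1} then 1 / tail s powr p else 0)" for s
  have [measurable]: "Uf \<in> borel_measurable borel" unfolding Uf_def by measurable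
  have MH: "(NINT s. ennreal (Uf s) * epow (G s) p) \<le> ennreal M * N"
  proof -
   have "(NINT s. ennreal (Uf s) * epow (NINT t:{s..}. f' t * ennreal (w t)) p)
     \<le> ennreal M * (NINT t. epow (f' t) p)" unfolding M_def
   proof (rule Muckenhoupt_Hardy[where A="\<lambda>s. enn2real (muck_A p s)" and W="\<lambda>s. enn2real (muck_W q s)" and I="{0<..<1}"])
    have e: "muck_A p s = 1 + (NINT t. ennreal (1 / tail t powr p) * (if 0 \<le> t \<and> t \<le> s then 1 else 0))"
     "muck_W q s = (NINT t. ennreal (w t powr q) * (if s \<le> t then 1 else 0))" for s
     unfolding muck_A_def muck_W_def
     by (intro arg_cong[where f="\<lambda>x. 1 + x"] nn_integral_cong; auto split: split_indicator)+
    show "(\<lambda>s. enn2real (muck_A p s)) \<in> borel_measurable borel" "(\<lambda>s. enn2real (muck_W q s)) \<in> borel_measurable borel"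
     unfolding e by measurable
    have fA: "muck_A p s < top" if "s \<in> {0<..<1}" for s using that p by (intro muck_A_finite) auto
    have fW: "muck_W q s < top" if "s \<in> {0<..<1}" for s
     using muck_W_le[OF m p(1) q that] by (auto intro: le_less_trans)
    show "0 < enn2real (muck_A p s)" if "s \<in> {0<..<1}" for s
     using fA[OF that] muck_A_ge_1[of p s] by (simp add: enn2real_positive_iff less_le_trans[of 0 1])
    show "0 < enn2real (muck_W q s)" if "s \<in> {0<..<1}" for s
     using fW[OF that] muck_W_pos[of s q] that q by (simp add: enn2real_positive_iff)
    show "enn2real (muck_A p s) \<le> enn2real (muck_A p t)" if "s \<in> {0<..<1}" "t \<in> {0<..<1}" "s \<le> t" for s t
     using that fA by (intro enn2real_mono muck_A_mono) auto
    show "enn2real (muck_W q t) \<le> enn2real (muck_W q s)" if "s \<in> {0<..<1}" "t \<in> {0<..<1}" "s \<le> t" for s t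
     using that fW by (intro enn2real_mono muck_W_antimono) auto
    show "(NINT t:{..s}. ennreal (Uf t)) \<le> ennreal (enn2real (muck_A p s))" if "s \<in> {0<..<1}" for s
    proof -
     have "(NINT t:{..s}. ennreal (Uf t)) \<le> 0 + (NINT t:{0..s}. ennreal (1 / tail t powr p))"
      unfolding add_0_left by (intro nn_integral_mono) (auto simp: Uf_def split: split_indicator)
     also have "\<dots> \<le> muck_A p s" unfolding muck_A_def by (intro add_right_mono) auto
     finally show ?thesis using fA[OF that] by simp
    qed
    show "(NINT t:{s..}. ennreal (w t powr q)) \<le> ennreal (enn2real (muck_W q s))" if "s \<in> {0<..<1}" for s
     using fW[OF that] by (simp add: muck_W_def)
    show "enn2real (muck_A p s) powr (1/p) * enn2real (muck_W q s) powr (1/q) \<le> K'" if s: "s \<in> {0<..<1}" for s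
    proof -
     have "ennreal (enn2real (muck_A p s) powr (1/p) * enn2real (muck_W q s) powr (1/q)) = epow (muck_A p s) (1/p) * epow (muck_W q s) (1/q)"
      using fA[OF s] fW[OF s] by (auto simp: epow_def ennreal_mult)
     with mK[OF s] have "ennreal (enn2real (muck_A p s) powr (1/p) * enn2real (muck_W q s) powr (1/q)) \<le> ennreal K'" by simp
     then show ?thesis by (simp add: K'_def)
    qed
   qed (use p in \<open>auto simp: Uf_def w_supp K'_def\<close>)
   moreover have "(NINT t. epow (f' t) p) = N"
    unfolding N_def f'_def by (intro nn_integral_cong) (auto split: split_indicator)
   ultimately show ?thesis by (simp add: G_eq')
  qed
  define gg where "gg v = ennreal (1 / tail (1 - v)) * G (1 - v) * indicator {0<..<1} v" for v
  have [measurable]: "gg \<in> borel_measurable borel" unfolding gg_def by measurable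
  have S_le: "S (1 - x) \<le> (NINT v. ennreal (hh_kernel x v) * gg v)" if x: "0 < x" "x < 1" for x
  proof -
   have "S (1 - x) = (NINT v. ennreal (phi (1 + (-1) * v)) * (if 0 \<le> 1 + (-1) * v \<and> 1 + (-1) * v \<le> 1 - x then 1 else 0) * G (1 + (-1) * v))"
    unfolding S_eq by (subst nn_integral_real_affine[of _ "-1" 1]) auto
   also have "\<dots> \<le> (NINT v. ennreal (hh_kernel x v) * gg v)"
   proof (rule nn_integral_mono_AE)
    \<comment> \<open>At \<open>v = 1\<close>, which is \<open>s = 0\<close>, the function
     \<open>gg\<close> is cut off.\<close>
    have "AE v in lborel. v \<noteq> (1::real)" by (rule AE_lborel_singleton)
    then show "AE v in lborel. ennreal (phi (1 + (-1) * v)) * (if 0 \<le> 1 + (-1) * v \<and> 1 + (-1) * v \<le> 1 - x then 1 else 0) * G (1 + (-1) * v)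
      \<le> ennreal (hh_kernel x v) * gg v"
    proof eventually_elim
     fix v :: real assume v1: "v \<noteq> 1"
     show "ennreal (phi (1 + (-1) * v)) * (if 0 \<le> 1 + (-1) * v \<and> 1 + (-1) * v \<le> 1 - x then 1 else 0) * G (1 + (-1) * v)
      \<le> ennreal (hh_kernel x v) * gg v"
     proof (cases "x \<le> v \<and> v < 1")
      case True
      have "ennreal (phi (1 - v)) = ennreal (1 / v) * ennreal (1 / tail (1 - v))"
       using True x by (simp add: phi_def ennreal_mult'[symmetric])
      then show ?thesis using True x by (simp add: hh_kernel_def gg_def max_def mult.assoc)
     next
      case False
      then show ?thesis using v1 by auto
     qed
    qed
   qed
   finally show ?thesis .
  qed
  have "(NINT y:{0<..<1}. epow (S y) p) = (NINT x. epow (S (1 + (-1) * x)) p * indicator {0<..<1} (1 + (-1) * x))"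
   by (subst nn_integral_real_affine[of _ "-1" 1]) auto
  also have "\<dots> \<le> (NINT x. epow (NINT v. ennreal (hh_kernel x v) * gg v) p)"
   using p S_le by (intro nn_integral_mono) (auto intro!: epow_mono split: split_indicator)
  also have "\<dots> \<le> ennreal ((p+q) powr p) * (NINT v. epow (gg v) p)"
   by (rule Hardy_Hilbert[OF _ p]) measurable
  also have "(NINT v. epow (gg v) p) = (NINT s. ennreal (Uf s) * epow (G s) p)"
  proof -
   have pt: "epow (gg v) p = ennreal (Uf (1 + (-1) * v)) * epow (G (1 + (-1) * v)) p" for v
   proof (cases "v \<in> {0<..<1}")
    case True
    then have "0 < tail (1 - v)" by (intro wtail_pos) auto
    then show ?thesis using True p by (simp add: gg_def Uf_def epow_mult powr_divide)
   next
    case False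
    then show ?thesis by (auto simp: gg_def Uf_def)
   qed
   show ?thesis unfolding pt by (subst (2) nn_integral_real_affine[of _ "-1" 1]) auto
  qed
  finally have Sb: "(NINT y:{0<..<1}. epow (S y) p) \<le> ennreal ((p+q) powr p) * (ennreal M * N)"
   using MH by (meson mult_left_mono order.trans zero_le)
  have "(NINT y:{0<..<1}. epow (T f y) p)
   \<le> (NINT y. ennreal (2 powr p) * (epow I0 p * indicator {0<..<1} y + epow (S y) p * indicator {0<..<1} y))"
   unfolding Teq using p by (intro nn_integral_mono) (auto intro!: epow_add_le split: split_indicator)
  also have "\<dots> = ennreal (2 powr p) * (NINT y. epow I0 p * indicator {0<..<1} y + epow (S y) p * indicator {0<..<1} y)"
   by (rule nn_integral_cmult) measurable
  also have "(NINT y. epow I0 p * indicator {0<..<1} y + epow (S y) p * indicator {0<..<1} y)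
    = (NINT y:{0<..<1::real}. epow I0 p) + (NINT y:{0<..<1}. epow (S y) p)"
   by (rule nn_integral_add) measurable
  also have "(NINT y:{0<..<1::real}. epow I0 p) = epow I0 p"
   by (subst nn_integral_cmult_indicator) auto
  finally have "(NINT y:{0<..<1}. epow (T f y) p)
   \<le> ennreal (2 powr p) * (epow I0 p + (NINT y:{0<..<1}. epow (S y) p))" .
  also have "\<dots> \<le> ennreal (2 powr p) * (ennreal (K powr p) * N + ennreal ((p+q) powr p) * (ennreal M * N))"
   by (intro mult_left_mono add_mono I0 Sb) auto
  also have "\<dots> = ennreal (2 powr p * (K powr p + (p+q) powr p * M)) * N"
   using M0 by (simp add: ennreal_mult ennreal_plus distrib_left distrib_right mult_ac)
  also have "\<dots> \<le> ennreal C * N" by (intro mult_right_mono ennreal_leI) (auto simp: C_def)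
  finally show ?thesis unfolding N_def .
 qed
 moreover have "0 < C" using M0 by (simp add: C_def add_nonneg_pos)
 ultimately show ?thesis by blast
qed

end

section \<open>The Hilbert-type operator as a power series\<close>

lemma powser_deriv_shift:
 fixes c :: "nat \<Rightarrow> complex"
 assumes c: "\<And>x. norm x < 1 \<Longrightarrow> summable (\<lambda>n. c n * x ^ n)" and z: "norm z < 1"
 shows "((\<lambda>x. \<Sum>n. c n * x ^ n) has_field_derivative (\<Sum>n. of_nat (Suc n) * c (Suc n) * z ^ n)) (at z)"
  "summable (\<lambda>n. of_nat (Suc n) * c (Suc n) * z ^ n)"
proof -
 obtain K :: real where K: "norm z < K" "K < 1" using dense z by blast
 have K0: "0 \<le> K" using K norm_ge_zero[of z] by linarith
 have s: "summable (\<lambda>n. c n * of_real K ^ n)" using K K0 by (intro c) auto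
 have n: "norm z < norm (of_real K :: complex)" using K K0 by simp
 show "((\<lambda>x. \<Sum>n. c n * x ^ n) has_field_derivative (\<Sum>n. of_nat (Suc n) * c (Suc n) * z ^ n)) (at z)"
  using termdiffs_strong[OF s n] by (simp only: diffs_def)
 show "summable (\<lambda>n. of_nat (Suc n) * c (Suc n) * z ^ n)"
  using termdiff_converges[OF z, of c] c by (simp only: diffs_def)
qed

context dweight
begin

text \<open>The functions for which the operator is an absolutely convergent integral at every point of the
  disc.\<close>

definition admissible :: "(real \<Rightarrow> complex) \<Rightarrow> bool" where
 "admissible f \<longleftrightarrow> f \<in> borel_measurable borel \<and> integrable lborel (\<lambda>t. norm (f t) * w t)"

definition mom :: "(real \<Rightarrow> complex) \<Rightarrow> nat \<Rightarrow> complex" where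
 "mom f n = (LBINT t. f t * of_real (w t * t ^ n))"

lemma admissible_measurable: "admissible f \<Longrightarrow> f \<in> borel_measurable borel"
 by (simp add: admissible_def)

lemma integrable_mom:
 assumes f: "admissible f" shows "integrable lborel (\<lambda>t. f t * of_real (w t * t ^ n))"
proof (rule Bochner_Integration.integrable_bound)
 have [measurable]: "f \<in> borel_measurable borel" using f by (rule admissible_measurable)
 show "integrable lborel (\<lambda>t. norm (f t) * w t)" using f by (simp add: admissible_def)
 show "(\<lambda>t. f t * of_real (w t * t ^ n)) \<in> borel_measurable lborel" by measurable
 have "norm (f t * of_real (w t * t ^ n)) \<le> norm (norm (f t) * w t)" for t
 proof (cases "t \<in> {0<..<1}")
  case True
  then have "w t * t ^ n \<le> w t * 1" by (intro mult_left_mono power_le_one) auto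
  then have "norm (f t) * (w t * t ^ n) \<le> norm (f t) * w t" by (intro mult_left_mono) auto
  then show ?thesis using True by (simp add: norm_mult abs_mult norm_power)
 qed (simp add: w_supp)
 then show "AE t in lborel. norm (f t * of_real (w t * t ^ n)) \<le> norm (norm (f t) * w t)" by simp
qed

lemma norm_mom_le:
 assumes f: "admissible f" shows "norm (mom f n) \<le> (LBINT t. norm (f t) * w t)"
proof -
 have "norm (mom f n) \<le> (LBINT t. norm (f t * of_real (w t * t ^ n)))"
  unfolding mom_def by (rule integral_norm_bound)
 also have "\<dots> \<le> (LBINT t. norm (f t) * w t)"
 proof (rule integral_mono[OF integrable_norm[OF integrable_mom[OF f]]])
  show "integrable lborel (\<lambda>t. norm (f t) * w t)" using f by (simp add: admissible_def)
  fix t show "norm (f t * of_real (w t * t ^ n)) \<le> norm (f t) * w t"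
  proof (cases "t \<in> {0<..<1}")
   case True
   then have "w t * t ^ n \<le> w t * 1" by (intro mult_left_mono power_le_one) auto
   then have "norm (f t) * (w t * t ^ n) \<le> norm (f t) * w t" by (intro mult_left_mono) auto
   then show ?thesis using True by (simp add: norm_mult norm_power)
  qed (simp add: w_supp)
 qed
 finally show ?thesis .
qed

text \<open>The interchange of sum and integral is justified by the absolute convergence of the kernel series at
  \<open>norm z\<close>.\<close>

lemma integral_powser:
 fixes a :: "nat \<Rightarrow> real"
 assumes f: "admissible f" and a: "\<And>n. 0 \<le> a n" "\<And>r. 0 \<le> r \<Longrightarrow> r < 1 \<Longrightarrow> summable (\<lambda>n. a n * r ^ n)"
  and z: "norm z < 1"
 shows "integrable lborel (\<lambda>t. f t * (\<Sum>n. of_real (a n) * (of_real t * z) ^ n) * of_real (w t))" (is ?int)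
  and "summable (\<lambda>n. norm (mom f n * of_real (a n) * z ^ n))" (is ?sum)
  and "(LBINT t. f t * (\<Sum>n. of_real (a n) * (of_real t * z) ^ n) * of_real (w t)) = (\<Sum>n. mom f n * of_real (a n) * z ^ n)" (is ?eq)
proof -
 define I where "I = (LBINT t. norm (f t) * w t)"
 define g where "g n t = f t * of_real (w t * t ^ n) * (of_real (a n) * z ^ n)" for n t
 have gi: "integrable lborel (g n)" for n unfolding g_def by (rule integrable_mult_left[OF integrable_mom[OF f]])
 have sa: "summable (\<lambda>n. I * (a n * norm z ^ n))" by (intro summable_mult a) (use z in auto)
 have I0: "0 \<le> I" unfolding I_def by (intro Bochner_Integration.integral_nonneg) auto
 have gint: "integral\<^sup>L lborel (g n) = mom f n * of_real (a n) * z ^ n" for n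
  unfolding g_def mom_def by (subst integral_mult_left_zero) (simp add: mult.assoc)
 have bnd: "norm (mom f n * of_real (a n) * z ^ n) \<le> I * (a n * norm z ^ n)" for n
 proof -
  have "norm (mom f n) * (a n * norm z ^ n) \<le> I * (a n * norm z ^ n)"
   using norm_mom_le[OF f, of n] a(1)[of n] unfolding I_def by (intro mult_right_mono) auto
  then show ?thesis using a(1)[of n] by (simp add: norm_mult norm_power mult.assoc)
 qed
 show ?sum by (rule summable_comparison_test'[OF sa]) (use bnd in auto)
 have pt: "(\<Sum>n. g n t) = f t * (\<Sum>n. of_real (a n) * (of_real t * z) ^ n) * of_real (w t)"
  and ps: "summable (\<lambda>n. norm (g n t))" for t
 proof -
  have "(\<Sum>n. g n t) = f t * (\<Sum>n. of_real (a n) * (of_real t * z) ^ n) * of_real (w t) \<and> summable (\<lambda>n. norm (g n t))"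
  proof (cases "t \<in> {0<..<1}")
   case False
   then show ?thesis by (simp add: g_def w_supp)
  next
   case True
   have tz: "norm (of_real t * z) < 1" using True z
    by (simp add: norm_mult) (metis mult.commute mult_less_cancel_left2 less_le_trans less_trans mult_left_le norm_ge_zero less_imp_le le_less_trans)
   have s: "summable (\<lambda>n. of_real (a n) * (of_real t * z) ^ n)"
    using a(1) by (intro summable_real_powser[where C=1 and v=a] a(2) tz) auto
   have sn: "summable (\<lambda>n. a n * norm (of_real t * z) ^ n)" by (intro a(2) tz) auto
   have geq: "g n t = (f t * of_real (w t)) * (of_real (a n) * (of_real t * z) ^ n)" for n
    by (simp add: g_def power_mult_distrib)
   have "norm (g n t) = norm (f t * of_real (w t)) * (a n * norm (of_real t * z) ^ n)" for n
    unfolding geq using a(1)[of n] by (simp add: norm_mult norm_power power_mult_distrib)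
   then have "summable (\<lambda>n. norm (g n t))" using summable_mult[OF sn] by simp
   moreover have "(\<Sum>n. g n t) = (f t * of_real (w t)) * (\<Sum>n. of_real (a n) * (of_real t * z) ^ n)"
    unfolding geq by (rule suminf_mult[OF s])
   ultimately show ?thesis by (simp add: mult_ac)
  qed
  then show "(\<Sum>n. g n t) = f t * (\<Sum>n. of_real (a n) * (of_real t * z) ^ n) * of_real (w t)" "summable (\<lambda>n. norm (g n t))" by auto
 qed
 have sg: "summable (\<lambda>n. (LBINT t. norm (g n t)))"
 proof (rule summable_comparison_test'[OF sa])
  fix n
  have fi: "integrable lborel (\<lambda>t. norm (f t) * w t)" using f by (simp add: admissible_def)
  have "(LBINT t. norm (g n t)) \<le> (LBINT t. (norm (f t) * w t) * (a n * norm z ^ n))"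
  proof (rule integral_mono[OF integrable_norm[OF gi] integrable_mult_left[OF fi]])
   fix t show "norm (g n t) \<le> norm (f t) * w t * (a n * norm z ^ n)"
   proof (cases "t \<in> {0<..<1}")
    case True
    then have "t ^ n \<le> 1" by (intro power_le_one) auto
    then have "(norm (f t) * w t * (a n * norm z ^ n)) * t ^ n \<le> (norm (f t) * w t * (a n * norm z ^ n)) * 1"
     using a(1)[of n] by (intro mult_left_mono) auto
    then show ?thesis using True a(1)[of n] by (simp add: g_def norm_mult norm_power mult_ac)
   qed (simp add: g_def w_supp)
  qed
  also have "\<dots> = I * (a n * norm z ^ n)" unfolding I_def by (rule integral_mult_left_zero)
  finally show "norm (LBINT t. norm (g n t)) \<le> I * (a n * norm z ^ n)" by simp
 qed
 have "integrable lborel (\<lambda>t. \<Sum>n. g n t)" using integrable_suminf[OF gi _ sg] ps by auto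
 then show ?int by (simp only: pt)
 have "(LBINT t. (\<Sum>n. g n t)) = (\<Sum>n. integral\<^sup>L lborel (g n))" using integral_suminf[OF gi _ sg] ps by auto
 then show ?eq by (simp only: pt gint)
qed

text \<open>The operator of the theorem, written with the explicit kernel.\<close>

definition Hop :: "(real \<Rightarrow> complex) \<Rightarrow> complex \<Rightarrow> complex" where
 "Hop f z = (LBINT t. f t * (V (of_real t * z) / 2) * of_real (w t))"

text \<open>The same integral with the Bergman kernel itself; it equals the derivative of
  \<open>z * Hop f z\<close>.\<close>

definition Bop :: "(real \<Rightarrow> complex) \<Rightarrow> complex \<Rightarrow> complex" where
 "Bop f z = (LBINT t. f t * (U (of_real t * z) / 2) * of_real (w t))"

text \<open>The Taylor coefficients of \<open>Hop f\<close>.\<close>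

definition hc :: "(real \<Rightarrow> complex) \<Rightarrow> nat \<Rightarrow> complex" where
 "hc f n = mom f n * of_real (u n / (real n + 1) / 2)"

lemma powser_coeff_half:
 assumes "summable (\<lambda>n. of_real (a n) * x ^ n)"
 shows "(\<Sum>n. of_real (a n / 2) * x ^ n) = (\<Sum>n. of_real (a n) * x ^ n) / (2 :: complex)"
 using suminf_divide[OF assms, of 2] by simp

lemma summable_coeff:
 assumes "0 \<le> r" "r < 1" shows "summable (\<lambda>n. u n / (real n + 1) / 2 * r ^ n)"
proof (rule summable_comparison_test'[OF summable_u[OF assms]])
 fix n
 have "u n / (real n + 1) / 2 = u n / ((real n + 1) * 2)" by simp
 also have "\<dots> \<le> u n / 1" by (intro divide_left_mono) auto
 finally have "u n / (real n + 1) / 2 * r ^ n \<le> u n * r ^ n" using assms by (intro mult_right_mono) auto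
 moreover have "0 \<le> u n / (real n + 1) / 2 * r ^ n" using assms by simp
 ultimately show "norm (u n / (real n + 1) / 2 * r ^ n) \<le> u n * r ^ n" by (simp only: real_norm_def abs_of_nonneg)
qed

context
 fixes f :: "real \<Rightarrow> complex"
 assumes f: "admissible f"
begin

lemma norm_mult_lt_1: "t \<in> {0<..<1} \<Longrightarrow> norm z < 1 \<Longrightarrow> norm (of_real t * z :: complex) < 1"
proof -
 assume t: "t \<in> {0<..<1}" and z: "norm z < 1"
 have "norm (of_real t * z) \<le> 1 * norm z" unfolding norm_mult using t by (intro mult_right_mono) auto
 then show ?thesis using z by simp
qed

lemma half_V: "f t * (\<Sum>n. of_real (u n / (real n + 1) / 2) * (of_real t * z) ^ n) * of_real (w t) =
  f t * (V (of_real t * z) / 2) * of_real (w t)" if "norm z < 1"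
proof (cases "t \<in> {0<..<1}")
 case True
 show ?thesis unfolding V_def by (subst powser_coeff_half[OF summable_V[OF norm_mult_lt_1[OF True that]]]) simp
qed (simp add: w_supp)

lemma half_U: "f t * (\<Sum>n. of_real (u n / 2) * (of_real t * z) ^ n) * of_real (w t) =
  f t * (U (of_real t * z) / 2) * of_real (w t)" if "norm z < 1"
proof (cases "t \<in> {0<..<1}")
 case True
 show ?thesis unfolding U_def by (subst powser_coeff_half[OF summable_U[OF norm_mult_lt_1[OF True that]]]) simp
qed (simp add: w_supp)

lemma Hop_integrable: "norm z < 1 \<Longrightarrow> integrable lborel (\<lambda>t. f t * (V (of_real t * z) / 2) * of_real (w t))"
 using integral_powser(1)[OF f, of "\<lambda>n. u n / (real n + 1) / 2" z] summable_coeff by (simp only: half_V) simp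

lemma hc_summable: "norm z < 1 \<Longrightarrow> summable (\<lambda>n. hc f n * z ^ n)"
 using integral_powser(2)[OF f, of "\<lambda>n. u n / (real n + 1) / 2" z, OF _ summable_coeff]
 unfolding hc_def by (intro summable_norm_cancel[where f="\<lambda>n. mom f n * of_real (u n / (real n + 1) / 2) * z ^ n"]) auto

lemma Hop_eq: "norm z < 1 \<Longrightarrow> Hop f z = (\<Sum>n. hc f n * z ^ n)" unfolding Hop_def hc_def
 using integral_powser(3)[OF f, of "\<lambda>n. u n / (real n + 1) / 2" z, OF _ summable_coeff] by (simp only: half_V) simp

lemma Hop_holomorphic: "Hop f holomorphic_on ball 0 1"
proof (rule power_series_holomorphic)
 fix x :: complex assume "x \<in> ball 0 1"
 then have "norm x < 1" by simp
 then show "(\<lambda>n. hc f n * (x - 0) ^ n) sums Hop f x" using summable_sums[OF hc_summable] Hop_eq by simp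
qed

lemma taylor_coeff_Hop: "taylor_coeff (Hop f) n = hc f n"
proof -
 have "(deriv ^^ n) (Hop f) 0 / fact n = hc f n"
 proof -
  have h: "(Hop f) has_fps_expansion Abs_fps (hc f)"
  proof (rule has_fps_expansionI)
   have "eventually (\<lambda>x. x \<in> ball 0 1) (nhds (0::complex))" by (intro eventually_nhds_in_open) auto
   then show "\<forall>\<^sub>F x in nhds 0. (\<lambda>n. fps_nth (Abs_fps (hc f)) n * x ^ n) sums Hop f x"
   proof eventually_elim
    fix x :: complex assume "x \<in> ball 0 1"
    then have "norm x < 1" by simp
    then show "(\<lambda>n. fps_nth (Abs_fps (hc f)) n * x ^ n) sums Hop f x"
     using summable_sums[OF hc_summable] Hop_eq by simp
   qed
  qed
  show ?thesis using fps_nth_fps_expansion[OF h, of n] by simp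
 qed
 then show ?thesis by (simp add: taylor_coeff_def)
qed

lemma Bop_integrable: "norm z < 1 \<Longrightarrow> integrable lborel (\<lambda>t. f t * (U (of_real t * z) / 2) * of_real (w t))"
proof -
 assume z: "norm z < 1"
 have s: "summable (\<lambda>n. u n / 2 * r ^ n)" if "0 \<le> r" "r < 1" for r
  using summable_divide[OF summable_u[OF that], of 2] by simp
 show ?thesis using integral_powser(1)[OF f, of "\<lambda>n. u n / 2" z] s z by (simp only: half_U) simp
qed

lemma Bop_eq: "norm z < 1 \<Longrightarrow> Bop f z = (\<Sum>n. of_nat (Suc n) * hc f n * z ^ n)"
proof -
 assume z: "norm z < 1"
 have s: "summable (\<lambda>n. u n / 2 * r ^ n)" if "0 \<le> r" "r < 1" for r
  using summable_divide[OF summable_u[OF that], of 2] by simp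
 have eq: "of_nat (Suc n) * hc f n = mom f n * of_real (u n / 2)" for n
 proof -
  have 1: "(of_nat (Suc n) :: complex) = of_real (real n + 1)" by simp
  have 2: "(real n + 1) * (u n / (real n + 1) / 2) = u n / 2" by (simp add: field_simps)
  have "of_nat (Suc n) * hc f n = mom f n * of_real ((real n + 1) * (u n / (real n + 1) / 2))"
   unfolding hc_def 1 of_real_mult by (simp only: mult_ac)
  then show ?thesis unfolding 2 .
 qed
 have "Bop f z = (\<Sum>n. mom f n * of_real (u n / 2) * z ^ n)"
  unfolding Bop_def using integral_powser(3)[OF f, of "\<lambda>n. u n / 2" z, OF _ s] z by (simp only: half_U) simp
 then show ?thesis by (simp only: eq)
qed

lemma Hop_deriv:
 assumes z: "norm z < 1" "z \<noteq> 0" shows "deriv (Hop f) z = (Bop f z - Hop f z) / z"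
proof -
 have hd: "(Hop f has_field_derivative deriv (Hop f) z) (at z)"
  using Hop_holomorphic z by (intro holomorphic_derivI[of _ "ball 0 1"]) auto
 have "((\<lambda>x. x * Hop f x) has_field_derivative (z * deriv (Hop f) z + 1 * Hop f z)) (at z)"
  by (rule DERIV_cong[OF DERIV_mult[OF DERIV_ident hd]]) (simp add: mult.commute)
 moreover have "((\<lambda>x. x * Hop f x) has_field_derivative Bop f z) (at z)"
 proof -
  have "((\<lambda>x. x * (\<Sum>n. hc f n * x ^ n)) has_field_derivative (\<Sum>n. of_nat (Suc n) * hc f n * z ^ n)) (at z)"
   by (rule powser_times_var_deriv[OF hc_summable z(1)])
  then show ?thesis unfolding Bop_eq[OF z(1), symmetric]
  proof (rule DERIV_cong_ev[THEN iffD1, rotated 3])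
   have "eventually (\<lambda>x. x \<in> ball 0 1) (nhds z)" using z by (intro eventually_nhds_in_open) auto
   then show "\<forall>\<^sub>F x in nhds z. x * (\<Sum>n. hc f n * x ^ n) = x * Hop f x"
    by eventually_elim (simp add: Hop_eq)
  qed auto
 qed
 ultimately have "z * deriv (Hop f) z + 1 * Hop f z = Bop f z" by (rule DERIV_unique)
 then show ?thesis using z by (simp add: field_simps)
qed

end

lemma Hop_deriv_eq:
 assumes f: "admissible f" and z: "norm z < 1"
 shows "deriv (Hop f) z = (\<Sum>n. of_nat (Suc n) * hc f (Suc n) * z ^ n)"
proof (rule DERIV_imp_deriv)
 have "((\<lambda>x. \<Sum>n. hc f n * x ^ n) has_field_derivative (\<Sum>n. of_nat (Suc n) * hc f (Suc n) * z ^ n)) (at z)"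
  by (rule powser_deriv_shift(1)[OF hc_summable[OF f] z])
 then show "(Hop f has_field_derivative (\<Sum>n. of_nat (Suc n) * hc f (Suc n) * z ^ n)) (at z)"
 proof (rule DERIV_cong_ev[THEN iffD1, rotated 3])
  have "eventually (\<lambda>x. x \<in> ball 0 1) (nhds z)" using z by (intro eventually_nhds_in_open) auto
  then show "\<forall>\<^sub>F x in nhds z. (\<Sum>n. hc f n * x ^ n) = Hop f x"
   by eventually_elim (simp add: Hop_eq[OF f])
 qed auto
qed

lemma measurable_Phi [measurable]: "Phi \<in> borel_measurable borel"
proof -
 have "Phi y = 1 + (NINT s. ennreal (phi s) * (if 0 \<le> s \<and> s \<le> y then 1 else 0))" for y
  unfolding Phi_def by (intro arg_cong[where f="\<lambda>x. 1 + x"] nn_integral_cong) (auto split: split_indicator)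
 then show ?thesis by (subst measurable_cong) auto
qed

lemma measurable_T [measurable]:
 assumes [measurable]: "f \<in> borel_measurable borel" shows "T f \<in> borel_measurable borel"
 unfolding T_def by measurable

abbreviation nf :: "(real \<Rightarrow> complex) \<Rightarrow> real \<Rightarrow> ennreal" where
 "nf f \<equiv> \<lambda>t. ennreal (norm (f t))"

text \<open>Passes from a pointwise bound of a kernel by \<open>Phi\<close> to a bound of the integral by
  \<open>T\<close>. The factor \<open>c\<close> carries the distance to the boundary in derivative
  estimates.\<close>

lemma kernel_integral_bound:
 assumes f: "admissible f" and i: "integrable lborel (\<lambda>t. f t * (k t / 2) * of_real (w t))" and c: "0 \<le> c"
  and b: "\<And>t. t \<in> {0<..<1} \<Longrightarrow> ennreal (norm (k t) * c) \<le> ennreal C * Phi (min t y)"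
 shows "ennreal (norm (LBINT t. f t * (k t / 2) * of_real (w t)) * c) \<le> ennreal C * T (nf f) y"
proof -
 have [measurable]: "f \<in> borel_measurable borel" using f by (rule admissible_measurable)
 have [measurable]: "(\<lambda>t. f t * (k t / 2) * of_real (w t)) \<in> borel_measurable lborel"
  by (rule borel_measurable_integrable[OF i])
 have "ennreal (norm (LBINT t. f t * (k t / 2) * of_real (w t)) * c)
   \<le> ennreal c * (NINT t. ennreal (norm (f t * (k t / 2) * of_real (w t))))"
  using mult_left_mono[OF integral_norm_bound_ennreal[OF i], of "ennreal c"] c by (simp add: ennreal_mult'[symmetric] mult.commute)
 also have "\<dots> = (NINT t. ennreal c * ennreal (norm (f t * (k t / 2) * of_real (w t))))"
  by (rule nn_integral_cmult[symmetric]) measurable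
 also have "\<dots> \<le> (NINT t. ennreal C * (ennreal (norm (f t)) * ennreal (w t) * Phi (min t y)))"
 proof (rule nn_integral_mono)
  fix t
  show "ennreal c * ennreal (norm (f t * (k t / 2) * of_real (w t))) \<le> ennreal C * (ennreal (norm (f t)) * ennreal (w t) * Phi (min t y))"
  proof (cases "t \<in> {0<..<1}")
   case True
   have half: "c * (a * (b / 2) * x) \<le> (a * x) * (b * c)" if "0 \<le> a" "0 \<le> b" "0 \<le> x" for a b x :: real
   proof -
    have "0 \<le> a * b * x * c" using that c by simp
    then show ?thesis by (simp add: mult_ac)
   qed
   have "ennreal c * ennreal (norm (f t * (k t / 2) * of_real (w t))) = ennreal (c * (norm (f t) * (norm (k t) / 2) * w t))"
    using c by (simp add: ennreal_mult'[symmetric] norm_mult norm_divide)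
   also have "\<dots> \<le> ennreal ((norm (f t) * w t) * (norm (k t) * c))" by (intro ennreal_leI half) auto
   also have "\<dots> = ennreal (norm (f t) * w t) * ennreal (norm (k t) * c)" by (rule ennreal_mult') simp
   also have "\<dots> \<le> ennreal (norm (f t) * w t) * (ennreal C * Phi (min t y))" by (intro mult_left_mono b True) auto
   finally show ?thesis by (simp add: ennreal_mult mult_ac)
  qed (simp add: w_supp)
 qed
 also have "\<dots> = ennreal C * T (nf f) y" unfolding T_def by (rule nn_integral_cmult) measurable
 finally show ?thesis .
qed

end

context dweight
begin

lemma norm_hc: "norm (hc f n) = norm (mom f n) * (u n / (real n + 1) / 2)"
proof -
 have "norm (of_real (u n / (real n + 1) / 2) :: complex) = u n / (real n + 1) / 2"
  unfolding norm_of_real by (rule abs_of_nonneg) (intro divide_nonneg_nonneg; simp)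
 then show ?thesis unfolding hc_def norm_mult by simp
qed

lemma total_le_T:
 assumes f: "admissible f" shows "ennreal (LBINT t. norm (f t) * w t) \<le> T (nf f) y"
proof -
 have "ennreal (LBINT t. norm (f t) * w t) = (NINT t. ennreal (norm (f t) * w t))"
  using f by (intro nn_integral_eq_integral[symmetric]) (auto simp: admissible_def)
 also have "\<dots> \<le> T (nf f) y" unfolding T_def
 proof (rule nn_integral_mono)
  fix t
  have "ennreal (norm (f t)) * ennreal (w t) * 1 \<le> ennreal (norm (f t)) * ennreal (w t) * Phi (min t y)"
   by (intro mult_left_mono) (auto simp: Phi_def)
  then show "ennreal (norm (f t) * w t) \<le> ennreal (norm (f t)) * ennreal (w t) * Phi (min t y)"
   by (simp add: ennreal_mult)
 qed
 finally show ?thesis .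
qed

lemma Hop_bound:
 "\<exists>C>0. \<forall>f r \<theta>. admissible f \<longrightarrow> 0 \<le> r \<longrightarrow> r < 1 \<longrightarrow> \<theta> \<in> {0..2*pi} \<longrightarrow>
  ennreal (norm (Hop f (of_real r * cis \<theta>))) \<le> ennreal C * T (nf f) (gap r \<theta>)"
proof -
 obtain C where C: "0 < C" "\<And>t r \<theta>. 0 \<le> t \<Longrightarrow> t < 1 \<Longrightarrow> 0 \<le> r \<Longrightarrow> r < 1 \<Longrightarrow> \<theta> \<in> {0..2*pi} \<Longrightarrow>
  ennreal (norm (V (of_real t * (of_real r * cis \<theta>)))) \<le> ennreal C * Phi (min t (gap r \<theta>))"
  using V_Phi_bound by blast
 show ?thesis
 proof (intro exI[of _ C] conjI allI impI)
  fix f and r \<theta> :: real assume h: "admissible f" "0 \<le> r" "r < 1" "\<theta> \<in> {0..2*pi}"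
  show "ennreal (norm (Hop f (of_real r * cis \<theta>))) \<le> ennreal C * T (nf f) (gap r \<theta>)"
  proof -
   have z: "norm (of_real r * cis \<theta>) < 1" using h by (simp add: norm_mult)
   have "ennreal (norm (Hop f (of_real r * cis \<theta>)) * 1) \<le> ennreal C * T (nf f) (gap r \<theta>)"
    unfolding Hop_def by (rule kernel_integral_bound[OF h(1) Hop_integrable[OF h(1) z]]) (use h C in auto)
   then show ?thesis by simp
  qed
 qed (rule C)
qed

lemma Bop_bound:
 "\<exists>C>0. \<forall>f r \<theta>. admissible f \<longrightarrow> 0 \<le> r \<longrightarrow> r < 1 \<longrightarrow> \<theta> \<in> {0..2*pi} \<longrightarrow>
  ennreal (norm (Bop f (of_real r * cis \<theta>)) * (1 - gap r \<theta>)) \<le> ennreal C * T (nf f) (gap r \<theta>)"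
proof -
 obtain C where C: "0 < C" "\<And>t r \<theta>. 0 \<le> t \<Longrightarrow> t < 1 \<Longrightarrow> 0 \<le> r \<Longrightarrow> r < 1 \<Longrightarrow> \<theta> \<in> {0..2*pi} \<Longrightarrow>
  ennreal (norm (U (of_real t * (of_real r * cis \<theta>))) * (1 - gap r \<theta>)) \<le> ennreal C * Phi (min t (gap r \<theta>))"
  using U_Phi_bound by blast
 show ?thesis
 proof (intro exI[of _ C] conjI allI impI)
  fix f and r \<theta> :: real assume h: "admissible f" "0 \<le> r" "r < 1" "\<theta> \<in> {0..2*pi}"
  show "ennreal (norm (Bop f (of_real r * cis \<theta>)) * (1 - gap r \<theta>)) \<le> ennreal C * T (nf f) (gap r \<theta>)"
  proof -
   have z: "norm (of_real r * cis \<theta>) < 1" using h by (simp add: norm_mult)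
   show ?thesis unfolding Bop_def
    by (rule kernel_integral_bound[OF h(1) Bop_integrable[OF h(1) z]]) (use h C gap_bounds[of r \<theta>] in auto)
  qed
 qed (rule C)
qed

lemma hc_bound:
 "\<exists>C>0. \<forall>f n. admissible f \<longrightarrow> ennreal ((real n + 1) * norm (hc f n)) \<le> ennreal C * T (nf f) (1 - 1 / (real n + 1))"
proof -
 obtain C where C: "0 < C" "\<And>t n. 0 \<le> t \<Longrightarrow> t < 1 \<Longrightarrow> ennreal (t ^ n * u n) \<le> ennreal C * Phi (min t (1 - 1 / (real n + 1)))"
  using coeff_Phi_bound by blast
 show ?thesis
 proof (intro exI[of _ C] conjI allI impI)
  fix f n assume f: "admissible f"
  let ?y = "1 - 1 / (real n + 1)"
  have e: "(\<lambda>t. f t * (of_real (t ^ n * u n) / 2) * of_real (w t)) = (\<lambda>t. f t * of_real (w t * t ^ n) * of_real (u n / 2))"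
   by (simp add: fun_eq_iff mult_ac)
  have i: "integrable lborel (\<lambda>t. f t * (of_real (t ^ n * u n) / 2) * of_real (w t))"
   unfolding e by (intro integrable_mult_left integrable_mom f)
  have "(real n + 1) * norm (hc f n) = norm (mom f n) * (u n / 2)" unfolding norm_hc by (simp add: field_simps)
  also have "\<dots> = norm (LBINT t. f t * (of_real (t ^ n * u n) / 2) * of_real (w t))"
   unfolding e mom_def integral_mult_left_zero norm_mult norm_of_real by simp
  finally have eq: "(real n + 1) * norm (hc f n) = norm (LBINT t. f t * (of_real (t ^ n * u n) / 2) * of_real (w t)) * 1" by simp
  show "ennreal ((real n + 1) * norm (hc f n)) \<le> ennreal C * T (nf f) ?y"
   unfolding eq by (rule kernel_integral_bound[OF f i]) (use C in \<open>auto simp: norm_mult norm_power\<close>)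
 qed (rule C)
qed

lemma Hop_deriv_near_0:
 "\<exists>C>0. \<forall>f z. admissible f \<longrightarrow> norm z \<le> 1/2 \<longrightarrow> norm (deriv (Hop f) z) \<le> C * (LBINT t. norm (f t) * w t)"
proof -
 have s: "summable (\<lambda>n. u (Suc n) * (1/2) ^ n)"
 proof -
  have "summable (\<lambda>n. u (Suc n) * (1/2) ^ Suc n)" by (subst summable_Suc_iff) (intro summable_u; simp)
  from summable_mult[OF this, of 2] show ?thesis by simp
 qed
 define S where "S = (\<Sum>n. u (Suc n) * (1/2) ^ n)"
 have S: "0 < S" unfolding S_def by (intro suminf_pos s) simp
 have "norm (deriv (Hop f) z) \<le> S * (LBINT t. norm (f t) * w t)" if f: "admissible f" and z: "norm z \<le> 1/2" for f z
 proof -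
  define I where "I = (LBINT t. norm (f t) * w t)"
  have le: "norm (of_nat (Suc n) * hc f (Suc n) * z ^ n) \<le> I * (u (Suc n) * (1/2) ^ n)" for n
  proof -
   define M where "M = real n + 1"
   have M: "0 < M" "real (Suc n) = M" by (auto simp: M_def)
   have I: "norm (mom f (Suc n)) \<le> I" unfolding I_def by (rule norm_mom_le[OF f])
   have "norm (of_nat (Suc n) * hc f (Suc n) * z ^ n) = norm (mom f (Suc n)) * ((M * (u (Suc n) / (M + 1) / 2)) * norm z ^ n)"
    by (simp only: norm_mult norm_power norm_hc norm_of_nat M(2) mult_ac)
   also have "\<dots> \<le> I * (u (Suc n) * (1/2) ^ n)"
   proof (intro mult_mono power_mono I z)
    have "u (Suc n) * (M / (2 * (M + 1))) \<le> u (Suc n) * 1" using M by (intro mult_left_mono) auto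
    then show "M * (u (Suc n) / (M + 1) / 2) \<le> u (Suc n)" by (simp add: mult_ac)
    show "0 \<le> I" using I norm_ge_zero order.trans by blast
   qed (use M in auto)
   finally show ?thesis .
  qed
  have "norm (deriv (Hop f) z) \<le> (\<Sum>n. I * (u (Suc n) * (1/2) ^ n))"
  proof -
   have "norm z < 1" using z by simp
   show ?thesis unfolding Hop_deriv_eq[OF f \<open>norm z < 1\<close>] by (rule norm_suminf_le[OF le summable_mult[OF s]])
  qed
  also have "\<dots> = S * I" unfolding S_def by (subst suminf_mult[OF s]) (rule mult.commute)
  finally show ?thesis by (simp add: I_def)
 qed
 then show ?thesis using S by blast
qed

text \<open>Away from the origin \<open>Hop_deriv\<close> expresses the derivative by \<open>Bop\<close> and
  \<open>Hop\<close>; near the origin its quotient by \<open>z\<close> is useless, and the power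
  series is estimated directly.\<close>

lemma Hop_deriv_bound:
 "\<exists>C>0. \<forall>f r \<theta>. admissible f \<longrightarrow> 0 \<le> r \<longrightarrow> r < 1 \<longrightarrow> \<theta> \<in> {0..2*pi} \<longrightarrow>
  ennreal (norm (deriv (Hop f) (of_real r * cis \<theta>)) * (1 - gap r \<theta>)) \<le> ennreal C * T (nf f) (gap r \<theta>)"
proof -
 obtain C1 where C1: "0 < C1" "\<And>f r \<theta>. admissible f \<Longrightarrow> 0 \<le> r \<Longrightarrow> r < 1 \<Longrightarrow> \<theta> \<in> {0..2*pi} \<Longrightarrow>
  ennreal (norm (Hop f (of_real r * cis \<theta>))) \<le> ennreal C1 * T (nf f) (gap r \<theta>)"
  using Hop_bound by blast
 obtain C2 where C2: "0 < C2" "\<And>f r \<theta>. admissible f \<Longrightarrow> 0 \<le> r \<Longrightarrow> r < 1 \<Longrightarrow> \<theta> \<in> {0..2*pi} \<Longrightarrow>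
  ennreal (norm (Bop f (of_real r * cis \<theta>)) * (1 - gap r \<theta>)) \<le> ennreal C2 * T (nf f) (gap r \<theta>)"
  using Bop_bound by blast
 obtain C3 where C3: "0 < C3" "\<And>f z. admissible f \<Longrightarrow> norm z \<le> 1/2 \<Longrightarrow> norm (deriv (Hop f) z) \<le> C3 * (LBINT t. norm (f t) * w t)"
  using Hop_deriv_near_0 by blast
 show ?thesis
 proof (intro exI[of _ "C3 + 2 * (C1 + C2)"] conjI allI impI)
  show "0 < C3 + 2 * (C1 + C2)" using C1 C2 C3 by simp
  fix f and r \<theta> :: real assume h: "admissible f" "0 \<le> r" "r < 1" "\<theta> \<in> {0..2*pi}"
  define z where "z = of_real r * cis \<theta>"
  define y where "y = gap r \<theta>"
  have y: "0 \<le> y" "y < 1" using gap_bounds[of r \<theta>] h by (auto simp: y_def)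
  have nz: "norm z = r" using h by (simp add: z_def norm_mult)
  show "ennreal (norm (deriv (Hop f) (of_real r * cis \<theta>)) * (1 - gap r \<theta>)) \<le> ennreal (C3 + 2 * (C1 + C2)) * T (nf f) (gap r \<theta>)"
  proof (cases "r \<le> 1/2")
   case True
   define I where "I = (LBINT t. norm (f t) * w t)"
   have "norm (deriv (Hop f) z) * (1 - y) \<le> norm (deriv (Hop f) z) * 1" using y by (intro mult_left_mono) auto
   also have "\<dots> \<le> C3 * I" using C3(2)[OF h(1), of z] True nz by (simp add: I_def)
   finally have "ennreal (norm (deriv (Hop f) z) * (1 - y)) \<le> ennreal (C3 * I)" by (rule ennreal_leI)
   also have "\<dots> = ennreal C3 * ennreal I" using C3(1) by (intro ennreal_mult') simp
   also have "\<dots> \<le> ennreal C3 * T (nf f) y" unfolding I_def by (intro mult_left_mono total_le_T h) auto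
   also have "\<dots> \<le> ennreal (C3 + 2 * (C1 + C2)) * T (nf f) y" using C1 C2 by (intro mult_right_mono ennreal_leI) auto
   finally show ?thesis by (simp add: z_def y_def)
  next
   case False
   then have z0: "z \<noteq> 0" using nz by auto
   have "deriv (Hop f) z = (Bop f z - Hop f z) / z" using h z0 nz by (intro Hop_deriv) auto
   then have "norm (deriv (Hop f) z) = norm (Bop f z - Hop f z) / r" by (simp add: norm_divide nz)
   also have "\<dots> \<le> norm (Bop f z - Hop f z) / (1/2)" using False by (intro divide_left_mono) auto
   also have "\<dots> \<le> 2 * (norm (Bop f z) + norm (Hop f z))" using norm_triangle_ineq4[of "Bop f z" "Hop f z"] by simp
   finally have "norm (deriv (Hop f) z) * (1 - y) \<le> 2 * (norm (Bop f z) + norm (Hop f z)) * (1 - y)"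
    using y by (intro mult_right_mono) auto
   also have "\<dots> \<le> 2 * (norm (Bop f z) * (1 - y) + norm (Hop f z))"
    using y by (simp add: distrib_right mult_left_le)
   finally have "ennreal (norm (deriv (Hop f) z) * (1 - y)) \<le> ennreal (2 * (norm (Bop f z) * (1 - y) + norm (Hop f z)))" by (rule ennreal_leI)
   also have "\<dots> = 2 * (ennreal (norm (Bop f z) * (1 - y)) + ennreal (norm (Hop f z)))"
    using y by (simp add: ennreal_mult ennreal_plus)
   also have "\<dots> \<le> 2 * (ennreal C2 * T (nf f) y + ennreal C1 * T (nf f) y)"
    unfolding z_def y_def by (intro mult_left_mono add_mono C1 C2 h) auto
   also have "\<dots> = ennreal (2 * (C1 + C2)) * T (nf f) y"
    using C1 C2 by (simp add: ennreal_mult ennreal_plus distrib_left distrib_right mult_ac add_ac)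
   also have "\<dots> \<le> ennreal (C3 + 2 * (C1 + C2)) * T (nf f) y" using C3 by (intro mult_right_mono ennreal_leI) auto
   finally show ?thesis by (simp add: z_def y_def)
  qed
 qed
qed

text \<open>Folding the circle makes \<open>1 - circle_dist \<theta>\<close> the variable of integration.\<close>

lemma T_circle:
 assumes [measurable]: "f \<in> borel_measurable borel" and p: "1 < p"
 shows "(NINT \<theta>:{0..2*pi}. epow (T f (1 - circle_dist \<theta>)) p)
  \<le> ennreal (4*pi) * (NINT y:{0<..<1}. epow (T f y) p)"
proof -
 have "(NINT \<theta>:{0..2*pi}. epow (T f (1 - circle_dist \<theta>)) p) =
  ennreal (2*pi) * (NINT v:{0..1/2}. (epow (T f (1 - circle_dist (2*pi * v))) p + epow (T f (1 - circle_dist (2*pi - 2*pi * v))) p))"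
  by (rule nn_integral_fold_circle) measurable
 also have "\<dots> \<le> ennreal (2*pi) * (NINT v. 2 * (epow (T f (1 + (-1) * v)) p * indicator {0<..<1} (1 + (-1) * v)))"
 proof (intro mult_left_mono nn_integral_mono_AE)
  have "AE v in lborel. v \<noteq> (0::real)" by (rule AE_lborel_singleton)
  then show "AE v in lborel. (epow (T f (1 - circle_dist (2*pi * v))) p + epow (T f (1 - circle_dist (2*pi - 2*pi * v))) p) * indicator {0..1/2} v
   \<le> 2 * (epow (T f (1 + (-1) * v)) p * indicator {0<..<1} (1 + (-1) * v))"
  proof eventually_elim
   fix v :: real assume "v \<noteq> 0"
   show "(epow (T f (1 - circle_dist (2*pi * v))) p + epow (T f (1 - circle_dist (2*pi - 2*pi * v))) p) * indicator {0..1/2} v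
   \<le> 2 * (epow (T f (1 + (-1) * v)) p * indicator {0<..<1} (1 + (-1) * v))"
   proof (cases "v \<in> {0..1/2}")
    case True
    then have c: "circle_dist (2*pi * v) = v" "circle_dist (2*pi - 2*pi * v) = v"
     by (auto intro: circle_dist_scaled)
    show ?thesis unfolding c using True \<open>v \<noteq> 0\<close> by (simp add: mult_2)
   qed simp
  qed
 qed simp
 also have "\<dots> = ennreal (2*pi) * (2 * (NINT v. epow (T f (1 + (-1) * v)) p * indicator {0<..<1} (1 + (-1) * v)))"
  by (subst nn_integral_cmult) auto
 also have "(NINT v. epow (T f (1 + (-1) * v)) p * indicator {0<..<1} (1 + (-1) * v)) = (NINT y:{0<..<1}. epow (T f y) p)"
  by (subst (2) nn_integral_real_affine[of _ "-1" 1]) auto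
 also have "ennreal (2*pi) * (2 * (NINT y:{0<..<1}. epow (T f y) p)) = ennreal (4*pi) * (NINT y:{0<..<1}. epow (T f y) p)"
 proof -
  have "ennreal (4*pi) = ennreal (2*pi) * 2" by (simp add: ennreal_mult'[symmetric] ennreal_numeral[symmetric] del: ennreal_numeral)
  then show ?thesis by (simp add: mult.assoc)
 qed
 finally show ?thesis .
qed

lemma measure_circle_dist_le:
 assumes "0 \<le> a"
 shows "(NINT \<theta>:{0..2*pi}. (if circle_dist \<theta> \<le> a then 1 else 0)) \<le> ennreal (4 * pi * a)"
proof -
 have "(NINT \<theta>:{0..2*pi}. (if circle_dist \<theta> \<le> a then 1 else 0)) =
  ennreal (2*pi) * (NINT v:{0..1/2}. ((if circle_dist (2*pi * v) \<le> a then 1 else 0) + (if circle_dist (2*pi - 2*pi * v) \<le> a then 1 else 0)))"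
  by (rule nn_integral_fold_circle) measurable
 also have "\<dots> \<le> ennreal (2*pi) * (NINT v:{0..a}. 2)"
 proof (intro mult_left_mono nn_integral_mono)
  fix v :: real
  show "((if circle_dist (2*pi * v) \<le> a then 1 else 0) + (if circle_dist (2*pi - 2*pi * v) \<le> a then 1 else 0)) * indicator {0..1/2} v \<le> 2 * (indicator {0..a} v :: ennreal)"
  proof (cases "v \<in> {0..1/2}")
   case True
   then have c: "circle_dist (2*pi * v) = v" "circle_dist (2*pi - 2*pi * v) = v"
    by (auto intro: circle_dist_scaled)
   show ?thesis unfolding c using True by (auto simp: mult_2 split: split_indicator)
  qed simp
 qed simp
 also have "\<dots> = ennreal (2*pi) * (2 * ennreal a)" using assms by (subst nn_integral_cmult_indicator) auto
 also have "\<dots> = ennreal (4 * pi * a)"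
  using assms by (simp add: ennreal_mult'[symmetric] ennreal_numeral[symmetric] del: ennreal_numeral)
 finally show ?thesis .
qed

end

section \<open>Sufficiency\<close>

definition Lp_enn :: "real \<Rightarrow> (real \<Rightarrow> complex) \<Rightarrow> ennreal" where
 "Lp_enn p f = (NINT t:{0<..<1}. ennreal (norm (f t) powr p))"

lemma continuous_deriv: "g holomorphic_on ball 0 1 \<Longrightarrow> continuous_on (ball 0 1) (deriv g)"
 by (intro holomorphic_on_imp_continuous_on holomorphic_deriv) auto

lemma measurable_disc_fun:
 fixes g :: "complex \<Rightarrow> real"
 assumes "continuous_on (ball 0 1) g"
 shows "(\<lambda>z. ennreal (g z) * indicator (ball 0 1) z) \<in> borel_measurable borel"
proof -
 have "(\<lambda>z. indicator (ball 0 1) z *\<^sub>R g z) \<in> borel_measurable borel"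
  using assms by (intro borel_measurable_continuous_on_indicator) auto
 then have "(\<lambda>z. ennreal (indicator (ball 0 1) z *\<^sub>R g z)) \<in> borel_measurable borel" by measurable
 also have "(\<lambda>z. ennreal (indicator (ball 0 1) z *\<^sub>R g z)) = (\<lambda>z. ennreal (g z) * indicator (ball 0 1) z)"
  by (auto simp: fun_eq_iff split: split_indicator)
 finally show ?thesis .
qed

definition dirichlet_enn :: "real \<Rightarrow> (complex \<Rightarrow> complex) \<Rightarrow> ennreal" where
 "dirichlet_enn p g = (NINT z:(ball 0 1). ennreal (norm (deriv g z) powr p * (1 - (norm z)\<^sup>2) powr (p - 1)))"

lemma continuous_dirichlet_integrand:
 assumes g: "g holomorphic_on ball 0 1" and p: "1 < p"
 shows "continuous_on (ball 0 1) (\<lambda>z. norm (deriv g z) powr p * (1 - (norm z)\<^sup>2) powr (p - 1))"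
proof (rule continuous_on_mult)
 have c: "continuous_on (ball 0 1) (\<lambda>z. norm (deriv g z))" by (intro continuous_on_norm continuous_deriv g)
 show "continuous_on (ball 0 1) (\<lambda>z. norm (deriv g z) powr p)"
  by (rule continuous_on_powr'[OF c]) (use p in auto)
 have c: "continuous_on (ball 0 1) (\<lambda>z::complex. 1 - (norm z)\<^sup>2)" by (intro continuous_intros)
 show "continuous_on (ball 0 1) (\<lambda>z::complex. (1 - (norm z)\<^sup>2) powr (p - 1))"
  by (rule continuous_on_powr'[OF c]) (use p in \<open>auto simp: power_le_one\<close>)
qed

lemma dirichlet_enn_polar:
 assumes g: "g holomorphic_on ball 0 1" and p: "1 < p"
 shows "dirichlet_enn p g = (NINT \<theta>:{0..2*pi}. (NINT r:{0<..<1}. ennreal r * ennreal (norm (deriv g (of_real r * cis \<theta>)) powr p * (1 - r\<^sup>2) powr (p - 1))))"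
proof -
 have eq: "ennreal r * (ennreal (norm (deriv g (of_real r * cis \<theta>)) powr p * (1 - (norm (of_real r * cis \<theta>))\<^sup>2) powr (p - 1)) *
   indicator (ball 0 1) (of_real r * cis \<theta>)) * indicator {0<..} r =
   ennreal r * ennreal (norm (deriv g (of_real r * cis \<theta>)) powr p * (1 - r\<^sup>2) powr (p - 1)) * indicator {0<..<1} r" for r \<theta>
  by (auto simp: norm_mult split: split_indicator)
 show ?thesis
  unfolding dirichlet_enn_def nn_integral_polar[OF measurable_disc_fun[OF continuous_dirichlet_integrand[OF g p]]] eq ..
qed

context dweight
begin

lemma Lp_enn_epow: "Lp_enn p f = (NINT t:{0<..<1}. epow (nf f t) p)" by (simp add: Lp_enn_def)

lemma epow_le_T:
 assumes "ennreal a \<le> ennreal C * X" "0 < p" "0 \<le> a" "0 \<le> C"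
 shows "ennreal (a powr p) \<le> ennreal (C powr p) * epow X p"
 using epow_mono[OF assms(1,2)] assms by (simp add: epow_mult)

lemma gap_le: "gap r \<theta> \<le> 1 - circle_dist \<theta>" "gap r \<theta> \<le> r" by (auto simp: gap_def)

text \<open>\<open>Hop_bound\<close>, monotonicity of \<open>T\<close> and \<open>T_circle\<close>.\<close>

theorem Hop_Hardy:
 assumes m: "muck p q K" and p: "1 < p" "1 / p + 1 / q = 1"
 shows "\<exists>C>0. \<forall>f r. admissible f \<longrightarrow> 0 < r \<longrightarrow> r < 1 \<longrightarrow> circle_mean p (Hop f) r \<le> ennreal C * Lp_enn p f"
proof -
 obtain C where C: "0 < C" "\<And>f. f \<in> borel_measurable borel \<Longrightarrow> (NINT y:{0<..<1}. epow (T f y) p)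
   \<le> ennreal C * (NINT t:{0<..<1}. epow (f t) p)" using T_bound[OF m p] by blast
 obtain D where D: "0 < D" "\<And>f r \<theta>. admissible f \<Longrightarrow> 0 \<le> r \<Longrightarrow> r < 1 \<Longrightarrow> \<theta> \<in> {0..2*pi} \<Longrightarrow>
  ennreal (norm (Hop f (of_real r * cis \<theta>))) \<le> ennreal D * T (nf f) (gap r \<theta>)"
  using Hop_bound by blast
 show ?thesis
 proof (intro exI[of _ "D powr p * (4*pi * C)"] conjI allI impI)
  show "0 < D powr p * (4*pi * C)" using C D by simp
  fix f and r :: real assume h: "admissible f" "0 < r" "r < 1"
  have [measurable]: "f \<in> borel_measurable borel" using h(1) by (rule admissible_measurable)
  have nfm: "nf f \<in> borel_measurable borel" by measurable
  have Tm [measurable]: "T (nf f) \<in> borel_measurable borel" by (rule measurable_T[OF nfm])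
  have "circle_mean p (Hop f) r \<le> (NINT \<theta>. ennreal (D powr p) * (epow (T (nf f) (1 - circle_dist \<theta>)) p * indicator {0..2*pi} \<theta>))"
   unfolding circle_mean_def
  proof (rule nn_integral_mono)
   fix \<theta>
   show "ennreal (norm (Hop f (of_real r * cis \<theta>)) powr p) * indicator {0..2*pi} \<theta>
     \<le> ennreal (D powr p) * (epow (T (nf f) (1 - circle_dist \<theta>)) p * indicator {0..2*pi} \<theta>)"
   proof (cases "\<theta> \<in> {0..2*pi}")
    case True
    have "ennreal (norm (Hop f (of_real r * cis \<theta>))) \<le> ennreal D * T (nf f) (gap r \<theta>)" using h True by (intro D) auto
    also have "\<dots> \<le> ennreal D * T (nf f) (1 - circle_dist \<theta>)" by (intro mult_left_mono T_mono gap_le) auto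
    finally have "ennreal (norm (Hop f (of_real r * cis \<theta>)) powr p) \<le> ennreal (D powr p) * epow (T (nf f) (1 - circle_dist \<theta>)) p"
     using p D by (intro epow_le_T) auto
    then show ?thesis using True by simp
   qed simp
  qed
  also have "\<dots> = ennreal (D powr p) * (NINT \<theta>:{0..2*pi}. epow (T (nf f) (1 - circle_dist \<theta>)) p)"
   by (rule nn_integral_cmult) measurable
  also have "\<dots> \<le> ennreal (D powr p) * (ennreal (4*pi) * (NINT y:{0<..<1}. epow (T (nf f) y) p))"
   by (intro mult_left_mono T_circle[OF nfm p(1)]) auto
  also have "\<dots> \<le> ennreal (D powr p) * (ennreal (4*pi) * (ennreal C * Lp_enn p f))"
   unfolding Lp_enn_epow by (intro mult_left_mono C(2)[OF nfm]) auto
  also have "\<dots> = ennreal (D powr p * (4*pi * C)) * Lp_enn p f"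
   using C D by (simp add: ennreal_mult mult.assoc)
  finally show "circle_mean p (Hop f) r \<le> ennreal (D powr p * (4*pi * C)) * Lp_enn p f" .
 qed
qed

lemma Hop_0_bound:
 assumes m: "muck p q K" and p: "1 < p" "1 / p + 1 / q = 1"
 shows "\<exists>C>0. \<forall>f. admissible f \<longrightarrow> ennreal (norm (Hop f 0) powr p) \<le> ennreal C * Lp_enn p f"
proof -
 obtain D where D: "0 < D" "\<And>f n. admissible f \<Longrightarrow> ennreal ((real n + 1) * norm (hc f n)) \<le> ennreal D * T (nf f) (1 - 1 / (real n + 1))"
  using hc_bound by blast
 obtain C where C: "0 < C" "\<And>f. f \<in> borel_measurable borel \<Longrightarrow> (NINT y:{0<..<1}. epow (T f y) p)
   \<le> ennreal C * (NINT t:{0<..<1}. epow (f t) p)" using T_bound[OF m p] by blast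
 show ?thesis
 proof (intro exI[of _ "D powr p * C"] conjI allI impI)
  show "0 < D powr p * C" using C D by simp
  fix f assume f: "admissible f"
  have [measurable]: "f \<in> borel_measurable borel" using f by (rule admissible_measurable)
  have nfm: "nf f \<in> borel_measurable borel" by measurable
  have "Hop f 0 = hc f 0" using Hop_eq[OF f, of 0] powser_zero[of "hc f"] by simp
  then have "ennreal (norm (Hop f 0) powr p) \<le> ennreal (D powr p) * epow (T (nf f) 0) p"
   using D(2)[OF f, of 0] D(1) p by (intro epow_le_T) auto
  also have "epow (T (nf f) 0) p = (NINT y:{0<..<1::real}. epow (T (nf f) 0) p)"
   by (subst nn_integral_cmult_indicator) auto
  then have "ennreal (D powr p) * epow (T (nf f) 0) p = ennreal (D powr p) * (NINT y:{0<..<1::real}. epow (T (nf f) 0) p)" by simp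
  also have "\<dots> \<le> ennreal (D powr p) * (NINT y:{0<..<1::real}. epow (T (nf f) y) p)"
   using p by (intro mult_left_mono nn_integral_mono) (auto intro!: epow_mono T_mono split: split_indicator)
  also have "\<dots> \<le> ennreal (D powr p) * (ennreal C * Lp_enn p f)"
   unfolding Lp_enn_epow by (intro mult_left_mono C(2)[OF nfm]) auto
  also have "\<dots> = ennreal (D powr p * C) * Lp_enn p f" using C by (simp add: ennreal_mult mult.assoc)
  finally show "ennreal (norm (Hop f 0) powr p) \<le> ennreal (D powr p * C) * Lp_enn p f" .
 qed
qed

text \<open>By \<open>hc_bound\<close> the \<open>n\<close>-th term is at most \<open>(T f)\<^sup>p\<close> at
  \<open>1 - 1 / (n + 1)\<close> times \<open>(n + 1) powr (-2)\<close>, and the latter is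
  comparable with the length of the interval up to the next such point, on which \<open>T f\<close>
  is larger by monotonicity.\<close>

theorem Hop_HL:
 assumes m: "muck p q K" and p: "1 < p" "1 / p + 1 / q = 1"
 shows "\<exists>C>0. \<forall>f. admissible f \<longrightarrow> (\<Sum>n. ennreal (norm (hc f n) powr p * (real n + 1) powr (p - 2))) \<le> ennreal C * Lp_enn p f"
proof -
 obtain D where D: "0 < D" "\<And>f n. admissible f \<Longrightarrow> ennreal ((real n + 1) * norm (hc f n)) \<le> ennreal D * T (nf f) (1 - 1 / (real n + 1))"
  using hc_bound by blast
 obtain C where C: "0 < C" "\<And>f. f \<in> borel_measurable borel \<Longrightarrow> (NINT y:{0<..<1}. epow (T f y) p)
   \<le> ennreal C * (NINT t:{0<..<1}. epow (f t) p)" using T_bound[OF m p] by blast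
 show ?thesis
 proof (intro exI[of _ "2 * D powr p * C"] conjI allI impI)
  show "0 < 2 * D powr p * C" using C D by simp
  fix f assume f: "admissible f"
  have [measurable]: "f \<in> borel_measurable borel" using f by (rule admissible_measurable)
  have nfm: "nf f \<in> borel_measurable borel" by measurable
  have Tm [measurable]: "T (nf f) \<in> borel_measurable borel" by (rule measurable_T[OF nfm])
  define y where "y n = 1 - 1 / (real n + 1)" for n :: nat
  define A where "A n = {y n<..<y (Suc n)}" for n
  have y_mono: "y m \<le> y n" if "m \<le> n" for m n using that by (auto simp: y_def intro!: divide_left_mono)
  have y01: "0 \<le> y n" "y n < 1" for n by (auto simp: y_def divide_le_eq)
  have ylen: "y (Suc n) - y n = 1 / ((real n + 1) * (real n + 2))" for n by (simp add: y_def field_simps)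
  have disj: "disjoint_family A" unfolding disjoint_family_on_def
  proof safe
   fix m n x assume "m \<noteq> n" and x: "x \<in> A m" "x \<in> A n"
   then consider "Suc m \<le> n" | "Suc n \<le> m" by linarith
   then show "x \<in> {}" using x y_mono[of "Suc m" n] y_mono[of "Suc n" m] by cases (auto simp: A_def)
  qed
  have term_le: "ennreal (norm (hc f n) powr p * (real n + 1) powr (p - 2)) \<le>
   ennreal (2 * D powr p) * (NINT x:(A n). epow (T (nf f) x) p)" for n
  proof -
   have "norm (hc f n) powr p * (real n + 1) powr (p - 2) = ((real n + 1) * norm (hc f n)) powr p * (1 / (real n + 1) powr 2)"
   proof -
    have "((real n + 1) * norm (hc f n)) powr p = (real n + 1) powr p * norm (hc f n) powr p" by (rule powr_mult)
    then show ?thesis by (simp add: powr_diff mult_ac del: of_nat_Suc)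
   qed
   also have "(real n + 1) powr 2 = (real n + 1)^2" by (simp add: powr_numeral)
   finally have e: "norm (hc f n) powr p * (real n + 1) powr (p - 2) = ((real n + 1) * norm (hc f n)) powr p * (1 / (real n + 1)^2)" .
   have "1 / (real n + 1)^2 \<le> 2 * (y (Suc n) - y n)"
   proof -
    define a where "a = real n + 1"
    have a: "1 \<le> a" by (simp add: a_def)
    then have "a * (a + 1) \<le> 2 * a\<^sup>2" by (simp add: power2_eq_square algebra_simps)
    then have "2 / (2 * a\<^sup>2) \<le> 2 / (a * (a + 1))" using a by (intro divide_left_mono mult_pos_pos) auto
    then show ?thesis unfolding ylen a_def[symmetric] by (simp add: a_def add.assoc)
   qed
   then have "ennreal (norm (hc f n) powr p * (real n + 1) powr (p - 2)) \<le> ennreal (((real n + 1) * norm (hc f n)) powr p * (2 * (y (Suc n) - y n)))"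
    unfolding e by (intro ennreal_leI mult_left_mono) auto
   also have "\<dots> = ennreal (((real n + 1) * norm (hc f n)) powr p) * (2 * ennreal (y (Suc n) - y n))"
   proof -
    define d where "d = y (Suc n) - y n"
    have "0 \<le> d" using y_mono[of n "Suc n"] by (simp add: d_def)
    then show ?thesis unfolding d_def[symmetric] by (simp add: ennreal_mult)
   qed
   also have "\<dots> \<le> (ennreal (D powr p) * epow (T (nf f) (y n)) p) * (2 * ennreal (y (Suc n) - y n))"
    using D(2)[OF f, of n] D(1) p unfolding y_def by (intro mult_right_mono epow_le_T) auto
   also have "\<dots> = ennreal (2 * D powr p) * (epow (T (nf f) (y n)) p * ennreal (y (Suc n) - y n))"
    by (simp add: ennreal_mult mult_ac)
   also have "epow (T (nf f) (y n)) p * ennreal (y (Suc n) - y n) = (NINT x:(A n). epow (T (nf f) (y n)) p)"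
    using y_mono[of n "Suc n"] by (subst nn_integral_cmult_indicator) (auto simp: A_def)
   finally have 1: "ennreal (norm (hc f n) powr p * (real n + 1) powr (p - 2)) \<le> ennreal (2 * D powr p) * (NINT x:(A n). epow (T (nf f) (y n)) p)" .
   have 2: "(NINT x:(A n). epow (T (nf f) (y n)) p) \<le> (NINT x:(A n). epow (T (nf f) x) p)"
    using p by (intro nn_integral_mono) (auto simp: A_def intro!: epow_mono T_mono split: split_indicator)
   show ?thesis by (intro order.trans[OF 1] mult_left_mono 2) auto
  qed
  have sumI: "(\<Sum>n. (NINT x:(A n). epow (T (nf f) x) p)) \<le> (NINT x:{0<..<1}. epow (T (nf f) x) p)"
  proof -
   let ?M = "density lborel (\<lambda>x. epow (T (nf f) x) p)"
   have "(\<Sum>n. (NINT x:(A n). epow (T (nf f) x) p)) = (\<Sum>n. emeasure ?M (A n))"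
    by (intro suminf_cong emeasure_density[symmetric]) (auto simp: A_def)
   also have "\<dots> = emeasure ?M (\<Union>n. A n)" by (intro suminf_emeasure disj) (auto simp: A_def)
   also have "\<dots> \<le> emeasure ?M {0<..<1}"
   proof (rule emeasure_mono)
    show "(\<Union>n. A n) \<subseteq> {0<..<1}"
    proof safe
     fix x n assume "x \<in> A n"
     then show "x \<in> {0<..<1}" using y01(1)[of n] y01(2)[of "Suc n"] by (auto simp: A_def)
    qed
   qed simp
   also have "\<dots> = (NINT x:{0<..<1}. epow (T (nf f) x) p)" by (intro emeasure_density) auto
   finally show ?thesis .
  qed
  have "(\<Sum>n. ennreal (norm (hc f n) powr p * (real n + 1) powr (p - 2))) \<le> (\<Sum>n. ennreal (2 * D powr p) * (NINT x:(A n). epow (T (nf f) x) p))"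
   by (intro suminf_le term_le) auto
  also have "\<dots> = ennreal (2 * D powr p) * (\<Sum>n. (NINT x:(A n). epow (T (nf f) x) p))"
   by (rule ennreal_suminf_cmult)
  also have "\<dots> \<le> ennreal (2 * D powr p) * (ennreal C * Lp_enn p f)"
   unfolding Lp_enn_epow by (intro mult_left_mono order.trans[OF sumI C(2)[OF nfm]]) auto
  also have "\<dots> = ennreal (2 * D powr p * C) * Lp_enn p f" using C by (simp add: ennreal_mult mult.assoc)
  finally show "(\<Sum>n. ennreal (norm (hc f n) powr p * (real n + 1) powr (p - 2))) \<le> ennreal (2 * D powr p * C) * Lp_enn p f" .
 qed
qed

text \<open>In polar coordinates the integrand is dominated by \<open>(T f)\<^sup>p\<close> at
  \<open>gap r \<theta>\<close> times a power weight. Where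
  \<open>circle_dist \<theta> \<le> 1 - r\<close> (\<open>X1\<close>) integrate over
  \<open>\<theta>\<close> first, elsewhere (\<open>X2\<close>) over \<open>r\<close> first; in both
  cases the inner integral of the weight is bounded and an integral of \<open>(T f)\<^sup>p\<close>
  over the interval remains.\<close>

theorem Hop_Dirichlet:
 assumes m: "muck p q K" and p: "1 < p" "1 / p + 1 / q = 1"
 shows "\<exists>C>0. \<forall>f. admissible f \<longrightarrow> dirichlet_enn p (Hop f) \<le> ennreal C * Lp_enn p f"
proof -
 obtain C where C: "0 < C" "\<And>f. f \<in> borel_measurable borel \<Longrightarrow> (NINT y:{0<..<1}. epow (T f y) p)
   \<le> ennreal C * (NINT t:{0<..<1}. epow (f t) p)" using T_bound[OF m p] by blast
 obtain D where D: "0 < D" "\<And>f r \<theta>. admissible f \<Longrightarrow> 0 \<le> r \<Longrightarrow> r < 1 \<Longrightarrow> \<theta> \<in> {0..2*pi} \<Longrightarrow>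
  ennreal (norm (deriv (Hop f) (of_real r * cis \<theta>)) * (1 - gap r \<theta>)) \<le> ennreal D * T (nf f) (gap r \<theta>)"
  using Hop_deriv_bound by blast
 define B where "B = D powr p * 2 powr (p - 1)"
 have B: "0 < B" using D by (simp add: B_def)
 show ?thesis
 proof (intro exI[of _ "B * (8 * pi * C)"] conjI allI impI)
  show "0 < B * (8 * pi * C)" using B C by simp
  fix f assume f: "admissible f"
  have [measurable]: "f \<in> borel_measurable borel" using f by (rule admissible_measurable)
  have nfm: "nf f \<in> borel_measurable borel" by measurable
  have Tm [measurable]: "T (nf f) \<in> borel_measurable borel" by (rule measurable_T[OF nfm])
  define E where "E x = epow (T (nf f) x) p" for x
  have [measurable]: "E \<in> borel_measurable borel" unfolding E_def by measurable
  define TT where "TT = (NINT y:{0<..<1}. E y)"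
  define X1 where "X1 r \<theta> = E r * ennreal (1 / (1 - r)) * (if circle_dist \<theta> \<le> 1 - r then 1 else 0) * indicator {0<..<1} r" for r \<theta>
  define X2 where "X2 r \<theta> = E (1 - circle_dist \<theta>) * ennreal ((1 - r) powr (p - 1) / circle_dist \<theta> powr p) * (if 1 - r < circle_dist \<theta> then 1 else 0) * indicator {0<..<1} r" for r \<theta>
  have X1m [measurable]: "(\<lambda>(r,\<theta>). X1 r \<theta>) \<in> borel_measurable (borel \<Otimes>\<^sub>M borel)"
   "(\<lambda>(\<theta>,r). X1 r \<theta>) \<in> borel_measurable (borel \<Otimes>\<^sub>M borel)" unfolding X1_def by measurable
  have X2m [measurable]: "(\<lambda>(r,\<theta>). X2 r \<theta>) \<in> borel_measurable (borel \<Otimes>\<^sub>M borel)"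
   "(\<lambda>(\<theta>,r). X2 r \<theta>) \<in> borel_measurable (borel \<Otimes>\<^sub>M borel)" unfolding X2_def by measurable
  have pt: "ennreal r * ennreal (norm (deriv (Hop f) (of_real r * cis \<theta>)) powr p * (1 - r\<^sup>2) powr (p - 1)) * indicator {0<..<1} r
    \<le> ennreal B * (X1 r \<theta> + X2 r \<theta>)" if \<theta>: "\<theta> \<in> {0..2*pi}" for r \<theta>
  proof (cases "r \<in> {0<..<1}")
   case True
   define c where "c = 1 - gap r \<theta>"
   have c: "c = max (1 - r) (circle_dist \<theta>)" unfolding c_def by (rule one_minus_gap)
   have c0: "0 < c" using True unfolding c by auto
   define G where "G = norm (deriv (Hop f) (of_real r * cis \<theta>))"
   have "ennreal (G * c) \<le> ennreal D * T (nf f) (gap r \<theta>)"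
    unfolding G_def c_def using True \<theta> by (intro D f) auto
   then have "ennreal ((G * c) powr p) \<le> ennreal (D powr p) * E (gap r \<theta>)"
    unfolding E_def using p D c0 by (intro epow_le_T) (auto simp: G_def)
   then have 1: "ennreal ((G * c) powr p) * ennreal ((1 - r) powr (p - 1) / c powr p) \<le> ennreal (D powr p) * E (gap r \<theta>) * ennreal ((1 - r) powr (p - 1) / c powr p)"
    by (rule mult_right_mono) simp
   have r2: "(1 - r\<^sup>2) powr (p - 1) \<le> 2 powr (p - 1) * (1 - r) powr (p - 1)"
   proof -
    have "1 - r\<^sup>2 \<le> 2 * (1 - r)" using sum_squares_ge_zero[of "1 - r" 0] by (simp add: power2_eq_square algebra_simps)
    then have "(1 - r\<^sup>2) powr (p - 1) \<le> (2 * (1 - r)) powr (p - 1)"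
     using True p by (intro powr_mono2) (auto simp: power_le_one)
    also have "(2 * (1 - r)) powr (p - 1) = 2 powr (p - 1) * (1 - r) powr (p - 1)" by (rule powr_mult)
    finally show ?thesis .
   qed
   have "ennreal r * ennreal (G powr p * (1 - r\<^sup>2) powr (p - 1)) \<le> 1 * ennreal (G powr p * (2 powr (p - 1) * (1 - r) powr (p - 1)))"
    using True r2 by (intro mult_mono ennreal_leI mult_left_mono) auto
   also have "\<dots> = ennreal (2 powr (p - 1)) * (ennreal ((G * c) powr p) * ennreal ((1 - r) powr (p - 1) / c powr p))"
    using c0 by (simp add: ennreal_mult[symmetric] powr_mult G_def mult_ac)
   also have "\<dots> \<le> ennreal (2 powr (p - 1)) * (ennreal (D powr p) * E (gap r \<theta>) * ennreal ((1 - r) powr (p - 1) / c powr p))"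
    by (intro mult_left_mono 1) auto
   also have "\<dots> = ennreal B * (E (gap r \<theta>) * ennreal ((1 - r) powr (p - 1) / c powr p))"
    using D(1) by (simp add: B_def ennreal_mult mult_ac)
   also have "\<dots> \<le> ennreal B * (X1 r \<theta> + X2 r \<theta>)"
   proof (intro mult_left_mono)
    show "E (gap r \<theta>) * ennreal ((1 - r) powr (p - 1) / c powr p) \<le> X1 r \<theta> + X2 r \<theta>"
    proof (cases "circle_dist \<theta> \<le> 1 - r")
     case le: True
     then have "c = 1 - r" "gap r \<theta> = r" using c c_def by (auto simp: max_def)
     moreover have "(1 - r) powr (p - 1) / (1 - r) powr p = 1 / (1 - r)" using True by (simp add: powr_diff)
     ultimately have "E (gap r \<theta>) * ennreal ((1 - r) powr (p - 1) / c powr p) = X1 r \<theta>"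
      using True le by (simp add: X1_def)
     then show ?thesis by simp
    next
     case False
     then have "c = circle_dist \<theta>" "gap r \<theta> = 1 - circle_dist \<theta>" using c c_def by (auto simp: max_def)
     then have "E (gap r \<theta>) * ennreal ((1 - r) powr (p - 1) / c powr p) = X2 r \<theta>"
      using True False by (simp add: X2_def)
     then show ?thesis by simp
    qed
   qed auto
   finally show ?thesis using True by (simp add: G_def)
  qed simp
  let ?J1 = "\<lambda>\<theta>. (NINT r. X1 r \<theta>)" and ?J2 = "\<lambda>\<theta>. (NINT r. X2 r \<theta>)"
  let ?I1 = "(NINT \<theta>:{0..2*pi}. ?J1 \<theta>)" and ?I2 = "(NINT \<theta>:{0..2*pi}. ?J2 \<theta>)"
  have I1: "?I1 \<le> ennreal (4*pi) * TT"
  proof -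
   have "?I1 = (NINT \<theta>. (NINT r. X1 r \<theta> * indicator {0..2*pi} \<theta>))"
    by (intro nn_integral_cong nn_integral_multc[symmetric]) measurable
   also have "\<dots> = (NINT r. (NINT \<theta>:{0..2*pi}. X1 r \<theta>))"
    by (rule lborel_pair.Fubini'[symmetric]) measurable
   also have "\<dots> \<le> (NINT r. ennreal (4*pi) * (E r * indicator {0<..<1} r))"
   proof (rule nn_integral_mono)
    fix r :: real
    show "(NINT \<theta>:{0..2*pi}. X1 r \<theta>) \<le> ennreal (4*pi) * (E r * indicator {0<..<1} r)"
    proof (cases "r \<in> {0<..<1}")
     case True
     have "(NINT \<theta>:{0..2*pi}. X1 r \<theta>) = (NINT \<theta>. E r * ennreal (1 / (1 - r)) * ((if circle_dist \<theta> \<le> 1 - r then 1 else 0) * indicator {0..2*pi} \<theta>))"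
      using True by (intro nn_integral_cong) (simp add: X1_def mult_ac)
     also have "\<dots> = E r * ennreal (1 / (1 - r)) * (NINT \<theta>:{0..2*pi}. (if circle_dist \<theta> \<le> 1 - r then 1 else 0))"
      by (rule nn_integral_cmult) measurable
     also have "\<dots> \<le> E r * ennreal (1 / (1 - r)) * ennreal (4 * pi * (1 - r))"
      using True by (intro mult_left_mono measure_circle_dist_le) auto
     also have "\<dots> = ennreal (4*pi) * E r"
      using True by (simp add: mult.assoc ennreal_mult'[symmetric] mult.commute)
     finally show ?thesis using True by simp
    qed (simp add: X1_def)
   qed
   also have "\<dots> = ennreal (4*pi) * TT" unfolding TT_def by (rule nn_integral_cmult) measurable
   finally show ?thesis .
  qed
  have I2: "?I2 \<le> ennreal (4*pi) * TT"
  proof -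
   have "?I2 \<le> (NINT \<theta>:{0..2*pi}. E (1 - circle_dist \<theta>))"
   proof (intro nn_integral_mono mult_right_mono)
    fix \<theta>
    define d where "d = circle_dist \<theta>"
    show "?J2 \<theta> \<le> E (1 - circle_dist \<theta>)"
    proof (cases "0 < d")
     case False
     have "X2 r \<theta> = 0" for r using False by (auto simp: X2_def d_def split: split_indicator)
     then show ?thesis by simp
    next
     case True
     have "?J2 \<theta> \<le> (NINT r:{1 - d..1}. E (1 - d) * ennreal (1 / d))"
     proof (rule nn_integral_mono)
      fix r
      show "X2 r \<theta> \<le> E (1 - d) * ennreal (1 / d) * indicator {1 - d..1} r"
      proof (cases "r \<in> {0<..<1} \<and> 1 - r < d")
       case r: True
       have "(1 - r) powr (p - 1) \<le> d powr (p - 1)" using r p by (intro powr_mono2) auto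
       then have "(1 - r) powr (p - 1) / d powr p \<le> d powr (p - 1) / d powr p" by (intro divide_right_mono) auto
       also have "\<dots> = 1 / d" using True by (simp add: powr_diff)
       finally have "ennreal ((1 - r) powr (p - 1) / d powr p) \<le> ennreal (1 / d)" by (rule ennreal_leI)
       then show ?thesis using r by (simp add: X2_def d_def[symmetric] mult_left_mono)
      qed (auto simp: X2_def d_def)
     qed
     also have "\<dots> = E (1 - d) * ennreal (1 / d) * ennreal d" using True by (subst nn_integral_cmult_indicator) auto
     also have "\<dots> = E (1 - d)" using True by (simp add: mult.assoc ennreal_mult'[symmetric])
     finally show ?thesis by (simp add: d_def)
    qed
   qed simp
   also have "\<dots> \<le> ennreal (4*pi) * TT" unfolding E_def TT_def by (rule T_circle[OF nfm p(1)])
   finally show ?thesis .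
  qed
  have "dirichlet_enn p (Hop f) \<le> (NINT \<theta>:{0..2*pi}. (NINT r. ennreal B * (X1 r \<theta> + X2 r \<theta>)))"
   unfolding dirichlet_enn_polar[OF Hop_holomorphic[OF f] p(1)]
  proof (rule nn_integral_mono)
   fix \<theta>
   show "(NINT r:{0<..<1}. ennreal r * ennreal (norm (deriv (Hop f) (of_real r * cis \<theta>)) powr p * (1 - r\<^sup>2) powr (p - 1))) * indicator {0..2*pi} \<theta>
     \<le> (NINT r. ennreal B * (X1 r \<theta> + X2 r \<theta>)) * indicator {0..2*pi} \<theta>"
    by (cases "\<theta> \<in> {0..2*pi}") (auto intro!: nn_integral_mono pt)
  qed
  also have "\<dots> = (NINT \<theta>. ennreal B * (?J1 \<theta> * indicator {0..2*pi} \<theta> + ?J2 \<theta> * indicator {0..2*pi} \<theta>))"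
  proof (rule nn_integral_cong)
   fix \<theta>
   have "(NINT r. ennreal B * (X1 r \<theta> + X2 r \<theta>)) = ennreal B * (NINT r. X1 r \<theta> + X2 r \<theta>)"
    by (rule nn_integral_cmult) measurable
   also have "(NINT r. X1 r \<theta> + X2 r \<theta>) = ?J1 \<theta> + ?J2 \<theta>"
    by (rule nn_integral_add) measurable
   finally show "(NINT r. ennreal B * (X1 r \<theta> + X2 r \<theta>)) * indicator {0..2*pi} \<theta> =
    ennreal B * (?J1 \<theta> * indicator {0..2*pi} \<theta> + ?J2 \<theta> * indicator {0..2*pi} \<theta>)"
    by (simp add: distrib_right mult.assoc)
  qed
  also have "\<dots> = ennreal B * (NINT \<theta>. ?J1 \<theta> * indicator {0..2*pi} \<theta> + ?J2 \<theta> * indicator {0..2*pi} \<theta>)"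
   by (rule nn_integral_cmult) measurable
  also have "(NINT \<theta>. ?J1 \<theta> * indicator {0..2*pi} \<theta> + ?J2 \<theta> * indicator {0..2*pi} \<theta>)
    = ?I1 + ?I2"
   by (rule nn_integral_add) measurable
  finally have 1: "dirichlet_enn p (Hop f) \<le> ennreal B * (?I1 + ?I2)" .
  have TTb: "TT \<le> ennreal C * Lp_enn p f" unfolding TT_def E_def Lp_enn_epow by (rule C(2)[OF nfm])
  have "dirichlet_enn p (Hop f) \<le> ennreal B * (ennreal (4*pi) * TT + ennreal (4*pi) * TT)"
   by (intro order.trans[OF 1] mult_left_mono add_mono I1 I2) auto
  also have "\<dots> = ennreal B * (ennreal (8*pi) * TT)"
  proof -
   have "ennreal (8*pi) = ennreal (4*pi) + ennreal (4*pi)" by (simp add: ennreal_plus[symmetric] del: ennreal_plus)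
   then show ?thesis by (simp add: distrib_right)
  qed
  also have "\<dots> \<le> ennreal B * (ennreal (8*pi) * (ennreal C * Lp_enn p f))" by (intro mult_left_mono TTb) auto
  also have "\<dots> = ennreal (B * (8 * pi * C)) * Lp_enn p f" using B C by (simp add: ennreal_mult mult.assoc)
  finally show "dirichlet_enn p (Hop f) \<le> ennreal (B * (8 * pi * C)) * Lp_enn p f" .
 qed
qed

end

section \<open>Necessity\<close>

context dweight
begin

text \<open>The intervals from \<open>1 - 1 / (n + 1)\<close> to \<open>1 - 1 / (n + 2)\<close> cover
  \<open>[0,1)\<close>.\<close>

lemma geometric_block_exists:
 assumes "0 \<le> \<rho>" "\<rho> < 1"
 obtains n :: nat where "1 - 1 / (real n + 1) \<le> \<rho>" "\<rho> < 1 - 1 / (real n + 2)"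
proof -
 define m where "m = nat \<lfloor>1 / (1 - \<rho>)\<rfloor>"
 have d: "1 \<le> 1 / (1 - \<rho>)" using assms by simp
 have fl: "1 \<le> \<lfloor>1 / (1 - \<rho>)\<rfloor>" using d by (simp add: le_floor_iff)
 have im: "int m = \<lfloor>1 / (1 - \<rho>)\<rfloor>"
  unfolding m_def by (rule nat_0_le) (rule order.trans[OF zero_le_one fl])
 have m1: "real m \<le> 1 / (1 - \<rho>)" "1 / (1 - \<rho>) < real m + 1"
 proof -
  have "real m = of_int \<lfloor>1 / (1 - \<rho>)\<rfloor>" unfolding im[symmetric] by simp
  then show "real m \<le> 1 / (1 - \<rho>)" "1 / (1 - \<rho>) < real m + 1" using floor_correct[of "1 / (1 - \<rho>)"] by linarith+
 qed
 have m0: "1 \<le> m" using fl unfolding im[symmetric] by simp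
 define n where "n = m - 1"
 have n: "real n + 1 = real m" using m0 by (simp add: n_def)
 show ?thesis
 proof (rule that[of n])
  have mp: "0 < real m" using m0 by simp
  show "1 - 1 / (real n + 1) \<le> \<rho>" unfolding n using m1(1) mp assms by (simp add: field_simps)
  have n2: "real n + 2 = real m + 1" using n by simp
  show "\<rho> < 1 - 1 / (real n + 2)" unfolding n2 using m1(2) mp assms by (simp add: field_simps)
 qed
qed

text \<open>For indices \<open>k\<close> from about \<open>n / 2\<close> to \<open>n\<close> the powers are
  bounded below by a constant and \<open>u k\<close> is at least a multiple of
  \<open>1 / tail \<rho>\<close>; at least \<open>(n + 1) / 2\<close> indices are of this kind.\<close>

lemma block_sum_lower:
 "\<exists>c>0. \<forall>n r \<rho>. 0 \<le> \<rho> \<longrightarrow> \<rho> \<le> r \<longrightarrow> 1 - 1 / (real n + 1) \<le> \<rho> \<longrightarrow> \<rho> < 1 - 1 / (real n + 2) \<longrightarrow>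
   c * (real n + 1) / tail \<rho> \<le> (\<Sum>k\<le>n. (r * \<rho>) ^ k * u k)"
proof -
 obtain c0 where c0: "0 < c0" "\<And>n. c0 \<le> u n * tail (1 - 1 / (2 * real n + 2))" using u_lower by blast
 have "(exp (-1) ^ 2 * c0 / 2) * (real n + 1) / tail \<rho> \<le> (\<Sum>k\<le>n. (r * \<rho>) ^ k * u k)"
  if h: "0 \<le> \<rho>" "\<rho> \<le> r" "1 - 1 / (real n + 1) \<le> \<rho>" "\<rho> < 1 - 1 / (real n + 2)" for n r \<rho>
 proof -
  define j where "j = (n + 1) div 2"
  have "0 < 1 / (real n + 2)" by simp
  then have r1: "\<rho> < 1" using h(4) by linarith
  have t: "0 < tail \<rho>" using h r1 by (intro wtail_pos)
  have nj: "n + 2 \<le> 2 * j + 2" "j \<le> n + 1" "n + 1 \<le> 2 * (n + 1 - j)" unfolding j_def by linarith+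
  have "1 / (2 * real j + 2) \<le> 1 / (real n + 2)" using nj(1) by (intro divide_left_mono) auto
  then have "tail (1 - 1 / (2 * real j + 2)) \<le> tail \<rho>" using h(4) by (intro tail_antimono) linarith
  then have "u j * tail (1 - 1 / (2 * real j + 2)) \<le> u j * tail \<rho>" by (intro mult_left_mono) auto
  with c0(2)[of j] have "c0 \<le> u j * tail \<rho>" by linarith
  then have uj: "c0 / tail \<rho> \<le> u j" using t by (simp add: pos_divide_le_eq)
  have pw: "exp (-1) ^ 2 \<le> (r * \<rho>) ^ k" if k: "k \<le> n" for k
  proof -
   define y where "y = 1 - 1 / (real n + 1)"
   have y: "0 \<le> y" "y \<le> 1" by (auto simp: y_def divide_le_eq)
   have "exp (-1) \<le> y ^ n" unfolding y_def by (rule exp_minus_1_le_power)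
   also have "y ^ n \<le> y ^ k" using k y by (intro power_decreasing) auto
   finally have e: "exp (-1) \<le> y ^ k" .
   then have "exp (-1) ^ 2 \<le> (y ^ k) ^ 2" by (intro power_mono) auto
   also have "\<dots> = (y * y) ^ k" by (simp add: power2_eq_square power_mult_distrib)
   also have "\<dots> \<le> (r * \<rho>) ^ k" using y h unfolding y_def[symmetric] by (intro power_mono mult_mono) auto
   finally show ?thesis .
  qed
  have "(exp (-1) ^ 2 * c0 / 2) * (real n + 1) / tail \<rho> = ((real n + 1) / 2) * (exp (-1) ^ 2 * (c0 / tail \<rho>))" by simp
  also have "\<dots> \<le> real (n + 1 - j) * (exp (-1) ^ 2 * (c0 / tail \<rho>))"
   using nj c0(1) t by (intro mult_right_mono) (auto simp del: of_nat_diff)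
  also have "\<dots> = (\<Sum>k\<in>{j..n}. exp (-1) ^ 2 * (c0 / tail \<rho>))" by simp
  also have "\<dots> \<le> (\<Sum>k\<in>{j..n}. (r * \<rho>) ^ k * u k)"
  proof (intro sum_mono mult_mono)
   fix k assume "k \<in> {j..n}"
   then show "c0 / tail \<rho> \<le> u k" "exp (-1) ^ 2 \<le> (r * \<rho>) ^ k" using uj u_mono[of j k] pw by auto
  qed (use c0 t h in auto)
  also have "\<dots> \<le> (\<Sum>k\<le>n. (r * \<rho>) ^ k * u k)" using h by (intro sum_mono2) auto
  finally show ?thesis .
 qed
 then show ?thesis using c0(1) by (intro exI[of _ "exp (-1) ^ 2 * c0 / 2"]) auto
qed

text \<open>Functions concentrated near the boundary, on which the operator can be bounded below. Boundedness
  from above makes them elements of every \<open>L\<^sup>p\<close> space.\<close>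

definition test_fun :: "real \<Rightarrow> (real \<Rightarrow> real) \<Rightarrow> bool" where
 "test_fun r g \<longleftrightarrow> g \<in> borel_measurable borel \<and> (\<forall>t. 0 \<le> g t) \<and> (\<forall>t. t < r \<longrightarrow> g t = 0) \<and> (\<exists>B. \<forall>t. g t \<le> B)"

text \<open>The only feature of a test function that enters the lower bounds.\<close>

definition J :: "(real \<Rightarrow> real) \<Rightarrow> real" where "J g = (LBINT t. g t * w t)"

abbreviation cg :: "(real \<Rightarrow> real) \<Rightarrow> real \<Rightarrow> complex" where "cg g \<equiv> \<lambda>t. of_real (g t)"

lemma test_integrable:
 assumes g: "test_fun r g" and [measurable]: "h \<in> borel_measurable borel" and h: "\<And>t. t \<in> {0<..<1} \<Longrightarrow> \<bar>h t\<bar> \<le> 1"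
 shows "integrable lborel (\<lambda>t. w t * (g t * h t))"
proof -
 obtain B where B: "\<And>t. 0 \<le> g t" "\<And>t. g t \<le> B" and [measurable]: "g \<in> borel_measurable borel" using g by (auto simp: test_fun_def)
 show ?thesis
 proof (rule integrable_w_mult[where B=B])
  fix t :: real assume "t \<in> {0<..<1}"
  then have "\<bar>g t\<bar> * \<bar>h t\<bar> \<le> B * 1" using B(1)[of t] B(2)[of t] by (intro mult_mono h) auto
  then show "\<bar>g t * h t\<bar> \<le> B" by (simp add: abs_mult)
 qed measurable
qed

lemma test_admissible: assumes g: "test_fun r g" shows "admissible (cg g)"
proof -
 have [measurable]: "g \<in> borel_measurable borel" and nn: "\<And>t. 0 \<le> g t" using g by (auto simp: test_fun_def)
 have "integrable lborel (\<lambda>t. w t * (g t * 1))" by (rule test_integrable[OF g]) auto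
 then show ?thesis using nn by (simp add: admissible_def mult.commute)
qed

text \<open>The coefficient \<open>hc\<close> of a test function as a real number.\<close>

definition test_coeff :: "(real \<Rightarrow> real) \<Rightarrow> nat \<Rightarrow> real" where
 "test_coeff g n = (LBINT t. w t * (g t * t ^ n)) * (u n / (real n + 1) / 2)"

lemma hc_test: "test_fun r g \<Longrightarrow> hc (cg g) n = of_real (test_coeff g n)"
proof -
 assume g: "test_fun r g"
 have "mom (cg g) n = (LBINT t. of_real (w t * (g t * t ^ n)))"
  unfolding mom_def by (intro Bochner_Integration.integral_cong) (simp_all add: mult_ac)
 also have "\<dots> = of_real (LBINT t. w t * (g t * t ^ n))" by (rule integral_complex_of_real)
 finally show ?thesis by (simp only: hc_def test_coeff_def of_real_mult)
qed

lemma test_coeff_lower: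
 assumes g: "test_fun r g" and r: "0 \<le> r"
 shows "r ^ n * J g * (u n / (real n + 1) / 2) \<le> test_coeff g n" "0 \<le> J g"
proof -
 have nn: "\<And>t. 0 \<le> g t" and z: "\<And>t. t < r \<Longrightarrow> g t = 0" using g by (auto simp: test_fun_def)
 have i1: "integrable lborel (\<lambda>t. w t * (g t * 1))" by (rule test_integrable[OF g]) auto
 have i2: "integrable lborel (\<lambda>t. w t * (g t * t ^ n))" by (rule test_integrable[OF g]) (auto intro: power_le_one)
 have Jeq: "J g = (LBINT t. w t * (g t * 1))" by (simp add: J_def mult.commute)
 show "0 \<le> J g" unfolding J_def using nn by (intro Bochner_Integration.integral_nonneg) auto
 have "r ^ n * J g = (LBINT t. r ^ n * (w t * (g t * 1)))"
  unfolding Jeq by (rule integral_mult_right_zero[symmetric])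
 also have "\<dots> \<le> (LBINT t. w t * (g t * t ^ n))"
 proof (rule integral_mono[OF integrable_mult_right[OF i1] i2])
  fix t
  show "r ^ n * (w t * (g t * 1)) \<le> w t * (g t * t ^ n)"
  proof (cases "r \<le> t")
   case True
   then have "r ^ n \<le> t ^ n" using r by (intro power_mono)
   then have "(w t * g t) * r ^ n \<le> (w t * g t) * t ^ n" using nn by (intro mult_left_mono) auto
   then show ?thesis by (simp add: mult_ac)
  qed (simp add: z)
 qed
 finally show "r ^ n * J g * (u n / (real n + 1) / 2) \<le> test_coeff g n"
  unfolding test_coeff_def by (rule mult_right_mono) (intro divide_nonneg_nonneg; simp)
qed

lemma test_coeff_nonneg: "test_fun r g \<Longrightarrow> 0 \<le> r \<Longrightarrow> 0 \<le> test_coeff g n"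
proof -
 assume g: "test_fun r g" "0 \<le> r"
 have "0 \<le> r ^ n * J g * (u n / (real n + 1) / 2)"
  using test_coeff_lower(2)[OF g] g(2) by (intro mult_nonneg_nonneg divide_nonneg_nonneg) auto
 then show ?thesis using test_coeff_lower(1)[OF g, of n] by linarith
qed

lemma norm_powser_lower:
 fixes b :: "nat \<Rightarrow> real"
 assumes s: "summable (\<lambda>n. of_real (b n) * (of_real \<rho> :: complex) ^ n)" and "0 \<le> \<rho>" "\<And>n. 0 \<le> b n"
 shows "(\<Sum>k\<le>n. b k * \<rho> ^ k) \<le> norm (\<Sum>n. of_real (b n) * (of_real \<rho> :: complex) ^ n)"
proof -
 have s': "summable (\<lambda>n. b n * \<rho> ^ n)"
  using s summable_complex_of_real[of "\<lambda>n. b n * \<rho> ^ n"] by simp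
 have "(\<Sum>k\<le>n. b k * \<rho> ^ k) \<le> (\<Sum>n. b n * \<rho> ^ n)"
  using assms by (intro sum_le_suminf s') auto
 also have "\<dots> \<le> norm (of_real (\<Sum>n. b n * \<rho> ^ n) :: complex)" by simp
 also have "of_real (\<Sum>n. b n * \<rho> ^ n) = (\<Sum>n. of_real (b n) * (of_real \<rho> :: complex) ^ n)"
  using suminf_of_real[OF s', where 'a=complex] by simp
 finally show ?thesis .
qed

text \<open>All coefficients are nonnegative, so a partial sum is a lower bound; since the test function lives
  on \<open>[r,1)\<close>, its \<open>k\<close>-th moment is at least \<open>r ^ k * J g\<close>,
  and \<open>block_sum_lower\<close> applies.\<close>

lemma Hop_test_lower:
 "\<exists>c>0. \<forall>g r \<rho>. test_fun r g \<longrightarrow> 0 \<le> \<rho> \<longrightarrow> \<rho> \<le> r \<longrightarrow> r < 1 \<longrightarrow> c * J g / tail \<rho> \<le> norm (Hop (cg g) (of_real \<rho>))"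
proof -
 obtain c where c: "0 < c" "\<And>n r \<rho>. 0 \<le> \<rho> \<Longrightarrow> \<rho> \<le> r \<Longrightarrow> 1 - 1 / (real n + 1) \<le> \<rho> \<Longrightarrow> \<rho> < 1 - 1 / (real n + 2) \<Longrightarrow>
   c * (real n + 1) / tail \<rho> \<le> (\<Sum>k\<le>n. (r * \<rho>) ^ k * u k)" using block_sum_lower by blast
 have "(c/2) * J g / tail \<rho> \<le> norm (Hop (cg g) (of_real \<rho>))"
  if h: "test_fun r g" "0 \<le> \<rho>" "\<rho> \<le> r" "r < 1" for g r \<rho>
 proof -
  have r0: "0 \<le> r" and \<rho>1: "\<rho> < 1" using h by auto
  have J0: "0 \<le> J g" by (rule test_coeff_lower(2)[OF h(1) r0])
  obtain n where n: "1 - 1 / (real n + 1) \<le> \<rho>" "\<rho> < 1 - 1 / (real n + 2)" using geometric_block_exists[OF h(2) \<rho>1] .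
  have adm: "admissible (cg g)" by (rule test_admissible[OF h(1)])
  have nr: "norm (of_real \<rho> :: complex) < 1" using h \<rho>1 by simp
  have "(c/2) * J g / tail \<rho> = J g / (2 * (real n + 1)) * (c * (real n + 1) / tail \<rho>)"
  proof -
   define N where "N = real n + 1"
   have "N \<noteq> 0" by (simp add: N_def)
   then show ?thesis unfolding N_def[symmetric] by simp
  qed
  also have "\<dots> \<le> J g / (2 * (real n + 1)) * (\<Sum>k\<le>n. (r * \<rho>) ^ k * u k)"
   using J0 h n by (intro mult_left_mono c) auto
  also have "\<dots> = (\<Sum>k\<le>n. J g / (2 * (real n + 1)) * ((r * \<rho>) ^ k * u k))" by (rule sum_distrib_left)
  also have "\<dots> \<le> (\<Sum>k\<le>n. test_coeff g k * \<rho> ^ k)"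
  proof (rule sum_mono)
   fix k assume k: "k \<in> {..n}"
   have "J g / (2 * (real n + 1)) * ((r * \<rho>) ^ k * u k) = (J g * (r * \<rho>) ^ k * u k) / (2 * (real n + 1))" by simp
   also have "\<dots> \<le> (J g * (r * \<rho>) ^ k * u k) / (2 * (real k + 1))"
    using k J0 r0 h by (intro divide_left_mono) auto
   also have "\<dots> = (r ^ k * J g * (u k / (real k + 1) / 2)) * \<rho> ^ k" by (simp add: power_mult_distrib field_simps)
   also have "\<dots> \<le> test_coeff g k * \<rho> ^ k" using h by (intro mult_right_mono test_coeff_lower(1)[OF h(1) r0]) auto
   finally show "J g / (2 * (real n + 1)) * ((r * \<rho>) ^ k * u k) \<le> test_coeff g k * \<rho> ^ k" .
  qed
  also have "\<dots> \<le> norm (\<Sum>n. of_real (test_coeff g n) * (of_real \<rho> :: complex) ^ n)"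
   using hc_summable[OF adm nr] h(2) test_coeff_nonneg[OF h(1) r0]
   by (intro norm_powser_lower) (auto simp: hc_test[OF h(1)])
  also have "(\<Sum>n. of_real (test_coeff g n) * (of_real \<rho> :: complex) ^ n) = Hop (cg g) (of_real \<rho>)"
   using Hop_eq[OF adm nr] by (simp add: hc_test[OF h(1)])
  finally show ?thesis .
 qed
 then show ?thesis using c(1) by (intro exI[of _ "c/2"]) auto
qed

text \<open>As in \<open>Hop_test_lower\<close>; differentiation multiplies the terms of index about
  \<open>1 / (1 - \<rho>)\<close> by this number, which the factor \<open>1 - \<rho>\<close>
  removes. The index shift loses a factor \<open>r\<close>, whence the lower bound on
  \<open>r\<close>.\<close>

lemma Hop_deriv_test_lower:
 "\<exists>c>0. \<forall>g r \<rho>. test_fun r g \<longrightarrow> 1/2 \<le> r \<longrightarrow> 0 \<le> \<rho> \<longrightarrow> \<rho> \<le> r \<longrightarrow> r < 1 \<longrightarrow> c * J g / tail \<rho> \<le> norm (deriv (Hop (cg g)) (of_real \<rho>)) * (1 - \<rho>)"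
proof -
 obtain c where c: "0 < c" "\<And>n r \<rho>. 0 \<le> \<rho> \<Longrightarrow> \<rho> \<le> r \<Longrightarrow> 1 - 1 / (real n + 1) \<le> \<rho> \<Longrightarrow> \<rho> < 1 - 1 / (real n + 2) \<Longrightarrow>
   c * (real n + 1) / tail \<rho> \<le> (\<Sum>k\<le>n. (r * \<rho>) ^ k * u k)" using block_sum_lower by blast
 have "(c/16) * J g / tail \<rho> \<le> norm (deriv (Hop (cg g)) (of_real \<rho>)) * (1 - \<rho>)"
  if h: "test_fun r g" "1/2 \<le> r" "0 \<le> \<rho>" "\<rho> \<le> r" "r < 1" for g r \<rho>
 proof -
  have r0: "0 \<le> r" and \<rho>1: "\<rho> < 1" using h by auto
  have J0: "0 \<le> J g" by (rule test_coeff_lower(2)[OF h(1) r0])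
  obtain n where n: "1 - 1 / (real n + 1) \<le> \<rho>" "\<rho> < 1 - 1 / (real n + 2)" using geometric_block_exists[OF h(3) \<rho>1] .
  have adm: "admissible (cg g)" by (rule test_admissible[OF h(1)])
  have nr: "norm (of_real \<rho> :: complex) < 1" using h \<rho>1 by simp
  define b where "b k = real (Suc k) * test_coeff g (Suc k)" for k
  have b0: "0 \<le> b k" for k using test_coeff_nonneg[OF h(1) r0] by (simp add: b_def)
  \<comment> \<open>Three factors 1/2: from the coefficients, from \<open>r \<ge> 1/2\<close> in
   the index shift, and from the quotient \<open>q\<close> below.\<close>
  have "J g / 8 * (c * (real n + 1) / tail \<rho>) \<le> J g / 8 * (\<Sum>k\<le>n. (r * \<rho>) ^ k * u k)"
   using J0 h n by (intro mult_left_mono c) auto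
  also have "\<dots> = (\<Sum>k\<le>n. J g / 8 * ((r * \<rho>) ^ k * u k))" by (rule sum_distrib_left)
  also have "\<dots> \<le> (\<Sum>k\<le>n. b k * \<rho> ^ k)"
  proof (rule sum_mono)
   fix k assume k: "k \<in> {..n}"
   define q where "q = (real k + 1) / (real k + 2)"
   have q: "1/2 \<le> q" by (simp add: q_def field_simps)
   have "J g / 8 * ((r * \<rho>) ^ k * u k) = (r ^ k * J g * (u k / 2)) * (1/2 * (1/2)) * \<rho> ^ k" by (simp add: power_mult_distrib)
   also have "\<dots> \<le> (r ^ k * J g * (u (Suc k) / 2)) * (r * q) * \<rho> ^ k"
    using h q J0 r0 u_mono[of k "Suc k"] by (intro mult_right_mono mult_mono mult_left_mono divide_right_mono) auto
   also have "\<dots> = real (Suc k) * (r ^ Suc k * J g * (u (Suc k) / (real (Suc k) + 1) / 2)) * \<rho> ^ k"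
    by (simp add: q_def mult_ac add_ac)
   also have "\<dots> \<le> b k * \<rho> ^ k"
    unfolding b_def using h by (intro mult_right_mono mult_left_mono test_coeff_lower(1)[OF h(1) r0]) auto
   finally show "J g / 8 * ((r * \<rho>) ^ k * u k) \<le> b k * \<rho> ^ k" .
  qed
  also have "\<dots> \<le> norm (\<Sum>n. of_real (b n) * (of_real \<rho> :: complex) ^ n)"
   using powser_deriv_shift(2)[OF hc_summable[OF adm] nr] h(3) b0
   by (intro norm_powser_lower) (simp_all add: hc_test[OF h(1)] b_def)
  also have "(\<Sum>n. of_real (b n) * (of_real \<rho> :: complex) ^ n) = deriv (Hop (cg g)) (of_real \<rho>)"
   using Hop_deriv_eq[OF adm nr] by (simp add: hc_test[OF h(1)] b_def)
  finally have 1: "J g / 8 * (c * (real n + 1) / tail \<rho>) \<le> norm (deriv (Hop (cg g)) (of_real \<rho>))" .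
  have n2: "1 / (real n + 2) \<le> 1 - \<rho>" using n(2) by simp
  have "1/2 \<le> (real n + 1) * (1 / (real n + 2))" by (simp add: field_simps)
  also have "\<dots> \<le> (real n + 1) * (1 - \<rho>)" by (intro mult_left_mono n2) auto
  finally have 2: "1/2 \<le> (real n + 1) * (1 - \<rho>)" .
  have t: "0 < tail \<rho>" using h \<rho>1 by (intro wtail_pos)
  have "(c/16) * J g / tail \<rho> = (J g * c / 8 / tail \<rho>) * (1/2)" by simp
  also have "\<dots> \<le> (J g * c / 8 / tail \<rho>) * ((real n + 1) * (1 - \<rho>))"
   using J0 c(1) t by (intro mult_left_mono 2) auto
  also have "\<dots> = (J g / 8 * (c * (real n + 1) / tail \<rho>)) * (1 - \<rho>)" by simp
  also have "\<dots> \<le> norm (deriv (Hop (cg g)) (of_real \<rho>)) * (1 - \<rho>)" using \<rho>1 by (intro mult_right_mono 1) auto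
  finally show ?thesis .
 qed
 then show ?thesis using c(1) by (intro exI[of _ "c/16"]) auto
qed

lemma Hop_0_test: "test_fun r g \<Longrightarrow> 0 \<le> r \<Longrightarrow> norm (Hop (cg g) 0) = J g * (u 0 / 2)"
proof -
 assume g: "test_fun r g" and r: "0 \<le> r"
 have adm: "admissible (cg g)" by (rule test_admissible[OF g])
 have "Hop (cg g) 0 = hc (cg g) 0" using Hop_eq[OF adm, of 0] powser_zero[of "hc (cg g)"] by simp
 also have "\<dots> = of_real (J g * (u 0 / 2))" unfolding hc_test[OF g] by (simp add: test_coeff_def J_def mult.commute)
 finally have e: "Hop (cg g) 0 = of_real (J g * (u 0 / 2))" .
 have "0 \<le> J g * (u 0 / 2)" using test_coeff_lower(2)[OF g r] by simp
 then show ?thesis unfolding e norm_of_real by (rule abs_of_nonneg)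
qed

lemma Hop_0_le_radius:
 assumes g: "test_fun r g" "0 \<le> r" and \<rho>: "0 \<le> \<rho>" "\<rho> < 1"
 shows "(u 0 / 2) * J g \<le> norm (Hop (cg g) (of_real \<rho>))"
proof -
 have adm: "admissible (cg g)" by (rule test_admissible[OF g(1)])
 have nr: "norm (of_real \<rho> :: complex) < 1" using \<rho> by simp
 have "(u 0 / 2) * J g = (\<Sum>k\<le>0. test_coeff g k * \<rho> ^ k)" by (simp add: test_coeff_def J_def mult.commute)
 also have "\<dots> \<le> norm (\<Sum>n. of_real (test_coeff g n) * (of_real \<rho> :: complex) ^ n)"
  using hc_summable[OF adm nr] \<rho> test_coeff_nonneg[OF g] by (intro norm_powser_lower) (auto simp: hc_test[OF g(1)])
 also have "(\<Sum>n. of_real (test_coeff g n) * (of_real \<rho> :: complex) ^ n) = Hop (cg g) (of_real \<rho>)"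
  using Hop_eq[OF adm nr] by (simp add: hc_test[OF g(1)])
 finally show ?thesis .
qed

end

lemma ennreal_term_le_suminf: "f n \<le> (\<Sum>n. f n)" for f :: "nat \<Rightarrow> ennreal"
proof -
 have "sum f {n} \<le> (\<Sum>n. f n)" by (rule sum_le_suminf) auto
 then show ?thesis by simp
qed

context dweight
begin

definition A_int :: "real \<Rightarrow> real \<Rightarrow> ennreal" where
 "A_int p r = (NINT t:{0..r}. ennreal (1 / tail t powr p))"

lemma muck_A_eq: "muck_A p r = 1 + A_int p r" by (simp add: muck_A_def A_int_def)

lemma J_powr_A_int:
 assumes "0 \<le> Jv" "0 < p"
 shows "ennreal (Jv powr p) * A_int p r = (NINT t:{0..r}. ennreal ((Jv / tail t) powr p))"
proof -
 have "ennreal (Jv powr p) * A_int p r = (NINT t. ennreal (Jv powr p) * (ennreal (1 / tail t powr p) * indicator {0..r} t))"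
  unfolding A_int_def by (rule nn_integral_cmult[symmetric]) measurable
 also have "\<dots> = (NINT t:{0..r}. ennreal ((Jv / tail t) powr p))"
  using assms by (intro nn_integral_cong) (auto simp: ennreal_mult'[symmetric] powr_divide mult.assoc[symmetric] split: split_indicator)
 finally show ?thesis .
qed

lemma powr_le_scaled:
 fixes c x y p :: real
 assumes "c * x \<le> y" "0 < c" "0 \<le> x" "0 < p"
 shows "x powr p \<le> (1 / c) powr p * y powr p"
proof -
 have "x \<le> (1 / c) * y" using assms by (simp add: field_simps)
 then have "x powr p \<le> ((1 / c) * y) powr p" using assms by (intro powr_mono2) auto
 also have "\<dots> = (1 / c) powr p * y powr p" by (rule powr_mult)
 finally show ?thesis .
qed

text \<open>Integrate \<open>Hop_test_lower\<close> over \<open>[0,r]\<close> and \<open>Hop_0_le_radius\<close>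
  over \<open>[0,1/2]\<close>, the latter for the summand 1 in \<open>muck_A\<close>, and use the
  Fejer-Riesz inequality.\<close>

theorem Hardy_necessity:
 assumes p: "1 < p" "1 / p + 1 / q = 1"
 shows "\<exists>C>0. \<forall>g r R. test_fun r g \<longrightarrow> 0 < r \<longrightarrow> r < R \<longrightarrow> 1/2 \<le> R \<longrightarrow> R < 1 \<longrightarrow>
  ennreal (J g powr p) * muck_A p r \<le> ennreal C * circle_mean p (Hop (cg g)) R"
proof -
 obtain c where c: "0 < c" "\<And>g r \<rho>. test_fun r g \<Longrightarrow> 0 \<le> \<rho> \<Longrightarrow> \<rho> \<le> r \<Longrightarrow> r < 1 \<Longrightarrow> c * J g / tail \<rho> \<le> norm (Hop (cg g) (of_real \<rho>))"
  using Hop_test_lower by blast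
 define C1 where "C1 = 2 * (1 / (u 0 / 2)) powr p"
 define C2 where "C2 = (1/c) powr p"
 define F where "F = (p + q) powr p * 2 powr p"
 have C: "0 < C1" "0 < C2" "0 < F" using c conjugate_gt_1[OF p] p less_imp_neq[OF u_pos[of 0]] by (auto simp: C1_def C2_def F_def)
 have "ennreal (J g powr p) * muck_A p r \<le> ennreal ((C1 + C2) * F) * circle_mean p (Hop (cg g)) R"
  if h: "test_fun r g" "0 < r" "r < R" "1/2 \<le> R" "R < 1" for g r R
 proof -
  define h where "h t = norm (Hop (cg g) (of_real t))" for t
  define X where "X = (NINT t:{0..<R}. ennreal (h t powr p))"
  have hol: "Hop (cg g) holomorphic_on ball 0 1" by (rule Hop_holomorphic[OF test_admissible[OF h(1)]])
  have J0: "0 \<le> J g" by (rule test_coeff_lower(2)[OF h(1)]) (use h in auto)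
  have X: "ennreal a * X = (NINT t. ennreal a * (ennreal (h t powr p) * indicator {0..<R} t))" for a
   unfolding X_def h_def using h by (intro nn_integral_cmult[symmetric]) (use measurable_radius_powr[OF hol] in auto)
  have "ennreal (J g powr p) = ennreal (2 * J g powr p) * ennreal (1/2)" by (subst ennreal_mult'[symmetric]) auto
  also have "\<dots> = (NINT t:{0..<1/2::real}. ennreal (2 * J g powr p))"
   by (subst nn_integral_cmult_indicator) auto
  also have "\<dots> \<le> ennreal C1 * X" unfolding X
  proof (rule nn_integral_mono)
   fix t :: real
   show "ennreal (2 * J g powr p) * indicator {0..<1/2} t \<le> ennreal C1 * (ennreal (h t powr p) * indicator {0..<R} t)"
   proof (cases "t \<in> {0..<1/2}")
    case True
    have "J g powr p \<le> (1 / (u 0 / 2)) powr p * h t powr p"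
     unfolding h_def using Hop_0_le_radius[OF h(1), of t] True h J0 p by (intro powr_le_scaled) auto
    then show ?thesis using True h by (simp add: ennreal_mult'[symmetric] ennreal_leI C1_def)
   qed simp
  qed
  finally have 1: "ennreal (J g powr p) \<le> ennreal C1 * X" .
  have "ennreal (J g powr p) * A_int p r = (NINT t:{0..r}. ennreal ((J g / tail t) powr p))"
   using p J0 by (intro J_powr_A_int) auto
  also have "\<dots> \<le> ennreal C2 * X" unfolding X
  proof (rule nn_integral_mono)
   fix t
   show "ennreal ((J g / tail t) powr p) * indicator {0..r} t \<le> ennreal C2 * (ennreal (h t powr p) * indicator {0..<R} t)"
   proof (cases "t \<in> {0..r}")
    case True
    have "(J g / tail t) powr p \<le> (1/c) powr p * h t powr p"
     unfolding h_def using c(2)[OF h(1), of t] c(1) True h J0 p by (intro powr_le_scaled) auto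
    then show ?thesis using True h by (simp add: ennreal_mult'[symmetric] ennreal_leI C2_def)
   qed simp
  qed
  finally have 2: "ennreal (J g powr p) * A_int p r \<le> ennreal C2 * X" .
  have "ennreal (J g powr p) * muck_A p r \<le> ennreal C1 * X + ennreal C2 * X"
   unfolding muck_A_eq distrib_left mult_1_right by (intro add_mono 1 2)
  also have "\<dots> = ennreal (C1 + C2) * X" using C by (simp add: distrib_right)
  also have "\<dots> \<le> ennreal (C1 + C2) * (ennreal F * circle_mean p (Hop (cg g)) R)"
   unfolding X_def h_def F_def using h by (intro mult_left_mono Fejer_Riesz_circle[OF hol _ _ p]) auto
  also have "\<dots> = ennreal ((C1 + C2) * F) * circle_mean p (Hop (cg g)) R"
   using C by (subst ennreal_mult) (auto simp: mult.assoc)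
  finally show ?thesis .
 qed
 moreover have "0 < (C1 + C2) * F" using C by simp
 ultimately show ?thesis by blast
qed

text \<open>On the \<open>n\<close>-th block, of length about \<open>(n + 1) powr (-2)\<close>, the integrand
  \<open>(J g / tail)\<^sup>p\<close> is at most a multiple of
  \<open>((n + 1) * \<bar>hc n\<bar>)\<^sup>p\<close>; the coefficient of index 0 accounts for the
  summand 1.\<close>

theorem HL_necessity:
 assumes p: "1 < p" "1 / p + 1 / q = 1"
 shows "\<exists>C>0. \<forall>g r. test_fun r g \<longrightarrow> 0 < r \<longrightarrow> r < 1 \<longrightarrow>
  ennreal (J g powr p) * muck_A p r \<le> ennreal C * (\<Sum>n. ennreal (norm (hc (cg g) n) powr p * (real n + 1) powr (p - 2)))"
proof -
 obtain c0 where c0: "0 < c0" "\<And>n. c0 \<le> u n * tail (1 - 1 / (2 * real n + 2))" using u_lower by blast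
 define C1 where "C1 = (1 / (u 0 / 2)) powr p"
 define d where "d = exp (-1) * c0 / 2"
 have d: "0 < d" using c0 by (simp add: d_def)
 define C2 where "C2 = (1 / d) powr p"
 have C: "0 \<le> C1" "0 \<le> C2" by (auto simp: C1_def C2_def)
 have "ennreal (J g powr p) * muck_A p r \<le> ennreal (C1 + C2 + 1) * (\<Sum>n. ennreal (norm (hc (cg g) n) powr p * (real n + 1) powr (p - 2)))"
  if h: "test_fun r g" "0 < r" "r < 1" for g r
 proof -
  define a where "a n = ennreal (norm (hc (cg g) n) powr p * (real n + 1) powr (p - 2))" for n
  define M where "M = (\<Sum>n. a n)"
  have J0: "0 \<le> J g" by (rule test_coeff_lower(2)[OF h(1)]) (use h in auto)
  have r0: "0 \<le> r" using h by simp
  have hcn: "norm (hc (cg g) n) = test_coeff g n" for n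
   using test_coeff_nonneg[OF h(1) r0] by (simp add: hc_test[OF h(1)])
  have adm: "admissible (cg g)" by (rule test_admissible[OF h(1)])
  have "hc (cg g) 0 = Hop (cg g) 0" using Hop_eq[OF adm, of 0] powser_zero[of "hc (cg g)"] by simp
  then have "J g powr p \<le> (1 / (u 0 / 2)) powr p * norm (hc (cg g) 0) powr p"
   using Hop_0_test[OF h(1)] h J0 p by (intro powr_le_scaled) auto
  then have "ennreal (J g powr p) \<le> ennreal C1 * a 0" by (simp add: a_def C1_def ennreal_mult'[symmetric] ennreal_leI)
  also have "a 0 \<le> M" unfolding M_def using sum_le_suminf[of a "{0}"] by simp
  then have "ennreal C1 * a 0 \<le> ennreal C1 * M" by (rule mult_left_mono) simp
  finally have 1: "ennreal (J g powr p) \<le> ennreal C1 * M" .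
  define y where "y n = 1 - 1 / (real n + 1)" for n :: nat
  have y_mono: "y m \<le> y n" if "m \<le> n" for m n using that by (auto simp: y_def intro!: divide_left_mono)
  have y01: "0 \<le> y n" "y n < 1" for n by (auto simp: y_def divide_le_eq)
  have ylen: "y (Suc n) - y n = 1 / ((real n + 1) * (real n + 2))" for n by (simp add: y_def field_simps)
  define B where "B n = {y n..y (Suc n)}" for n
  define F where "F t = ennreal ((J g / tail t) powr p) * indicator {0..r} t" for t
  have [measurable]: "F \<in> borel_measurable borel" unfolding F_def by measurable
  have block: "(NINT t:(B n). F t) \<le> ennreal C2 * a n" for n
  proof (cases "y n \<le> r")
   case False
   have z: "(\<lambda>t. F t * indicator (B n) t) = (\<lambda>t. 0)"
    using False by (auto simp: fun_eq_iff F_def B_def split: split_indicator)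
   show ?thesis unfolding z by simp
  next
   case True
   let ?t = "tail (y (Suc n))"
   let ?z = "J g / ?t"
   let ?L = "?z powr p * (1 / ((real n + 1) * (real n + 2)))"
   have t1: "0 < ?t" using y01[of "Suc n"] by (intro wtail_pos) auto
   have Ft: "F t * indicator (B n) t \<le> ennreal ((?z) powr p) * indicator (B n) t" for t
   proof (cases "t \<in> B n \<and> t \<in> {0..r}")
    case True
    then have "?t \<le> tail t" by (intro tail_antimono) (auto simp: B_def)
    then have "J g / tail t \<le> ?z" using t1 J0 by (intro divide_left_mono mult_pos_pos) auto
    moreover have "0 \<le> J g / tail t" using J0 by simp
    ultimately have "(J g / tail t) powr p \<le> (?z) powr p" using p by (intro powr_mono2) auto
    then show ?thesis using True by (simp add: F_def ennreal_leI)
   qed (auto simp: F_def split: split_indicator)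
   have "(NINT t:(B n). F t) \<le> (NINT t:(B n). ennreal ((?z) powr p))"
    by (intro nn_integral_mono Ft)
   also have "\<dots> = ennreal ((?z) powr p) * ennreal (y (Suc n) - y n)"
    using y_mono[of n "Suc n"] by (subst nn_integral_cmult_indicator) (auto simp: B_def)
   also have "\<dots> = ennreal (?L)"
    unfolding ylen by (rule ennreal_mult'[symmetric]) simp
   also have "\<dots> \<le> ennreal (C2 * (norm (hc (cg g) n) powr p * (real n + 1) powr (p - 2)))"
   proof (rule ennreal_leI)
    have "tail (1 - 1 / (2 * real n + 2)) \<le> ?t"
     by (intro tail_antimono) (auto simp: y_def intro!: divide_left_mono)
    then have "u n * tail (1 - 1 / (2 * real n + 2)) \<le> u n * ?t" by (intro mult_left_mono) auto
    with c0(2)[of n] have "c0 \<le> u n * ?t" by linarith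
    then have un: "c0 / ?t \<le> u n" using t1 by (simp add: pos_divide_le_eq)
    have "exp (-1) \<le> y n ^ n" unfolding y_def by (rule exp_minus_1_le_power)
    also have "\<dots> \<le> r ^ n" using True y01 by (intro power_mono) auto
    finally have rn: "exp (-1) \<le> r ^ n" .
    have "d * (?z) = exp (-1) * (J g * ((c0 / ?t) / 2))" by (simp add: d_def mult_ac)
    also have "\<dots> \<le> r ^ n * (J g * (u n / 2))"
     using rn un J0 r0 c0(1) t1 by (intro mult_mono mult_left_mono divide_right_mono) auto
    also have "\<dots> = (real n + 1) * (r ^ n * J g * (u n / (real n + 1) / 2))"
    proof -
     define N where "N = real n + 1"
     have "N \<noteq> 0" by (simp add: N_def add_nonneg_eq_0_iff)
     then show ?thesis unfolding N_def[symmetric] by (simp add: field_simps)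
    qed
    also have "\<dots> \<le> (real n + 1) * norm (hc (cg g) n)"
     unfolding hcn by (intro mult_left_mono test_coeff_lower(1)[OF h(1) r0]) auto
    finally have "(?z) powr p \<le> C2 * ((real n + 1) * norm (hc (cg g) n)) powr p"
     unfolding C2_def using d J0 p by (intro powr_le_scaled) auto
    then have "?L \<le> C2 * ((real n + 1) * norm (hc (cg g) n)) powr p * (1 / (real n + 1)^2)"
     by (intro mult_mono divide_left_mono) (auto simp: power2_eq_square C2_def)
    also have "\<dots> = C2 * (norm (hc (cg g) n) powr p * (real n + 1) powr (p - 2))"
    proof -
     have "((real n + 1) * norm (hc (cg g) n)) powr p = (real n + 1) powr p * norm (hc (cg g) n) powr p"
      by (rule powr_mult)
     moreover have "(real n + 1) powr (p - 2) = (real n + 1) powr p / (real n + 1)^2"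
      by (simp add: powr_diff powr_numeral)
     ultimately show ?thesis by simp
    qed
    finally show "?L \<le> C2 * (norm (hc (cg g) n) powr p * (real n + 1) powr (p - 2))" .
   qed
   also have "\<dots> = ennreal C2 * a n" unfolding a_def using C by (intro ennreal_mult) auto
   finally show ?thesis .
  qed
  have "ennreal (J g powr p) * A_int p r = (NINT t. F t)" unfolding F_def using p J0 by (intro J_powr_A_int) auto
  also have "\<dots> \<le> (NINT t. (\<Sum>n. F t * indicator (B n) t))"
  proof (rule nn_integral_mono)
   fix t
   show "F t \<le> (\<Sum>n. F t * indicator (B n) t)"
   proof (cases "t \<in> {0..r}")
    case True
    then have "0 \<le> t" "t < 1" using h by auto
    then obtain n where n: "1 - 1 / (real n + 1) \<le> t" "t < 1 - 1 / (real n + 2)" using geometric_block_exists by blast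
    then have "t \<in> B n" by (auto simp: B_def y_def add_ac)
    then have "F t = F t * indicator (B n) t" by simp
    also have "\<dots> \<le> (\<Sum>n. F t * indicator (B n) t)" by (rule ennreal_term_le_suminf)
    finally show ?thesis .
   qed (simp add: F_def)
  qed
  also have "\<dots> = (\<Sum>n. (NINT t:(B n). F t))" by (rule nn_integral_suminf) (simp add: B_def)
  also have "\<dots> \<le> (\<Sum>n. ennreal C2 * a n)" by (intro suminf_le block) auto
  also have "\<dots> = ennreal C2 * M" unfolding M_def by (rule ennreal_suminf_cmult)
  finally have 2: "ennreal (J g powr p) * A_int p r \<le> ennreal C2 * M" .
  have "ennreal (J g powr p) * muck_A p r = ennreal (J g powr p) + ennreal (J g powr p) * A_int p r"
   by (simp add: muck_A_eq distrib_left)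
  also have "\<dots> \<le> ennreal C1 * M + ennreal C2 * M" by (intro add_mono 1 2)
  also have "\<dots> = ennreal (C1 + C2) * M" using C by (simp add: distrib_right)
  also have "\<dots> \<le> ennreal (C1 + C2 + 1) * M" by (intro mult_right_mono ennreal_leI) auto
  finally show ?thesis unfolding M_def a_def .
 qed
 then show ?thesis using C by (intro exI[of _ "C1 + C2 + 1"]) auto
qed

end

context dweight
begin

lemma dirichlet_enn_radial:
 assumes g: "g holomorphic_on ball 0 1" and p: "1 < p"
 defines "cm \<equiv> (\<lambda>R. (NINT \<theta>:{0..2*pi}. ennreal (norm (deriv g (of_real R * cis \<theta>)) powr p) * indicator (ball 0 1) (of_real R * cis \<theta>)))"
 shows "cm \<in> borel_measurable borel"
  and "\<And>R. 0 \<le> R \<Longrightarrow> R < 1 \<Longrightarrow> cm R = circle_mean p (deriv g) R"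
  and "dirichlet_enn p g = (NINT r:{0<..<1}. ennreal (r * (1 - r\<^sup>2) powr (p - 1)) * cm r)"
proof -
 let ?k = "\<lambda>r. ennreal (r * (1 - r\<^sup>2) powr (p - 1)) * indicator {0<..<1} r"
 define Gm where "Gm z = ennreal (norm (deriv g z) powr p) * indicator (ball 0 1) z" for z
 have Gm [measurable]: "Gm \<in> borel_measurable borel" unfolding Gm_def
 proof (rule measurable_disc_fun)
  have c: "continuous_on (ball 0 1) (\<lambda>z. norm (deriv g z))" by (intro continuous_on_norm continuous_deriv g)
  show "continuous_on (ball 0 1) (\<lambda>z. norm (deriv g z) powr p)"
   by (rule continuous_on_powr'[OF c]) (use p in auto)
 qed
 have cm: "cm R = (NINT \<theta>:{0..2*pi}. Gm (of_real R * cis \<theta>))" for R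
  unfolding cm_def Gm_def ..
 show cmm [measurable]: "cm \<in> borel_measurable borel" unfolding cm[abs_def] by measurable
 show "cm R = circle_mean p (deriv g) R" if "0 \<le> R" "R < 1" for R
  unfolding cm_def circle_mean_def using that by (intro nn_integral_cong) (simp add: norm_mult)
 have rew: "ennreal r * ennreal (norm (deriv g (of_real r * cis \<theta>)) powr p * (1 - r\<^sup>2) powr (p - 1)) * indicator {0<..<1} r
   = ?k r * Gm (of_real r * cis \<theta>)" for r \<theta> :: real
  by (auto simp: Gm_def norm_mult ennreal_mult'[symmetric] mult_ac split: split_indicator)
 have "dirichlet_enn p g = (NINT \<theta>:{0..2*pi}. (NINT r. ?k r * Gm (of_real r * cis \<theta>)))"
  unfolding dirichlet_enn_polar[OF g p] rew ..
 also have "\<dots> = (NINT \<theta>. (NINT r. ?k r * Gm (of_real r * cis \<theta>) * indicator {0..2*pi} \<theta>))"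
  by (intro nn_integral_cong nn_integral_multc[symmetric]) measurable
 also have "\<dots> = (NINT r. (NINT \<theta>:{0..2*pi}. ?k r * Gm (of_real r * cis \<theta>)))"
  by (rule lborel_pair.Fubini'[symmetric]) measurable
 also have "\<dots> = (NINT r:{0<..<1}. ennreal (r * (1 - r\<^sup>2) powr (p - 1)) * cm r)"
 proof (rule nn_integral_cong)
  fix r :: real
  have "(NINT \<theta>. (?k r) * (Gm (of_real r * cis \<theta>) * indicator {0..2*pi} \<theta>))
   = (?k r) * cm r"
   unfolding cm by (rule nn_integral_cmult) measurable
  then show "(NINT \<theta>:{0..2*pi}. ?k r * Gm (of_real r * cis \<theta>))
   = ennreal (r * (1 - r\<^sup>2) powr (p - 1)) * cm r * indicator {0<..<1} r" by (simp add: mult_ac)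
 qed
 finally show "dirichlet_enn p g = (NINT r:{0<..<1}. ennreal (r * (1 - r\<^sup>2) powr (p - 1)) * cm r)" .
qed

text \<open>Apply the Fejer-Riesz inequality to the derivative on the circle of radius \<open>R\<close>,
  multiply by the weight at \<open>R\<close> and integrate over \<open>R\<close>. After
  interchanging the integrals the radii \<open>R > \<rho>\<close> contribute a weight of order
  \<open>(1 - \<rho>)\<^sup>p\<close>.\<close>

lemma radial_derivative_le_dirichlet:
 assumes g: "g holomorphic_on ball 0 1" and p: "1 < p" "1 / p + 1 / q = 1"
 shows "(NINT \<rho>:{0..<1}. ennreal ((norm (deriv g (of_real \<rho>)) * (1 - \<rho>)) powr p))
  \<le> ennreal (2 * 4 powr p * ((p + q) powr p * 2 powr p)) * dirichlet_enn p g"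
proof -
 define F where "F \<rho> = ennreal (norm (deriv g (of_real \<rho>)) powr p) * indicator {0..<1} \<rho>" for \<rho> :: real
 define k where "k R = ennreal (R * (1 - R\<^sup>2) powr (p - 1)) * indicator {0<..<1} R" for R :: real
 define cm where "cm R = (NINT \<theta>:{0..2*pi}. ennreal (norm (deriv g (of_real R * cis \<theta>)) powr p) * indicator (ball 0 1) (of_real R * cis \<theta>))" for R
 define D where "D = (p + q) powr p * 2 powr p"
 have D: "0 \<le> D" by (simp add: D_def)
 note rad = dirichlet_enn_radial[OF g p(1), folded cm_def]
 have hol: "deriv g holomorphic_on ball 0 1" by (intro holomorphic_deriv g) auto
 have [measurable]: "cm \<in> borel_measurable borel" "F \<in> borel_measurable borel" "k \<in> borel_measurable borel"
  unfolding F_def k_def using rad(1) by (auto intro!: measurable_radius_powr hol)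
 let ?k = "\<lambda>R \<rho>. k R * (F \<rho> * (if \<rho> < R then 1 else 0))" and ?S = "\<lambda>R. (NINT \<rho>. F \<rho> * (if \<rho> < R then 1 else 0))" and ?c = "ennreal (2 * 4 powr p)"
 have FR: "k R * ?S R \<le> ennreal D * (ennreal (R * (1 - R\<^sup>2) powr (p - 1)) * cm R * indicator {0<..<1} R)" for R
 proof (cases "R \<in> {0<..<1}")
  case True
  have "?S R = (NINT \<rho>:{0..<R}. ennreal (norm (deriv g (of_real \<rho>)) powr p))"
   using True by (intro nn_integral_cong) (auto simp: F_def split: split_indicator)
  also have "\<dots> \<le> ennreal D * cm R"
   using True rad(2)[of R] Fejer_Riesz_circle[OF hol _ _ p, of R] by (simp add: D_def)
  finally have "k R * ?S R \<le> k R * (ennreal D * cm R)" by (rule mult_left_mono) simp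
  then show ?thesis using True by (simp add: k_def mult_ac)
 qed (simp add: k_def)
 \<comment> \<open>With \<open>s = (1 - \<rho>) / 4\<close>, all radii \<open>R\<close> in an interval of length \<open>s\<close> satisfy \<open>\<rho> < R\<close>,
  \<open>1/2 \<le> R\<close> and \<open>1 - R \<ge> s\<close>; only these are kept.\<close>
 have low: "ennreal ((norm (deriv g (of_real \<rho>)) * (1 - \<rho>)) powr p) * indicator {0..<1} \<rho>
   \<le> ?c * (NINT R. ?k R \<rho>)" for \<rho>
 proof (cases "\<rho> \<in> {0..<1}")
  case True
  define s where "s = (1 - \<rho>) / 4"
  have s: "0 < s" "1 - \<rho> = 4 * s" using True by (auto simp: s_def)
  have e: "s powr p / 2 = s powr (p - 1) / 2 * s" using s by (simp add: powr_diff)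
  have "ennreal (s powr p / 2) * F \<rho> = (ennreal (s powr (p - 1) / 2) * F \<rho>) * ennreal s"
   unfolding e using s by (subst ennreal_mult) (auto simp: mult_ac)
  also have "\<dots> = (NINT R:{1 - 2 * s..1 - s}. (ennreal (s powr (p - 1) / 2) * F \<rho>))"
   using s by (subst nn_integral_cmult_indicator) auto
  also have "\<dots> \<le> (NINT R. ?k R \<rho>)"
  proof (rule nn_integral_mono)
   fix R
   show "(ennreal (s powr (p - 1) / 2) * F \<rho>) * indicator {1 - 2 * s..1 - s} R \<le> ?k R \<rho>"
   proof (cases "R \<in> {1 - 2 * s..1 - s}")
    case R: True
    have "1 - 2 * s \<le> R" "R \<le> 1 - s" "0 \<le> \<rho>" using R True by auto
    with s have R1: "1/2 \<le> R" "R < 1" "\<rho> < R" "s \<le> 1 - R" by linarith+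
    have "R\<^sup>2 \<le> R * 1" unfolding power2_eq_square using R1 by (intro mult_left_mono) auto
    then have "s powr (p - 1) \<le> (1 - R\<^sup>2) powr (p - 1)" using R1 s p by (intro powr_mono2) auto
    then have "1/2 * s powr (p - 1) \<le> R * (1 - R\<^sup>2) powr (p - 1)" using R1 by (intro mult_mono) auto
    then have "ennreal (s powr (p - 1) / 2) * F \<rho> \<le> ennreal (R * (1 - R\<^sup>2) powr (p - 1)) * F \<rho>"
     by (intro mult_right_mono ennreal_leI) auto
    then show ?thesis using R R1 by (simp add: k_def)
   qed simp
  qed
  finally have "?c * (ennreal (s powr p / 2) * F \<rho>) \<le> ?c * (NINT R. ?k R \<rho>)"
   by (rule mult_left_mono) simp
  moreover have "?c * (ennreal (s powr p / 2) * F \<rho>) = ennreal ((norm (deriv g (of_real \<rho>)) * (1 - \<rho>)) powr p)"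
   unfolding s(2) powr_mult using True by (simp add: F_def ennreal_mult'[symmetric] mult_ac)
  ultimately show ?thesis using True by simp
 qed simp
 have "(NINT \<rho>:{0..<1}. ennreal ((norm (deriv g (of_real \<rho>)) * (1 - \<rho>)) powr p))
   \<le> (NINT \<rho>. ?c * (NINT R. ?k R \<rho>))"
  by (intro nn_integral_mono low)
 also have "\<dots> = ?c * (NINT \<rho>. (NINT R. ?k R \<rho>))"
  by (intro nn_integral_cmult) measurable
 also have "(NINT \<rho>. (NINT R. ?k R \<rho>)) = (NINT R. (NINT \<rho>. ?k R \<rho>))"
  by (rule lborel_pair.Fubini') measurable
 also have "\<dots> = (NINT R. k R * ?S R)"
  by (intro nn_integral_cong nn_integral_cmult) measurable
 also have "\<dots> \<le> (NINT R. ennreal D * (ennreal (R * (1 - R\<^sup>2) powr (p - 1)) * cm R * indicator {0<..<1} R))"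
  by (intro nn_integral_mono FR)
 also have "\<dots> = ennreal D * dirichlet_enn p g" unfolding rad(3) by (rule nn_integral_cmult) measurable
 finally show ?thesis using D by (simp add: D_def[symmetric] ennreal_mult mult.assoc mult_left_mono)
qed

text \<open>\<open>Hop_deriv_test_lower\<close> integrated over \<open>[0,r]\<close>, for
  \<open>r \<ge> 1/2\<close>. For smaller \<open>r\<close> the condition is bounded by its value at
  1/2 and \<open>Hop f 0\<close> suffices.\<close>

theorem Dirichlet_necessity:
 assumes p: "1 < p" "1 / p + 1 / q = 1"
 shows "\<exists>C>0. \<forall>g r. test_fun r g \<longrightarrow> 0 < r \<longrightarrow> r < 1 \<longrightarrow>
  ennreal (J g powr p) * muck_A p r \<le> ennreal C * (ennreal (norm (Hop (cg g) 0) powr p) + dirichlet_enn p (Hop (cg g)))"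
proof -
 obtain c where c: "0 < c" "\<And>g r \<rho>. test_fun r g \<Longrightarrow> 1/2 \<le> r \<Longrightarrow> 0 \<le> \<rho> \<Longrightarrow> \<rho> \<le> r \<Longrightarrow> r < 1 \<Longrightarrow>
   c * J g / tail \<rho> \<le> norm (deriv (Hop (cg g)) (of_real \<rho>)) * (1 - \<rho>)"
  using Hop_deriv_test_lower by blast
 define C1 where "C1 = (1 / (u 0 / 2)) powr p"
 define C2 where "C2 = (1/c) powr p * (2 * 4 powr p * ((p + q) powr p * 2 powr p))"
 have "A_int p (1/2) < top" using muck_A_finite[of "1/2" p] p by (simp add: muck_A_eq)
 then obtain a where a: "A_int p (1/2) = ennreal a" "0 \<le> a" by (cases "A_int p (1/2)") auto
 have C: "0 \<le> C1" "0 \<le> C2" by (auto simp: C1_def C2_def)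
 have "ennreal (J g powr p) * muck_A p r \<le> ennreal (C1 + C1 * a + C2 + 1) * (ennreal (norm (Hop (cg g) 0) powr p) + dirichlet_enn p (Hop (cg g)))"
  if h: "test_fun r g" "0 < r" "r < 1" for g r
 proof -
  define M where "M = ennreal (norm (Hop (cg g) 0) powr p) + dirichlet_enn p (Hop (cg g))"
  have adm: "admissible (cg g)" by (rule test_admissible[OF h(1)])
  have hol: "Hop (cg g) holomorphic_on ball 0 1" by (rule Hop_holomorphic[OF adm])
  have J0: "0 \<le> J g" by (rule test_coeff_lower(2)[OF h(1)]) (use h in auto)
  have "J g powr p \<le> C1 * norm (Hop (cg g) 0) powr p"
   unfolding C1_def using Hop_0_test[OF h(1)] h J0 p by (intro powr_le_scaled) auto
  then have "ennreal (J g powr p) \<le> ennreal C1 * ennreal (norm (Hop (cg g) 0) powr p)"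
   using C by (simp add: ennreal_mult[symmetric] ennreal_leI)
  also have "\<dots> \<le> ennreal C1 * M" by (intro mult_left_mono) (auto simp: M_def)
  finally have 1: "ennreal (J g powr p) \<le> ennreal C1 * M" .
  have 2: "ennreal (J g powr p) * A_int p r \<le> ennreal (C1 * a + C2) * M"
  proof (cases "1/2 \<le> r")
   case False
   have "A_int p r \<le> A_int p (1/2)" unfolding A_int_def using False
    by (intro nn_integral_mono) (auto split: split_indicator)
   then have "ennreal (J g powr p) * A_int p r \<le> (ennreal C1 * M) * ennreal a"
    unfolding a(1)[symmetric] by (intro mult_mono 1) auto
   also have "\<dots> = ennreal (C1 * a) * M" using C a by (simp add: ennreal_mult mult_ac)
   also have "\<dots> \<le> ennreal (C1 * a + C2) * M" using C by (intro mult_right_mono ennreal_leI) auto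
   finally show ?thesis .
  next
   case True
   have "ennreal (J g powr p) * A_int p r = (NINT t:{0..r}. ennreal ((J g / tail t) powr p))"
    using p J0 by (intro J_powr_A_int) auto
   also have "\<dots> \<le> (NINT t. ennreal ((1/c) powr p) * (ennreal ((norm (deriv (Hop (cg g)) (of_real t)) * (1 - t)) powr p) * indicator {0..<1} t))"
   proof (rule nn_integral_mono)
    fix t
    show "ennreal ((J g / tail t) powr p) * indicator {0..r} t \<le> ennreal ((1/c) powr p) * (ennreal ((norm (deriv (Hop (cg g)) (of_real t)) * (1 - t)) powr p) * indicator {0..<1} t)"
    proof (cases "t \<in> {0..r}")
     case t: True
     have "(J g / tail t) powr p \<le> (1/c) powr p * (norm (deriv (Hop (cg g)) (of_real t)) * (1 - t)) powr p"
      using c(2)[OF h(1) True, of t] c(1) t h J0 p by (intro powr_le_scaled) auto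
     then show ?thesis using t h by (simp add: ennreal_mult'[symmetric] ennreal_leI)
    qed simp
   qed
   also have "\<dots> = ennreal ((1/c) powr p) * (NINT t:{0..<1}. ennreal ((norm (deriv (Hop (cg g)) (of_real t)) * (1 - t)) powr p))"
   proof (rule nn_integral_cmult)
    have [measurable]: "(\<lambda>t. ennreal (norm (deriv (Hop (cg g)) (of_real t)) powr p) * indicator {0..<1} t) \<in> borel_measurable borel"
     by (intro measurable_radius_powr holomorphic_deriv hol) auto
    have "(\<lambda>t. ennreal ((1 - t) powr p) * (ennreal (norm (deriv (Hop (cg g)) (of_real t)) powr p) * indicator {0..<1} t)) \<in> borel_measurable lborel"
     by measurable
    then show "(\<lambda>t. ennreal ((norm (deriv (Hop (cg g)) (of_real t)) * (1 - t)) powr p) * indicator {0..<1} t) \<in> borel_measurable lborel"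
     by (simp add: powr_mult ennreal_mult mult_ac)
   qed
   also have "\<dots> \<le> ennreal ((1/c) powr p) * (ennreal (2 * 4 powr p * ((p + q) powr p * 2 powr p)) * dirichlet_enn p (Hop (cg g)))"
    by (intro mult_left_mono radial_derivative_le_dirichlet[OF hol p]) auto
   also have "\<dots> = ennreal C2 * dirichlet_enn p (Hop (cg g))" unfolding C2_def by (simp add: ennreal_mult mult.assoc)
   also have "\<dots> \<le> ennreal (C1 * a + C2) * M" using C a by (intro mult_mono ennreal_leI) (auto simp: M_def)
   finally show ?thesis .
  qed
  have "ennreal (J g powr p) * muck_A p r = ennreal (J g powr p) + ennreal (J g powr p) * A_int p r"
   by (simp add: muck_A_eq distrib_left)
  also have "\<dots> \<le> ennreal C1 * M + ennreal (C1 * a + C2) * M" by (intro add_mono 1 2)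
  also have "\<dots> = ennreal (C1 + (C1 * a + C2)) * M" using C a by (simp only: ennreal_plus[of C1 "C1 * a + C2"] mult_nonneg_nonneg add_nonneg_nonneg distrib_right less_imp_le)
  also have "\<dots> \<le> ennreal (C1 + C1 * a + C2 + 1) * M" by (intro mult_right_mono ennreal_leI) auto
  finally show ?thesis unfolding M_def .
 qed
 moreover have "0 < C1 + C1 * a + C2 + 1" using C a by (simp add: add_nonneg_pos)
 ultimately show ?thesis by blast
qed

text \<open>Take \<open>g = min w k powr (q - 1)\<close> on \<open>[r,1)\<close>. The \<open>p\<close>-th power
  of its norm is the integral \<open>I\<close> of \<open>min w k powr q\<close>, because
  \<open>(q - 1) * p = q\<close>, and \<open>J g \<ge> I\<close>. The truncation makes
  \<open>I\<close> finite, so that one factor \<open>I\<close> can be cancelled in the hypothesis;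
  then let \<open>k\<close> tend to infinity.\<close>

theorem muck_from_test:
 assumes p: "1 < p" "1 / p + 1 / q = 1" and C0: "0 < C0"
  and N: "\<And>g r. test_fun r g \<Longrightarrow> 0 < r \<Longrightarrow> r < 1 \<Longrightarrow> ennreal (J g powr p) * muck_A p r \<le> ennreal C0 * Lp_enn p (cg g)"
 shows "muck p q (C0 powr (1/p))" unfolding muck_def
proof
 fix r :: real assume r: "r \<in> {0<..<1}"
 have q: "1 < q" by (rule conjugate_gt_1[OF p])
 have pq: "(q - 1) * p = q" "1 / (p - 1) = q / p" using p q by (auto simp: field_simps)
 have "muck_A p r < top" using r p by (intro muck_A_finite) auto
 then obtain \<alpha> where \<alpha>: "muck_A p r = ennreal \<alpha>" "0 \<le> \<alpha>" by (cases "muck_A p r") auto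
 have \<alpha>1: "1 \<le> \<alpha>" using muck_A_ge_1[of p r] \<alpha> by simp
 define I where "I k = (NINT t:{r..}. ennreal (min (w t) (real k) powr q))" for k
 have Ik: "I k \<le> ennreal ((C0 / \<alpha>) powr (q/p))" for k
 proof -
  define g where "g t = min (w t) (real k) powr (q - 1) * indicator {r..} t" for t
  have [measurable]: "g \<in> borel_measurable borel" unfolding g_def by measurable
  have tf: "test_fun r g" unfolding test_fun_def
  proof (intro conjI allI impI exI)
   show "g t \<le> real k powr (q - 1)" for t
    using q by (auto simp: g_def intro!: powr_mono2 split: split_indicator)
  qed (auto simp: g_def)
  have "I k \<le> (NINT t:{r..1}. ennreal (real k powr q))" unfolding I_def
  proof (rule nn_integral_mono)
   fix t
   show "ennreal (min (w t) (real k) powr q) * indicator {r..} t \<le> ennreal (real k powr q) * indicator {r..1} t"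
   proof (cases "t \<in> {r..1}")
    case True
    then show ?thesis using q by (auto intro!: ennreal_leI powr_mono2)
   next
    case False
    then show ?thesis using r by (cases "r \<le> t") (auto simp: w_supp)
   qed
  qed
  also have "\<dots> = ennreal (real k powr q) * ennreal (1 - r)"
   using r by (subst nn_integral_cmult_indicator) auto
  also have "\<dots> < top" by (simp add: ennreal_mult_less_top)
  finally obtain i where i: "I k = ennreal i" "0 \<le> i" by (cases "I k") auto
  have "Lp_enn p (cg g) \<le> I k" unfolding Lp_enn_def I_def
  proof (rule nn_integral_mono)
   fix t
   show "ennreal (norm (cg g t) powr p) * indicator {0<..<1} t \<le> ennreal (min (w t) (real k) powr q) * indicator {r..} t"
    using pq p by (auto simp: g_def powr_powr split: split_indicator)
  qed
  then have L: "Lp_enn p (cg g) \<le> ennreal i" by (simp add: i)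
  have ig: "integrable lborel (\<lambda>t. g t * w t)"
   using test_integrable[OF tf, of "\<lambda>_. 1"] by (simp add: mult.commute)
  have gn: "0 \<le> g t" for t by (simp add: g_def)
  have "ennreal i \<le> ennreal (J g)"
  proof -
   have "I k \<le> (NINT t. ennreal (g t * w t))" unfolding I_def
   proof (rule nn_integral_mono)
    fix t
    define m where "m = min (w t) (real k)"
    have m: "0 \<le> m" "m \<le> w t" by (auto simp: m_def)
    have "m powr q = m powr (q - 1) * m"
    proof (cases "m = 0")
     case False
     then show ?thesis using m by (simp add: powr_diff)
    qed simp
    also have "\<dots> \<le> m powr (q - 1) * w t" using m by (intro mult_left_mono) auto
    finally have "m powr q \<le> m powr (q - 1) * w t" .
    then show "ennreal (min (w t) (real k) powr q) * indicator {r..} t \<le> ennreal (g t * w t)"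
     by (auto simp: g_def m_def[symmetric] intro!: ennreal_leI split: split_indicator)
   qed
   also have "\<dots> = ennreal (J g)" unfolding J_def using gn by (intro nn_integral_eq_integral ig) auto
   finally show ?thesis by (simp add: i)
  qed
  moreover have "0 \<le> J g" unfolding J_def using gn by (intro integral_nonneg_AE) auto
  ultimately have iJ: "i \<le> J g" by simp
  have "ennreal (i powr p * \<alpha>) = ennreal (i powr p) * muck_A p r" using \<alpha> by (simp add: ennreal_mult)
  also have "\<dots> \<le> ennreal (J g powr p) * muck_A p r" using iJ i p by (intro mult_right_mono ennreal_leI powr_mono2) auto
  also have "\<dots> \<le> ennreal C0 * Lp_enn p (cg g)" using r by (intro N tf) auto
  also have "\<dots> \<le> ennreal C0 * ennreal i" by (intro mult_left_mono L) auto
  also have "\<dots> = ennreal (C0 * i)" using C0 i by (simp add: ennreal_mult)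
  finally have e: "i powr p * \<alpha> \<le> C0 * i" using C0 i by (simp add: ennreal_le_iff)
  have "i \<le> (C0 / \<alpha>) powr (q/p)"
  proof (cases "i = 0")
   case False
   then have ip: "0 < i" using i by simp
   have "i powr p = i powr (p - 1) * i" using ip by (simp add: powr_diff)
   then have "(i powr (p - 1) * \<alpha>) * i \<le> C0 * i" using e by (simp add: mult_ac)
   then have "i powr (p - 1) * \<alpha> \<le> C0" using ip by (rule mult_right_le_imp_le)
   then have "i powr (p - 1) \<le> C0 / \<alpha>" using \<alpha>1 by (simp add: pos_le_divide_eq)
   then have "(i powr (p - 1)) powr (q/p) \<le> (C0 / \<alpha>) powr (q/p)" using p q by (intro powr_mono2) auto
   moreover have "(p - 1) * (q / p) = 1" using p unfolding pq(2)[symmetric] by simp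
   ultimately show ?thesis using ip by (simp add: powr_powr del: times_divide_eq_right)
  qed simp
  then show ?thesis by (simp add: i ennreal_leI)
 qed
 have "muck_W q r = (NINT t. (SUP k. ennreal (min (w t) (real k) powr q) * indicator {r..} t))" unfolding muck_W_def
 proof (rule nn_integral_cong)
  fix t
  obtain k where k: "w t \<le> real k" using real_arch_simple by blast
  show "ennreal (w t powr q) * indicator {r..} t = (SUP k. ennreal (min (w t) (real k) powr q) * indicator {r..} t)"
  proof (rule antisym)
   have "ennreal (w t powr q) * indicator {r..} t = ennreal (min (w t) (real k) powr q) * indicator {r..} t" using k by (simp add: min_absorb1)
   also have "\<dots> \<le> (SUP k. ennreal (min (w t) (real k) powr q) * indicator {r..} t)" by (rule SUP_upper) simp
   finally show "ennreal (w t powr q) * indicator {r..} t \<le> (SUP k. ennreal (min (w t) (real k) powr q) * indicator {r..} t)" .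
   show "(SUP k. ennreal (min (w t) (real k) powr q) * indicator {r..} t) \<le> ennreal (w t powr q) * indicator {r..} t"
    using q by (intro SUP_least mult_right_mono ennreal_leI powr_mono2) auto
  qed
 qed
 also have "\<dots> = (SUP k. I k)" unfolding I_def
 proof (rule nn_integral_monotone_convergence_SUP)
  show "incseq (\<lambda>k t. ennreal (min (w t) (real k) powr q) * indicator {r..} t)"
   using q by (intro incseq_SucI le_funI mult_right_mono ennreal_leI powr_mono2) auto
 qed measurable
 also have "\<dots> \<le> ennreal ((C0 / \<alpha>) powr (q/p))" by (intro SUP_least Ik)
 finally have W: "muck_W q r \<le> ennreal ((C0 / \<alpha>) powr (q/p))" .
 have "epow (muck_A p r) (1/p) * epow (muck_W q r) (1/q) \<le> epow (muck_A p r) (1/p) * epow (ennreal ((C0 / \<alpha>) powr (q/p))) (1/q)"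
  using q by (intro mult_left_mono epow_mono W) auto
 also have "\<dots> = ennreal (\<alpha> powr (1/p)) * ennreal ((C0 / \<alpha>) powr (1/p))"
  using q \<alpha> by (simp add: powr_powr)
 also have "\<dots> = ennreal (\<alpha> powr (1/p) * (C0 / \<alpha>) powr (1/p))" by (rule ennreal_mult'[symmetric]) simp
 also have "\<alpha> powr (1/p) * (C0 / \<alpha>) powr (1/p) = C0 powr (1/p)"
  using powr_mult[of \<alpha> "C0 / \<alpha>" "1/p"] \<alpha>1 by simp
 finally show "epow (muck_A p r) (1/p) * epow (muck_W q r) (1/q) \<le> ennreal (C0 powr (1/p))" .
qed

end

section \<open>Borel versions and the Bergman kernel\<close>

lemma measurable_completion_AE:
 fixes f :: "'a \<Rightarrow> 'b::topological_space"
 assumes g [measurable]: "g \<in> borel_measurable M" and eq: "AE x in M. f x = g x"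
 shows "f \<in> borel_measurable (completion M)"
proof (rule measurableI)
 fix A :: "'b set" assume A [measurable]: "A \<in> sets borel"
 have 1 [measurable]: "Measurable.pred (completion M) (\<lambda>x. (f x \<in> A) \<noteq> (g x \<in> A))"
  by (rule sets_completion_AE) (use eq in eventually_elim, simp)
 have 2 [measurable]: "Measurable.pred (completion M) (\<lambda>x. g x \<in> A)"
 proof -
  have "g \<in> borel_measurable (completion M)" by (rule measurable_completion) measurable
  then show ?thesis using A by measurable
 qed
 have "Measurable.pred (completion M) (\<lambda>x. ((f x \<in> A) \<noteq> (g x \<in> A)) \<noteq> (g x \<in> A))" by measurable
 also have "(\<lambda>x. ((f x \<in> A) \<noteq> (g x \<in> A)) \<noteq> (g x \<in> A)) = (\<lambda>x. f x \<in> A)" by auto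
 finally show "f -` A \<inter> space (completion M) \<in> sets (completion M)"
  by (simp add: pred_def vimage_def Int_def conj_commute)
qed simp

text \<open>Integrals against the completed measure are reduced to Borel functions, for which products and
  interchange of integrals are available.\<close>

lemma lebesgue_borel_version:
 fixes F F' :: "'a::euclidean_space \<Rightarrow> 'b::{banach, second_countable_topology}"
 assumes F' [measurable]: "F' \<in> borel_measurable borel" and eq: "AE x in lborel. F x = F' x"
 shows "integrable lebesgue F \<longleftrightarrow> integrable lborel F'"
  and "integral\<^sup>L lebesgue F = integral\<^sup>L lborel F'"
proof -
 have F: "F \<in> borel_measurable lebesgue" by (rule measurable_completion_AE[OF _ eq]) simp
 have F'2: "F' \<in> borel_measurable lebesgue" by (rule measurable_completion) simp
 have eq': "AE x in lebesgue. F x = F' x" by (rule AE_completion[OF eq])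
 show "integrable lebesgue F \<longleftrightarrow> integrable lborel F'"
  using integrable_cong_AE[OF F F'2 eq'] integrable_completion[of F' lborel] by simp
 show "integral\<^sup>L lebesgue F = integral\<^sup>L lborel F'"
  using integral_cong_AE[OF F F'2 eq'] integral_completion[of F' lborel] by simp
qed

lemma lborel_polar:
 "(lborel :: complex measure) = distr (density (lborel \<Otimes>\<^sub>M lborel)
   (\<lambda>(\<theta>, r). ennreal (r * indicator {0<..} r * indicator {0..2*pi} \<theta>))) borel (\<lambda>(\<theta>, r). of_real r * cis \<theta>)"
 (is "_ = distr (density ?L ?d) borel ?f")
proof (rule measure_eqI)
 have d [measurable]: "?d \<in> borel_measurable ?L" unfolding case_prod_beta by measurable
 have f [measurable]: "?f \<in> borel_measurable ?L" unfolding case_prod_beta by measurable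
 fix A :: "complex set" assume "A \<in> sets lborel"
 then have A [measurable]: "A \<in> sets borel" by simp
 have "emeasure (distr (density ?L ?d) borel ?f) A = (\<integral>\<^sup>+z. indicator A z \<partial>distr (density ?L ?d) borel ?f)"
  by simp
 also have "\<dots> = (\<integral>\<^sup>+x. indicator A (?f x) \<partial>density ?L ?d)" by (rule nn_integral_distr) auto
 also have "\<dots> = (\<integral>\<^sup>+x. ?d x * indicator A (?f x) \<partial>?L)" by (rule nn_integral_density) auto
 also have "\<dots> = (NINT \<theta>. (NINT r. ?d (\<theta>, r) * indicator A (?f (\<theta>, r))))"
  by (rule lborel.nn_integral_fst[symmetric]) measurable
 also have "\<dots> = (NINT \<theta>:{0..2*pi}. (NINT r:{0<..}. ennreal r * indicator A (of_real r * cis \<theta>)))"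
 proof (rule nn_integral_cong)
  fix \<theta> :: real
  have "(NINT r. ?d (\<theta>, r) * indicator A (?f (\<theta>, r)))
   = (NINT r. ennreal r * indicator A (of_real r * cis \<theta>) * indicator {0<..} r * indicator {0..2*pi} \<theta>)"
   by (intro nn_integral_cong) (auto split: split_indicator)
  also have "\<dots> = (NINT r:{0<..}. ennreal r * indicator A (of_real r * cis \<theta>)) * indicator {0..2*pi} \<theta>"
   by (rule nn_integral_multc) measurable
  finally show "(NINT r. ?d (\<theta>, r) * indicator A (?f (\<theta>, r)))
   = (NINT r:{0<..}. ennreal r * indicator A (of_real r * cis \<theta>)) * indicator {0..2*pi} \<theta>" .
 qed
 also have "\<dots> = (NINT z. indicator A z)" by (rule nn_integral_polar[symmetric]) measurable
 finally show "emeasure lborel A = emeasure (distr (density ?L ?d) borel ?f) A" by simp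
qed simp

text \<open>Polar coordinates for signed integrands, from the equality of measures \<open>lborel_polar\<close>.\<close>

lemma integral_polar:
 fixes g :: "complex \<Rightarrow> complex"
 assumes g: "integrable lborel g"
 shows "integral\<^sup>L lborel g = (LBINT r. (r * indicator {0<..} r) *\<^sub>R (LBINT \<theta>. indicator {0..2*pi} \<theta> *\<^sub>R g (of_real r * cis \<theta>)))"
proof -
 let ?L = "lborel \<Otimes>\<^sub>M lborel :: (real \<times> real) measure"
 let ?d = "\<lambda>(\<theta>, r). r * indicator {0<..} r * indicator {0..2*pi} \<theta> :: real"
 let ?f = "\<lambda>(\<theta>, r). of_real r * cis \<theta> :: complex"
 have d [measurable]: "?d \<in> borel_measurable ?L" unfolding case_prod_beta by measurable
 have f [measurable]: "?f \<in> borel_measurable ?L" unfolding case_prod_beta by measurable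
 have gm [measurable]: "g \<in> borel_measurable borel" using g by simp
 have L: "(lborel :: complex measure) = distr (density ?L (\<lambda>x. ennreal (?d x))) borel ?f"
 proof -
  have dd: "(\<lambda>x. ennreal (?d x)) = (\<lambda>(\<theta>, r). ennreal (r * indicator {0<..} r * indicator {0..2*pi} \<theta>))"
   by (auto simp: fun_eq_iff)
  show ?thesis unfolding dd by (rule lborel_polar)
 qed
 have nn: "AE x in ?L. 0 \<le> ?d x" by (rule AE_I2) (auto split: split_indicator)
 have gf: "(\<lambda>x. g (?f x)) \<in> borel_measurable ?L" by measurable
 have "integrable (distr (density ?L (\<lambda>x. ennreal (?d x))) borel ?f) g" using g L by simp
 then have "integrable (density ?L (\<lambda>x. ennreal (?d x))) (\<lambda>x. g (?f x))"
  by (subst (asm) integrable_distr_eq) auto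
 then have i: "integrable ?L (\<lambda>x. ?d x *\<^sub>R g (?f x))" by (subst (asm) integrable_density[OF gf d nn])
 have "integral\<^sup>L lborel g = (\<integral>x. g x \<partial>distr (density ?L (\<lambda>x. ennreal (?d x))) borel ?f)"
  by (subst L) simp
 also have "\<dots> = (\<integral>x. g (?f x) \<partial>density ?L (\<lambda>x. ennreal (?d x)))" by (rule integral_distr) auto
 also have "\<dots> = (\<integral>x. ?d x *\<^sub>R g (?f x) \<partial>?L)" by (rule integral_density[OF gf d nn])
 also have "\<dots> = (\<integral>x. (case x of (\<theta>, r) \<Rightarrow> (r * indicator {0<..} r * indicator {0..2*pi} \<theta>) *\<^sub>R g (of_real r * cis \<theta>)) \<partial>?L)"
  by (simp add: case_prod_beta)
 also have "\<dots> = (LBINT r. (LBINT \<theta>. (r * indicator {0<..} r * indicator {0..2*pi} \<theta>) *\<^sub>R g (of_real r * cis \<theta>)))"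
  by (rule lborel_pair.integral_snd[symmetric]) (use i in \<open>simp add: split_beta'\<close>)
 also have "\<dots> = (LBINT r. (r * indicator {0<..} r) *\<^sub>R (LBINT \<theta>. indicator {0..2*pi} \<theta> *\<^sub>R g (of_real r * cis \<theta>)))"
  by (simp add: scaleR_scaleR[symmetric] del: scaleR_scaleR)
 finally show ?thesis .
qed

text \<open>On the circle \<open>cnj z = r\<^sup>2 / z\<close>, so this is Cauchy's formula for the
  \<open>n\<close>-th derivative at 0.\<close>

lemma circle_coefficient:
 fixes f :: "complex \<Rightarrow> complex"
 assumes f: "f holomorphic_on ball 0 1" and r: "0 < r" "r < 1"
 shows "(LBINT \<theta>. indicator {0..2*pi} \<theta> *\<^sub>R (f (of_real r * cis \<theta>) * cnj ((of_real r * cis \<theta>) ^ n)))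
  = of_real (2 * pi * r ^ (2 * n)) * taylor_coeff f n"
proof -
 have sub: "cball 0 r \<subseteq> ball (0::complex) 1" using r by auto
 have "((\<lambda>u. f u / (u - 0) ^ (Suc n)) has_contour_integral ((2 * pi * \<i>) / (fact n) * (deriv ^^ n) f 0)) (circlepath 0 r)"
  using r by (intro Cauchy_has_contour_integral_higher_derivative_circlepath holomorphic_on_imp_continuous_on
    holomorphic_on_subset[OF f]) auto
 then have 1: "((\<lambda>\<theta>. f (0 + of_real r * cis \<theta>) / (0 + of_real r * cis \<theta> - 0) ^ Suc n * of_real r * \<i> * cis \<theta>)
   has_integral ((2 * pi * \<i>) / (fact n) * (deriv ^^ n) f 0)) {0..2*pi}"
  unfolding circlepath_def by (subst (asm) has_contour_integral_part_circlepath_iff) auto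
 have e: "(of_real (r ^ (2 * n)) / \<i>) * (f (0 + of_real r * cis \<theta>) / (0 + of_real r * cis \<theta> - 0) ^ Suc n * of_real r * \<i> * cis \<theta>)
   = f (of_real r * cis \<theta>) * cnj ((of_real r * cis \<theta>) ^ n)" for \<theta>
 proof -
  define z where "z = of_real r * cis \<theta>"
  have z: "z \<noteq> 0" using r by (simp add: z_def)
  have zz: "z * cnj z = of_real (r ^ 2)"
   unfolding complex_norm_square[symmetric] using r by (simp add: z_def norm_mult)
  have "z ^ n * cnj (z ^ n) = of_real (r ^ (2 * n))"
   using arg_cong[OF zz, of "\<lambda>x. x ^ n"] by (simp add: power_mult_distrib power_mult)
  then have "cnj (z ^ n) = of_real (r ^ (2 * n)) / z ^ n" using z by (simp add: field_simps)
  moreover have "f z / z ^ Suc n * of_real r * \<i> * cis \<theta> = \<i> * (f z / z ^ n)"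
  proof -
   have "f z / z ^ Suc n * of_real r * \<i> * cis \<theta> = f z / z ^ Suc n * \<i> * z" by (simp add: z_def mult_ac)
   also have "\<dots> = \<i> * (f z / z ^ n)" using z by simp
   finally show ?thesis .
  qed
  moreover have "k \<noteq> 0 \<Longrightarrow> (A / k) * (k * F) = F * A" for k A F :: complex by simp
  from this[OF complex_i_not_zero]
  have "(of_real (r ^ (2 * n)) / \<i>) * (\<i> * (f z / z ^ n)) = f z * (of_real (r ^ (2 * n)) / z ^ n)" by simp
  ultimately show ?thesis by (simp only: z_def[symmetric] add_0_left diff_0_right)
 qed
 have 2: "((\<lambda>\<theta>. f (of_real r * cis \<theta>) * cnj ((of_real r * cis \<theta>) ^ n)) has_integral
   (of_real (r ^ (2 * n)) / \<i>) * ((2 * pi * \<i>) / (fact n) * (deriv ^^ n) f 0)) {0..2*pi}"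
  using has_integral_mult_right[OF 1, of "of_real (r ^ (2 * n)) / \<i>"] unfolding e .
 have c: "continuous_on {0..2*pi} (\<lambda>\<theta>. f (of_real r * cis \<theta>) * cnj ((of_real r * cis \<theta>) ^ n))"
 proof -
  have "continuous_on {0..2*pi} (\<lambda>\<theta>. f (of_real r * cis \<theta>))"
   by (rule continuous_on_compose2[OF holomorphic_on_imp_continuous_on[OF f]])
     (use r in \<open>auto simp: norm_mult intro!: continuous_intros\<close>)
  then show ?thesis by (intro continuous_on_mult continuous_on_cnj continuous_on_power continuous_intros)
 qed
 have "(LBINT \<theta>. indicator {0..2*pi} \<theta> *\<^sub>R (f (of_real r * cis \<theta>) * cnj ((of_real r * cis \<theta>) ^ n)))
   = integral {0..2*pi} (\<lambda>\<theta>. f (of_real r * cis \<theta>) * cnj ((of_real r * cis \<theta>) ^ n))"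
  using set_borel_integral_eq_integral(2)[OF borel_integrable_atLeastAtMost'[OF c]]
  by (simp add: set_lebesgue_integral_def)
 also have "\<dots> = (of_real (r ^ (2 * n)) / \<i>) * ((2 * pi * \<i>) / (fact n) * (deriv ^^ n) f 0)"
  using 2 by (rule integral_unique)
 also have "\<dots> = of_real (2 * pi * r ^ (2 * n)) * taylor_coeff f n"
 proof -
  have "k \<noteq> 0 \<Longrightarrow> (A / k) * ((q * k) / F * D) = q * A * (D / F)" for k A q F D :: complex by simp
  from this[OF complex_i_not_zero] show ?thesis by (simp add: taylor_coeff_def)
 qed
 finally show ?thesis .
qed

text \<open>A null set of radii sweeps out a null set in the disc.\<close>

lemma AE_disc_norm:
 assumes "AE t in lborel. t \<in> {0<..<1::real} \<longrightarrow> Q t"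
 shows "AE z in lborel. z \<in> ball (0::complex) 1 \<longrightarrow> z \<noteq> 0 \<longrightarrow> Q (norm z)"
proof -
 obtain N where N: "\<And>t. t \<in> space lborel - N \<Longrightarrow> t \<in> {0<..<1::real} \<longrightarrow> Q t" "N \<in> null_sets lborel"
  using AE_E3[OF assms] by blast
 then have [measurable]: "N \<in> sets borel" by auto
 define S where "S = {z::complex. norm z \<in> N}"
 have [measurable]: "S \<in> sets borel" unfolding S_def by measurable
 have z: "(NINT r:{0<..}. ennreal r * indicator S (of_real r * cis \<theta>)) = 0" for \<theta>
 proof -
  have "(NINT r:{0<..}. ennreal r * indicator S (of_real r * cis \<theta>))
    = (NINT r:N. ennreal r * indicator {0<..} r)"
   by (intro nn_integral_cong) (auto simp: S_def norm_mult split: split_indicator)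
  also have "\<dots> = 0" by (rule nn_integral_null_set[OF N(2)])
  finally show ?thesis .
 qed
 have "(NINT z. indicator S z) = 0" by (subst nn_integral_polar) (simp_all add: z)
 then have "emeasure lborel S = 0" by simp
 then have "S \<in> null_sets lborel" by (simp add: null_sets_def)
 then have "AE z in lborel. z \<notin> S" by (rule AE_not_in)
 then show ?thesis
 proof eventually_elim
  fix z assume "z \<notin> S"
  then show "z \<in> ball (0::complex) 1 \<longrightarrow> z \<noteq> 0 \<longrightarrow> Q (norm z)" using N(1)[of "norm z"] by (auto simp: S_def)
 qed
qed

lemma measurable_disc_continuous:
 fixes G :: "complex \<Rightarrow> 'a::{banach, second_countable_topology}"
 assumes "continuous_on (ball 0 1) G"
 shows "(\<lambda>z. indicator (ball 0 1) z *\<^sub>R G z) \<in> borel_measurable borel"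
 by (rule borel_measurable_continuous_on_indicator[OF _ assms]) simp

context dweight
begin

abbreviation weighted :: "complex \<Rightarrow> 'b::real_vector \<Rightarrow> 'b" where
 "weighted z v \<equiv> indicator (ball 0 1) z *\<^sub>R (w (norm z) *\<^sub>R v)"

lemma integrable_disc_weight:
 fixes G :: "complex \<Rightarrow> 'a::{banach, second_countable_topology}"
 assumes G: "continuous_on (ball 0 1) G" and b: "\<And>z. norm z < 1 \<Longrightarrow> norm (G z) \<le> B"
 shows "integrable lborel (\<lambda>z. weighted z (G z))"
proof -
 have [measurable]: "(\<lambda>z. indicator (ball 0 1) z *\<^sub>R G z) \<in> borel_measurable borel"
  by (rule measurable_disc_continuous[OF G])
 have e: "(\<lambda>z. weighted z (G z)) = (\<lambda>z. w (norm z) *\<^sub>R (indicator (ball 0 1) z *\<^sub>R G z))"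
  by (simp add: mult.commute)
 have wi: "integrable lborel (\<lambda>z::complex. w (norm z))"
 proof (rule integrableI_bounded)
  have "(NINT z. ennreal (norm (w (norm (z::complex)))))
   = (NINT \<theta>:{0..2*pi}. (NINT r:{0<..}. ennreal r * ennreal (w (norm (of_real r * cis \<theta>)))))"
   by (subst nn_integral_polar) auto
  also have "\<dots> \<le> (NINT \<theta>:{0..2*pi}. (NINT r. ennreal (w r)))"
  proof (intro nn_integral_mono mult_right_mono)
   fix \<theta> r :: real
   show "ennreal r * ennreal (w (norm (of_real r * cis \<theta>))) * indicator {0<..} r \<le> ennreal (w r)"
   proof (cases "r \<in> {0<..<1}")
    case True
    then have "r * w r \<le> 1 * w r" by (intro mult_right_mono) auto
    then show ?thesis using True by (simp add: norm_mult ennreal_mult'[symmetric] ennreal_leI)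
   next
    case False
    then show ?thesis by (cases "0 < r") (auto simp: norm_mult w_supp)
   qed
  qed auto
  also have "\<dots> = (NINT r. ennreal (w r)) * ennreal (2 * pi)" by (subst nn_integral_cmult_indicator) auto
  also have "(NINT r. ennreal (w r)) = ennreal (integral\<^sup>L lborel w)"
   by (intro nn_integral_eq_integral w_integrable) auto
  finally show "(NINT z. ennreal (norm (w (norm (z::complex))))) < \<infinity>"
   by (auto simp: ennreal_mult_less_top elim: le_less_trans)
 qed measurable
 show ?thesis
 proof (rule Bochner_Integration.integrable_bound)
  show "integrable lborel (\<lambda>z::complex. B * w (norm z))" using wi by simp
  show "AE z in lborel. norm (weighted z (G z)) \<le> norm (B * w (norm z))"
  proof (intro AE_I2)
   fix z :: complex
   show "norm (weighted z (G z)) \<le> norm (B * w (norm z))"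
   proof (cases "norm z < 1")
    case True
    then have "norm (G z) \<le> \<bar>B\<bar>" using b[of z] by linarith
    then have "w (norm z) * norm (G z) \<le> w (norm z) * \<bar>B\<bar>" by (rule mult_left_mono) simp
    then show ?thesis using True by (simp add: abs_mult mult.commute)
   qed simp
  qed
 qed (unfold e, measurable)
qed

lemma disc_coefficient:
 assumes f: "f holomorphic_on ball 0 1"
  and i: "integrable lborel (\<lambda>z. weighted z (f z * cnj (z ^ n)))"
 shows "(LBINT z. weighted z (f z * cnj (z ^ n)))
   = of_real (2 * pi * moment (2 * n + 1)) * taylor_coeff f n"
proof -
 have eq: "(r * indicator {0<..} r) *\<^sub>R (LBINT \<theta>. indicator {0..2*pi} \<theta> *\<^sub>R (indicator (ball 0 1) (of_real r * cis \<theta>) *\<^sub>R (w (norm (of_real r * cis \<theta>)) *\<^sub>R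
   (f (of_real r * cis \<theta>) * cnj ((of_real r * cis \<theta>) ^ n))))) = of_real (w r * r ^ (2 * n + 1)) * (of_real (2 * pi) * taylor_coeff f n)" for r
 proof (cases "r \<in> {0<..<1}")
  case True
  then have "(LBINT \<theta>. indicator {0..2*pi} \<theta> *\<^sub>R (indicator (ball 0 1) (of_real r * cis \<theta>) *\<^sub>R (w (norm (of_real r * cis \<theta>)) *\<^sub>R
   (f (of_real r * cis \<theta>) * cnj ((of_real r * cis \<theta>) ^ n)))))
   = (LBINT \<theta>. w r *\<^sub>R (indicator {0..2*pi} \<theta> *\<^sub>R (f (of_real r * cis \<theta>) * cnj ((of_real r * cis \<theta>) ^ n))))"
   by (simp add: norm_mult mult.commute)
  also have "\<dots> = w r *\<^sub>R (of_real (2 * pi * r ^ (2 * n)) * taylor_coeff f n)"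
   using True by (subst integral_scaleR_right) (simp only: circle_coefficient[OF f] greaterThanLessThan_iff)
  finally show ?thesis using True by (simp add: scaleR_conv_of_real mult_ac)
 next
  case False
  then show ?thesis by (cases "0 < r") (auto simp: w_supp norm_mult)
 qed
 have "(LBINT z. weighted z (f z * cnj (z ^ n)))
   = (LBINT r. of_real (w r * r ^ (2 * n + 1)) * (of_real (2 * pi) * taylor_coeff f n))"
  unfolding integral_polar[OF i] eq ..
 also have "\<dots> = of_real (moment (2 * n + 1)) * (of_real (2 * pi) * taylor_coeff f n)"
  unfolding moment_def by (simp only: integral_mult_left_zero integral_complex_of_real)
 finally show ?thesis by (simp add: mult_ac)
qed

end

text \<open>A weight as it is given, together with a Borel representative.\<close>

locale weight_version = dweight w for w +
 fixes \<omega> :: "real \<Rightarrow> real"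
 assumes version: "AE t in lborel. t \<in> {0<..<1} \<longrightarrow> \<omega> t = w t"
begin

lemma disc_version:
 fixes G :: "complex \<Rightarrow> 'a::{banach, second_countable_topology}"
 assumes G: "continuous_on (ball 0 1) G"
 shows "disc_integrable (\<lambda>z. \<omega> (norm z) *\<^sub>R G z) \<longleftrightarrow> integrable lborel (\<lambda>z. weighted z (G z))"
  and "disc_integral (\<lambda>z. \<omega> (norm z) *\<^sub>R G z) = (1 / pi) *\<^sub>R (LBINT z. weighted z (G z))"
proof -
 have [measurable]: "(\<lambda>z. indicator (ball 0 1) z *\<^sub>R G z) \<in> borel_measurable borel"
  by (rule measurable_disc_continuous[OF G])
 have e: "(\<lambda>z. weighted z (G z)) = (\<lambda>z. w (norm z) *\<^sub>R (indicator (ball 0 1) z *\<^sub>R G z))"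
  by (simp add: mult.commute)
 have m: "(\<lambda>z. weighted z (G z)) \<in> borel_measurable borel"
  unfolding e by measurable
 have "AE z in lborel. z \<noteq> (0::complex)" by (rule AE_lborel_singleton)
 with AE_disc_norm[OF version]
 have ae: "AE z in lborel. indicator (ball 0 1) z *\<^sub>R (\<omega> (norm z) *\<^sub>R G z) = weighted z (G z)"
  by eventually_elim (auto split: split_indicator)
 show "disc_integrable (\<lambda>z. \<omega> (norm z) *\<^sub>R G z) \<longleftrightarrow> integrable lborel (\<lambda>z. weighted z (G z))"
  unfolding disc_integrable_def set_integrable_def by (rule lebesgue_borel_version(1)[OF m ae])
 show "disc_integral (\<lambda>z. \<omega> (norm z) *\<^sub>R G z) = (1 / pi) *\<^sub>R (LBINT z. weighted z (G z))"
  unfolding disc_integral_def set_lebesgue_integral_def lebesgue_borel_version(2)[OF m ae] ..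
qed

lemma bergman_space_iff:
 "f \<in> bergman_space \<omega> \<longleftrightarrow> f holomorphic_on ball 0 1 \<and> integrable lborel (\<lambda>z. weighted z ((norm (f z))\<^sup>2))"
proof (cases "f holomorphic_on ball 0 1")
 case True
 have "continuous_on (ball 0 1) (\<lambda>z. (norm (f z))\<^sup>2)"
  by (intro continuous_intros holomorphic_on_imp_continuous_on True)
 from disc_version(1)[OF this] show ?thesis using True by (simp add: bergman_space_def mult.commute)
qed (simp add: bergman_space_def)

lemma bounded_in_bergman_space:
 assumes f: "f holomorphic_on ball 0 1" and b: "\<And>z. norm z < 1 \<Longrightarrow> norm (f z) \<le> B"
 shows "f \<in> bergman_space \<omega>" unfolding bergman_space_iff
proof
 show "integrable lborel (\<lambda>z. weighted z ((norm (f z))\<^sup>2))"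
 proof (rule integrable_disc_weight)
  show "continuous_on (ball 0 1) (\<lambda>z. (norm (f z))\<^sup>2)"
   by (intro continuous_intros holomorphic_on_imp_continuous_on f)
  show "norm ((norm (f z))\<^sup>2) \<le> B\<^sup>2" if "norm z < 1" for z
   using b[OF that] by (simp add: power_mono)
 qed
qed (rule f)

text \<open>\<open>\<bar>f\<bar> \<le> 1 + \<bar>f\<bar>\<^sup>2\<close> and the weight is integrable over the
  disc.\<close>

lemma integrable_bergman_times_bounded:
 assumes f: "f \<in> bergman_space \<omega>" and c: "continuous_on (ball 0 1) k" and b: "\<And>z. norm z < 1 \<Longrightarrow> norm (k z) \<le> B"
 shows "integrable lborel (\<lambda>z. weighted z (f z * k z))"
proof (rule Bochner_Integration.integrable_bound)
 have h: "f holomorphic_on ball 0 1" and 2: "integrable lborel (\<lambda>z. weighted z ((norm (f z))\<^sup>2))"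
  using f by (auto simp: bergman_space_iff)
 have 1: "integrable lborel (\<lambda>z::complex. weighted z (1::real))"
  by (rule integrable_disc_weight[where B=1]) auto
 show "integrable lborel (\<lambda>z. B * (weighted z (1::real) + weighted z ((norm (f z))\<^sup>2)))"
  by (intro integrable_mult_right Bochner_Integration.integrable_add 1 2)
 have c2: "continuous_on (ball 0 1) (\<lambda>z. f z * k z)"
  by (intro continuous_on_mult c holomorphic_on_imp_continuous_on h)
 have [measurable]: "(\<lambda>z. indicator (ball 0 1) z *\<^sub>R (f z * k z)) \<in> borel_measurable borel"
  by (rule measurable_disc_continuous[OF c2])
 have e: "(\<lambda>z. weighted z (f z * k z)) = (\<lambda>z. w (norm z) *\<^sub>R (indicator (ball 0 1) z *\<^sub>R (f z * k z)))"
  by (simp add: mult.commute)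
 show "(\<lambda>z. weighted z (f z * k z)) \<in> borel_measurable lborel"
  unfolding e by measurable
 show "AE z in lborel. norm (weighted z (f z * k z))
  \<le> norm (B * (weighted z (1::real) + weighted z ((norm (f z))\<^sup>2)))"
 proof (intro AE_I2)
  fix z :: complex
  show "norm (weighted z (f z * k z))
  \<le> norm (B * (weighted z (1::real) + weighted z ((norm (f z))\<^sup>2)))"
  proof (cases "norm z < 1")
   case True
   have B: "0 \<le> B" using b[OF True] norm_ge_zero[of "k z"] by linarith
   have "norm (f z) \<le> 1 + (norm (f z))\<^sup>2" using sum_squares_bound[of 1 "norm (f z)"] norm_ge_zero[of "f z"]
    unfolding one_power2 mult_1_right by linarith
   then have "norm (f z) * norm (k z) \<le> (1 + (norm (f z))\<^sup>2) * B" using b[OF True] by (intro mult_mono) auto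
   then have "w (norm z) * (norm (f z) * norm (k z)) \<le> w (norm z) * ((1 + (norm (f z))\<^sup>2) * B)" by (rule mult_left_mono) simp
   then show ?thesis using True B by (simp add: norm_mult abs_mult algebra_simps)
  qed simp
 qed
qed

lemma bergman_coefficient:
 assumes f: "f \<in> bergman_space \<omega>"
 shows "disc_integral (\<lambda>z. f z * cnj (z ^ n) * of_real (\<omega> (norm z))) = of_real (2 * moment (2 * n + 1)) * taylor_coeff f n"
proof -
 have h: "f holomorphic_on ball 0 1" using f by (auto simp: bergman_space_iff)
 have c: "continuous_on (ball 0 1) (\<lambda>z. f z * cnj (z ^ n))"
  by (intro continuous_intros holomorphic_on_imp_continuous_on h)
 have "integrable lborel (\<lambda>z. weighted z (f z * cnj (z ^ n)))"
  by (rule integrable_bergman_times_bounded[OF f, of _ 1])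
    (auto intro!: continuous_intros simp: norm_power power_le_one)
 from disc_coefficient[OF h this] disc_version(2)[OF c]
 have "disc_integral (\<lambda>z. \<omega> (norm z) *\<^sub>R (f z * cnj (z ^ n))) = (1 / pi) *\<^sub>R (of_real (2 * pi * moment (2 * n + 1)) * taylor_coeff f n)"
  by simp
 then show ?thesis by (simp add: scaleR_conv_of_real mult_ac)
qed

text \<open>Integrate the kernel series term by term: its \<open>n\<close>-th term picks out
  \<open>t ^ n\<close> times the \<open>n\<close>-th coefficient of \<open>f\<close>, by
  orthogonality.\<close>

lemma kernel_is_bergman_kernel:
 assumes t: "0 \<le> t" "t < 1"
 shows "is_bergman_kernel \<omega> (of_real t) (\<lambda>\<zeta>. U (of_real t * \<zeta>) / 2)"
proof -
 have nt: "norm (of_real t * \<zeta> :: complex) \<le> t" if "norm \<zeta> < 1" for \<zeta>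
  using mult_left_mono[of "norm \<zeta>" 1 t] that t by (simp add: norm_mult)
 have inb: "of_real t * \<zeta> \<in> ball (0::complex) 1" if "\<zeta> \<in> ball 0 1" for \<zeta> using nt[of \<zeta>] that t by simp
 have hU: "U holomorphic_on ball 0 1"
 proof -
  have "P holomorphic_on ball 0 1" unfolding holomorphic_on_open[OF open_ball] using P_deriv by (metis mem_ball_0)
  then have "deriv P holomorphic_on ball 0 1" by (rule holomorphic_deriv) simp
  then show ?thesis by (rule holomorphic_transform) (auto intro!: DERIV_imp_deriv P_deriv)
 qed
 have hB: "(\<lambda>\<zeta>. U (of_real t * \<zeta>) / 2) holomorphic_on ball 0 1"
 proof -
  have "(U \<circ> (\<lambda>\<zeta>. of_real t * \<zeta>)) holomorphic_on ball 0 1"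
   by (rule holomorphic_on_compose_gen[OF _ hU]) (use inb in \<open>auto intro!: holomorphic_intros\<close>)
  then show ?thesis by (intro holomorphic_intros) (simp_all add: o_def)
 qed
 define S where "S = (\<Sum>n. u n * t ^ n)"
 have su: "summable (\<lambda>n. u n * t ^ n)" using t by (intro summable_u) auto
 have tn: "norm (of_real (u n) * (of_real t * \<zeta>) ^ n) \<le> u n * t ^ n" if "norm \<zeta> < 1" for n and \<zeta> :: complex
  using power_mono[OF nt[OF that], of n] by (simp add: norm_mult norm_power mult_left_mono)
 have bB: "norm (U (of_real t * \<zeta>) / 2) \<le> S" if \<zeta>: "norm \<zeta> < 1" for \<zeta>
 proof -
  have "norm (U (of_real t * \<zeta>)) \<le> S" unfolding U_def S_def by (rule norm_suminf_le[OF tn[OF \<zeta>] su])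
  moreover have "0 \<le> norm (U (of_real t * \<zeta>))" by simp
  ultimately show ?thesis unfolding norm_divide norm_numeral by linarith
 qed
 have B: "(\<lambda>\<zeta>. U (of_real t * \<zeta>) / 2) \<in> bergman_space \<omega>"
  by (rule bounded_in_bergman_space[OF hB bB])
 show ?thesis unfolding is_bergman_kernel_def
 proof (intro conjI B ballI)
  fix f assume f: "f \<in> bergman_space \<omega>"
  have h: "f holomorphic_on ball 0 1" using f by (auto simp: bergman_space_iff)
  define g where "g n z = of_real (u n * t ^ n / 2) * (weighted z (f z * cnj (z ^ n)))" for n and z :: complex
  define G where "G z = weighted z (f z * 1)" for z :: complex
  have Gi: "integrable lborel G" unfolding G_def by (rule integrable_bergman_times_bounded[OF f, of _ 1]) auto
  have mi: "integrable lborel (\<lambda>z. weighted z (f z * cnj (z ^ n)))" for n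
   by (rule integrable_bergman_times_bounded[OF f, of _ 1])
     (auto intro!: continuous_intros simp: norm_power power_le_one)
  have gi: "integrable lborel (g n)" for n unfolding g_def[abs_def] by (intro integrable_mult_right mi)
  have gb: "norm (g n z) \<le> (u n * t ^ n) * norm (G z)" for n z
  proof (cases "norm z < 1")
   case True
   have "norm (cnj (z ^ n)) \<le> 1" using True by (simp add: norm_power power_le_one)
   then have "(u n * t ^ n / 2) * (norm (G z) * norm (cnj (z ^ n))) \<le> (u n * t ^ n) * (norm (G z) * 1)"
    using t by (intro mult_mono mult_left_mono) auto
   moreover have "norm (g n z) = (u n * t ^ n / 2) * (norm (G z) * norm (cnj (z ^ n)))"
    using t by (simp add: g_def G_def norm_mult norm_power)
   ultimately show ?thesis by (simp only: mult_1_right)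
  qed (use t in \<open>simp add: g_def\<close>)
  have s1: "AE z in lborel. summable (\<lambda>n. norm (g n z))"
   by (intro AE_I2 summable_comparison_test_ev[OF _ summable_mult2[OF su]]) (auto intro!: always_eventually gb)
  have s2: "summable (\<lambda>n. (LBINT z. norm (g n z)))"
  proof (rule summable_comparison_test_ev[OF _ summable_mult2[OF su]])
   have "(LBINT z. norm (g n z)) \<le> (LBINT z. (u n * t ^ n) * norm (G z))" for n
    by (intro integral_mono gb integrable_norm gi integrable_mult_right Gi)
   then have "norm (LBINT z. norm (g n z)) \<le> u n * t ^ n * (LBINT z. norm (G z))" for n by simp
   then show "\<forall>\<^sub>F n in sequentially. norm (LBINT z. norm (g n z)) \<le> u n * t ^ n * (LBINT z. norm (G z))" by simp
  qed
  have gs: "(\<Sum>n. g n z) = weighted z (f z * cnj (U (of_real t * z) / 2))" for z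
  proof (cases "norm z < 1")
   case True
   have "(\<lambda>n. of_real (u n) * (of_real t * z) ^ n) sums U (of_real t * z)"
    unfolding U_def using inb[of z] True by (intro summable_sums summable_U) auto
   then have "(\<lambda>n. cnj (of_real (u n) * (of_real t * z) ^ n)) sums cnj (U (of_real t * z))" by (simp only: sums_cnj)
   then have "(\<lambda>n. (w (norm z) *\<^sub>R f z / 2) * cnj (of_real (u n) * (of_real t * z) ^ n)) sums ((w (norm z) *\<^sub>R f z / 2) * cnj (U (of_real t * z)))"
    by (rule sums_mult)
   also have "(\<lambda>n. (w (norm z) *\<^sub>R f z / 2) * cnj (of_real (u n) * (of_real t * z) ^ n)) = (\<lambda>n. g n z)"
    using True by (simp add: g_def fun_eq_iff power_mult_distrib scaleR_conv_of_real mult_ac)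
   finally show ?thesis using True by (simp add: sums_iff scaleR_conv_of_real)
  qed (simp add: g_def)
  have ev: "(LBINT z. g n z) = of_real pi * (taylor_coeff f n * of_real t ^ n)" for n
  proof -
   have "(LBINT z. g n z) = of_real (u n * t ^ n / 2) * (of_real (2 * pi * moment (2 * n + 1)) * taylor_coeff f n)"
    unfolding g_def by (simp only: integral_mult_right_zero disc_coefficient[OF h mi])
   also have "\<dots> = of_real (u n * moment (2 * n + 1)) * (of_real pi * (taylor_coeff f n * of_real t ^ n))" by (simp add: mult_ac)
   also have "u n * moment (2 * n + 1) = 1" using moment_pos[of "2 * n + 1"] by (simp add: u_def)
   finally show ?thesis by simp
  qed
  have "(\<lambda>n. taylor_coeff f n * (of_real t - 0) ^ n) sums f (of_real t)"
   unfolding taylor_coeff_def using t by (intro holomorphic_power_series[OF h]) auto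
  then have fs: "(\<lambda>n. of_real pi * (taylor_coeff f n * of_real t ^ n)) sums (of_real pi * f (of_real t))"
   by (intro sums_mult) simp
  have c: "continuous_on (ball 0 1) (\<lambda>z. f z * cnj (U (of_real t * z) / 2))"
   by (intro continuous_on_mult continuous_on_cnj holomorphic_on_imp_continuous_on h hB)
  have "disc_integral (\<lambda>z. \<omega> (norm z) *\<^sub>R (f z * cnj (U (of_real t * z) / 2)))
    = (1 / pi) *\<^sub>R (LBINT z. (\<Sum>n. g n z))" unfolding gs by (rule disc_version(2)[OF c])
  also have "(LBINT z. (\<Sum>n. g n z)) = (\<Sum>n. integral\<^sup>L lborel (g n))"
   by (rule integral_suminf[OF gi s1 s2])
  also have "\<dots> = of_real pi * f (of_real t)" using fs unfolding ev by (rule sums_unique[symmetric])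
  finally show "f (of_real t) = disc_integral (\<lambda>z. f z * cnj (U (of_real t * z) / 2) * of_real (\<omega> (norm z)))"
   by (simp add: scaleR_conv_of_real mult_ac)
 qed
qed

text \<open>Testing the reproducing property with monomials determines every coefficient.\<close>

lemma bergman_kernel_unique:
 assumes B: "is_bergman_kernel \<omega> (of_real t) B" and z: "norm z < 1"
 shows "B z = U (of_real t * z) / 2"
proof -
 have Bs: "B \<in> bergman_space \<omega>" and rep: "\<And>f. f \<in> bergman_space \<omega> \<Longrightarrow>
   f (of_real t) = disc_integral (\<lambda>\<zeta>. f \<zeta> * cnj (B \<zeta>) * of_real (\<omega> (norm \<zeta>)))"
  using B by (auto simp: is_bergman_kernel_def)
 have h: "B holomorphic_on ball 0 1" using Bs by (auto simp: bergman_space_iff)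
 have coeff: "taylor_coeff B n = of_real (u n / 2 * t ^ n)" for n
 proof -
  have mon: "(\<lambda>\<zeta>. \<zeta> ^ n) \<in> bergman_space \<omega>"
   by (rule bounded_in_bergman_space[of _ 1]) (auto intro!: holomorphic_intros simp: norm_power power_le_one)
  have "of_real t ^ n = disc_integral (\<lambda>\<zeta>. \<zeta> ^ n * cnj (B \<zeta>) * of_real (\<omega> (norm \<zeta>)))"
   using rep[OF mon] by simp
  also have "\<dots> = cnj (disc_integral (\<lambda>\<zeta>. B \<zeta> * cnj (\<zeta> ^ n) * of_real (\<omega> (norm \<zeta>))))"
  proof -
   have e: "(\<lambda>z. indicator (ball 0 1) z *\<^sub>R (z ^ n * cnj (B z) * of_real (\<omega> (norm z)))) =
    (\<lambda>z. cnj (indicator (ball 0 1) z *\<^sub>R (B z * cnj (z ^ n) * of_real (\<omega> (norm z)))))"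
    by (simp add: fun_eq_iff mult_ac)
   have "(LINT z|lebesgue. indicator (ball 0 1) z *\<^sub>R (z ^ n * cnj (B z) * of_real (\<omega> (norm z)))) =
    cnj (LINT z|lebesgue. indicator (ball 0 1) z *\<^sub>R (B z * cnj (z ^ n) * of_real (\<omega> (norm z))))"
    unfolding e by (rule Bochner_Integration.integral_cnj)
   then show ?thesis by (simp only: disc_integral_def set_lebesgue_integral_def complex_cnj_scaleR)
  qed
  also have "\<dots> = cnj (of_real (2 * moment (2 * n + 1)) * taylor_coeff B n)"
   by (simp only: bergman_coefficient[OF Bs])
  finally have "cnj (of_real t ^ n) = of_real (2 * moment (2 * n + 1)) * taylor_coeff B n"
   by (metis complex_cnj_cnj)
  then have "of_real t ^ n = of_real (2 * moment (2 * n + 1)) * taylor_coeff B n" by simp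
  moreover have "of_real (2 * moment (2 * n + 1)) \<noteq> (0::complex)" using moment_pos[of "2 * n + 1"] by simp
  ultimately show ?thesis by (simp add: u_def field_simps)
 qed
 have "(\<lambda>n. taylor_coeff B n * (z - 0) ^ n) sums B z"
  unfolding taylor_coeff_def using z by (intro holomorphic_power_series[OF h]) auto
 then have "B z = (\<Sum>n. of_real (u n) * (of_real t * z) ^ n / 2)"
  by (simp add: coeff sums_iff power_mult_distrib mult_ac)
 also have "\<dots> = U (of_real t * z) / 2"
 proof (cases "summable (\<lambda>n. of_real (u n) * (of_real t * z) ^ n)")
  case True
  then show ?thesis unfolding U_def by (rule suminf_divide)
 next
  case False
  then have "\<not> summable (\<lambda>n. of_real (u n) * (of_real t * z) ^ n / 2)" by (simp add: summable_divide_iff)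
  moreover have "summable (\<lambda>n. of_real (u n) * (of_real t * z) ^ n / 2)"
   using \<open>(\<lambda>n. taylor_coeff B n * (z - 0) ^ n) sums B z\<close>
   by (simp add: coeff sums_iff power_mult_distrib mult_ac)
  ultimately show ?thesis by simp
 qed
 finally show ?thesis .
qed

lemma hilbert_kernel_eq:
 assumes t: "0 < t" "t < 1" and z: "norm z < 1"
 shows "hilbert_kernel \<omega> t z = V (of_real t * z) / 2"
proof -
 have "is_bergman_kernel \<omega> (of_real t) (bergman_kernel \<omega> (of_real t))"
  unfolding bergman_kernel_def by (rule someI[where P = "is_bergman_kernel \<omega> (of_real t)", OF kernel_is_bergman_kernel]) (use t in auto)
 then have K: "bergman_kernel \<omega> (of_real t) \<zeta> = U (of_real t * \<zeta>) / 2" if "norm \<zeta> < 1" for \<zeta>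
  using that by (rule bergman_kernel_unique)
 show ?thesis
 proof (cases "z = 0")
  case True
  then show ?thesis using K[of 0] by (simp add: hilbert_kernel_def)
 next
  case False
  have seg: "path_image (linepath 0 z) \<subseteq> ball (0::complex) 1" using z by (simp add: closed_segment_subset)
  have "contour_integral (linepath 0 z) (bergman_kernel \<omega> (of_real t)) = contour_integral (linepath 0 z) (\<lambda>\<zeta>. U (of_real t * \<zeta>) / 2)"
   by (rule contour_integral_eq) (use seg K in auto)
  also have "\<dots> = P (of_real t * z) / (2 * of_real t) - P (of_real t * 0) / (2 * of_real t)"
  proof -
   have "((\<lambda>\<zeta>. U (of_real t * \<zeta>) / 2) has_contour_integral
     (P (of_real t * pathfinish (linepath 0 z)) / (2 * of_real t) - P (of_real t * pathstart (linepath 0 z)) / (2 * of_real t))) (linepath 0 z)"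
   proof (rule contour_integral_primitive[OF _ valid_path_linepath seg])
    fix x :: complex assume x: "x \<in> ball 0 1"
    have "norm (of_real t * x) < 1" using mult_strict_mono'[of t 1 "norm x" 1] x t by (simp add: norm_mult)
    then have "(P has_field_derivative U (of_real t * x)) (at (of_real t * x))" by (rule P_deriv)
    then have "((\<lambda>\<zeta>. P (of_real t * \<zeta>)) has_field_derivative U (of_real t * x) * of_real t) (at x)"
     by (rule DERIV_chain2) (auto intro!: derivative_eq_intros)
    then have "((\<lambda>\<zeta>. P (of_real t * \<zeta>) / (2 * of_real t)) has_field_derivative U (of_real t * x) * of_real t / (2 * of_real t)) (at x)"
     by (rule DERIV_cdivide)
    then have "((\<lambda>\<zeta>. P (of_real t * \<zeta>) / (2 * of_real t)) has_field_derivative U (of_real t * x) / 2) (at x)" using t by simp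
    then show "((\<lambda>\<zeta>. P (of_real t * \<zeta>) / (2 * of_real t)) has_field_derivative U (of_real t * x) / 2) (at x within ball 0 1)"
     by (rule has_field_derivative_at_within)
   qed
   then show ?thesis using contour_integral_unique by fastforce
  qed
  also have "\<dots> = z * (V (of_real t * z) / 2)" using t by (simp add: P_def)
  finally show ?thesis using False by (simp add: hilbert_kernel_def)
 qed
qed

end

section \<open>The norms of the function spaces\<close>

lemma powr_inverse_powr: "0 \<le> x \<Longrightarrow> 0 < p \<Longrightarrow> (x powr (1 / p)) powr p = x" for x p :: real
 by (simp add: powr_powr)

lemma powr_powr_inverse: "0 \<le> x \<Longrightarrow> 0 < p \<Longrightarrow> (x powr p) powr (1 / p) = x" for x p :: real
 by (simp add: powr_powr)

lemma hardy_mean_nonneg: "0 \<le> hardy_mean p g r" by (simp add: hardy_mean_def)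

text \<open>The factor \<open>2 * pi\<close> and the exponent are the only differences, since the integrand is
  continuous.\<close>

lemma circle_mean_hardy_mean:
 assumes g: "g holomorphic_on ball 0 1" and r: "0 < r" "r < 1" and p: "1 < p"
 shows "circle_mean p g r = ennreal (2 * pi * hardy_mean p g r powr p)"
proof -
 define h where "h \<theta> = indicator {0..2*pi} \<theta> *\<^sub>R (norm (g (of_real r * cis \<theta>)) powr p)" for \<theta> :: real
 have c: "continuous_on {0..2*pi} (\<lambda>\<theta>. norm (g (of_real r * cis \<theta>)) powr p)"
  by (rule continuous_on_powr'[OF continuous_on_norm[OF continuous_on_circle[OF g]]]) (use r p in auto)
 have i: "integrable lborel h"
  using borel_integrable_atLeastAtMost'[OF c] unfolding set_integrable_def h_def[abs_def] .
 have h0: "0 \<le> h \<theta>" for \<theta> by (simp add: h_def)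
 have I0: "0 \<le> integral\<^sup>L lborel h" by (intro integral_nonneg_AE) (simp add: h0)
 have "hardy_mean p g r = (1 / (2 * pi) * integral\<^sup>L lebesgue h) powr (1 / p)"
  by (simp add: hardy_mean_def set_lebesgue_integral_def h_def[abs_def])
 also have "integral\<^sup>L lebesgue h = integral\<^sup>L lborel h" by (rule integral_completion) (use i in simp)
 finally have "hardy_mean p g r powr p = 1 / (2 * pi) * integral\<^sup>L lborel h"
  using I0 p by (simp add: powr_powr)
 then have "2 * pi * hardy_mean p g r powr p = integral\<^sup>L lborel h" by simp
 moreover have "circle_mean p g r = (NINT \<theta>. ennreal (h \<theta>))"
  unfolding circle_mean_def by (intro nn_integral_cong) (auto simp: h_def split: split_indicator)
 moreover have "\<dots> = ennreal (integral\<^sup>L lborel h)" by (intro nn_integral_eq_integral i) (simp add: h0)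
 ultimately show ?thesis by simp
qed

lemma hardy_space_bound:
 assumes g: "g holomorphic_on ball 0 1" and p: "1 < p" and M: "0 \<le> M"
  and b: "\<And>r. 0 < r \<Longrightarrow> r < 1 \<Longrightarrow> circle_mean p g r \<le> ennreal M"
 shows "g \<in> hardy_space p" "hardy_norm p g \<le> M powr (1 / p)"
proof -
 have le: "hardy_mean p g r \<le> M powr (1 / p)" if r: "r \<in> {0<..<1}" for r
 proof -
  have "ennreal (2 * pi * hardy_mean p g r powr p) \<le> ennreal M"
   using b[of r] circle_mean_hardy_mean[OF g _ _ p, of r] r by simp
  then have "2 * pi * hardy_mean p g r powr p \<le> M" using M by (simp add: ennreal_le_iff)
  moreover have "1 * hardy_mean p g r powr p \<le> 2 * pi * hardy_mean p g r powr p"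
   using pi_gt3 by (intro mult_right_mono) auto
  ultimately have "hardy_mean p g r powr p \<le> M" by linarith
  then have "(hardy_mean p g r powr p) powr (1 / p) \<le> M powr (1 / p)" using p by (intro powr_mono2) auto
  then show ?thesis using powr_powr_inverse[OF hardy_mean_nonneg, of p p g r] p by simp
 qed
 have "bdd_above (hardy_mean p g ` {0<..<1})" by (rule bdd_aboveI2[OF le])
 then show "g \<in> hardy_space p" using g by (simp add: hardy_space_def)
 show "hardy_norm p g \<le> M powr (1 / p)" unfolding hardy_norm_def by (rule cSUP_least) (use le in auto)
qed

lemma hardy_norm_nonneg:
 assumes "g \<in> hardy_space p" shows "0 \<le> hardy_norm p g"
proof -
 have "hardy_mean p g (1/2) \<le> hardy_norm p g"
  unfolding hardy_norm_def using assms by (intro cSUP_upper) (auto simp: hardy_space_def)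
 then show ?thesis using hardy_mean_nonneg[of p g "1/2"] by linarith
qed

lemma circle_mean_le_hardy_norm:
 assumes g: "g \<in> hardy_space p" and r: "0 < r" "r < 1" and p: "1 < p"
 shows "circle_mean p g r \<le> ennreal (2 * pi * hardy_norm p g powr p)"
proof -
 have "hardy_mean p g r \<le> hardy_norm p g"
  unfolding hardy_norm_def using g r by (intro cSUP_upper) (auto simp: hardy_space_def)
 then have "2 * pi * hardy_mean p g r powr p \<le> 2 * pi * hardy_norm p g powr p"
  using p hardy_mean_nonneg by (intro mult_left_mono powr_mono2) auto
 then show ?thesis using circle_mean_hardy_mean[of g r p] g r p by (auto simp: hardy_space_def intro!: ennreal_leI)
qed

lemma dirichlet_enn_disc_integral:
 fixes p g
 defines "h \<equiv> \<lambda>z. norm (deriv g z) powr p * (1 - (norm z)\<^sup>2) powr (p - 1)"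
 assumes g: "g holomorphic_on ball 0 1" and p: "1 < p"
 shows "g \<in> dirichlet_space p \<longleftrightarrow> dirichlet_enn p g < top"
  and "dirichlet_enn p g < top \<Longrightarrow> dirichlet_enn p g = ennreal (pi * disc_integral h)"
  and "0 \<le> disc_integral h"
proof -
 define k where "k z = indicator (ball 0 1) z *\<^sub>R h z" for z
 have k [measurable]: "k \<in> borel_measurable borel"
  unfolding k_def[abs_def] h_def by (rule measurable_disc_continuous[OF continuous_dirichlet_integrand[OF g p]])
 have k0: "0 \<le> k z" for z by (simp add: k_def h_def)
 have enn: "dirichlet_enn p g = (NINT z. ennreal (k z))"
  unfolding dirichlet_enn_def by (intro nn_integral_cong) (auto simp: k_def h_def split: split_indicator)
 have I: "integral\<^sup>L lebesgue k = integral\<^sup>L lborel k" by (rule integral_completion) simp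
 have di: "disc_integral h = (1 / pi) * integral\<^sup>L lborel k"
  unfolding disc_integral_def set_lebesgue_integral_def k_def[abs_def, symmetric] I by simp
 have iff: "integrable lborel k \<longleftrightarrow> dirichlet_enn p g < top"
  unfolding enn using k0 by (auto simp: integrable_iff_bounded)
 have "disc_integrable h \<longleftrightarrow> integrable lebesgue k"
  by (simp add: disc_integrable_def set_integrable_def k_def[abs_def])
 also have "\<dots> \<longleftrightarrow> integrable lborel k" by (rule integrable_completion) simp
 finally show "g \<in> dirichlet_space p \<longleftrightarrow> dirichlet_enn p g < top"
  using g iff by (simp add: dirichlet_space_def h_def)
 show "dirichlet_enn p g = ennreal (pi * disc_integral h)" if "dirichlet_enn p g < top"
  using nn_integral_eq_integral[of lborel k] iff that k0 unfolding enn di by simp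
 show "0 \<le> disc_integral h" unfolding di by (intro mult_nonneg_nonneg integral_nonneg_AE) (auto simp: k0)
qed

lemma HL_ennreal:
 fixes p g
 defines "a \<equiv> \<lambda>n. norm (taylor_coeff g n) powr p * (real n + 1) powr (p - 2)"
 assumes g: "g holomorphic_on ball 0 1"
 shows "g \<in> HL_space p \<longleftrightarrow> (\<Sum>n. ennreal (a n)) < top"
  and "g \<in> HL_space p \<Longrightarrow> 0 < p \<Longrightarrow> (\<Sum>n. ennreal (a n)) = ennreal (HL_norm p g powr p)"
proof -
 have a0: "0 \<le> a n" for n by (simp add: a_def)
 have "summable a \<longleftrightarrow> (\<Sum>n. ennreal (a n)) < top"
 proof
  assume "summable a"
  then have "(\<Sum>n. ennreal (a n)) = ennreal (\<Sum>n. a n)" by (intro suminf_ennreal2 a0)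
  then show "(\<Sum>n. ennreal (a n)) < top" by simp
 next
  assume "(\<Sum>n. ennreal (a n)) < top"
  then show "summable a" by (intro summable_suminf_not_top a0) auto
 qed
 then show iff: "g \<in> HL_space p \<longleftrightarrow> (\<Sum>n. ennreal (a n)) < top" using g by (simp add: HL_space_def a_def)
 assume "g \<in> HL_space p" and p: "0 < p"
 then have s: "summable a" by (simp add: HL_space_def a_def)
 then have "(\<Sum>n. ennreal (a n)) = ennreal (\<Sum>n. a n)" by (intro suminf_ennreal2 a0)
 moreover have "HL_norm p g powr p = (\<Sum>n. a n)"
  using suminf_nonneg[OF s a0] p by (simp add: HL_norm_def a_def[symmetric] powr_powr)
 ultimately show "(\<Sum>n. ennreal (a n)) = ennreal (HL_norm p g powr p)" by simp
qed

lemma taylor_coeff_cong: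
 assumes "g holomorphic_on ball 0 1" "f holomorphic_on ball 0 1" "\<And>z. norm z < 1 \<Longrightarrow> f z = g z"
 shows "taylor_coeff f n = taylor_coeff g n" unfolding taylor_coeff_def
 using higher_deriv_transform_within_open[of f "ball 0 1" g 0 n] assms by simp

lemma dirichlet_enn_cong:
 assumes "g holomorphic_on ball 0 1" "f holomorphic_on ball 0 1" "\<And>z. norm z < 1 \<Longrightarrow> f z = g z"
 shows "dirichlet_enn p f = dirichlet_enn p g" unfolding dirichlet_enn_def
proof (rule nn_integral_cong)
 fix z
 show "ennreal (norm (deriv f z) powr p * (1 - (norm z)\<^sup>2) powr (p - 1)) * indicator (ball 0 1) z =
  ennreal (norm (deriv g z) powr p * (1 - (norm z)\<^sup>2) powr (p - 1)) * indicator (ball 0 1) z"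
 proof (cases "z \<in> ball 0 1")
  case True
  then have "deriv f z = deriv g z"
   by (intro complex_derivative_transform_within_open[OF assms(2,1) open_ball]) (auto simp: assms(3))
  then show ?thesis by simp
 qed simp
qed

lemma circle_mean_cong:
 assumes "\<And>z. norm z < 1 \<Longrightarrow> f z = g z" "0 < r" "r < 1"
 shows "circle_mean p f r = circle_mean p g r"
 unfolding circle_mean_def using assms by (intro nn_integral_cong) (simp add: norm_mult)

lemma Lp_norm_nonneg: "0 \<le> Lp_norm p f" by (simp add: Lp_norm_def)

lemma AE_indicator_eq:
 assumes "AE t in lborel. t \<in> {0<..<1::real} \<longrightarrow> Q t"
 shows "AE t in lborel. t \<in> {0..<1} \<longrightarrow> Q t"
proof -
 have "AE t in lborel. t \<noteq> (0::real)" by (rule AE_lborel_singleton)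
 with assms show ?thesis by eventually_elim auto
qed

lemma Borel_version:
 fixes f :: "real \<Rightarrow> complex"
 assumes "set_borel_measurable lebesgue {0..<1} f"
 obtains f' where "f' \<in> borel_measurable borel" "AE t in lborel. t \<in> {0<..<1} \<longrightarrow> f t = f' t"
proof -
 have m: "(\<lambda>t. indicator {0..<1} t *\<^sub>R f t) \<in> borel_measurable lebesgue"
  using assms by (simp add: set_borel_measurable_def)
 have "(\<lambda>t. Re (indicator {0..<1} t *\<^sub>R f t)) \<in> borel_measurable lebesgue" using m by measurable
 then obtain a where a: "a \<in> borel_measurable lborel" "AE t in lborel. Re (indicator {0..<1} t *\<^sub>R f t) = a t"
  using completion_ex_borel_measurable_real by blast
 have "(\<lambda>t. Im (indicator {0..<1} t *\<^sub>R f t)) \<in> borel_measurable lebesgue" using m by measurable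
 then obtain b where b: "b \<in> borel_measurable lborel" "AE t in lborel. Im (indicator {0..<1} t *\<^sub>R f t) = b t"
  using completion_ex_borel_measurable_real by blast
 show ?thesis
 proof
  have [measurable]: "a \<in> borel_measurable borel" "b \<in> borel_measurable borel" using a(1) b(1) by auto
  show "(\<lambda>t. Complex (a t) (b t)) \<in> borel_measurable borel" unfolding Complex_eq by measurable
  show "AE t in lborel. t \<in> {0<..<1} \<longrightarrow> f t = Complex (a t) (b t)"
   using a(2) b(2) by eventually_elim (auto simp: complex_eq_iff)
 qed
qed

lemma Lp_version:
 assumes f': "f' \<in> borel_measurable borel" and eq: "AE t in lborel. t \<in> {0<..<1} \<longrightarrow> f t = f' t" and p: "1 < p"
 shows "f \<in> Lp_space p \<longleftrightarrow> Lp_enn p f' < top"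
  and "Lp_enn p f' < top \<Longrightarrow> Lp_enn p f' = ennreal (Lp_norm p f powr p)"
proof -
 note [measurable] = f'
 define h where "h t = indicator {0..<1} t *\<^sub>R (norm (f' t) powr p)" for t :: real
 have [measurable]: "h \<in> borel_measurable borel" unfolding h_def by measurable
 have h0: "0 \<le> h t" for t by (simp add: h_def)
 have ae: "AE t in lborel. indicator {0..<1} t *\<^sub>R (norm (f t) powr p) = h t"
  using AE_indicator_eq[OF eq] by eventually_elim (auto simp: h_def split: split_indicator)
 have ae1: "AE t in lborel. indicator {0..<1} t *\<^sub>R f t = indicator {0..<1} t *\<^sub>R f' t"
  using AE_indicator_eq[OF eq] by eventually_elim (auto split: split_indicator)
 have m: "set_borel_measurable lebesgue {0..<1} f"
  unfolding set_borel_measurable_def by (rule measurable_completion_AE[OF _ ae1]) measurable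
 have enn: "Lp_enn p f' = (NINT t. ennreal (h t))"
 proof -
  have "AE t in lborel. t \<noteq> (0::real)" by (rule AE_lborel_singleton)
  then have "AE t in lborel. ennreal (norm (f' t) powr p) * indicator {0<..<1} t = ennreal (h t)"
   by eventually_elim (auto simp: h_def split: split_indicator)
  then show ?thesis unfolding Lp_enn_def by (rule nn_integral_cong_AE)
 qed
 have iff: "integrable lborel h \<longleftrightarrow> Lp_enn p f' < top"
  unfolding enn using h0 by (auto simp: integrable_iff_bounded)
 show "f \<in> Lp_space p \<longleftrightarrow> Lp_enn p f' < top"
  using m iff lebesgue_borel_version(1)[OF _ ae] by (simp add: Lp_space_def set_integrable_def)
 have L: "(LINT t:{0..<1}|lebesgue. norm (f t) powr p) = integral\<^sup>L lborel h"
  unfolding set_lebesgue_integral_def by (rule lebesgue_borel_version(2)[OF _ ae]) simp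
 have "0 \<le> integral\<^sup>L lborel h" by (intro integral_nonneg_AE) (simp add: h0)
 then have N: "Lp_norm p f powr p = integral\<^sup>L lborel h" using p by (simp add: Lp_norm_def L powr_powr)
 assume "Lp_enn p f' < top"
 then show "Lp_enn p f' = ennreal (Lp_norm p f powr p)"
  unfolding N enn using iff h0 enn by (intro nn_integral_eq_integral) auto
qed

text \<open>The Fejer-Riesz inequality on circles of radius tending to 1.\<close>

lemma radial_restriction_Lp:
 assumes f: "f \<in> hardy_space p" and p: "1 < p" "1 / p + 1 / q = 1"
 shows "radial_restriction f \<in> Lp_space p"
  and "Lp_norm p (radial_restriction f) \<le> ((p + q) powr p * 2 powr p * (2 * pi)) powr (1 / p) * hardy_norm p f"
proof -
 have h: "f holomorphic_on ball 0 1" using f by (simp add: hardy_space_def)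
 have q: "1 < q" by (rule conjugate_gt_1[OF p])
 define C where "C = (p + q) powr p * 2 powr p * (2 * pi)"
 have C: "0 \<le> C" by (simp add: C_def)
 define f0 where "f0 t = indicator {0..<1} t *\<^sub>R f (of_real t)" for t :: real
 have [measurable]: "f0 \<in> borel_measurable borel"
 proof -
  have "continuous_on {0..<1} (\<lambda>t::real. f (of_real t))"
   by (rule continuous_on_compose2[OF holomorphic_on_imp_continuous_on[OF h]]) (auto intro!: continuous_intros)
  then show ?thesis unfolding f0_def[abs_def] by (intro borel_measurable_continuous_on_indicator) auto
 qed
 have eq: "AE t in lborel. t \<in> {0<..<1} \<longrightarrow> radial_restriction f t = f0 t"
  by (rule AE_I2) (auto simp: radial_restriction_def f0_def)
 define R where "R n = 1 - 1 / (real n + 2)" for n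
 have R: "0 < R n" "R n < 1" for n by (auto simp: R_def)
 have "Lp_enn p f0 \<le> (NINT t:(\<Union>n. {0..<R n}). ennreal (norm (f0 t) powr p))"
  unfolding Lp_enn_def
 proof (rule nn_integral_mono)
  fix t :: real
  have "t \<in> (\<Union>n. {0..<R n})" if "t \<in> {0<..<1}"
  proof -
   obtain n where n: "inverse (real (Suc n)) < 1 - t" using reals_Archimedean[of "1 - t"] \<open>t \<in> {0<..<1}\<close> by auto
   have "1 / (real n + 2) \<le> inverse (real (Suc n))" by (simp add: inverse_eq_divide frac_le)
   then have "t < R n" using n by (simp add: R_def)
   then show ?thesis using that by auto
  qed
  then show "ennreal (norm (f0 t) powr p) * indicator {0<..<1} t \<le> ennreal (norm (f0 t) powr p) * indicator (\<Union>n. {0..<R n}) t"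
   by (auto split: split_indicator)
 qed
 also have "\<dots> = (SUP n. (NINT t:{0..<R n}. ennreal (norm (f0 t) powr p)))"
 proof (rule nn_integral_incseq)
  show "incseq (\<lambda>n. {0..<R n})"
  proof (rule incseq_SucI)
   fix n
   have "R n \<le> R (Suc n)" by (auto simp: R_def intro!: divide_left_mono)
   then show "{0..<R n} \<subseteq> {0..<R (Suc n)}" by auto
  qed
 qed measurable
 also have "\<dots> \<le> ennreal (C * hardy_norm p f powr p)"
 proof (rule SUP_least)
  fix n
  have "(NINT t:{0..<R n}. ennreal (norm (f0 t) powr p)) =
    (NINT t:{0..<R n}. ennreal (norm (f (of_real t)) powr p))"
   using R(2)[of n] by (intro nn_integral_cong) (auto simp: f0_def split: split_indicator)
  also have "\<dots> \<le> ennreal ((p + q) powr p * 2 powr p) * circle_mean p f (R n)"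
   by (rule Fejer_Riesz_circle[OF h R p])
  also have "\<dots> \<le> ennreal ((p + q) powr p * 2 powr p) * ennreal (2 * pi * hardy_norm p f powr p)"
   by (intro mult_left_mono circle_mean_le_hardy_norm[OF f R p(1)]) auto
  also have "\<dots> = ennreal (C * hardy_norm p f powr p)" by (simp add: C_def ennreal_mult'[symmetric] mult_ac)
  finally show "(NINT t:{0..<R n}. ennreal (norm (f0 t) powr p)) \<le> ennreal (C * hardy_norm p f powr p)" .
 qed
 finally have b: "Lp_enn p f0 \<le> ennreal (C * hardy_norm p f powr p)" .
 then have fin: "Lp_enn p f0 < top" by (auto elim: le_less_trans)
 then show "radial_restriction f \<in> Lp_space p" using Lp_version(1)[OF _ eq p(1)] by simp
 have "ennreal (Lp_norm p (radial_restriction f) powr p) \<le> ennreal (C * hardy_norm p f powr p)"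
  using Lp_version(2)[OF _ eq p(1) fin] b by simp
 then have "Lp_norm p (radial_restriction f) powr p \<le> C * hardy_norm p f powr p"
  using C by (simp add: ennreal_le_iff)
 then have "(Lp_norm p (radial_restriction f) powr p) powr (1 / p) \<le> (C * hardy_norm p f powr p) powr (1 / p)"
  using p by (intro powr_mono2) auto
 then show "Lp_norm p (radial_restriction f) \<le> ((p + q) powr p * 2 powr p * (2 * pi)) powr (1 / p) * hardy_norm p f"
  unfolding powr_mult C_def[symmetric]
  using powr_powr_inverse[OF Lp_norm_nonneg, of p p "radial_restriction f"] powr_powr_inverse[OF hardy_norm_nonneg[OF f], of p] p by simp
qed

section \<open>The operator and the condition for a Borel version of the weight\<close>

context weight_version
begin

lemma weight_tail_eq:
 assumes "0 \<le> r" shows "weight_tail \<omega> r = tail r"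
 unfolding weight_tail_def set_lebesgue_integral_def wtail_def
proof (rule lebesgue_borel_version(2))
 show "AE s in lborel. indicator {r..<1} s *\<^sub>R \<omega> s = w s * indicator {r..} s"
  using AE_indicator_eq[OF version]
  by eventually_elim (use assms in \<open>auto simp: w_supp split: split_indicator\<close>)
qed measurable

lemma muck_A_eq_integral:
 assumes "0 < r" "r < 1" "0 < p"
 shows "muck_A p r = ennreal (1 + (LINT t:{0..r}|lebesgue. 1 / weight_tail \<omega> t powr p))"
  and "0 \<le> (LINT t:{0..r}|lebesgue. 1 / weight_tail \<omega> t powr p)"
proof -
 define h where "h t = indicator {0..r} t *\<^sub>R (1 / tail t powr p)" for t :: real
 have [measurable]: "h \<in> borel_measurable borel" unfolding h_def by measurable
 have h0: "0 \<le> h t" for t by (simp add: h_def)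
 have A: "muck_A p r = 1 + (NINT t. ennreal (h t))"
  unfolding muck_A_def by (intro arg_cong2[where f = "(+)"] nn_integral_cong) (auto simp: h_def split: split_indicator)
 have "muck_A p r < top" using assms by (intro muck_A_finite) auto
 then have i: "integrable lborel h" using h0 by (auto simp: A integrable_iff_bounded)
 have "(LINT t:{0..r}|lebesgue. 1 / weight_tail \<omega> t powr p) = integral\<^sup>L lebesgue h"
  unfolding set_lebesgue_integral_def
  by (rule arg_cong[where f = "integral\<^sup>L lebesgue"]) (auto simp: h_def fun_eq_iff weight_tail_eq split: split_indicator)
 also have "\<dots> = integral\<^sup>L lborel h" by (rule integral_completion) simp
 finally have L: "(LINT t:{0..r}|lebesgue. 1 / weight_tail \<omega> t powr p) = integral\<^sup>L lborel h" .
 show n: "0 \<le> (LINT t:{0..r}|lebesgue. 1 / weight_tail \<omega> t powr p)"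
  unfolding L by (intro integral_nonneg_AE) (simp add: h0)
 have "(NINT t. ennreal (h t)) = ennreal (integral\<^sup>L lborel h)"
  by (intro nn_integral_eq_integral i) (simp add: h0)
 then show "muck_A p r = ennreal (1 + (LINT t:{0..r}|lebesgue. 1 / weight_tail \<omega> t powr p))"
  unfolding A L using n L by (simp add: ennreal_plus)
qed

lemma muck_W_eq_integral:
 assumes "0 < r" "r < 1" "1 < q"
 shows "set_integrable lebesgue {r..<1} (\<lambda>t. \<omega> t powr q) \<longleftrightarrow> muck_W q r < top"
  and "muck_W q r < top \<Longrightarrow> muck_W q r = ennreal (LINT t:{r..<1}|lebesgue. \<omega> t powr q)"
  and "0 \<le> (LINT t:{r..<1}|lebesgue. \<omega> t powr q)"
proof -
 define h where "h t = indicator {r..} t *\<^sub>R (w t powr q)" for t :: real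
 have [measurable]: "h \<in> borel_measurable borel" unfolding h_def by measurable
 have h0: "0 \<le> h t" for t by (simp add: h_def)
 have ae: "AE t in lborel. indicator {r..<1} t *\<^sub>R (\<omega> t powr q) = h t"
  using version by eventually_elim (use assms in \<open>auto simp: h_def w_supp split: split_indicator\<close>)
 have W: "muck_W q r = (NINT t. ennreal (h t))"
  unfolding muck_W_def by (intro nn_integral_cong) (auto simp: h_def split: split_indicator)
 have iff: "integrable lborel h \<longleftrightarrow> muck_W q r < top"
  unfolding W using h0 by (auto simp: integrable_iff_bounded)
 show "set_integrable lebesgue {r..<1} (\<lambda>t. \<omega> t powr q) \<longleftrightarrow> muck_W q r < top"
  unfolding set_integrable_def iff[symmetric] by (rule lebesgue_borel_version(1)[OF _ ae]) simp
 have L: "(LINT t:{r..<1}|lebesgue. \<omega> t powr q) = integral\<^sup>L lborel h"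
  unfolding set_lebesgue_integral_def by (rule lebesgue_borel_version(2)[OF _ ae]) simp
 show "0 \<le> (LINT t:{r..<1}|lebesgue. \<omega> t powr q)" unfolding L by (intro integral_nonneg_AE) (simp add: h0)
 assume "muck_W q r < top"
 then show "muck_W q r = ennreal (LINT t:{r..<1}|lebesgue. \<omega> t powr q)"
  unfolding L W using iff W h0 by (intro nn_integral_eq_integral) auto
qed

lemma muckenhoupt_cond_iff:
 assumes p: "1 < p" "1 / p + 1 / q = 1"
 shows "muckenhoupt_cond p q \<omega> \<longleftrightarrow> (\<exists>K. muck p q K)"
proof -
 have q: "1 < q" by (rule conjugate_gt_1[OF p])
 define E where "E r = (1 + (LINT t:{0..r}|lebesgue. 1 / weight_tail \<omega> t powr p)) powr (1 / p) *
    (LINT t:{r..<1}|lebesgue. \<omega> t powr q) powr (1 / q)" for r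
 have E: "epow (muck_A p r) (1/p) * epow (muck_W q r) (1/q) = ennreal (E r)" "0 \<le> E r"
  if r: "r \<in> {0<..<1}" and W: "muck_W q r < top" for r
 proof -
  have "0 < p" using p by simp
  with r have A: "muck_A p r = ennreal (1 + (LINT t:{0..r}|lebesgue. 1 / weight_tail \<omega> t powr p))"
    "0 \<le> (LINT t:{0..r}|lebesgue. 1 / weight_tail \<omega> t powr p)" by (auto intro: muck_A_eq_integral)
  have Wr: "muck_W q r = ennreal (LINT t:{r..<1}|lebesgue. \<omega> t powr q)" "0 \<le> (LINT t:{r..<1}|lebesgue. \<omega> t powr q)"
   using r q W by (auto intro: muck_W_eq_integral)
  show "epow (muck_A p r) (1/p) * epow (muck_W q r) (1/q) = ennreal (E r)"
  proof -
   have "0 \<le> 1 + (LINT t:{0..r}|lebesgue. 1 / weight_tail \<omega> t powr p)" using A(2) by simp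
   then show ?thesis
    unfolding A(1) Wr(1) E_def epow_ennreal[OF Wr(2)] by (subst epow_ennreal) (auto intro: ennreal_mult[symmetric])
  qed
  show "0 \<le> E r" by (simp add: E_def)
 qed
 have cond: "muckenhoupt_cond p q \<omega> \<longleftrightarrow> (\<forall>r\<in>{0<..<1}. muck_W q r < top) \<and> bdd_above (E ` {0<..<1})"
  unfolding muckenhoupt_cond_def E_def[abs_def, symmetric]
  using muck_W_eq_integral(1)[OF _ _ q] by (auto simp: Ball_def)
 show ?thesis
 proof
  assume "muckenhoupt_cond p q \<omega>"
  then have W: "\<And>r. r \<in> {0<..<1} \<Longrightarrow> muck_W q r < top" and "bdd_above (E ` {0<..<1})" by (auto simp: cond)
  then obtain K where "\<forall>x\<in>E ` {0<..<1}. x \<le> K" unfolding bdd_above_def by blast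
  then have K: "\<And>r. r \<in> {0<..<1} \<Longrightarrow> E r \<le> K" by blast
  have "muck p q K" unfolding muck_def
  proof
   fix r :: real assume r: "r \<in> {0<..<1}"
   show "epow (muck_A p r) (1/p) * epow (muck_W q r) (1/q) \<le> ennreal K"
    unfolding E(1)[OF r W[OF r]] by (intro ennreal_leI K r)
  qed
  then show "\<exists>K. muck p q K" ..
 next
  assume "\<exists>K. muck p q K"
  then obtain K where K: "muck p q K" ..
  have W: "muck_W q r < top" if "r \<in> {0<..<1}" for r
   using muck_W_le[OF K p(1) q that] by (auto elim: le_less_trans)
  have "E r \<le> max 0 K" if r: "r \<in> {0<..<1}" for r
  proof -
   have "ennreal (E r) \<le> ennreal K" unfolding E(1)[OF r W[OF r], symmetric] using K r unfolding muck_def by blast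
   also have "\<dots> \<le> ennreal (max 0 K)" by (intro ennreal_leI) simp
   finally show ?thesis by (simp add: ennreal_le_iff)
  qed
  then have "bdd_above (E ` {0<..<1})" by (intro bdd_aboveI2)
  then show "muckenhoupt_cond p q \<omega>" using W by (simp add: cond)
 qed
qed

lemma hilbert_op_eq_Hop:
 assumes f': "admissible f'" and eq: "AE t in lborel. t \<in> {0<..<1} \<longrightarrow> f t = f' t"
 shows "hilbert_op_defined \<omega> f" and "\<And>z. norm z < 1 \<Longrightarrow> hilbert_op \<omega> f z = Hop f' z"
proof -
 have i: "integrable lborel (\<lambda>t. f' t * (V (of_real t * z) / 2) * of_real (w t))" if z: "norm z < 1" for z
  by (rule Hop_integrable[OF f' z])
 have ae: "AE t in lborel. indicator {0..<1} t *\<^sub>R (f t * hilbert_kernel \<omega> t z * of_real (\<omega> t)) = f' t * (V (of_real t * z) / 2) * of_real (w t)"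
  if z: "norm z < 1" for z
 proof -
  have "AE t in lborel. t \<noteq> (0::real)" by (rule AE_lborel_singleton)
  with eq version show ?thesis
  proof eventually_elim
   fix t :: real
   assume h: "t \<in> {0<..<1} \<longrightarrow> f t = f' t" "t \<in> {0<..<1} \<longrightarrow> \<omega> t = w t" "t \<noteq> 0"
   show "indicator {0..<1} t *\<^sub>R (f t * hilbert_kernel \<omega> t z * of_real (\<omega> t)) = f' t * (V (of_real t * z) / 2) * of_real (w t)"
   proof (cases "t \<in> {0<..<1}")
    case True
    then show ?thesis using h hilbert_kernel_eq[of t z] z by simp
   next
    case False
    then show ?thesis using h by (auto simp: w_supp split: split_indicator)
   qed
  qed
 qed
 show "hilbert_op_defined \<omega> f" unfolding hilbert_op_defined_def set_integrable_def
  using lebesgue_borel_version(1)[OF _ ae] i by (auto simp: borel_measurable_integrable)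
 show "hilbert_op \<omega> f z = Hop f' z" if z: "norm z < 1" for z
  unfolding hilbert_op_def set_lebesgue_integral_def Hop_def
  by (rule lebesgue_borel_version(2)[OF _ ae[OF z]]) (use i[OF z] in simp)
qed

text \<open>By \<open>total_bound\<close> the condition makes every \<open>L\<^sup>p\<close> function integrable
  against the weight.\<close>

lemma muck_imp_admissible:
 assumes m: "muck p q K" and p: "1 < p" "1 / p + 1 / q = 1"
  and f [measurable]: "f \<in> borel_measurable borel" and L: "Lp_enn p f < top"
 shows "admissible f"
proof -
 have "epow (NINT t. ennreal (norm (f t)) * ennreal (w t)) p
   \<le> ennreal (K powr p) * (NINT t:{0<..<1}. epow (ennreal (norm (f t))) p)"
  by (rule total_bound[OF _ m p]) measurable
 also have "\<dots> < top" using L by (simp add: Lp_enn_def ennreal_mult_less_top)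
 finally have "epow (NINT t. ennreal (norm (f t)) * ennreal (w t)) p \<noteq> top" by (rule less_imp_neq)
 then have "(NINT t. ennreal (norm (f t)) * ennreal (w t)) < top" unfolding epow_eq_top_iff by (simp add: less_top)
 then show ?thesis by (simp add: admissible_def integrable_iff_bounded abs_mult ennreal_mult)
qed

lemma Lp_admissible_version:
 assumes m: "muck p q K" and p: "1 < p" "1 / p + 1 / q = 1" and f: "f \<in> Lp_space p"
 obtains f' where "admissible f'" "hilbert_op_defined \<omega> f" "\<And>z. norm z < 1 \<Longrightarrow> hilbert_op \<omega> f z = Hop f' z"
  "Lp_enn p f' = ennreal (Lp_norm p f powr p)" "hilbert_op \<omega> f holomorphic_on ball 0 1"
proof -
 have "set_borel_measurable lebesgue {0..<1} f" using f by (simp add: Lp_space_def)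
 then obtain f' where f': "f' \<in> borel_measurable borel" "AE t in lborel. t \<in> {0<..<1} \<longrightarrow> f t = f' t"
  by (rule Borel_version)
 have L: "Lp_enn p f' < top" using Lp_version(1)[OF f' p(1)] f by simp
 have a: "admissible f'" by (rule muck_imp_admissible[OF m p f'(1) L])
 note H = hilbert_op_eq_Hop[OF a f'(2)]
 have "hilbert_op \<omega> f holomorphic_on ball 0 1"
  by (rule holomorphic_transform[OF Hop_holomorphic[OF a]]) (simp add: H(2))
 then show thesis using that[of f'] a H Lp_version(2)[OF f' p(1) L] by blast
qed

lemma test_fun_version:
 assumes g: "test_fun r g" and p: "1 < p"
 shows "cg g \<in> Lp_space p" "Lp_enn p (cg g) = ennreal (Lp_norm p (cg g) powr p)"
  "\<And>z. norm z < 1 \<Longrightarrow> hilbert_op \<omega> (cg g) z = Hop (cg g) z"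
proof -
 have a: "admissible (cg g)" by (rule test_admissible[OF g])
 have m: "cg g \<in> borel_measurable borel" by (rule admissible_measurable[OF a])
 obtain B where B: "\<And>t. 0 \<le> g t" "\<And>t. g t \<le> B" using g by (auto simp: test_fun_def)
 have "Lp_enn p (cg g) \<le> (NINT t:{0<..<1::real}. ennreal (B powr p))" unfolding Lp_enn_def
 proof (rule nn_integral_mono)
  fix t
  have "norm (cg g t) powr p \<le> B powr p" using B[of t] p by (intro powr_mono2) auto
  then show "ennreal (norm (cg g t) powr p) * indicator {0<..<1} t \<le> ennreal (B powr p) * indicator {0<..<1} t"
   by (intro mult_right_mono ennreal_leI) auto
 qed
 also have "\<dots> = ennreal (B powr p)" by (subst nn_integral_cmult_indicator) auto
 finally have L: "Lp_enn p (cg g) < top" by (auto elim: le_less_trans)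
 have eq: "AE t in lborel. t \<in> {0<..<1} \<longrightarrow> cg g t = cg g t" by simp
 show "cg g \<in> Lp_space p" using Lp_version(1)[OF m eq p] L by simp
 show "Lp_enn p (cg g) = ennreal (Lp_norm p (cg g) powr p)" by (rule Lp_version(2)[OF m eq p L])
 show "\<And>z. norm z < 1 \<Longrightarrow> hilbert_op \<omega> (cg g) z = Hop (cg g) z" by (rule hilbert_op_eq_Hop(2)[OF a eq])
qed

end

section \<open>The equivalence\<close>

text \<open>Changing the weight on a null set, at the origin and outside the interval affects neither tails nor
  integrals.\<close>

lemma D_hat_weight_version:
 assumes "\<omega> \<in> D_hat"
 obtains w where "weight_version w \<omega>"
proof -
 have i: "integrable lebesgue (\<lambda>t. indicator {0..<1} t *\<^sub>R \<omega> t)" and nn: "\<And>t. t \<in> {0..<1} \<Longrightarrow> 0 \<le> \<omega> t"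
  and pos: "\<And>r. r \<in> {0..<1} \<Longrightarrow> 0 < weight_tail \<omega> r"
  using assms by (auto simp: D_hat_def radial_weight_def set_integrable_def)
 obtain C where C: "1 \<le> C" "\<And>r. r \<in> {0..<1} \<Longrightarrow> weight_tail \<omega> r \<le> C * weight_tail \<omega> ((1 + r) / 2)"
  using assms by (auto simp: D_hat_def)
 obtain g where g: "g \<in> borel_measurable lborel" "AE t in lborel. indicator {0..<1} t *\<^sub>R \<omega> t = g t"
  using completion_ex_borel_measurable_real[OF borel_measurable_integrable[OF i]] by blast
 define w where "w t = (if t \<in> {0<..<1} then max 0 (g t) else 0)" for t :: real
 have [measurable]: "g \<in> borel_measurable borel" using g(1) by simp
 have wm [measurable]: "w \<in> borel_measurable borel" unfolding w_def by measurable
 have eq: "AE t in lborel. t \<in> {0<..<1} \<longrightarrow> \<omega> t = w t" using g(2)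
 proof eventually_elim
  fix t :: real assume "indicator {0..<1} t *\<^sub>R \<omega> t = g t"
  then show "t \<in> {0<..<1} \<longrightarrow> \<omega> t = w t" using nn[of t] by (auto simp: w_def)
 qed
 have wi: "integrable lborel w"
 proof -
  have "AE t in lborel. indicator {0..<1} t *\<^sub>R \<omega> t = w t"
   using AE_indicator_eq[OF eq] AE_lborel_singleton[of "0::real"]
   by eventually_elim (auto simp: w_def split: split_indicator)
  then show ?thesis using lebesgue_borel_version(1)[of w] i by simp
 qed
 have tail: "weight_tail \<omega> r = wtail w r" if "0 \<le> r" for r
  unfolding weight_tail_def set_lebesgue_integral_def wtail_def
 proof (rule lebesgue_borel_version(2))
  show "AE s in lborel. indicator {r..<1} s *\<^sub>R \<omega> s = w s * indicator {r..} s"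
   using AE_indicator_eq[OF eq] AE_lborel_singleton[of "0::real"]
   by eventually_elim (use that in \<open>auto simp: w_def split: split_indicator\<close>)
 qed measurable
 have "weight_version w \<omega>"
 proof
  show "w \<in> borel_measurable borel" "integrable lborel w" by fact+
  show "0 \<le> w t" for t by (simp add: w_def)
  show "t \<notin> {0<..<1} \<Longrightarrow> w t = 0" for t unfolding w_def by (rule if_not_P)
  show "0 \<le> r \<Longrightarrow> r < 1 \<Longrightarrow> 0 < wtail w r" for r using pos[of r] tail[of r] by simp
  show "\<exists>C\<ge>1. \<forall>r\<in>{0..<1}. wtail w r \<le> C * wtail w ((1 + r) / 2)"
   using C tail by (intro exI[of _ C]) force
  show "AE t in lborel. t \<in> {0<..<1} \<longrightarrow> \<omega> t = w t" by (rule eq)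
 qed
 then show thesis by (rule that)
qed

context weight_version
begin

text \<open>The common step of the three sufficiency proofs: replace an element of the \<open>L\<^sup>p\<close>
  space by a Borel version and identify the operator with \<open>Hop\<close> on the disc.\<close>

lemma muck_imp_bounded:
 assumes m: "muck p q K" and p: "1 < p" "1 / p + 1 / q = 1" and D: "0 \<le> D"
  and N: "\<And>f g L. admissible f \<Longrightarrow> g holomorphic_on ball 0 1 \<Longrightarrow> (\<And>z. norm z < 1 \<Longrightarrow> g z = Hop f z) \<Longrightarrow>
   0 \<le> L \<Longrightarrow> Lp_enn p f = ennreal L \<Longrightarrow> g \<in> Y \<and> N g \<le> (D * L) powr (1/p)"
 shows "hilbert_op_bounded \<omega> id (Lp_space p) (Lp_norm p) Y N" unfolding hilbert_op_bounded_def id_apply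
proof (intro exI[of _ "D powr (1/p)"] ballI)
 fix f assume f: "f \<in> Lp_space p"
 obtain f' where f': "admissible f'" "hilbert_op_defined \<omega> f" "\<And>z. norm z < 1 \<Longrightarrow> hilbert_op \<omega> f z = Hop f' z"
  "Lp_enn p f' = ennreal (Lp_norm p f powr p)" "hilbert_op \<omega> f holomorphic_on ball 0 1"
  by (rule Lp_admissible_version[OF m p f]) blast
 have "(D * Lp_norm p f powr p) powr (1/p) = D powr (1/p) * Lp_norm p f"
  unfolding powr_mult using powr_powr_inverse[OF Lp_norm_nonneg, of p p f] p by simp
 with N[OF f'(1,5,3) _ f'(4)] f'(2)
 show "hilbert_op_defined \<omega> f \<and> hilbert_op \<omega> f \<in> Y \<and> N (hilbert_op \<omega> f) \<le> D powr (1/p) * Lp_norm p f" by simp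
qed

lemma muck_imp_Hardy_bounded:
 assumes m: "muck p q K" and p: "1 < p" "1 / p + 1 / q = 1"
 shows "hilbert_op_bounded \<omega> id (Lp_space p) (Lp_norm p) (hardy_space p) (hardy_norm p)"
proof -
 obtain C where C: "0 < C" "\<And>f r. admissible f \<Longrightarrow> 0 < r \<Longrightarrow> r < 1 \<Longrightarrow> circle_mean p (Hop f) r \<le> ennreal C * Lp_enn p f"
  using Hop_Hardy[OF m p] by blast
 show ?thesis
 proof (rule muck_imp_bounded[OF m p])
  show "0 \<le> C" using C by simp
  fix f g L assume h: "admissible f" "g holomorphic_on ball 0 1" "\<And>z. norm z < 1 \<Longrightarrow> g z = Hop f z" "0 \<le> L" "Lp_enn p f = ennreal L"
  have b: "circle_mean p g r \<le> ennreal (C * L)" if "0 < r" "r < 1" for r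
   using C(2)[OF h(1) that] circle_mean_cong[OF h(3) that, where p = p] C(1) h(4) by (simp add: h(5) ennreal_mult)
  have "0 \<le> C * L" using C h(4) by simp
  from hardy_space_bound[OF h(2) p(1) this b] show "g \<in> hardy_space p \<and> hardy_norm p g \<le> (C * L) powr (1/p)" by simp
 qed
qed

lemma muck_imp_Dirichlet_bounded:
 assumes m: "muck p q K" and p: "1 < p" "1 / p + 1 / q = 1"
 shows "hilbert_op_bounded \<omega> id (Lp_space p) (Lp_norm p) (dirichlet_space p) (dirichlet_norm p)"
proof -
 obtain C where C: "0 < C" "\<And>f. admissible f \<Longrightarrow> dirichlet_enn p (Hop f) \<le> ennreal C * Lp_enn p f"
  using Hop_Dirichlet[OF m p] by blast
 obtain D where D: "0 < D" "\<And>f. admissible f \<Longrightarrow> ennreal (norm (Hop f 0) powr p) \<le> ennreal D * Lp_enn p f"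
  using Hop_0_bound[OF m p] by blast
 show ?thesis
 proof (rule muck_imp_bounded[OF m p])
  show "0 \<le> D + p * (C / pi)" using C D p by simp
  fix f g L assume h: "admissible f" "g holomorphic_on ball 0 1" "\<And>z. norm z < 1 \<Longrightarrow> g z = Hop f z" "0 \<le> L" "Lp_enn p f = ennreal L"
  define I where "I = disc_integral (\<lambda>z. norm (deriv g z) powr p * (1 - (norm z)\<^sup>2) powr (p - 1))"
  note dis = dirichlet_enn_disc_integral[OF h(2) p(1), folded I_def]
  have b: "dirichlet_enn p g \<le> ennreal (C * L)"
   using C(2)[OF h(1)] C(1) h(4) dirichlet_enn_cong[OF Hop_holomorphic[OF h(1)] h(2,3), where p = p] unfolding h(5)
   by (simp add: ennreal_mult)
  then have fin: "dirichlet_enn p g < top" by (auto elim: le_less_trans)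
  have "ennreal (pi * I) \<le> ennreal (C * L)" using b unfolding dis(2)[OF fin] .
  then have "pi * I \<le> C * L" using C h(4) by (simp add: ennreal_le_iff)
  then have I: "I \<le> (C / pi) * L" by (simp add: field_simps)
  have "ennreal (norm (g 0) powr p) \<le> ennreal (D * L)"
   using D(2)[OF h(1)] D(1) h(3)[of 0] h(4) unfolding h(5) by (simp add: ennreal_mult)
  then have z: "norm (g 0) powr p \<le> D * L" using D h(4) by (simp add: ennreal_le_iff)
  have "norm (g 0) powr p + p * I \<le> D * L + p * ((C / pi) * L)"
   using z I p by (intro add_mono mult_left_mono) auto
  also have "\<dots> = (D + p * (C / pi)) * L" by (simp add: distrib_right)
  finally have "(norm (g 0) powr p + p * I) powr (1/p) \<le> ((D + p * (C / pi)) * L) powr (1/p)"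
   using p dis(3) by (intro powr_mono2) auto
  then show "g \<in> dirichlet_space p \<and> dirichlet_norm p g \<le> ((D + p * (C / pi)) * L) powr (1/p)"
   using dis(1) fin by (simp add: dirichlet_norm_def I_def)
 qed
qed

lemma muck_imp_HL_bounded:
 assumes m: "muck p q K" and p: "1 < p" "1 / p + 1 / q = 1"
 shows "hilbert_op_bounded \<omega> id (Lp_space p) (Lp_norm p) (HL_space p) (HL_norm p)"
proof -
 obtain C where C: "0 < C" "\<And>f. admissible f \<Longrightarrow> (\<Sum>n. ennreal (norm (hc f n) powr p * (real n + 1) powr (p - 2))) \<le> ennreal C * Lp_enn p f"
  using Hop_HL[OF m p] by blast
 have p0: "0 < p" using p(1) by simp
 show ?thesis
 proof (rule muck_imp_bounded[OF m p])
  show "0 \<le> C" using C by simp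
  fix f g L assume h: "admissible f" "g holomorphic_on ball 0 1" "\<And>z. norm z < 1 \<Longrightarrow> g z = Hop f z" "0 \<le> L" "Lp_enn p f = ennreal L"
  have t: "taylor_coeff g n = hc f n" for n
   using taylor_coeff_cong[OF Hop_holomorphic[OF h(1)] h(2,3)] taylor_coeff_Hop[OF h(1)] by simp
  note hl = HL_ennreal[OF h(2), where p = p, unfolded t]
  have b: "(\<Sum>n. ennreal (norm (hc f n) powr p * (real n + 1) powr (p - 2))) \<le> ennreal (C * L)"
   using C(2)[OF h(1)] C(1) h(4) by (simp add: h(5) ennreal_mult)
  then have mem: "g \<in> HL_space p" unfolding hl(1) by (auto elim: le_less_trans)
  have "ennreal (HL_norm p g powr p) \<le> ennreal (C * L)" using b unfolding hl(2)[OF mem p0] .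
  then have "HL_norm p g powr p \<le> C * L" using C h(4) by (simp add: ennreal_le_iff)
  then have "(HL_norm p g powr p) powr (1/p) \<le> (C * L) powr (1/p)" using p by (intro powr_mono2) auto
  moreover have "(HL_norm p g powr p) powr (1/p) = HL_norm p g"
   using p by (intro powr_powr_inverse) (auto simp: HL_norm_def)
  ultimately show "g \<in> HL_space p \<and> HL_norm p g \<le> (C * L) powr (1/p)" using mem by simp
 qed
qed

text \<open>The common step of the three necessity proofs: only the action on test functions is used, and a
  lower bound of the target norm by \<open>J g\<close> is all that depends on the target space.\<close>

lemma bounded_imp_muck:
 assumes b: "hilbert_op_bounded \<omega> id (Lp_space p) (Lp_norm p) Y N" and p: "1 < p" "1 / p + 1 / q = 1" and D: "0 < D"
  and N: "\<And>g r G. test_fun r g \<Longrightarrow> 0 < r \<Longrightarrow> r < 1 \<Longrightarrow> G \<in> Y \<Longrightarrow> (\<And>z. norm z < 1 \<Longrightarrow> G z = Hop (cg g) z) \<Longrightarrow>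
   0 \<le> N G \<and> ennreal (J g powr p) * muck_A p r \<le> ennreal D * ennreal (N G powr p)"
 shows "\<exists>K. muck p q K"
proof -
 obtain C where C: "\<And>f. f \<in> Lp_space p \<Longrightarrow> hilbert_op \<omega> f \<in> Y \<and> N (hilbert_op \<omega> f) \<le> C * Lp_norm p f"
  using b by (auto simp: hilbert_op_bounded_def)
 define E where "E = D * max C 1 powr p"
 have "muck p q (E powr (1/p))"
 proof (rule muck_from_test[OF p])
  show "0 < E" using D by (simp add: E_def)
  fix g r assume g: "test_fun r g" and r: "0 < r" "r < 1"
  define G where "G = hilbert_op \<omega> (cg g)"
  note v = test_fun_version[OF g p(1)]
  note Gb = C[OF v(1), folded G_def]
  have "\<And>z. norm z < 1 \<Longrightarrow> G z = Hop (cg g) z" unfolding G_def by (rule v(3))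
  note NG = N[OF g r conjunct1[OF Gb] this]
  have "C * Lp_norm p (cg g) \<le> max C 1 * Lp_norm p (cg g)" by (intro mult_right_mono Lp_norm_nonneg) simp
  then have "N G powr p \<le> (max C 1 * Lp_norm p (cg g)) powr p" using Gb NG p by (intro powr_mono2) auto
  then have "D * N G powr p \<le> E * Lp_norm p (cg g) powr p" using D by (simp add: E_def powr_mult mult.assoc)
  then have "ennreal D * ennreal (N G powr p) \<le> ennreal E * Lp_enn p (cg g)"
   unfolding v(2) using D by (simp add: ennreal_mult'[symmetric] E_def ennreal_leI)
  then show "ennreal (J g powr p) * muck_A p r \<le> ennreal E * Lp_enn p (cg g)" using NG order.trans by blast
 qed
 then show ?thesis ..
qed

lemma Hardy_bounded_imp_muck:
 assumes b: "hilbert_op_bounded \<omega> id (Lp_space p) (Lp_norm p) (hardy_space p) (hardy_norm p)"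
  and p: "1 < p" "1 / p + 1 / q = 1"
 shows "\<exists>K. muck p q K"
proof -
 obtain D where D: "0 < D" "\<And>g r R. test_fun r g \<Longrightarrow> 0 < r \<Longrightarrow> r < R \<Longrightarrow> 1/2 \<le> R \<Longrightarrow> R < 1 \<Longrightarrow>
  ennreal (J g powr p) * muck_A p r \<le> ennreal D * circle_mean p (Hop (cg g)) R"
  using Hardy_necessity[OF p] by blast
 show ?thesis
 proof (rule bounded_imp_muck[OF b p])
  show "0 < D * (2 * pi)" using D by simp
  fix g r G assume h: "test_fun r g" "0 < r" "r < 1" "G \<in> hardy_space p" "\<And>z. norm z < 1 \<Longrightarrow> G z = Hop (cg g) z"
  define R where "R = (1 + r) / 2"
  have R: "0 < R" "r < R" "R < 1" "1/2 \<le> R" using h by (auto simp: R_def)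
  have "ennreal D * circle_mean p (Hop (cg g)) R \<le> ennreal D * ennreal (2 * pi * hardy_norm p G powr p)"
   using mult_left_mono[OF circle_mean_le_hardy_norm[OF h(4) R(1,3) p(1)], of "ennreal D"]
    circle_mean_cong[OF h(5) R(1,3), where p = p] by simp
  also have "\<dots> = ennreal (D * (2 * pi)) * ennreal (hardy_norm p G powr p)"
   using D by (simp add: ennreal_mult'[symmetric] mult.assoc)
  finally show "0 \<le> hardy_norm p G \<and> ennreal (J g powr p) * muck_A p r \<le> ennreal (D * (2 * pi)) * ennreal (hardy_norm p G powr p)"
   using hardy_norm_nonneg[OF h(4)] D(2)[OF h(1,2) R(2,4,3)] order.trans by blast
 qed
qed

lemma Dirichlet_bounded_imp_muck:
 assumes b: "hilbert_op_bounded \<omega> id (Lp_space p) (Lp_norm p) (dirichlet_space p) (dirichlet_norm p)"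
  and p: "1 < p" "1 / p + 1 / q = 1"
 shows "\<exists>K. muck p q K"
proof -
 obtain D where D: "0 < D" "\<And>g r. test_fun r g \<Longrightarrow> 0 < r \<Longrightarrow> r < 1 \<Longrightarrow>
  ennreal (J g powr p) * muck_A p r \<le> ennreal D * (ennreal (norm (Hop (cg g) 0) powr p) + dirichlet_enn p (Hop (cg g)))"
  using Dirichlet_necessity[OF p] by blast
 show ?thesis
 proof (rule bounded_imp_muck[OF b p])
  show "0 < D * pi" using D by simp
  fix g r G assume t: "test_fun r g" "0 < r" "r < 1" and mem: "G \<in> dirichlet_space p" and eq: "\<And>z. norm z < 1 \<Longrightarrow> G z = Hop (cg g) z"
  have h: "G holomorphic_on ball 0 1" using mem by (simp add: dirichlet_space_def)
  have hol: "Hop (cg g) holomorphic_on ball 0 1" by (rule Hop_holomorphic[OF test_admissible[OF t(1)]])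
  define I where "I = disc_integral (\<lambda>z. norm (deriv G z) powr p * (1 - (norm z)\<^sup>2) powr (p - 1))"
  note dis = dirichlet_enn_disc_integral[OF h p(1), folded I_def]
  have fin: "dirichlet_enn p G < top" using dis(1) mem by simp
  have "ennreal (norm (Hop (cg g) 0) powr p) + dirichlet_enn p (Hop (cg g)) = ennreal (norm (G 0) powr p) + ennreal (pi * I)"
   using eq[of 0] dirichlet_enn_cong[OF hol h eq, where p = p] dis(2)[OF fin] by simp
  also have "\<dots> = ennreal (norm (G 0) powr p + pi * I)" using dis(3) by (simp add: ennreal_plus)
  also have "\<dots> \<le> ennreal (pi * (norm (G 0) powr p + p * I))"
  proof (rule ennreal_leI)
   have "1 * norm (G 0) powr p \<le> pi * norm (G 0) powr p" using pi_gt3 by (intro mult_right_mono) auto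
   moreover have "pi * (1 * I) \<le> pi * (p * I)" using p dis(3) by (intro mult_left_mono mult_right_mono) auto
   ultimately show "norm (G 0) powr p + pi * I \<le> pi * (norm (G 0) powr p + p * I)"
    unfolding distrib_left mult_1_left by linarith
  qed
  also have "norm (G 0) powr p + p * I = dirichlet_norm p G powr p"
   unfolding dirichlet_norm_def I_def[symmetric] using p dis(3) by (simp add: powr_inverse_powr)
  finally have "ennreal D * (ennreal (norm (Hop (cg g) 0) powr p) + dirichlet_enn p (Hop (cg g))) \<le> ennreal D * ennreal (pi * dirichlet_norm p G powr p)"
   by (rule mult_left_mono) simp
  also have "\<dots> = ennreal (D * pi) * ennreal (dirichlet_norm p G powr p)"
   using D by (simp add: ennreal_mult'[symmetric] mult.assoc)
  finally have "ennreal (J g powr p) * muck_A p r \<le> ennreal (D * pi) * ennreal (dirichlet_norm p G powr p)"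
   using D(2)[OF t] order.trans by blast
  then show "0 \<le> dirichlet_norm p G \<and> ennreal (J g powr p) * muck_A p r \<le> ennreal (D * pi) * ennreal (dirichlet_norm p G powr p)"
   by (simp add: dirichlet_norm_def)
 qed
qed

lemma HL_bounded_imp_muck:
 assumes b: "hilbert_op_bounded \<omega> id (Lp_space p) (Lp_norm p) (HL_space p) (HL_norm p)"
  and p: "1 < p" "1 / p + 1 / q = 1"
 shows "\<exists>K. muck p q K"
proof -
 obtain D where D: "0 < D" "\<And>g r. test_fun r g \<Longrightarrow> 0 < r \<Longrightarrow> r < 1 \<Longrightarrow>
  ennreal (J g powr p) * muck_A p r \<le> ennreal D * (\<Sum>n. ennreal (norm (hc (cg g) n) powr p * (real n + 1) powr (p - 2)))"
  using HL_necessity[OF p] by blast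
 have p0: "0 < p" using p(1) by simp
 show ?thesis
 proof (rule bounded_imp_muck[OF b p D(1)])
  fix g r G assume t: "test_fun r g" "0 < r" "r < 1" and mem: "G \<in> HL_space p" and eq: "\<And>z. norm z < 1 \<Longrightarrow> G z = Hop (cg g) z"
  have h: "G holomorphic_on ball 0 1" using mem by (simp add: HL_space_def)
  note adm = test_admissible[OF t(1)]
  have c: "taylor_coeff G n = hc (cg g) n" for n
   using taylor_coeff_cong[OF Hop_holomorphic[OF adm] h eq] taylor_coeff_Hop[OF adm] by simp
  show "0 \<le> HL_norm p G \<and> ennreal (J g powr p) * muck_A p r \<le> ennreal D * ennreal (HL_norm p G powr p)"
   unfolding HL_ennreal(2)[OF h mem p0, unfolded c, symmetric] using D(2)[OF t] by (simp add: HL_norm_def)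
 qed
qed

end

text \<open>Compose with the restriction to the radius.\<close>

lemma Hardy_to_Hardy:
 assumes b: "hilbert_op_bounded \<omega> id (Lp_space p) (Lp_norm p) Y N"
  and p: "1 < p" "1 / p + 1 / q = 1"
 shows "hilbert_op_bounded \<omega> radial_restriction (hardy_space p) (hardy_norm p) Y N"
proof -
 obtain C where C: "\<And>f. f \<in> Lp_space p \<Longrightarrow> hilbert_op_defined \<omega> f \<and> hilbert_op \<omega> f \<in> Y \<and> N (hilbert_op \<omega> f) \<le> C * Lp_norm p f"
  using b by (auto simp: hilbert_op_bounded_def)
 define D where "D = ((p + q) powr p * 2 powr p * (2 * pi)) powr (1 / p)"
 show ?thesis unfolding hilbert_op_bounded_def
 proof (intro exI[of _ "max C 0 * D"] ballI)
  fix f assume f: "f \<in> hardy_space p"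
  note rr = radial_restriction_Lp[OF f p, folded D_def]
  have "N (hilbert_op \<omega> (radial_restriction f)) \<le> C * Lp_norm p (radial_restriction f)" using C[OF rr(1)] by simp
  also have "\<dots> \<le> max C 0 * Lp_norm p (radial_restriction f)" by (intro mult_right_mono Lp_norm_nonneg) simp
  also have "\<dots> \<le> max C 0 * (D * hardy_norm p f)" by (intro mult_left_mono rr(2)) simp
  finally show "hilbert_op_defined \<omega> (radial_restriction f) \<and> hilbert_op \<omega> (radial_restriction f) \<in> Y \<and>
    N (hilbert_op \<omega> (radial_restriction f)) \<le> max C 0 * D * hardy_norm p f"
   using C[OF rr(1)] by (simp add: mult.assoc)
 qed
qed

theorem theorem3:
  fixes \<omega> :: "real \<Rightarrow> real" and p p' :: real
  assumes "\<omega> \<in> D_hat"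
    and "1 < p"
    and "1 / p + 1 / p' = 1"
  shows "(hilbert_op_bounded \<omega> id (Lp_space p) (Lp_norm p) (hardy_space p) (hardy_norm p)
            \<longleftrightarrow> muckenhoupt_cond p p' \<omega>) \<and>
         (hilbert_op_bounded \<omega> id (Lp_space p) (Lp_norm p) (dirichlet_space p) (dirichlet_norm p)
            \<longleftrightarrow> muckenhoupt_cond p p' \<omega>) \<and>
         (hilbert_op_bounded \<omega> id (Lp_space p) (Lp_norm p) (HL_space p) (HL_norm p)
            \<longleftrightarrow> muckenhoupt_cond p p' \<omega>) \<and>
         (muckenhoupt_cond p p' \<omega> \<longrightarrow>
            hilbert_op_bounded \<omega> radial_restriction
              (hardy_space p) (hardy_norm p) (hardy_space p) (hardy_norm p))"
proof -
  note p = assms(2,3)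
  obtain w where "weight_version w \<omega>" using assms(1) by (rule D_hat_weight_version)
  then interpret weight_version w \<omega> .
  have iff: "muckenhoupt_cond p p' \<omega> \<longleftrightarrow> (\<exists>K. muck p p' K)" by (rule muckenhoupt_cond_iff[OF p])
  have Hardy: "muckenhoupt_cond p p' \<omega> \<Longrightarrow> hilbert_op_bounded \<omega> id (Lp_space p) (Lp_norm p) (hardy_space p) (hardy_norm p)"
    using muck_imp_Hardy_bounded[OF _ p] unfolding iff by blast
  show ?thesis using Hardy Hardy_to_Hardy[OF Hardy p] Hardy_bounded_imp_muck[OF _ p]
      muck_imp_Dirichlet_bounded[OF _ p] Dirichlet_bounded_imp_muck[OF _ p]
      muck_imp_HL_bounded[OF _ p] HL_bounded_imp_muck[OF _ p] unfolding iff by blast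
qed

end
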